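(* Let $(A,\mathfrak m)$ be a Cohen-Macaulay local ring with $d=\dim A>0$ and $I$ a canonical ideal of $A$. Let $n\ge1$ be an integer and $Q$ a parameter ideal of $A$ which satisfies the condition $(\sharp)$ with respect to $I$. Set $J=I+Q$, $\mathcal T=\mathcal R(Q)$, and $\mathcal B=\mathcal T/\mathfrak m\mathcal T$. Then the following conditions are equivalent. (1) $A$ is an $n$-Goto ring with respect to $Q$. (2) There exist integers $0\le\ell<n$ and $s_i\ge1$ ($0\le i\le\ell$) such that $n=\sum_{i=0}^{\ell}s_i$ and $\mathfrak m^{\ell}\mathcal S_Q(J)\cong\mathcal B(-1)^{\oplus s_0}$, and, if $\ell>0$, for each $1\le i\le\ell$ there exists an exact sequence $$0\to\mathfrak m^{\ell-i+1}\mathcal S_Q(J)\to\mathfrak m^{\ell-i}\mathcal S_Q(J)\to\mathcal B(-1)^{\oplus s_i}\to0$$ of graded $\mathcal T$-modules. When this is the case, if $\ell>0$, there is a non-split exact sequence $$0\to\mathcal B(-1)^{\oplus s_0}\to\mathfrak m^{\ell-1}\mathcal S_Q(J)\to\mathcal B(-1)^{\oplus s_1}\to0$$ of graded $\mathcal T$-modules.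
   Context: A canonical ideal of $A$ is an ideal $I\ne A$ isomorphic as an $A$-module to the canonical module $\mathrm K_A$. A parameter ideal $Q=(a_1,\ldots,a_d)$ (generated by a system of parameters) satisfies $(\sharp)$ with respect to $I$ if $a_1\in I$ and $Q$ is a reduction of $J=I+Q$, i.e. $J^{r+1}=QJ^r$ for some $r\ge0$. With $t$ an indeterminate, $\mathcal T=\mathcal R(Q)=A[Qt]$, the Sally module is $\mathcal S_Q(J)=JA[Jt]/J\mathcal T\cong\bigoplus_{i\ge1}J^{i+1}/JQ^i$, a graded $\mathcal T$-module with $[\mathcal S_Q(J)]_i=J^{i+1}/JQ^i$; $\operatorname{rank}\mathcal S_Q(J)=\ell_{\mathcal T_{\mathfrak p}}([\mathcal S_Q(J)]_{\mathfrak p})$ with $\mathfrak p=\mathfrak m\mathcal T$. For a graded module $M$, $M(j)$ is the shift with $[M(j)]_m=M_{j+m}$. $A$ is an $n$-Goto ring with respect to $Q$ if $\mathcal S_Q(J)=\mathcal T[\mathcal S_Q(J)]_1$ and $\operatorname{rank}\mathcal S_Q(J)=n$; equivalently, $J^3=QJ^2$ and $\ell_A(J^2/QJ)=n$. *)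

theory Defs
  imports
    "HOL-Library.Extended_Nat"
    "HOL-Algebra.UnivPoly"
    "HOL-Algebra.Ideal_Product"
    "HOL-Algebra.Ring_Divisibility"
begin

section \<open>Local rings, dimension, depth\<close>

definition krull_dim :: "('a, 'b) ring_scheme \<Rightarrow> enat" where
  "krull_dim A = (SUP n \<in> {n. \<exists>P :: nat \<Rightarrow> 'a set.
      (\<forall>i\<le>n. primeideal (P i) A) \<and> (\<forall>i<n. P i \<subset> P (Suc i))}. enat n)"

definition noeth_local_ring :: "('a, 'b) ring_scheme \<Rightarrow> 'a set \<Rightarrow> bool" where
  "noeth_local_ring A \<mm> \<longleftrightarrow> cring A \<and> noetherian_ring A \<and>
     maximalideal \<mm> A \<and> (\<forall>M. maximalideal M A \<longrightarrow> M = \<mm>)"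

text \<open>Properness of the ideal generated by the sequence is part of the usual definition; here it is
  automatic because the entries lie in the maximal ideal.\<close>

definition regular_seq :: "('a, 'b) ring_scheme \<Rightarrow> 'a set \<Rightarrow> 'a list \<Rightarrow> bool" where
  "regular_seq A \<mm> xs \<longleftrightarrow> set xs \<subseteq> \<mm> \<and>
     (\<forall>i<length xs. \<forall>y\<in>carrier A.
        xs ! i \<otimes>\<^bsub>A\<^esub> y \<in> Idl\<^bsub>A\<^esub> (set (take i xs)) \<longrightarrow> y \<in> Idl\<^bsub>A\<^esub> (set (take i xs)))"

definition ring_depth :: "('a, 'b) ring_scheme \<Rightarrow> 'a set \<Rightarrow> enat" where
  "ring_depth A \<mm> = (SUP xs \<in> {xs. regular_seq A \<mm> xs}. enat (length xs))"

definition CM_local_ring :: "('a, 'b) ring_scheme \<Rightarrow> 'a set \<Rightarrow> bool" where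
  "CM_local_ring A \<mm> \<longleftrightarrow> noeth_local_ring A \<mm> \<and> ring_depth A \<mm> = krull_dim A"

primrec ideal_pow :: "('a, 'b) ring_scheme \<Rightarrow> 'a set \<Rightarrow> nat \<Rightarrow> 'a set" where
  "ideal_pow A K 0 = carrier A"
| "ideal_pow A K (Suc i) = K \<cdot>\<^bsub>A\<^esub> ideal_pow A K i"

definition ring_radical :: "('a, 'b) ring_scheme \<Rightarrow> 'a set \<Rightarrow> 'a set" where
  "ring_radical A K = {x \<in> carrier A. \<exists>k::nat. x [^]\<^bsub>A\<^esub> k \<in> K}"

definition system_of_params :: "('a, 'b) ring_scheme \<Rightarrow> 'a set \<Rightarrow> 'a list \<Rightarrow> bool" where
  "system_of_params A \<mm> as \<longleftrightarrow> enat (length as) = krull_dim A \<and> set as \<subseteq> \<mm> \<and>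
     ring_radical A (Idl\<^bsub>A\<^esub> (set as)) = \<mm>"

definition is_reduction :: "('a, 'b) ring_scheme \<Rightarrow> 'a set \<Rightarrow> 'a set \<Rightarrow> bool" where
  "is_reduction A Q J \<longleftrightarrow> Q \<subseteq> J \<and>
     (\<exists>r. ideal_pow A J (Suc r) = Q \<cdot>\<^bsub>A\<^esub> ideal_pow A J r)"

text \<open>Only the first generator is required to lie in \<open>I\<close>, so the condition is about the existence
  of a suitable ordered generating system of parameters of \<open>Q\<close>.\<close>

definition sharp_param_ideal :: "('a, 'b) ring_scheme \<Rightarrow> 'a set \<Rightarrow> 'a set \<Rightarrow> 'a set \<Rightarrow> bool" where
  "sharp_param_ideal A \<mm> I Q \<longleftrightarrow>
     (\<exists>as. system_of_params A \<mm> as \<and> Q = Idl\<^bsub>A\<^esub> (set as) \<and> as ! 0 \<in> I) \<and>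
     is_reduction A Q (I <+>\<^bsub>A\<^esub> Q)"


section \<open>Modules\<close>

text \<open>The fields \<open>mult\<close> and \<open>one\<close> of the library record \<open>module\<close> play no role for a module;
  they are left undefined below.\<close>

definition self_module :: "('a, 'b) ring_scheme \<Rightarrow> 'a set \<Rightarrow> ('a, 'a) module" where
  "self_module R K = \<lparr>carrier = K, monoid.mult = undefined, one = undefined,
     zero = \<zero>\<^bsub>R\<^esub>, add = add R, smult = monoid.mult R\<rparr>"

definition mod_hom :: "('a, 'b) ring_scheme \<Rightarrow> ('a, 'm, 'x) module_scheme \<Rightarrow>
    ('a, 'n, 'y) module_scheme \<Rightarrow> ('m \<Rightarrow> 'n) set" where
  "mod_hom R M N = {h \<in> carrier M \<rightarrow> carrier N.
     (\<forall>x\<in>carrier M. \<forall>y\<in>carrier M. h (x \<oplus>\<^bsub>M\<^esub> y) = h x \<oplus>\<^bsub>N\<^esub> h y) \<and>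
     (\<forall>r\<in>carrier R. \<forall>x\<in>carrier M. h (r \<odot>\<^bsub>M\<^esub> x) = r \<odot>\<^bsub>N\<^esub> h x)}"

definition mod_iso :: "('a, 'b) ring_scheme \<Rightarrow> ('a, 'm, 'x) module_scheme \<Rightarrow>
    ('a, 'n, 'y) module_scheme \<Rightarrow> bool" where
  "mod_iso R M N \<longleftrightarrow> (\<exists>h \<in> mod_hom R M N. bij_betw h (carrier M) (carrier N))"

definition submod_span :: "('a, 'b) ring_scheme \<Rightarrow> ('a, 'm, 'x) module_scheme \<Rightarrow> 'm set \<Rightarrow> 'm set" where
  "submod_span R M X = \<Inter>{N. submodule N R M \<and> X \<subseteq> N}"

definition quot_module :: "('a, 'm, 'x) module_scheme \<Rightarrow> 'm set \<Rightarrow> ('a, 'm set) module" where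
  "quot_module M N = \<lparr>carrier = a_rcosets\<^bsub>M\<^esub> N, monoid.mult = undefined, one = undefined,
     zero = N, add = set_add M,
     smult = (\<lambda>r X. \<Union>x\<in>X. N +>\<^bsub>M\<^esub> (r \<odot>\<^bsub>M\<^esub> x))\<rparr>"

definition mod_power :: "('a, 'm, 'x) module_scheme \<Rightarrow> nat \<Rightarrow> ('a, nat \<Rightarrow> 'm) module" where
  "mod_power M s = \<lparr>carrier = {..<s} \<rightarrow>\<^sub>E carrier M, monoid.mult = undefined, one = undefined,
     zero = (\<lambda>i\<in>{..<s}. \<zero>\<^bsub>M\<^esub>), add = (\<lambda>f g. \<lambda>i\<in>{..<s}. f i \<oplus>\<^bsub>M\<^esub> g i),
     smult = (\<lambda>r f. \<lambda>i\<in>{..<s}. r \<odot>\<^bsub>M\<^esub> f i)\<rparr>"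

definition hom_module :: "('a, 'b) ring_scheme \<Rightarrow> ('a, 'm, 'x) module_scheme \<Rightarrow>
    ('a, 'n, 'y) module_scheme \<Rightarrow> ('a, 'm \<Rightarrow> 'n) module" where
  "hom_module R M N = \<lparr>carrier = mod_hom R M N \<inter> extensional (carrier M),
     monoid.mult = undefined, one = undefined,
     zero = (\<lambda>x\<in>carrier M. \<zero>\<^bsub>N\<^esub>), add = (\<lambda>f g. \<lambda>x\<in>carrier M. f x \<oplus>\<^bsub>N\<^esub> g x),
     smult = (\<lambda>r f. \<lambda>x\<in>carrier M. r \<odot>\<^bsub>N\<^esub> f x)\<rparr>"

definition module_length :: "('a, 'b) ring_scheme \<Rightarrow> ('a, 'm, 'x) module_scheme \<Rightarrow> enat" where
  "module_length R M = (SUP n \<in> {n. \<exists>N :: nat \<Rightarrow> 'm set.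
      (\<forall>i\<le>n. submodule (N i) R M) \<and> (\<forall>i<n. N i \<subset> N (Suc i))}. enat n)"


section \<open>Canonical modules\<close>

abbreviation free_mod :: "('a, 'b) ring_scheme \<Rightarrow> nat \<Rightarrow> ('a, nat \<Rightarrow> 'a) module" where
  "free_mod A k \<equiv> mod_power (self_module A (carrier A)) k"

text \<open>A resolution \<open>\<dots> \<rightarrow> A\<^bsup>b 1\<^esup> \<rightarrow> A\<^bsup>b 0\<^esup> \<rightarrow> N \<rightarrow> 0\<close> by free modules of
  finite rank, with differentials \<open>\<phi> i : A\<^bsup>b (i+1)\<^esup> \<rightarrow> A\<^bsup>b i\<^esup>\<close> and augmentation \<open>\<epsilon>\<close>.\<close>

definition free_resolution :: "('a, 'b) ring_scheme \<Rightarrow> (nat \<Rightarrow> nat) \<Rightarrow>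
    (nat \<Rightarrow> (nat \<Rightarrow> 'a) \<Rightarrow> (nat \<Rightarrow> 'a)) \<Rightarrow> ((nat \<Rightarrow> 'a) \<Rightarrow> 'm) \<Rightarrow>
    ('a, 'm, 'x) module_scheme \<Rightarrow> bool" where
  "free_resolution A b \<phi> \<epsilon> N \<longleftrightarrow>
     \<epsilon> \<in> mod_hom A (free_mod A (b 0)) N \<and> \<epsilon> ` carrier (free_mod A (b 0)) = carrier N \<and>
     (\<forall>i. \<phi> i \<in> mod_hom A (free_mod A (b (Suc i))) (free_mod A (b i))) \<and>
     \<phi> 0 ` carrier (free_mod A (b 1)) = {x \<in> carrier (free_mod A (b 0)). \<epsilon> x = \<zero>\<^bsub>N\<^esub>} \<and>
     (\<forall>i. \<phi> (Suc i) ` carrier (free_mod A (b (Suc (Suc i)))) =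
        {x \<in> carrier (free_mod A (b (Suc i))). \<phi> i x = \<zero>\<^bsub>free_mod A (b i)\<^esub>})"

definition dual_diff :: "('a, 'b) ring_scheme \<Rightarrow> (nat \<Rightarrow> nat) \<Rightarrow>
    (nat \<Rightarrow> (nat \<Rightarrow> 'a) \<Rightarrow> (nat \<Rightarrow> 'a)) \<Rightarrow> nat \<Rightarrow>
    ((nat \<Rightarrow> 'a) \<Rightarrow> 'm) \<Rightarrow> ((nat \<Rightarrow> 'a) \<Rightarrow> 'm)" where
  "dual_diff A b \<phi> i f = restrict (f \<circ> \<phi> i) (carrier (free_mod A (b (Suc i))))"

text \<open>\<open>Ext\<^sup>i(N, C)\<close>, as the cohomology of \<open>Hom(F, C)\<close> for a free resolution \<open>F = (b, \<phi>)\<close> of \<open>N\<close>.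
  Up to isomorphism it does not depend on the chosen resolution.\<close>

definition Ext_cocycles :: "('a, 'b) ring_scheme \<Rightarrow> (nat \<Rightarrow> nat) \<Rightarrow>
    (nat \<Rightarrow> (nat \<Rightarrow> 'a) \<Rightarrow> (nat \<Rightarrow> 'a)) \<Rightarrow> ('a, 'm, 'x) module_scheme \<Rightarrow>
    nat \<Rightarrow> ((nat \<Rightarrow> 'a) \<Rightarrow> 'm) set" where
  "Ext_cocycles A b \<phi> C i = {f \<in> carrier (hom_module A (free_mod A (b i)) C).
     dual_diff A b \<phi> i f = \<zero>\<^bsub>hom_module A (free_mod A (b (Suc i))) C\<^esub>}"

definition Ext_coboundaries :: "('a, 'b) ring_scheme \<Rightarrow> (nat \<Rightarrow> nat) \<Rightarrow>
    (nat \<Rightarrow> (nat \<Rightarrow> 'a) \<Rightarrow> (nat \<Rightarrow> 'a)) \<Rightarrow> ('a, 'm, 'x) module_scheme \<Rightarrow>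
    nat \<Rightarrow> ((nat \<Rightarrow> 'a) \<Rightarrow> 'm) set" where
  "Ext_coboundaries A b \<phi> C i = (case i of
       0 \<Rightarrow> {\<zero>\<^bsub>hom_module A (free_mod A (b 0)) C\<^esub>}
     | Suc j \<Rightarrow> dual_diff A b \<phi> j ` carrier (hom_module A (free_mod A (b j)) C))"

definition Ext_module :: "('a, 'b) ring_scheme \<Rightarrow> (nat \<Rightarrow> nat) \<Rightarrow>
    (nat \<Rightarrow> (nat \<Rightarrow> 'a) \<Rightarrow> (nat \<Rightarrow> 'a)) \<Rightarrow> ('a, 'm, 'x) module_scheme \<Rightarrow>
    nat \<Rightarrow> ('a, ((nat \<Rightarrow> 'a) \<Rightarrow> 'm) set) module" where
  "Ext_module A b \<phi> C i = quot_module
     ((hom_module A (free_mod A (b i)) C)\<lparr>carrier := Ext_cocycles A b \<phi> C i\<rparr>)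
     (Ext_coboundaries A b \<phi> C i)"

definition fin_gen_module :: "('a, 'b) ring_scheme \<Rightarrow> ('a, 'm, 'x) module_scheme \<Rightarrow> bool" where
  "fin_gen_module R M \<longleftrightarrow> module R M \<and>
     (\<exists>X. finite X \<and> X \<subseteq> carrier M \<and> submod_span R M X = carrier M)"

text \<open>A finitely generated module \<open>C\<close> over a Cohen-Macaulay local ring \<open>(A, \<mm>, k)\<close> of dimension
  \<open>d\<close> is a canonical module iff \<open>Ext\<^sup>d(k, C) \<cong> k\<close> and \<open>Ext\<^sup>i(k, C) = 0\<close> for \<open>i \<noteq> d\<close>,
  i.e. \<open>C\<close> is maximal Cohen-Macaulay, of type one and of finite injective dimension
  (Bruns and Herzog, Cohen-Macaulay Rings, Section 3.3).\<close>

definition canonical_module :: "('a, 'b) ring_scheme \<Rightarrow> 'a set \<Rightarrow> ('a, 'm, 'x) module_scheme \<Rightarrow> bool" where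
  "canonical_module A \<mm> C \<longleftrightarrow> fin_gen_module A C \<and>
     (let k = quot_module (self_module A (carrier A)) \<mm> in
      \<exists>b \<phi> \<epsilon>. free_resolution A b \<phi> \<epsilon> k \<and>
        (\<forall>i. if enat i = krull_dim A then mod_iso A (Ext_module A b \<phi> C i) k
             else carrier (Ext_module A b \<phi> C i) = {\<zero>\<^bsub>Ext_module A b \<phi> C i\<^esub>}))"

text \<open>Being a canonical module is invariant under isomorphism, so an ideal is isomorphic to the
  canonical module iff it is itself a canonical module.\<close>

definition canonical_ideal :: "('a, 'b) ring_scheme \<Rightarrow> 'a set \<Rightarrow> 'a set \<Rightarrow> bool" where
  "canonical_ideal A \<mm> I \<longleftrightarrow> ideal I A \<and> I \<noteq> carrier A \<and> canonical_module A \<mm> (self_module A I)"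


section \<open>Localization\<close>

text \<open>The class of the fraction \<open>x / u\<close> in the localization of the module \<open>M\<close> at \<open>U\<close>.\<close>

definition loc_frac :: "('a, 'm, 'x) module_scheme \<Rightarrow> 'a set \<Rightarrow> 'm \<Rightarrow> 'a \<Rightarrow> ('m \<times> 'a) set" where
  "loc_frac M U x u = {(y, v). y \<in> carrier M \<and> v \<in> U \<and>
     (\<exists>w\<in>U. w \<odot>\<^bsub>M\<^esub> (v \<odot>\<^bsub>M\<^esub> x) = w \<odot>\<^bsub>M\<^esub> (u \<odot>\<^bsub>M\<^esub> y))}"

definition loc_ring :: "('a, 'b) ring_scheme \<Rightarrow> 'a set \<Rightarrow> ('a \<times> 'a) set ring" where
  "loc_ring R U = (let frac = loc_frac (self_module R (carrier R)) U in
     \<lparr>carrier = {frac x u | x u. x \<in> carrier R \<and> u \<in> U},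
      monoid.mult = (\<lambda>X Y. \<Union>(x, u)\<in>X. \<Union>(y, v)\<in>Y. frac (x \<otimes>\<^bsub>R\<^esub> y) (u \<otimes>\<^bsub>R\<^esub> v)),
      one = frac \<one>\<^bsub>R\<^esub> \<one>\<^bsub>R\<^esub>,
      zero = frac \<zero>\<^bsub>R\<^esub> \<one>\<^bsub>R\<^esub>,
      add = (\<lambda>X Y. \<Union>(x, u)\<in>X. \<Union>(y, v)\<in>Y.
               frac (v \<otimes>\<^bsub>R\<^esub> x \<oplus>\<^bsub>R\<^esub> u \<otimes>\<^bsub>R\<^esub> y) (u \<otimes>\<^bsub>R\<^esub> v))\<rparr>)"

definition loc_module :: "('a, 'b) ring_scheme \<Rightarrow> 'a set \<Rightarrow> ('a, 'm, 'x) module_scheme \<Rightarrow>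
    (('a \<times> 'a) set, ('m \<times> 'a) set) module" where
  "loc_module R U M =
     \<lparr>carrier = {loc_frac M U x u | x u. x \<in> carrier M \<and> u \<in> U},
      monoid.mult = undefined, one = undefined,
      zero = loc_frac M U \<zero>\<^bsub>M\<^esub> \<one>\<^bsub>R\<^esub>,
      add = (\<lambda>X Y. \<Union>(x, u)\<in>X. \<Union>(y, v)\<in>Y.
               loc_frac M U (v \<odot>\<^bsub>M\<^esub> x \<oplus>\<^bsub>M\<^esub> u \<odot>\<^bsub>M\<^esub> y) (u \<otimes>\<^bsub>R\<^esub> v)),
      smult = (\<lambda>F X. \<Union>(r, u)\<in>F. \<Union>(x, v)\<in>X. loc_frac M U (r \<odot>\<^bsub>M\<^esub> x) (u \<otimes>\<^bsub>R\<^esub> v))\<rparr>"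


section \<open>Graded modules\<close>

record ('a, 'm) gmodule = "('a, 'm) module" +
  hpart :: "int \<Rightarrow> 'm set"

definition gshift :: "('a, 'm) gmodule \<Rightarrow> int \<Rightarrow> ('a, 'm) gmodule" where
  "gshift M j = M\<lparr>hpart := (\<lambda>i. hpart M (j + i))\<rparr>"

definition gpower :: "('a, 'm) gmodule \<Rightarrow> nat \<Rightarrow> ('a, nat \<Rightarrow> 'm) gmodule" where
  "gpower M s = module.extend (mod_power M s)
     (gmodule.fields (\<lambda>i. {..<s} \<rightarrow>\<^sub>E hpart M i))"

definition gsub :: "('a, 'm) gmodule \<Rightarrow> 'm set \<Rightarrow> ('a, 'm) gmodule" where
  "gsub M N = M\<lparr>carrier := N, hpart := (\<lambda>i. N \<inter> hpart M i)\<rparr>"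

definition graded_hom :: "('a, 'b) ring_scheme \<Rightarrow> ('a, 'm) gmodule \<Rightarrow> ('a, 'n) gmodule \<Rightarrow>
    ('m \<Rightarrow> 'n) set" where
  "graded_hom R M N = {h \<in> mod_hom R M N. \<forall>i. h ` hpart M i \<subseteq> hpart N i}"

definition graded_iso :: "('a, 'b) ring_scheme \<Rightarrow> ('a, 'm) gmodule \<Rightarrow> ('a, 'n) gmodule \<Rightarrow> bool" where
  "graded_iso R M N \<longleftrightarrow> (\<exists>h \<in> graded_hom R M N. bij_betw h (carrier M) (carrier N))"

definition graded_short_exact :: "('a, 'b) ring_scheme \<Rightarrow> ('a, 'k) gmodule \<Rightarrow> ('a, 'm) gmodule \<Rightarrow>
    ('a, 'n) gmodule \<Rightarrow> ('k \<Rightarrow> 'm) \<Rightarrow> ('m \<Rightarrow> 'n) \<Rightarrow> bool" where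
  "graded_short_exact R K M N f g \<longleftrightarrow> f \<in> graded_hom R K M \<and> g \<in> graded_hom R M N \<and>
     inj_on f (carrier K) \<and> f ` carrier K = {x \<in> carrier M. g x = \<zero>\<^bsub>N\<^esub>} \<and>
     g ` carrier M = carrier N"

definition split_epi :: "('a, 'b) ring_scheme \<Rightarrow> ('a, 'm, 'x) module_scheme \<Rightarrow>
    ('a, 'n, 'y) module_scheme \<Rightarrow> ('m \<Rightarrow> 'n) \<Rightarrow> bool" where
  "split_epi R M N g \<longleftrightarrow> (\<exists>h \<in> mod_hom R N M. \<forall>y\<in>carrier N. g (h y) = y)"


section \<open>Rees algebras and Sally modules\<close>

text \<open>\<open>A[Kt]\<close> as a subring of the polynomial ring \<open>A[t]\<close>.\<close>

definition rees :: "('a, 'b) ring_scheme \<Rightarrow> 'a set \<Rightarrow> ('a, nat \<Rightarrow> 'a) up_ring" where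
  "rees A K = (UP A)\<lparr>carrier := {f \<in> carrier (UP A). \<forall>i. coeff (UP A) f i \<in> ideal_pow A K i}\<rparr>"

text \<open>The extension \<open>K\<cdot>A[Lt]\<close> of an ideal \<open>K\<close> of \<open>A\<close> to the Rees algebra of \<open>L\<close>.\<close>

definition rees_ext :: "('a, 'b) ring_scheme \<Rightarrow> 'a set \<Rightarrow> 'a set \<Rightarrow> (nat \<Rightarrow> 'a) set" where
  "rees_ext A K L = Idl\<^bsub>rees A L\<^esub> ((\<lambda>a. monom (UP A) a 0) ` K)"

definition poly_hpart :: "('a, 'b) ring_scheme \<Rightarrow> int \<Rightarrow> (nat \<Rightarrow> 'a) set" where
  "poly_hpart A i = (if i < 0 then {\<zero>\<^bsub>UP A\<^esub>} else (\<lambda>a. monom (UP A) a (nat i)) ` carrier A)"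

text \<open>The quotient \<open>E/N\<close> of graded subgroups \<open>N \<subseteq> E\<close> of \<open>A[t]\<close>, with the action of polynomials
  by multiplication and the grading by powers of \<open>t\<close>.\<close>

definition poly_quot :: "('a, 'b) ring_scheme \<Rightarrow> (nat \<Rightarrow> 'a) set \<Rightarrow> (nat \<Rightarrow> 'a) set \<Rightarrow>
    (nat \<Rightarrow> 'a, (nat \<Rightarrow> 'a) set) gmodule" where
  "poly_quot A E N = module.extend (quot_module (self_module (UP A) E) N)
     (gmodule.fields (\<lambda>i. (\<lambda>f. N +>\<^bsub>UP A\<^esub> f) ` (E \<inter> poly_hpart A i)))"

definition sally_module :: "('a, 'b) ring_scheme \<Rightarrow> 'a set \<Rightarrow> 'a set \<Rightarrow>
    (nat \<Rightarrow> 'a, (nat \<Rightarrow> 'a) set) gmodule" where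
  "sally_module A Q J = poly_quot A (rees_ext A J J) (rees_ext A J Q)"

definition rees_fibre :: "('a, 'b) ring_scheme \<Rightarrow> 'a set \<Rightarrow> 'a set \<Rightarrow>
    (nat \<Rightarrow> 'a, (nat \<Rightarrow> 'a) set) gmodule" where
  "rees_fibre A \<mm> Q = poly_quot A (carrier (rees A Q)) (rees_ext A \<mm> Q)"

text \<open>\<open>K\<cdot>M\<close> for an ideal \<open>K\<close> of \<open>A\<close> acting on a graded module \<open>M\<close> over the Rees algebra of \<open>Q\<close>
  through constant polynomials.\<close>

definition ideal_smult :: "('a, 'b) ring_scheme \<Rightarrow> 'a set \<Rightarrow> 'a set \<Rightarrow>
    (nat \<Rightarrow> 'a, 'm) gmodule \<Rightarrow> (nat \<Rightarrow> 'a, 'm) gmodule" where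
  "ideal_smult A Q K M = gsub M (submod_span (rees A Q) M
     {monom (UP A) a 0 \<odot>\<^bsub>M\<^esub> x | a x. a \<in> K \<and> x \<in> carrier M})"

definition sally_rank :: "('a, 'b) ring_scheme \<Rightarrow> 'a set \<Rightarrow> 'a set \<Rightarrow> 'a set \<Rightarrow> enat" where
  "sally_rank A \<mm> Q J = (let U = carrier (rees A Q) - rees_ext A \<mm> Q in
     module_length (loc_ring (rees A Q) U) (loc_module (rees A Q) U (sally_module A Q J)))"

text \<open>The \<open>n\<close>-Goto property with respect to \<open>Q\<close> involves the fixed canonical ideal \<open>I\<close>
  through \<open>J = I + Q\<close>.\<close>

definition n_Goto_ring :: "nat \<Rightarrow> ('a, 'b) ring_scheme \<Rightarrow> 'a set \<Rightarrow> 'a set \<Rightarrow> 'a set \<Rightarrow> bool" where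
  "n_Goto_ring n A \<mm> I Q \<longleftrightarrow> (let J = I <+>\<^bsub>A\<^esub> Q; S = sally_module A Q J in
     carrier S = submod_span (rees A Q) S (hpart S 1) \<and> sally_rank A \<mm> Q J = enat n)"

end

theory Submission
  imports Defs "HOL-Algebra.Subrings"
begin

text \<open>Write \<open>Q = (x, x\<^sub>2, \<dots>, x\<^sub>d)\<close> with \<open>x \<in> I\<close>, put
  \<open>q = (x\<^sub>2, \<dots>, x\<^sub>d)\<close>, and let \<open>\<T>\<close> and \<open>S\<close> be the Rees
  algebra of \<open>Q\<close> and the Sally module. All modules in question are subquotients of
  \<open>A[t]\<close>, so statements about them become statements about ideals of \<open>A\<close>, one degree at
  a time: \<open>\<mm>^j S\<close> consists of the classes of the polynomials with \<open>i\<close>-th coefficient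
  in \<open>W j i = \<mm>^j J^(i+1) + J Q^i\<close> (\<open>mS_span\<close>).\<close>

text \<open>Generation of \<open>S\<close> in degree one forces \<open>J\<^sup>3 = Q J\<^sup>2\<close>
  (\<open>cube_of_generation\<close>), and then \<open>W j (i+1) = Q^i W j 1\<close>, so that the whole filtration
  is controlled by the chain of ideals \<open>W j 1\<close> between \<open>J Q\<close> and
  \<open>J\<^sup>2\<close>. Take minimal generators \<open>m\<^sub>1, \<dots>, m\<^sub>s\<close> of
  \<open>W j 1\<close> modulo \<open>W (j+1) 1\<close>. Elements of \<open>\<mm>^j S\<close> are combinations of
  the \<open>m\<^sub>r t\<close> over \<open>\<T>\<close>, modulo \<open>\<mm>^(j+1) S\<close>, and the
  coefficients turn out to be unique modulo \<open>\<mm>\<T>\<close>. Hence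
  \<open>\<mm>^j S / \<mm>^(j+1) S\<close> is isomorphic to \<open>\<B>(-1)^s\<close>
  (\<open>layer_exact\<close>).\<close>

text \<open>Uniqueness is the heart of the matter (\<open>form_independence\<close>). It says that elements of
  \<open>J\<^sup>2\<close> that are independent modulo \<open>\<mm>\<close> remain so after multiplication by
  forms in the parameters, and it rests on \<open>q \<inter> J\<^sup>2 \<subseteq> q J\<close>. This is where the
  canonical ideal enters: the vanishing of \<open>Ext^i(A/\<mm>, I)\<close> below \<open>d\<close> makes the
  parameters a regular sequence on \<open>I\<close>, in every order, so \<open>x\<close> is regular on
  \<open>I/qI\<close>; as \<open>x\<close> multiplies \<open>q \<inter> I\<close> into \<open>q I\<close>, this
  yields \<open>q \<inter> I \<subseteq> q I\<close> (\<open>canonical_ideal_tail\<close>) and then the claim on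
  \<open>J\<^sup>2\<close> (\<open>square_tail\<close>). Independence of the order comes from Koszul cohomology
  (\<open>rreg_of_parameters\<close>). The same argument applied to \<open>A\<close> makes the parameters regular
  on \<open>A\<close>, and the fibre \<open>\<B>\<close> is then a polynomial ring over the residue field, hence a
  domain (\<open>fibre_domain\<close>).\<close>

text \<open>By Nakayama's lemma the chain \<open>W j 1\<close> decreases strictly until it reaches \<open>J Q\<close>, so
  the layers are nonzero up to some \<open>\<ell>\<close> and \<open>\<mm>^(\<ell>+1) S = 0\<close>; this is the
  filtration of the second condition (\<open>filtration_exists\<close>). Localizing at \<open>\<mm>\<T>\<close>
  turns \<open>\<B>\<close> into a field, so that the rank of \<open>S\<close> is the sum of the ranks of the
  layers (\<open>filtration_rank\<close>). Conversely, an extension of modules generated in degree one is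
  generated in degree one, so the filtration returns both halves of the Goto property
  (\<open>filtration_generated\<close>). Finally, if \<open>\<mm>^(\<ell>-1) S\<close> were the direct sum of the
  two outer terms of the top extension, then \<open>\<mm>\<close> would annihilate it, as it annihilates
  \<open>\<B>\<close>; but then \<open>\<mm>^\<ell> S = 0\<close> (\<open>nonsplit_extension\<close>).\<close>

no_notation Sum_Type.Plus (infixr \<open><+>\<close> 65)

section \<open>Ideals of a commutative ring\<close>

context cring
begin

lemma idl_carr: "ideal I R ==> x \<in> I ==> x \<in> carrier R"
  by (rule ideal.Icarr)

lemma idl_zero: "ideal I R ==> \<zero> \<in> I"
  by (simp add: additive_subgroup.zero_closed ideal.axioms(1))

lemma idl_add: "ideal I R ==> x \<in> I ==> y \<in> I ==> x \<oplus> y \<in> I"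
  by (simp add: additive_subgroup.a_closed ideal.axioms(1))

lemma idl_neg: "ideal I R ==> x \<in> I ==> \<ominus> x \<in> I"
  by (simp add: additive_subgroup.a_inv_closed ideal.axioms(1))

lemma idl_diff: "ideal I R ==> x \<in> I ==> y \<in> I ==> x \<ominus> y \<in> I"
  by (simp add: a_minus_def idl_add idl_neg)

lemma idl_l: "ideal I R ==> x \<in> I ==> a \<in> carrier R ==> a \<otimes> x \<in> I"
  by (rule ideal.I_l_closed)

lemma idl_r: "ideal I R ==> x \<in> I ==> a \<in> carrier R ==> x \<otimes> a \<in> I"
  by (rule ideal.I_r_closed)

lemmas idl_intros = idl_zero idl_add idl_neg idl_diff idl_l idl_r

lemma idl_sub: "ideal I R ==> I \<subseteq> carrier R"
  by (auto intro: idl_carr)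

lemma idl_diffD: "ideal I R ==> a \<ominus> b \<in> I ==> b \<in> I ==> a \<in> carrier R ==> a \<in> I"
proof -
  assume I: "ideal I R" and ab: "a \<ominus> b \<in> I" "b \<in> I" "a \<in> carrier R"
  have "b \<in> carrier R" using I ab idl_carr by blast
  then have "a = (a \<ominus> b) \<oplus> b" using ab(3) by algebra
  then show ?thesis using idl_add[OF I ab(1,2)] by simp
qed

lemma idl_addD: "ideal I R ==> a \<oplus> b \<in> I ==> b \<in> I ==> a \<in> carrier R ==> a \<in> I"
proof -
  assume I: "ideal I R" and ab: "a \<oplus> b \<in> I" "b \<in> I" "a \<in> carrier R"
  have "b \<in> carrier R" using I ab idl_carr by blast
  then have "a = (a \<oplus> b) \<ominus> b" using ab(3) by algebra
  then show ?thesis using idl_diff[OF I ab(1,2)] by simp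
qed

lemma idealI':
  assumes "I \<subseteq> carrier R" "\<zero> \<in> I" "\<And>x y. x \<in> I ==> y \<in> I ==> x \<oplus> y \<in> I"
    "\<And>a x. a \<in> carrier R ==> x \<in> I ==> a \<otimes> x \<in> I"
  shows "ideal I R"
proof (rule idealI)
  show "ring R" by (rule ring_axioms)
  have neg: "\<ominus> x \<in> I" if "x \<in> I" for x
  proof -
    have "x \<in> carrier R" using that assms(1) by blast
    then have "\<ominus> x = (\<ominus> \<one>) \<otimes> x" by algebra
    then show ?thesis using assms(4)[of "\<ominus> \<one>" x] that by simp
  qed
  show "subgroup I (add_monoid R)"
    by (rule add.subgroupI) (use assms neg in \<open>auto simp: a_inv_def\<close>)
  show "x \<otimes> a \<in> I" if "a \<in> I" "x \<in> carrier R" for a x using assms(4) that by blast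
  show "a \<otimes> x \<in> I" if "a \<in> I" "x \<in> carrier R" for a x
    using assms(1,4) that by (metis m_comm subsetD)
qed

lemma sum_mem: "x \<in> I <+> J \<longleftrightarrow> (\<exists>i\<in>I. \<exists>j\<in>J. x = i \<oplus> j)"
  unfolding set_add_def' by blast

lemma sum_le: "ideal K R ==> I \<subseteq> K ==> J \<subseteq> K ==> I <+> J \<subseteq> K"
  by (rule subsetI) (metis idl_add subsetD sum_mem)

lemma sum_ge1: "ideal I R ==> ideal J R ==> I \<subseteq> I <+> J"
  by (metis idl_carr idl_zero r_zero subsetI sum_mem)

lemma sum_ge2: "ideal I R ==> ideal J R ==> J \<subseteq> I <+> J"
  by (metis idl_carr idl_zero l_zero subsetI sum_mem)

lemma sum_mono: "I \<subseteq> I' ==> J \<subseteq> J' ==> I <+> J \<subseteq> I' <+> J'"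
  by (rule subsetI) (metis subsetD sum_mem)

lemma prod_le:
  assumes "ideal K R" "\<And>i j. i \<in> I ==> j \<in> J ==> i \<otimes> j \<in> K"
  shows "I \<cdot> J \<subseteq> K"
proof
  fix x assume "x \<in> I \<cdot> J" then show "x \<in> K"
    by induct (auto intro: assms(2) idl_add[OF assms(1)])
qed

lemma prod_mono: "I \<subseteq> I' ==> J \<subseteq> J' ==> I \<cdot> J \<subseteq> I' \<cdot> J'"
proof
  fix x assume a: "I \<subseteq> I'" "J \<subseteq> J'" "x \<in> I \<cdot> J"
  from a(3) show "x \<in> I' \<cdot> J'"
    by induct (use a in \<open>auto intro: ideal_prod.intros\<close>)
qed

lemma prod_mem: "i \<in> I ==> j \<in> J ==> i \<otimes> j \<in> I \<cdot> J"
  by (rule ideal_prod.prod)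

lemma prod_le1: "ideal I R ==> ideal J R ==> I \<cdot> J \<subseteq> I"
  by (rule prod_le) (auto intro: idl_r idl_carr)

lemma prod_le2: "ideal I R ==> ideal J R ==> I \<cdot> J \<subseteq> J"
  by (rule prod_le) (auto intro: idl_l idl_carr)

lemma prod_one: "ideal I R ==> carrier R \<cdot> I = I"
  by (simp add: ideal_prod_commute ideal_prod_one oneideal)

lemmas prod_ideal = ideal_prod_is_ideal
lemmas prod_comm = ideal_prod_commute
lemmas prod_assoc = ideal_prod_assoc

lemma prod_lcomm:
  "ideal I R ==> ideal J R ==> ideal K R ==> I \<cdot> (J \<cdot> K) = J \<cdot> (I \<cdot> K)"
  by (metis prod_assoc prod_comm)

lemma prod_principal_mem:
  assumes "x \<in> carrier R" "ideal L R"
  shows "y \<in> (PIdl x) \<cdot> L \<longleftrightarrow> (\<exists>l\<in>L. y = x \<otimes> l)"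
proof
  have id: "ideal {x \<otimes> l | l. l \<in> L} R"
  proof (rule idealI')
    show "{x \<otimes> l |l. l \<in> L} \<subseteq> carrier R" using assms idl_carr by auto
    show "\<zero> \<in> {x \<otimes> l |l. l \<in> L}" using assms idl_zero by (auto intro!: exI[of _ \<zero>])
  next
    fix u v assume "u \<in> {x \<otimes> l |l. l \<in> L}" "v \<in> {x \<otimes> l |l. l \<in> L}"
    then obtain l k where "u = x \<otimes> l" "v = x \<otimes> k" and lk: "l \<in> L" "k \<in> L" by blast
    then have "u \<oplus> v = x \<otimes> (l \<oplus> k)" using assms idl_carr by (simp add: r_distr)
    then show "u \<oplus> v \<in> {x \<otimes> l |l. l \<in> L}" using lk idl_add[OF assms(2)] by blast
  next
    fix a u assume a: "a \<in> carrier R" and "u \<in> {x \<otimes> l |l. l \<in> L}"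
    then obtain l where "u = x \<otimes> l" and l: "l \<in> L" by blast
    then have "a \<otimes> u = x \<otimes> (a \<otimes> l)" using assms a idl_carr m_lcomm by simp
    then show "a \<otimes> u \<in> {x \<otimes> l |l. l \<in> L}" using l idl_l[OF assms(2)] a by blast
  qed
  have "(PIdl x) \<cdot> L \<subseteq> {x \<otimes> l | l. l \<in> L}"
  proof (rule prod_le[OF id])
    fix i j assume "i \<in> PIdl x" and j: "j \<in> L"
    then obtain a where a: "a \<in> carrier R" "i = a \<otimes> x" unfolding cgenideal_def by blast
    have jc: "j \<in> carrier R" using j assms idl_carr by blast
    have "i \<otimes> j = x \<otimes> (a \<otimes> j)" using a jc assms(1) by algebra
    then show "i \<otimes> j \<in> {x \<otimes> l | l. l \<in> L}" using a j idl_l[OF assms(2)] by blast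
  qed
  then show "y \<in> (PIdl x) \<cdot> L ==> \<exists>l\<in>L. y = x \<otimes> l" by blast
  show "\<exists>l\<in>L. y = x \<otimes> l ==> y \<in> (PIdl x) \<cdot> L"
    using prod_mem cgenideal_self[OF assms(1)] by blast
qed

lemma Idl_Cons: "x \<in> carrier R ==> X \<subseteq> carrier R ==> Idl (insert x X) = PIdl x <+> Idl X"
proof
  assume x: "x \<in> carrier R" and X: "X \<subseteq> carrier R"
  have id: "ideal (PIdl x) R" "ideal (Idl X) R" using x X cgenideal_ideal genideal_ideal by auto
  have ids: "ideal (PIdl x <+> Idl X) R" by (rule add_ideals[OF id])
  have "x \<in> PIdl x <+> Idl X" using sum_ge1[OF id] cgenideal_self[OF x] by blast
  moreover have "X \<subseteq> PIdl x <+> Idl X" using sum_ge2[OF id] genideal_self[OF X] by blast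
  ultimately show "Idl (insert x X) \<subseteq> PIdl x <+> Idl X" by (intro genideal_minimal ids) auto
  have idr: "ideal (Idl (insert x X)) R" using x X by (intro genideal_ideal) auto
  have sub: "insert x X \<subseteq> Idl (insert x X)" using x X by (intro genideal_self) auto
  show "PIdl x <+> Idl X \<subseteq> Idl (insert x X)"
    using sub by (intro sum_le idr cgenideal_minimal genideal_minimal) auto
qed

lemma Idl_empty: "Idl {} = {\<zero>}"
proof
  show "Idl {} \<subseteq> {\<zero>}" by (rule genideal_minimal[OF zeroideal]) auto
  show "{\<zero>} \<subseteq> Idl {}" using idl_zero genideal_ideal[of "{}"] by auto
qed

lemma pow_ideal: "ideal K R ==> ideal (ideal_pow R K i) R"
  by (induct i) (auto intro: oneideal prod_ideal)

lemma pow_one: "ideal K R ==> ideal_pow R K (Suc 0) = K"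
  by (simp add: ideal_prod_one)

lemma pow_add: "ideal K R ==> ideal_pow R K (i + j) = ideal_pow R K i \<cdot> ideal_pow R K j"
proof (induct i)
  case 0 then show ?case using prod_one[OF pow_ideal] by simp
next
  case (Suc i) then show ?case by (simp add: prod_assoc pow_ideal)
qed

lemma pow_mono: "K \<subseteq> L ==> ideal_pow R K i \<subseteq> ideal_pow R L i"
  by (induct i) (auto dest: prod_mono[THEN subsetD, rotated 2])

lemma pow_Suc_le: "ideal K R ==> ideal_pow R K (Suc i) \<subseteq> ideal_pow R K i"
  by (simp add: prod_le2 pow_ideal)

lemma idl_finsum: "ideal D R ==> (\<And>r. r \<in> S ==> f r \<in> D) ==> finite S ==> finsum R f S \<in> D"
proof (induct S rule: infinite_finite_induct)
  case (insert x F)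
  have "f \<in> F \<rightarrow> carrier R" "f x \<in> carrier R" using insert idl_carr by auto
  then show ?case using insert by (auto intro: idl_add)
qed (auto intro: idl_zero)

text \<open>Combinations of \<open>m 0, \<dots>, m (s - 1)\<close> with coefficients in an ideal \<open>N\<close>, up to
  elements of \<open>B\<close>. The coefficients are constrained at all indices, also beyond \<open>s\<close>,
  which spares case distinctions.\<close>

definition lin_set :: "nat => (nat => 'a) => 'a set => 'a set => 'a set" where
  "lin_set s m N B = {(\<Oplus>r\<in>{..<s}. c r \<otimes> m r) \<oplus> b | c b. (\<forall>r. c r \<in> N) \<and> b \<in> B}"

lemma lin_set_ideal:
  assumes N: "ideal N R" and B: "ideal B R" and m: "\<And>r. r < s ==> m r \<in> carrier R"
  shows "ideal (lin_set s m N B) R"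
proof (rule idealI')
  have cl: "(\<lambda>r. c r \<otimes> m r) \<in> {..<s} \<rightarrow> carrier R" if "\<forall>r. c r \<in> N" for c
    using that m idl_carr[OF N] by auto
  show "lin_set s m N B \<subseteq> carrier R"
    unfolding lin_set_def using cl idl_carr[OF B] by (auto intro!: add.m_closed finsum_closed)
  have "(\<Oplus>r\<in>{..<s}. \<zero> \<otimes> m r) = \<zero>"
    by (rule add.finprod_one_eqI) (use m in auto)
  then show "\<zero> \<in> lin_set s m N B"
    unfolding lin_set_def using idl_zero[OF N] idl_zero[OF B]
    by (auto intro!: exI[of _ "\<lambda>_. \<zero>"] exI[of _ \<zero>])
next
  fix x y assume "x \<in> lin_set s m N B" "y \<in> lin_set s m N B"
  then obtain c b d e where c: "\<forall>r. c r \<in> N" and d: "\<forall>r. d r \<in> N" and b: "b \<in> B" "e \<in> B"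
    and x: "x = (\<Oplus>r\<in>{..<s}. c r \<otimes> m r) \<oplus> b" and y: "y = (\<Oplus>r\<in>{..<s}. d r \<otimes> m r) \<oplus> e"
    unfolding lin_set_def by blast
  have cl: "(\<lambda>r. c r \<otimes> m r) \<in> {..<s} \<rightarrow> carrier R" "(\<lambda>r. d r \<otimes> m r) \<in> {..<s} \<rightarrow> carrier R"
    using c d m idl_carr[OF N] by auto
  have "(\<Oplus>r\<in>{..<s}. (c r \<oplus> d r) \<otimes> m r) = (\<Oplus>r\<in>{..<s}. c r \<otimes> m r \<oplus> d r \<otimes> m r)"
    by (rule finsum_cong') (use c d m idl_carr[OF N] in \<open>auto simp: l_distr\<close>)
  also have "\<dots> = (\<Oplus>r\<in>{..<s}. c r \<otimes> m r) \<oplus> (\<Oplus>r\<in>{..<s}. d r \<otimes> m r)"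
    using cl by (rule finsum_addf)
  finally have "x \<oplus> y = (\<Oplus>r\<in>{..<s}. (c r \<oplus> d r) \<otimes> m r) \<oplus> (b \<oplus> e)"
    unfolding x y using cl[THEN finsum_closed] b idl_carr[OF B]
    by (simp add: a_ac)
  moreover have "\<forall>r. c r \<oplus> d r \<in> N" using c d idl_add[OF N] by blast
  ultimately show "x \<oplus> y \<in> lin_set s m N B"
    unfolding lin_set_def using idl_add[OF B b]
    by (intro CollectI exI[of _ "\<lambda>r. c r \<oplus> d r"] exI[of _ "b \<oplus> e"] conjI)
next
  fix a x assume a: "a \<in> carrier R" and "x \<in> lin_set s m N B"
  then obtain c b where c: "\<forall>r. c r \<in> N" and b: "b \<in> B"
    and x: "x = (\<Oplus>r\<in>{..<s}. c r \<otimes> m r) \<oplus> b"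
    unfolding lin_set_def by blast
  have cl: "(\<lambda>r. c r \<otimes> m r) \<in> {..<s} \<rightarrow> carrier R"
    using c m idl_carr[OF N] by auto
  have "a \<otimes> (\<Oplus>r\<in>{..<s}. c r \<otimes> m r) = (\<Oplus>r\<in>{..<s}. a \<otimes> (c r \<otimes> m r))"
    using cl a by (intro finsum_rdistr) auto
  also have "\<dots> = (\<Oplus>r\<in>{..<s}. (a \<otimes> c r) \<otimes> m r)"
    by (rule finsum_cong') (use c a m idl_carr[OF N] in \<open>auto simp: m_assoc\<close>)
  finally have "a \<otimes> x = (\<Oplus>r\<in>{..<s}. (a \<otimes> c r) \<otimes> m r) \<oplus> a \<otimes> b"
    unfolding x using cl[THEN finsum_closed] b idl_carr[OF B] a
    by (simp add: r_distr)
  moreover have "\<forall>r. a \<otimes> c r \<in> N" using c a idl_l[OF N] by blast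
  ultimately show "a \<otimes> x \<in> lin_set s m N B"
    unfolding lin_set_def using idl_l[OF B b a]
    by (intro CollectI exI[of _ "\<lambda>r. a \<otimes> c r"] exI[of _ "a \<otimes> b"] conjI)
qed

lemma lin_set_gen:
  assumes N: "ideal N R" and B: "ideal B R" and m: "\<And>r. r < s ==> m r \<in> carrier R"
    and "r < s" "a \<in> N"
  shows "a \<otimes> m r \<in> lin_set s m N B"
proof -
  have ac: "a \<in> carrier R" using assms idl_carr by blast
  have "(\<Oplus>j\<in>{..<s}. (if j = r then a else \<zero>) \<otimes> m j) = (\<Oplus>j\<in>{..<s}. if r = j then a \<otimes> m j else \<zero>)"
    by (rule finsum_cong') (use m ac in auto)
  also have "\<dots> = a \<otimes> m r"
    using assms ac by (intro finsum_singleton) auto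
  finally have "a \<otimes> m r = (\<Oplus>j\<in>{..<s}. (if j = r then a else \<zero>) \<otimes> m j) \<oplus> \<zero>"
    using ac m[OF \<open>r < s\<close>] by simp
  then show ?thesis unfolding lin_set_def using idl_zero[OF N] idl_zero[OF B] \<open>a \<in> N\<close>
    by (intro CollectI exI[of _ "\<lambda>j. if j = r then a else \<zero>"] exI[of _ \<zero>]) auto
qed

lemma lin_set_base: "ideal N R ==> ideal B R ==> (\<And>r. r < s ==> m r \<in> carrier R) ==> B \<subseteq> lin_set s m N B"
proof
  fix b assume N: "ideal N R" and B: "ideal B R" and m: "\<And>r. r < s ==> m r \<in> carrier R" and b: "b \<in> B"
  have "(\<Oplus>r\<in>{..<s}. \<zero> \<otimes> m r) = \<zero>"
    by (rule add.finprod_one_eqI) (use m in auto)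
  then have "b = (\<Oplus>r\<in>{..<s}. \<zero> \<otimes> m r) \<oplus> b" using b idl_carr[OF B] by simp
  then show "b \<in> lin_set s m N B" unfolding lin_set_def using idl_zero[OF N] b
    by (intro CollectI exI[of _ "\<lambda>_. \<zero>"] exI[of _ b]) auto
qed

lemma lin_set_le:
  assumes "ideal D R" "B \<subseteq> D" "\<And>r a. r < s ==> a \<in> N ==> a \<otimes> m r \<in> D"
  shows "lin_set s m N B \<subseteq> D"
  unfolding lin_set_def using assms by (auto intro!: idl_add idl_finsum)

text \<open>A prime contains a product only if it contains a factor, so the product of elements of \<open>N\<close> and of
  the ideals in \<open>F\<close>, all outside \<open>P\<close>, does the job.\<close>

lemma ex_avoid:
  assumes "primeideal P R" "ideal N R" "\<not> N \<subseteq> P" "finite F" "\<And>Q. Q \<in> F ==> ideal Q R \<and> \<not> Q \<subseteq> P"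
  shows "\<exists>z\<in>N. z \<notin> P \<and> (\<forall>Q\<in>F. z \<in> Q)"
  using assms(4,5)
proof (induct F)
  case empty then show ?case using assms by blast
next
  case (insert Q F)
  have "\<exists>z\<in>N. z \<notin> P \<and> (\<forall>Q\<in>F. z \<in> Q)" by (rule insert.hyps(3)) (simp add: insert.prems)
  then obtain z where z: "z \<in> N" "z \<notin> P" "\<forall>Q\<in>F. z \<in> Q" by blast
  have idQ: "ideal Q R" and "\<not> Q \<subseteq> P" using insert.prems[of Q] by auto
  then obtain q where q: "q \<in> Q" "q \<notin> P" by blast
  have c: "z \<in> carrier R" "q \<in> carrier R" using idl_carr[OF assms(2) z(1)] idl_carr[OF idQ q(1)] by auto
  have "z \<otimes> q \<notin> P" using primeideal.I_prime[OF assms(1) c] z(2) q(2) by blast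
  moreover have "z \<otimes> q \<in> N" using idl_r[OF assms(2) z(1) c(2)] .
  moreover have "\<forall>Q\<in>insert Q F. z \<otimes> q \<in> Q"
  proof
    fix Q' assume Q': "Q' \<in> insert Q F"
    then have id: "ideal Q' R" using insert.prems by blast
    show "z \<otimes> q \<in> Q'"
      using Q' z(3) q(1) idl_r[OF id _ c(2)] idl_l[OF id _ c(1)] by blast
  qed
  ultimately show ?case by blast
qed

text \<open>For an antichain of primes the usual correction works at each step: an element avoiding \<open>F\<close> that
  lies in \<open>P\<close> is changed by an element of \<open>N\<close> outside \<open>P\<close> that lies in all
  members of \<open>F\<close>.\<close>

lemma prime_avoidance:
  assumes "ideal N R" "finite F" "\<And>P. P \<in> F ==> primeideal P R \<and> \<not> N \<subseteq> P"
    "\<And>P Q. P \<in> F ==> Q \<in> F ==> P \<subseteq> Q ==> P = Q"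
  shows "\<exists>x\<in>N. \<forall>P\<in>F. x \<notin> P"
  using assms(2,3,4)
proof (induct F)
  case empty then show ?case using idl_zero[OF assms(1)] by blast
next
  case (insert P F)
  have pid: "\<And>Q. Q \<in> insert P F ==> ideal Q R" using insert.prems(1) primeideal.axioms(1) by metis
  have "\<exists>x\<in>N. \<forall>P\<in>F. x \<notin> P"
    by (rule insert.hyps(3)) (simp_all add: insert.prems)
  then obtain x where x: "x \<in> N" "\<forall>P\<in>F. x \<notin> P" by blast
  show ?case
  proof (cases "x \<in> P")
    case False then show ?thesis using x by blast
  next
    case True
    have "\<exists>z\<in>N. z \<notin> P \<and> (\<forall>Q\<in>F. z \<in> Q)"
    proof (rule ex_avoid[OF _ assms(1) _ insert.hyps(1)])
      show "primeideal P R" "\<not> N \<subseteq> P" using insert.prems(1)[of P] by auto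
      fix Q assume "Q \<in> F"
      then show "ideal Q R \<and> \<not> Q \<subseteq> P" using pid[of Q] insert.prems(2)[of Q P] insert.hyps(2) by auto
    qed
    then obtain z where z: "z \<in> N" "z \<notin> P" "\<forall>Q\<in>F. z \<in> Q" by blast
    have xz: "x \<in> carrier R" "z \<in> carrier R" using idl_carr[OF assms(1)] x(1) z(1) by auto
    have "x \<oplus> z \<notin> Q" if "Q \<in> insert P F" for Q
    proof
      assume q: "x \<oplus> z \<in> Q"
      show False
      proof (cases "Q = P")
        case True
        have "z \<in> P" using q True \<open>x \<in> P\<close> xz idl_addD[of P z x] pid a_comm by auto
        then show False using z by blast
      next
        case False
        then have "Q \<in> F" using that by blast
        then have "x \<in> Q" using idl_addD[of Q x z] z pid q xz by blast
        then show False using x \<open>Q \<in> F\<close> by blast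
      qed
    qed
    then show ?thesis using idl_add[OF assms(1) x(1) z(1)] by blast
  qed
qed

text \<open>In a product of \<open>k + l\<close> factors from \<open>U + V\<close>, either at least \<open>k\<close> come
  from \<open>U\<close> or at least \<open>l\<close> come from \<open>V\<close>.\<close>

lemma pow_sum_le: "ideal U R ==> ideal V R ==>
  ideal_pow R (U <+> V) (k + l) \<subseteq> ideal_pow R U k <+> ideal_pow R V l"
proof (induct "k + l" arbitrary: k l)
  case 0 then show ?case using sum_ge1[OF oneideal oneideal] by simp
next
  case (Suc n)
  note U = Suc.prems(1) and V = Suc.prems(2)
  have UV: "ideal (U <+> V) R" using U V by (rule add_ideals)
  show ?case
  proof (cases "k = 0 \<or> l = 0")
    case True
    have c: "ideal_pow R (U <+> V) (k + l) \<subseteq> carrier R" using pow_ideal[OF UV] idl_sub by blast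
    from True show ?thesis
    proof
      assume "k = 0"
      then show ?thesis using c sum_ge1[OF oneideal pow_ideal[OF V]] by fastforce
    next
      assume "l = 0"
      then show ?thesis using c sum_ge2[OF pow_ideal[OF U] oneideal] by fastforce
    qed
  next
    case False
    then obtain k' l' where k: "k = Suc k'" and l: "l = Suc l'" by (metis not0_implies_Suc)
    let ?T = "ideal_pow R U k <+> ideal_pow R V l"
    have T: "ideal ?T R" by (intro add_ideals pow_ideal U V)
    have e: "ideal_pow R (U <+> V) (k + l) = (U <+> V) \<cdot> ideal_pow R (U <+> V) n"
      using Suc.hyps(2) by (metis ideal_pow.simps(2))
    have 1: "ideal_pow R (U <+> V) n \<subseteq> ideal_pow R U k' <+> ideal_pow R V l"
      using Suc.hyps(1)[of k' l] Suc.hyps(2) k U V by simp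
    have 2: "ideal_pow R (U <+> V) n \<subseteq> ideal_pow R U k <+> ideal_pow R V l'"
      using Suc.hyps(1)[of k l'] Suc.hyps(2) l U V by simp
    have "(U <+> V) \<cdot> ideal_pow R (U <+> V) n \<subseteq> ?T"
    proof (rule prod_le[OF T])
      fix i j assume "i \<in> U <+> V" and j: "j \<in> ideal_pow R (U <+> V) n"
      then obtain u v where uv: "u \<in> U" "v \<in> V" "i = u \<oplus> v" by (auto simp: sum_mem)
      obtain a b where ab: "a \<in> ideal_pow R U k'" "b \<in> ideal_pow R V l" "j = a \<oplus> b"
        using subsetD[OF 1 j] unfolding sum_mem by blast
      obtain c d where cd: "c \<in> ideal_pow R U k" "d \<in> ideal_pow R V l'" "j = c \<oplus> d"
        using subsetD[OF 2 j] unfolding sum_mem by blast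
      have car: "u \<in> carrier R" "v \<in> carrier R" "a \<in> carrier R" "b \<in> carrier R" "c \<in> carrier R" "d \<in> carrier R"
        using uv ab cd U V idl_carr pow_ideal by blast+
      have "i \<otimes> j = u \<otimes> j \<oplus> v \<otimes> j" using uv car ab by (simp add: l_distr)
      also have "\<dots> = (u \<otimes> a \<oplus> u \<otimes> b) \<oplus> (v \<otimes> c \<oplus> v \<otimes> d)"
        using ab(3) cd(3) car by (metis r_distr)
      also have "\<dots> = (u \<otimes> a \<oplus> v \<otimes> c) \<oplus> (u \<otimes> b \<oplus> v \<otimes> d)" using car by algebra
      finally have eq: "i \<otimes> j = (u \<otimes> a \<oplus> v \<otimes> c) \<oplus> (u \<otimes> b \<oplus> v \<otimes> d)" .
      have "u \<otimes> a \<oplus> v \<otimes> c \<in> ideal_pow R U k"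
        using idl_add[OF pow_ideal[OF U], of "u \<otimes> a" k "v \<otimes> c"] idl_l[OF pow_ideal[OF U] cd(1) car(2)]
          prod_mem[OF uv(1) ab(1)] k by simp
      moreover have "u \<otimes> b \<oplus> v \<otimes> d \<in> ideal_pow R V l"
        using idl_add[OF pow_ideal[OF V], of "u \<otimes> b" l "v \<otimes> d"] idl_l[OF pow_ideal[OF V] ab(2) car(1)]
          prod_mem[OF uv(2) cd(2)] l by simp
      ultimately show "i \<otimes> j \<in> ?T" using eq by (auto simp: sum_mem)
    qed
    then show ?thesis using e by simp
  qed
qed

lemma pow_principal: "x \<in> carrier R ==> ideal_pow R (PIdl x) k = PIdl (x [^] k)"
proof (induct k)
  case 0
  have "PIdl \<one> = carrier R" unfolding cgenideal_def by (auto intro!: exI)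
  then show ?case by simp
next
  case (Suc k)
  have id: "ideal (PIdl (x [^] k)) R" using Suc by (intro cgenideal_ideal) auto
  have "y \<in> (PIdl x) \<cdot> (PIdl (x [^] k)) \<longleftrightarrow> y \<in> PIdl (x [^] Suc k)" for y
  proof -
    have "y \<in> (PIdl x) \<cdot> (PIdl (x [^] k)) \<longleftrightarrow> (\<exists>a\<in>carrier R. y = x \<otimes> (a \<otimes> x [^] k))"
      by (subst prod_principal_mem[OF Suc.prems id]) (auto simp: cgenideal_def)
    moreover have "x \<otimes> (a \<otimes> x [^] k) = a \<otimes> x [^] Suc k" if "a \<in> carrier R" for a
      using Suc.prems that by (simp add: m_ac)
    ultimately show ?thesis by (auto simp: cgenideal_def)
  qed
  then show ?case using Suc by auto
qed

lemma fin_gen_nilpotent: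
  assumes "ideal Q R" "finite X" "X \<subseteq> carrier R" "\<And>x. x \<in> X ==> \<exists>k::nat. x [^] k \<in> Q"
  shows "\<exists>k. ideal_pow R (Idl X) k \<subseteq> Q"
  using assms(2,3,4)
proof (induct X)
  case empty
  have "ideal_pow R (Idl {}) 1 \<subseteq> Q" using idl_zero[OF assms(1)] by (simp add: Idl_empty ideal_prod_one zeroideal)
  then show ?case by blast
next
  case (insert x X)
  then obtain k where k: "ideal_pow R (Idl X) k \<subseteq> Q" by auto
  obtain l :: nat where l: "x [^] l \<in> Q" using insert.prems(2)[of x] by auto
  have id: "ideal (PIdl x) R" "ideal (Idl X) R" using insert cgenideal_ideal genideal_ideal by auto
  have "ideal_pow R (PIdl x) l \<subseteq> Q" using insert l by (simp add: pow_principal cgenideal_minimal[OF assms(1)])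
  then have "ideal_pow R (PIdl x <+> Idl X) (l + k) \<subseteq> Q"
    using pow_sum_le[OF id, of l k] sum_le[OF assms(1)] k by blast
  then show ?case using Idl_Cons insert by auto
qed

end

section \<open>Noetherian local rings\<close>

lemma (in noetherian_ring) ex_maximal_ideal_in:
  assumes "S \<noteq> {}" "\<And>I. I \<in> S ==> ideal I R"
  shows "\<exists>M\<in>S. \<forall>X\<in>S. M \<subseteq> X --> X = M"
proof (rule subset_Zorn_nonempty[OF assms(1)])
  fix C assume C: "C \<noteq> {}" "subset.chain S C"
  have "subset.chain {I. ideal I R} C" using C(2) assms(2) unfolding subset.chain_def by blast
  then have "\<Union>C \<in> C" using ideal_chain_is_trivial C(1) by blast
  then show "\<Union>C \<in> S" using C(2) unfolding subset.chain_def by blast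
qed

locale noeth_local = cring R for R (structure) +
  fixes \<mm> :: "'a set"
  assumes nl: "noeth_local_ring R \<mm>"
begin

lemma noeth: "noetherian_ring R" using nl unfolding noeth_local_ring_def by blast

lemma mmax: "maximalideal \<mm> R" using nl unfolding noeth_local_ring_def by blast

lemma mid: "ideal \<mm> R" using mmax maximalideal.axioms(1) by blast

lemma mprime: "primeideal \<mm> R" using mmax by (rule maximalideal_prime)

lemma one_notin_m: "\<one> \<notin> \<mm>"
  using ideal.one_imp_carrier[OF mid] maximalideal.I_notcarr[OF mmax] by blast

lemma proper_ideal_le: "ideal I R ==> \<one> \<notin> I ==> I \<subseteq> \<mm>"
proof -
  assume I: "ideal I R" "\<one> \<notin> I"
  let ?S = "{K. ideal K R \<and> I \<subseteq> K \<and> \<one> \<notin> K}"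
  have "\<exists>M\<in>?S. \<forall>X\<in>?S. M \<subseteq> X --> X = M"
    by (rule noetherian_ring.ex_maximal_ideal_in[OF noeth]) (use I in auto)
  then obtain M where "M \<in> ?S" and Mm: "\<forall>X\<in>?S. M \<subseteq> X --> X = M" by (rule bexE)
  then have M: "ideal M R" "I \<subseteq> M" "\<one> \<notin> M" by simp_all
  have M4: "\<And>X. ideal X R ==> \<one> \<notin> X ==> M \<subseteq> X ==> X = M"
    using Mm M(2) by (metis (mono_tags, lifting) mem_Collect_eq order_trans)
  have "maximalideal M R"
  proof (rule maximalidealI[OF M(1)])
    show "carrier R \<noteq> M" using M(3) by blast
    fix J assume J: "ideal J R" "M \<subseteq> J" "J \<subseteq> carrier R"
    show "J = M \<or> J = carrier R" using M4[OF J(1) _ J(2)] ideal.one_imp_carrier[OF J(1)] by metis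
  qed
  then have "M = \<mm>" using nl unfolding noeth_local_ring_def by simp
  then show ?thesis using M(2) by simp
qed

lemma unit_ex:
  assumes "a \<in> carrier R" "a \<notin> \<mm>" shows "\<exists>b\<in>carrier R. b \<otimes> a = \<one>"
proof (rule ccontr)
  assume "\<not> ?thesis"
  then have "\<one> \<notin> PIdl a" unfolding cgenideal_def by (auto simp: eq_commute[of \<one>])
  then have "PIdl a \<subseteq> \<mm>" by (rule proper_ideal_le[OF cgenideal_ideal[OF assms(1)]])
  then show False using cgenideal_self[OF assms(1)] assms(2) by blast
qed

text \<open>A generating family of \<open>Z\<close> modulo \<open>B\<close> of least length: a relation with a unit
  coefficient would allow one generator to be eliminated, so all coefficients of relations lie in
  \<open>\<mm>\<close>. Relations are taken modulo \<open>\<mm>Z + B\<close>, not just modulo \<open>B\<close>,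
  because this is the form in which they yield a basis of \<open>Z/(\<mm>Z + B)\<close>.\<close>

lemma minimal_generators:
  assumes Z: "ideal Z R" and B: "ideal B R" and "B \<subseteq> Z"
  shows "\<exists>s m. (\<forall>r<s. m r \<in> Z) \<and> Z = lin_set s m (carrier R) B \<and>
    (\<forall>c. (\<forall>r. c r \<in> carrier R) \<and> (\<Oplus>r\<in>{..<s}. c r \<otimes> m r) \<in> \<mm> \<cdot> Z <+> B --> (\<forall>r<s. c r \<in> \<mm>))"
proof -
  define P where "P s = (\<exists>m. (\<forall>r<s. m r \<in> Z) \<and> Z \<subseteq> lin_set s m (carrier R) B)" for s :: nat
  obtain X where X: "X \<subseteq> carrier R" "finite X" "Z = Idl X"
    using noetherian_ring.finetely_gen[OF noeth Z] by blast
  obtain m0 where m0: "X = m0 ` {i::nat. i < card X}"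
    using finite_imp_nat_seg_image_inj_on[OF X(2)] by (metis card_Collect_less_nat card_image)
  have "P (card X)"
    unfolding P_def
  proof (intro exI conjI)
    have XZ: "X \<subseteq> Z" using X genideal_self by blast
    show "\<forall>r<card X. m0 r \<in> Z" using XZ m0 by blast
    have c: "\<And>r. r < card X ==> m0 r \<in> carrier R" using X m0 by blast
    have "X \<subseteq> lin_set (card X) m0 (carrier R) B"
    proof
      fix x assume "x \<in> X"
      then obtain r where r: "x = m0 r" "r < card X" using m0 by blast
      have "\<one> \<otimes> m0 r \<in> lin_set (card X) m0 (carrier R) B"
        by (rule lin_set_gen) (use oneideal B c r in auto)
      then show "x \<in> lin_set (card X) m0 (carrier R) B" using r c by simp
    qed
    then show "Z \<subseteq> lin_set (card X) m0 (carrier R) B"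
      unfolding X(3) by (intro genideal_minimal lin_set_ideal oneideal B c)
  qed
  define s where "s = (LEAST s. P s)"
  have "P s" unfolding s_def using \<open>P (card X)\<close> by (rule LeastI)
  then obtain m where m: "\<And>r. r < s ==> m r \<in> Z" and Zle: "Z \<subseteq> lin_set s m (carrier R) B"
    unfolding P_def by blast
  have mc: "\<And>r. r < s ==> m r \<in> carrier R" using m idl_carr[OF Z] by blast
  have Zeq: "Z = lin_set s m (carrier R) B"
    using Zle lin_set_le[OF Z assms(3), of s "carrier R" m] m idl_l[OF Z] by blast
  show ?thesis
  proof (intro exI[of _ s] exI[of _ m] conjI allI impI)
    show "m r \<in> Z" if "r < s" for r using that by (rule m)
    show "Z = lin_set s m (carrier R) B" by (rule Zeq)
    fix c r0 assume "(\<forall>r. c r \<in> carrier R) \<and> (\<Oplus>r\<in>{..<s}. c r \<otimes> m r) \<in> \<mm> \<cdot> Z <+> B"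
      and r0: "r0 < s"
    then have c: "\<And>r. c r \<in> carrier R" and rel: "(\<Oplus>r\<in>{..<s}. c r \<otimes> m r) \<in> \<mm> \<cdot> Z <+> B" by simp_all
    show "c r0 \<in> \<mm>"
    proof (rule ccontr)
      assume nc: "c r0 \<notin> \<mm>"
      have idl: "ideal (lin_set s m \<mm> B) R" by (rule lin_set_ideal[OF mid B mc])
      have base: "B \<subseteq> lin_set s m \<mm> B" by (rule lin_set_base[OF mid B mc])
      have "\<mm> \<cdot> Z \<subseteq> lin_set s m \<mm> B"
      proof (rule prod_le[OF idl])
        fix i z assume i: "i \<in> \<mm>" and "z \<in> Z"
        have ic: "i \<in> carrier R" using i mid idl_carr by blast
        obtain c b where c: "\<And>r. c r \<in> carrier R" and b: "b \<in> B" and z: "z = (\<Oplus>r\<in>{..<s}. c r \<otimes> m r) \<oplus> b"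
          using \<open>z \<in> Z\<close> Zle unfolding lin_set_def by blast
        have cl: "(\<lambda>r. c r \<otimes> m r) \<in> {..<s} \<rightarrow> carrier R" using c mc by auto
        have "i \<otimes> z = (\<Oplus>r\<in>{..<s}. i \<otimes> (c r \<otimes> m r)) \<oplus> i \<otimes> b"
          unfolding z using finsum_closed[OF cl] b idl_carr[OF B] ic
          by (simp add: r_distr finsum_rdistr[OF _ ic cl])
        moreover have "(\<Oplus>r\<in>{..<s}. i \<otimes> (c r \<otimes> m r)) \<in> lin_set s m \<mm> B"
        proof (rule idl_finsum[OF idl])
          fix r assume "r \<in> {..<s}"
          moreover have "(i \<otimes> c r) \<otimes> m r \<in> lin_set s m \<mm> B"
            by (rule lin_set_gen[OF mid B mc]) (use \<open>r \<in> {..<s}\<close> i c idl_r[OF mid] in auto)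
          ultimately show "i \<otimes> (c r \<otimes> m r) \<in> lin_set s m \<mm> B" using ic c mc by (simp add: m_assoc)
        qed simp
        moreover have "i \<otimes> b \<in> lin_set s m \<mm> B"
          using base idl_l[OF B b ic] by blast
        ultimately show "i \<otimes> z \<in> lin_set s m \<mm> B" using idl_add[OF idl] by simp
      qed
      then have "\<mm> \<cdot> Z <+> B \<subseteq> lin_set s m \<mm> B"
        using base by (rule sum_le[OF idl])
      then obtain d b where d: "\<And>r. d r \<in> \<mm>" and b: "b \<in> B"
        and eq: "(\<Oplus>r\<in>{..<s}. c r \<otimes> m r) = (\<Oplus>r\<in>{..<s}. d r \<otimes> m r) \<oplus> b"
        using rel unfolding lin_set_def by blast
      define e where "e = c r0 \<ominus> d r0"
      have dc: "\<And>r. d r \<in> carrier R" using d idl_carr[OF mid] by blast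
      have ec: "e \<in> carrier R" unfolding e_def using c dc by simp
      have "e \<notin> \<mm>" using idl_diffD[OF mid _ d c] nc unfolding e_def by blast
      then obtain e' where e': "e' \<in> carrier R" "e' \<otimes> e = \<one>" using unit_ex ec by blast
      obtain s' where s': "s = Suc s'" using r0 by (cases s) auto
      define m' where "m' r = m (if r = r0 then s' else r)" for r
      have m'Z: "\<And>r. r < s' ==> m' r \<in> Z" unfolding m'_def using m s' r0 by auto
      have m'c: "\<And>r. r < s' ==> m' r \<in> carrier R" using m'Z idl_carr[OF Z] by blast
      let ?D = "lin_set s' m' (carrier R) B"
      have D: "ideal ?D R" by (rule lin_set_ideal[OF oneideal B m'c])
      have BD: "B \<subseteq> ?D" by (rule lin_set_base[OF oneideal B m'c])
      have others: "m r \<in> ?D" if r: "r < s" "r \<noteq> r0" for r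
      proof -
        obtain t where t: "t < s'" "m r = m' t"
        proof (cases "r = s'")
          case True then show ?thesis using that[of r0] r r0 s' unfolding m'_def by auto
        next
          case False then show ?thesis using that[of r] r s' unfolding m'_def by auto
        qed
        have "\<one> \<otimes> m' t \<in> ?D" by (rule lin_set_gen[OF oneideal B m'c]) (use t in auto)
        then show ?thesis using t m'c by simp
      qed
      let ?f = "\<lambda>r. (c r \<ominus> d r) \<otimes> m r"
      have fc: "?f \<in> {..<s} \<rightarrow> carrier R" using c dc mc by auto
      have "(\<Oplus>r\<in>{..<s}. c r \<otimes> m r) = (\<Oplus>r\<in>{..<s}. ?f r \<oplus> d r \<otimes> m r)"
      proof (rule finsum_cong')
        show "(\<lambda>r. ?f r \<oplus> d r \<otimes> m r) \<in> {..<s} \<rightarrow> carrier R" using c dc mc by auto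
        fix r assume "r \<in> {..<s}"
        then have "m r \<in> carrier R" using mc by simp
        then show "c r \<otimes> m r = ?f r \<oplus> d r \<otimes> m r" using c[of r] dc[of r] by algebra
      qed simp
      also have "\<dots> = (\<Oplus>r\<in>{..<s}. ?f r) \<oplus> (\<Oplus>r\<in>{..<s}. d r \<otimes> m r)"
        by (rule finsum_addf[OF fc]) (use dc mc in auto)
      finally have "(\<Oplus>r\<in>{..<s}. d r \<otimes> m r) \<oplus> b = (\<Oplus>r\<in>{..<s}. ?f r) \<oplus> (\<Oplus>r\<in>{..<s}. d r \<otimes> m r)"
        using eq by simp
      moreover have "(\<Oplus>r\<in>{..<s}. d r \<otimes> m r) \<in> carrier R" using dc mc by (intro finsum_closed) auto
      moreover have "(\<Oplus>r\<in>{..<s}. ?f r) \<in> carrier R" using fc by (rule finsum_closed)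
      ultimately have fb: "(\<Oplus>r\<in>{..<s}. ?f r) = b" using idl_carr[OF B b]
        add.l_cancel[of "\<Oplus>r\<in>{..<s}. d r \<otimes> m r" b "\<Oplus>r\<in>{..<s}. ?f r"]
          a_comm[of "\<Oplus>r\<in>{..<s}. d r \<otimes> m r" "\<Oplus>r\<in>{..<s}. ?f r"] by simp
      have "{..<s} = insert r0 ({..<s} - {r0})" using r0 by auto
      then have "(\<Oplus>r\<in>{..<s}. ?f r) = ?f r0 \<oplus> (\<Oplus>r\<in>{..<s} - {r0}. ?f r)"
        using finsum_insert[of "{..<s} - {r0}" r0 ?f] fc r0 by auto
      then have bb: "b = e \<otimes> m r0 \<oplus> (\<Oplus>r\<in>{..<s} - {r0}. ?f r)" using fb e_def by simp
      have "(\<Oplus>r\<in>{..<s} - {r0}. ?f r) \<in> ?D"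
        by (rule idl_finsum[OF D]) (use others idl_l[OF D] c dc in auto)
      then have "e \<otimes> m r0 \<in> ?D"
        using idl_addD[OF D, of "e \<otimes> m r0"] bb b BD ec mc[OF r0] by auto
      then have "e' \<otimes> (e \<otimes> m r0) \<in> ?D" using idl_l[OF D] e' by blast
      then have "m r0 \<in> ?D" using e' ec mc[OF r0] by (metis l_one m_assoc)
      then have all: "\<And>r. r < s ==> m r \<in> ?D" using others by blast
      have "Z \<subseteq> ?D" unfolding Zeq by (rule lin_set_le[OF D BD]) (use all idl_l[OF D] in blast)
      then have "P s'" unfolding P_def using m'Z by blast
      then have "s \<le> s'" unfolding s_def by (rule Least_le)
      then show False using s' by simp
    qed
  qed
qed

text \<open>If \<open>\<mm>Z + B\<close> is all of \<open>Z\<close>, every combination of minimal generators is a relation;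
  the relation given by a single generator has coefficient one, so there is no generator.\<close>

lemma nakayama:
  assumes Z: "ideal Z R" and B: "ideal B R" and "B \<subseteq> Z" "Z \<subseteq> \<mm> \<cdot> Z <+> B"
  shows "Z = B"
proof -
  obtain s m where mm: "\<forall>r<s. m r \<in> Z" and Zeq: "Z = lin_set s m (carrier R) B"
    and ind: "\<forall>c. (\<forall>r. c r \<in> carrier R) \<and> (\<Oplus>r\<in>{..<s}. c r \<otimes> m r) \<in> \<mm> \<cdot> Z <+> B --> (\<forall>r<s. c r \<in> \<mm>)"
    using minimal_generators[OF Z B assms(3)] by (elim exE conjE)
  have m: "\<And>r. r < s ==> m r \<in> Z" using mm by simp
  have mc: "\<And>r. r < s ==> m r \<in> carrier R" using m idl_carr[OF Z] by blast
  show ?thesis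
  proof (cases s)
    case 0
    have "Z \<subseteq> B"
    proof
      fix z assume "z \<in> Z"
      then obtain c b where "b \<in> B" "z = (\<Oplus>r\<in>{..<s}. c r \<otimes> m r) \<oplus> b"
        unfolding Zeq lin_set_def by blast
      then show "z \<in> B" using 0 idl_carr[OF B] by simp
    qed
    then show ?thesis using assms(3) by blast
  next
    case (Suc k)
    have "(\<Oplus>r\<in>{..<s}. \<one> \<otimes> m r) \<in> Z"
      by (rule idl_finsum[OF Z]) (use m idl_l[OF Z] in simp_all)
    then have "(\<Oplus>r\<in>{..<s}. \<one> \<otimes> m r) \<in> \<mm> \<cdot> Z <+> B" using assms(4) by (rule rev_subsetD)
    then have "\<one> \<in> \<mm>" using ind[rule_format, of "\<lambda>_. \<one>" 0] Suc by simp
    then show ?thesis using one_notin_m by simp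
  qed
qed

lemma radical_pow_le:
  assumes "ideal Q R" "\<mm> \<subseteq> ring_radical R Q"
  shows "\<exists>k. ideal_pow R \<mm> k \<subseteq> Q"
proof -
  obtain X where X: "X \<subseteq> carrier R" "finite X" "\<mm> = Idl X"
    using noetherian_ring.finetely_gen[OF noeth mid] by blast
  have "X \<subseteq> \<mm>" unfolding X(3) by (rule genideal_self[OF X(1)])
  then have "\<And>x. x \<in> X ==> \<exists>k::nat. x [^] k \<in> Q" using assms(2) unfolding ring_radical_def by blast
  then show ?thesis
    unfolding X(3) by (rule fin_gen_nilpotent[OF assms(1) X(2,1)])
qed

text \<open>The zero divisors on \<open>L/K\<close> are covered by the annihilators of elements of \<open>L/K\<close> that
  are maximal among such annihilators. These are prime, they differ from \<open>\<mm>\<close> because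
  \<open>L/K\<close> has no socle, and there are finitely many of them; so prime avoidance applies.\<close>

lemma ex_nonzerodivisor:
  assumes L: "ideal L R" and K: "ideal K R" and KL: "K \<subseteq> L"
    and soc: "\<And>w. w \<in> L ==> (\<And>a. a \<in> \<mm> ==> a \<otimes> w \<in> K) ==> w \<in> K"
  shows "\<exists>y\<in>\<mm>. \<forall>w\<in>L. y \<otimes> w \<in> K --> w \<in> K"
proof -
  define Ann where "Ann w = {a \<in> carrier R. a \<otimes> w \<in> K}" for w
  have Ann_id: "ideal (Ann w) R" if "w \<in> carrier R" for w
    by (rule idealI') (use that idl_intros[OF K] in \<open>auto simp: Ann_def l_distr m_assoc\<close>)
  define S where "S = Ann ` (L - K)"
  define PP where "PP = {P \<in> S. \<forall>X\<in>S. P \<subseteq> X --> X = P}"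
  have Sid: "ideal I R" if I: "I \<in> S" for I
  proof -
    obtain w where w: "w \<in> L" "I = Ann w" using I unfolding S_def by auto
    then show ?thesis using Ann_id[OF idl_carr[OF L w(1)]] by simp
  qed
  have above: "\<exists>P\<in>PP. Ann w \<subseteq> P" if w: "w \<in> L - K" for w
  proof -
    have "\<exists>M\<in>{I\<in>S. Ann w \<subseteq> I}. \<forall>X\<in>{I\<in>S. Ann w \<subseteq> I}. M \<subseteq> X --> X = M"
      by (rule noetherian_ring.ex_maximal_ideal_in[OF noeth]) (use w Sid in \<open>auto simp: S_def\<close>)
    then obtain M where M: "M \<in> S" "Ann w \<subseteq> M" "\<forall>X\<in>{I\<in>S. Ann w \<subseteq> I}. M \<subseteq> X --> X = M" by auto
    then have "M \<in> PP" unfolding PP_def by auto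
    then show ?thesis using M(2) by blast
  qed
  have prime: "primeideal P R" if P: "P \<in> PP" for P
  proof -
    obtain w where w: "w \<in> L" "w \<notin> K" "P = Ann w" using P unfolding PP_def S_def by auto
    have wc: "w \<in> carrier R" using idl_carr[OF L w(1)] .
    show ?thesis
    proof (rule primeidealI)
      show "ideal P R" using w(3) Ann_id[OF wc] by simp
      show "cring R" by (rule cring_axioms)
      show "carrier R \<noteq> P"
      proof
        assume "carrier R = P"
        then have "\<one> \<in> Ann w" using w(3) one_closed by simp
        then show False using w(2) wc unfolding Ann_def by simp
      qed
      fix a b assume ab: "a \<in> carrier R" "b \<in> carrier R" "a \<otimes> b \<in> P"
      show "a \<in> P \<or> b \<in> P"
      proof (cases "b \<in> P")
        case False
        have bw: "b \<otimes> w \<in> L - K" using False w(3) ab(2) idl_l[OF L w(1) ab(2)] unfolding Ann_def by simp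
        have "P \<subseteq> Ann (b \<otimes> w)"
        proof
          fix x assume "x \<in> P"
          then have x: "x \<in> carrier R" "x \<otimes> w \<in> K" unfolding w Ann_def by auto
          have "x \<otimes> (b \<otimes> w) = b \<otimes> (x \<otimes> w)" using x ab wc by algebra
          then show "x \<in> Ann (b \<otimes> w)" unfolding Ann_def using x idl_l[OF K] ab by simp
        qed
        moreover have "Ann (b \<otimes> w) \<in> S" using bw unfolding S_def by simp
        ultimately have "Ann (b \<otimes> w) = P" using P unfolding PP_def by simp
        moreover have "a \<in> Ann (b \<otimes> w)" using ab w wc unfolding Ann_def by (simp add: m_assoc)
        ultimately show ?thesis by simp
      qed simp
    qed
  qed
  have "\<forall>P\<in>PP. \<exists>w. w \<in> L - K \<and> P = Ann w" unfolding PP_def S_def by auto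
  then obtain wt where wt0: "\<forall>P\<in>PP. wt P \<in> L - K \<and> P = Ann (wt P)" by (rule bchoice[THEN exE])
  have wt: "\<And>P. P \<in> PP ==> wt P \<in> L \<and> wt P \<notin> K" "\<And>P. P \<in> PP ==> Ann (wt P) = P"
    using wt0 by simp_all
  have wtc: "wt P \<in> carrier R" if "P \<in> PP" for P using wt(1)[OF that] idl_carr[OF L] by simp
  \<comment> \<open>Take finitely many of the elements \<open>wt P\<close> generating an ideal that is maximal among such ideals.
    For every further \<open>P\<close> the element \<open>wt P\<close> then lies in this ideal, so it is killed by
    the intersection of the chosen primes; primality of \<open>P\<close> and maximality of annihilators make
    \<open>P\<close> one of them.\<close>
  have fin: "finite PP"
  proof -
    let ?G = "{Idl (wt ` F) | F. finite F \<and> F \<subseteq> PP}"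
    have "\<exists>M\<in>?G. \<forall>X\<in>?G. M \<subseteq> X --> X = M"
    proof (rule noetherian_ring.ex_maximal_ideal_in[OF noeth])
      show "?G \<noteq> {}" by auto
      fix I assume "I \<in> ?G"
      then obtain F where F: "I = Idl (wt ` F)" "F \<subseteq> PP" by auto
      have "wt ` F \<subseteq> carrier R" using F(2) wtc by auto
      then show "ideal I R" unfolding F(1) by (rule genideal_ideal)
    qed
    then obtain F where F: "finite F" "F \<subseteq> PP"
      and Fm: "\<forall>X\<in>?G. Idl (wt ` F) \<subseteq> X --> X = Idl (wt ` F)" by auto
    have Fmax: "Idl (wt ` F') = Idl (wt ` F)"
      if "finite F'" "F' \<subseteq> PP" "Idl (wt ` F) \<subseteq> Idl (wt ` F')" for F'
    proof -
      have "Idl (wt ` F') \<in> ?G" using that(1,2) by auto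
      then show ?thesis using Fm that(3) by simp
    qed
    have Fc: "wt ` F \<subseteq> carrier R" using F(2) wtc by auto
    have "PP \<subseteq> F"
    proof
      fix P assume P: "P \<in> PP"
      have insc: "wt ` insert P F \<subseteq> carrier R" using Fc wtc P by auto
      have "Idl (wt ` F) \<subseteq> Idl (wt ` insert P F)"
        by (rule subset_Idl_subset[OF insc]) auto
      then have "Idl (wt ` insert P F) = Idl (wt ` F)" using F P by (intro Fmax) auto
      then have wP: "wt P \<in> Idl (wt ` F)" using genideal_self[OF insc] by auto
      let ?T = "{v \<in> carrier R. \<forall>a\<in>carrier R. (\<forall>Q\<in>F. a \<in> Q) --> a \<otimes> v \<in> K}"
      have T: "ideal ?T R"
      proof (rule idealI')
        show "a \<otimes> x \<in> ?T" if "a \<in> carrier R" "x \<in> ?T" for a x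
        proof -
          have x: "x \<in> carrier R" "a \<otimes> x \<in> carrier R" using that by simp_all
          have "b \<otimes> (a \<otimes> x) \<in> K" if b: "b \<in> carrier R" "\<forall>Q\<in>F. b \<in> Q" for b
          proof -
            have "b \<otimes> x \<in> K" using b \<open>x \<in> ?T\<close> by simp
            then have "a \<otimes> (b \<otimes> x) \<in> K" by (rule idl_l[OF K]) (rule \<open>a \<in> carrier R\<close>)
            then show ?thesis using m_lcomm[OF b(1) \<open>a \<in> carrier R\<close> x(1)] by simp
          qed
          then show ?thesis using x by simp
        qed
      qed (use idl_intros[OF K] in \<open>auto simp: r_distr\<close>)
      have "wt ` F \<subseteq> ?T"
      proof
        fix v assume "v \<in> wt ` F"
        then obtain Q where Q: "Q \<in> F" "v = wt Q" by auto
        then have "Ann v = Q" using wt(2) F(2) by auto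
        then have "a \<otimes> v \<in> K" if "a \<in> Q" for a using that unfolding Ann_def by auto
        then show "v \<in> ?T" using Q Fc by auto
      qed
      then have "Idl (wt ` F) \<subseteq> ?T" by (rule genideal_minimal[OF T])
      then have "wt P \<in> ?T" using wP by (rule subsetD)
      then have kill: "a \<in> P" if "a \<in> carrier R" "\<forall>Q\<in>F. a \<in> Q" for a
        using that wt(2)[OF P] unfolding Ann_def by auto
      show "P \<in> F"
      proof (rule ccontr)
        assume nP: "P \<notin> F"
        have "\<exists>z\<in>carrier R. z \<notin> P \<and> (\<forall>Q\<in>F. z \<in> Q)"
        proof (rule ex_avoid[OF prime[OF P] oneideal _ F(1)])
          show "\<not> carrier R \<subseteq> P" using primeideal.I_notcarr[OF prime[OF P]]
              idl_sub[OF primeideal.axioms(1)[OF prime[OF P]]] by auto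
          fix Q assume Q: "Q \<in> F"
          then have "Q \<in> PP" using F(2) by (rule rev_subsetD)
          then have "ideal Q R" "Q \<subseteq> P --> P = Q" using Sid P unfolding PP_def by auto
          then show "ideal Q R \<and> \<not> Q \<subseteq> P" using Q nP by auto
        qed
        then obtain z where "z \<in> carrier R" "z \<notin> P" "\<forall>Q\<in>F. z \<in> Q" by (elim bexE conjE)
        then show False using kill[of z] by simp
      qed
    qed
    then show ?thesis using F(1) by (rule finite_subset)
  qed
  have "\<exists>y\<in>\<mm>. \<forall>P\<in>PP. y \<notin> P"
  proof (rule prime_avoidance[OF mid fin])
    fix P assume P: "P \<in> PP"
    have "\<not> \<mm> \<subseteq> P"
    proof
      assume "\<mm> \<subseteq> P"
      then have "a \<otimes> wt P \<in> K" if "a \<in> \<mm>" for a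
        using that wt(2)[OF P] unfolding Ann_def by auto
      then have "wt P \<in> K" using soc[of "wt P"] wt(1)[OF P] by simp
      then show False using wt(1)[OF P] by simp
    qed
    then show "primeideal P R \<and> \<not> \<mm> \<subseteq> P" using prime[OF P] by simp
  next
    fix P Q assume "P \<in> PP" "Q \<in> PP" "P \<subseteq> Q"
    then show "P = Q" unfolding PP_def by simp
  qed
  then obtain y where y: "y \<in> \<mm>" "\<forall>P\<in>PP. y \<notin> P" by (elim bexE)
  have "w \<in> K" if w: "w \<in> L" "y \<otimes> w \<in> K" for w
  proof (rule ccontr)
    assume "w \<notin> K"
    then obtain P where "P \<in> PP" "Ann w \<subseteq> P" using above[of w] w(1) \<open>w \<notin> K\<close> by auto
    moreover have "y \<in> Ann w" unfolding Ann_def using idl_carr[OF mid y(1)] w(2) by simp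
    ultimately show False using y(2) by auto
  qed
  then show ?thesis using y(1) by (intro bexI[of _ y]) simp_all
qed

end

section \<open>Koszul cohomology and regular sequences\<close>

text \<open>The Koszul complex on a list \<open>xs\<close> has as basis in each degree the subsets of the list, written as
  bit strings of the length of \<open>xs\<close>; the degree of a bit string is the number of its true bits.
  Degrees are integers because vanishing in degree \<open>i\<close> refers to degree \<open>i - 1\<close>, also
  for \<open>i = 0\<close>.\<close>

definition bdeg :: "bool list => int" where
  "bdeg b = int (length (filter id b))"

lemma bdeg_simps [simp]: "bdeg [] = 0" "bdeg (True # b) = bdeg b + 1" "bdeg (False # b) = bdeg b"
  by (simp_all add: bdeg_def)

lemma bdeg_nonneg: "0 \<le> bdeg b" by (simp add: bdeg_def)

lemma bdeg_le: "bdeg b \<le> int (length b)" by (simp add: bdeg_def)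

lemma bdeg_replicate: "bdeg (replicate n True) = int n"
  by (induct n) auto

context cring
begin

text \<open>The Koszul differential by recursion on the sequence: the complex on \<open>x # xs\<close> is the mapping cone
  of multiplication by \<open>x\<close> on the complex on \<open>xs\<close>, and the first bit tells the two
  copies apart.\<close>

primrec koszul_d :: "'a list => (bool list => 'a) => bool list => 'a" where
  "koszul_d [] f b = \<zero>"
| "koszul_d (x # xs) f b = (case b of [] => \<zero> | s # c =>
     if s then x \<otimes> f (False # c) \<ominus> koszul_d xs (\<lambda>e. f (True # e)) c
     else koszul_d xs (\<lambda>e. f (False # e)) c)"

text \<open>The adjoint of the differential, for coefficients \<open>xs\<close>; it provides contracting homotopies.\<close>

primrec koszul_h :: "'a list => (bool list => 'a) => bool list => 'a" where
  "koszul_h [] f b = \<zero>"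
| "koszul_h (x # xs) f b = (case b of [] => \<zero> | s # c =>
     if s then \<ominus> koszul_h xs (\<lambda>e. f (True # e)) c
     else x \<otimes> f (True # c) \<oplus> koszul_h xs (\<lambda>e. f (False # e)) c)"

text \<open>Functions vanish outside their degree, so that equality of cochains is equality of functions.\<close>

definition cochains :: "nat => int => 'a set => (bool list => 'a) set" where
  "cochains n i L = {f. \<forall>b. if length b = n \<and> bdeg b = i then f b \<in> L else f b = \<zero>}"

lemma cochainsD: "f \<in> cochains n i L ==> length b = n ==> bdeg b = i ==> f b \<in> L"
  by (auto simp: cochains_def)

lemma cochainsD0: "f \<in> cochains n i L ==> \<not> (length b = n \<and> bdeg b = i) ==> f b = \<zero>"
  unfolding cochains_def mem_Collect_eq by metis

lemma cochainsI: "(\<And>b. length b = n ==> bdeg b = i ==> f b \<in> L) ==>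
   (\<And>b. \<not> (length b = n \<and> bdeg b = i) ==> f b = \<zero>) ==> f \<in> cochains n i L"
  by (simp add: cochains_def)

lemma cochains_val: "f \<in> cochains n i L ==> ideal L R ==> f b \<in> L"
  by (cases "length b = n \<and> bdeg b = i") (auto simp: cochains_def idl_zero split: if_splits)

lemma cochains_carr: "f \<in> cochains n i L ==> ideal L R ==> f b \<in> carrier R"
  using cochains_val idl_carr by metis

lemma cochains_zero: "ideal L R ==> (\<lambda>_. \<zero>) \<in> cochains n i L"
  by (simp add: cochains_def idl_zero)

lemma cochains_add: "f \<in> cochains n i L ==> g \<in> cochains n i L ==> ideal L R ==> (\<lambda>b. f b \<oplus> g b) \<in> cochains n i L"
  by (rule cochainsI) (simp_all add: cochainsD0 cochains_val idl_add)

lemma cochains_diff: "f \<in> cochains n i L ==> g \<in> cochains n i L ==> ideal L R ==> (\<lambda>b. f b \<ominus> g b) \<in> cochains n i L"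
  by (rule cochainsI) (simp add: cochains_val idl_diff, simp add: cochainsD0 a_minus_def)

lemma cochains_neg: "f \<in> cochains n i L ==> ideal L R ==> (\<lambda>b. \<ominus> f b) \<in> cochains n i L"
  by (rule cochainsI) (simp_all add: cochainsD0 cochains_val idl_neg)

lemma cochains_smult: "f \<in> cochains n i L ==> a \<in> carrier R ==> ideal L R ==> (\<lambda>b. a \<otimes> f b) \<in> cochains n i L"
  by (rule cochainsI) (simp_all add: cochainsD0 cochains_val idl_l)

lemma cochains_False: "f \<in> cochains (Suc n) i L ==> (\<lambda>b. f (False # b)) \<in> cochains n i L"
  by (rule cochainsI) (simp add: cochainsD, rule cochainsD0, assumption, simp)

lemma cochains_True: "f \<in> cochains (Suc n) i L ==> (\<lambda>b. f (True # b)) \<in> cochains n (i - 1) L"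
  by (rule cochainsI) (simp add: cochainsD, rule cochainsD0, assumption, auto)

lemma cochains_Cons:
  assumes "u \<in> cochains n i L" "v \<in> cochains n (i - 1) L"
  shows "(\<lambda>b. case b of [] => \<zero> | s # c => if s then v c else u c) \<in> cochains (Suc n) i L"
proof (rule cochainsI)
  fix b assume "length b = Suc n" "bdeg b = i"
  then show "(case b of [] => \<zero> | s # c => if s then v c else u c) \<in> L"
    using cochainsD[OF assms(1)] cochainsD[OF assms(2)] by (cases b; cases "hd b") auto
next
  fix b assume "\<not> (length b = Suc n \<and> bdeg b = i)"
  then show "(case b of [] => \<zero> | s # c => if s then v c else u c) = \<zero>"
    using cochainsD0[OF assms(1)] cochainsD0[OF assms(2)] by (cases b; cases "hd b") auto
qed

lemmas ring_norm = r_distr l_distr a_minus_def minus_add r_minus l_minus a_ac m_ac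
  r_neg l_neg r_neg1 r_neg2

lemma koszul_identities:
  assumes "a \<in> carrier R" "b \<in> carrier R" "c \<in> carrier R" "d \<in> carrier R" "x \<in> carrier R"
  shows "x \<otimes> (a \<oplus> b) \<ominus> (c \<oplus> d) = (x \<otimes> a \<ominus> c) \<oplus> (x \<otimes> b \<ominus> d)"
    and "x \<otimes> (b \<otimes> a) \<ominus> b \<otimes> c = b \<otimes> (x \<otimes> a \<ominus> c)"
    and "x \<otimes> (a \<ominus> b) \<oplus> (c \<ominus> d) = (x \<otimes> a \<oplus> c) \<ominus> (x \<otimes> b \<oplus> d)"
    and "\<ominus> (c \<ominus> d) = (\<ominus> c) \<ominus> (\<ominus> d)"
    and "x \<otimes> (b \<otimes> a) \<oplus> b \<otimes> c = b \<otimes> (x \<otimes> a \<oplus> c)"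
  using assms by (simp_all add: ring_norm)

lemma koszul_homotopy_identity:
  assumes "a \<in> carrier R" "b \<in> carrier R" "c \<in> carrier R" "d \<in> carrier R" "e \<in> carrier R" "x \<in> carrier R"
  shows "x \<otimes> (c \<otimes> a \<oplus> b) \<ominus> (\<ominus> d) \<oplus> \<ominus> (x \<otimes> b \<ominus> e) = c \<otimes> x \<otimes> a \<oplus> (d \<oplus> e)"
    and "(c \<otimes> b \<oplus> d) \<oplus> (c \<otimes> (x \<otimes> a \<ominus> b) \<oplus> e) = c \<otimes> x \<otimes> a \<oplus> (d \<oplus> e)"
  using assms by (simp_all add: ring_norm)

lemma koszul_d_closed:
  "set xs \<subseteq> carrier R ==> (\<And>b. f b \<in> carrier R) ==> koszul_d xs f b \<in> carrier R"
  by (induct xs arbitrary: f b) (auto split: list.split)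

lemma koszul_d_cochains:
  assumes L: "ideal L R"
  shows "set xs \<subseteq> carrier R ==> f \<in> cochains (length xs) i L ==> koszul_d xs f \<in> cochains (length xs) (i + 1) L"
proof (induct xs arbitrary: f i)
  case Nil then show ?case by (simp add: cochains_def idl_zero[OF L])
next
  case (Cons x xs)
  have f: "f \<in> cochains (Suc (length xs)) i L" using Cons by simp
  have F: "koszul_d xs (\<lambda>e. f (False # e)) \<in> cochains (length xs) (i + 1) L"
    using Cons cochains_False[OF f] by simp
  have T: "koszul_d xs (\<lambda>e. f (True # e)) \<in> cochains (length xs) i L"
    using Cons(1)[OF _ cochains_True[OF f]] Cons.prems by simp
  have x: "x \<in> carrier R" using Cons by simp
  have T2: "(\<lambda>c. x \<otimes> f (False # c) \<ominus> koszul_d xs (\<lambda>e. f (True # e)) c) \<in> cochains (length xs) i L"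
    by (rule cochains_diff[OF cochains_smult[OF cochains_False[OF f] x L] T L])
  show ?case
    using cochains_Cons[OF F, of "\<lambda>c. x \<otimes> f (False # c) \<ominus> koszul_d xs (\<lambda>e. f (True # e)) c"] T2 by simp
qed

lemma koszul_h_cochains:
  assumes L: "ideal L R"
  shows "set cs \<subseteq> carrier R ==> f \<in> cochains (length cs) i L ==> koszul_h cs f \<in> cochains (length cs) (i - 1) L"
proof (induct cs arbitrary: f i)
  case Nil then show ?case by (simp add: cochains_def idl_zero[OF L])
next
  case (Cons x xs)
  have f: "f \<in> cochains (Suc (length xs)) i L" using Cons by simp
  have F: "koszul_h xs (\<lambda>e. f (False # e)) \<in> cochains (length xs) (i - 1) L"
    using Cons cochains_False[OF f] by simp
  have T: "koszul_h xs (\<lambda>e. f (True # e)) \<in> cochains (length xs) (i - 1 - 1) L"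
    using Cons(1)[OF _ cochains_True[OF f]] Cons.prems by simp
  have x: "x \<in> carrier R" using Cons by simp
  have F2: "(\<lambda>c. x \<otimes> f (True # c) \<oplus> koszul_h xs (\<lambda>e. f (False # e)) c) \<in> cochains (length xs) (i - 1) L"
    by (rule cochains_add[OF cochains_smult[OF cochains_True[OF f] x L] F L])
  show ?case
    using cochains_Cons[OF F2 cochains_neg[OF T L]] by simp
qed

lemma koszul_d_add:
  "set xs \<subseteq> carrier R ==> (\<And>b. f b \<in> carrier R) ==> (\<And>b. g b \<in> carrier R) ==>
   koszul_d xs (\<lambda>b. f b \<oplus> g b) b = koszul_d xs f b \<oplus> koszul_d xs g b"
proof (induct xs arbitrary: f g b)
  case (Cons x xs)
  have cl: "\<And>h c. (\<And>b. h b \<in> carrier R) ==> koszul_d xs h c \<in> carrier R"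
    using koszul_d_closed Cons.prems by simp
  have x: "x \<in> carrier R" using Cons by simp
  show ?case
  proof (cases b)
    case (Cons s c)
    have e1: "koszul_d xs (\<lambda>e. f (s # e) \<oplus> g (s # e)) c = koszul_d xs (\<lambda>e. f (s # e)) c \<oplus> koszul_d xs (\<lambda>e. g (s # e)) c"
      by (rule Cons.hyps) (use Cons.prems in auto)
    have "f (False # c) \<in> carrier R" "g (False # c) \<in> carrier R"
      "koszul_d xs (\<lambda>e. f (s # e)) c \<in> carrier R" "koszul_d xs (\<lambda>e. g (s # e)) c \<in> carrier R"
      using Cons.prems cl by auto
    then have "x \<otimes> (f (False # c) \<oplus> g (False # c)) \<ominus> (koszul_d xs (\<lambda>e. f (s # e)) c \<oplus> koszul_d xs (\<lambda>e. g (s # e)) c)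
       = (x \<otimes> f (False # c) \<ominus> koszul_d xs (\<lambda>e. f (s # e)) c) \<oplus> (x \<otimes> g (False # c) \<ominus> koszul_d xs (\<lambda>e. g (s # e)) c)"
      using x by (intro koszul_identities(1))
    then show ?thesis using e1 Cons by (cases s) simp_all
  qed simp
qed simp

lemma koszul_d_smult:
  "set xs \<subseteq> carrier R ==> (\<And>b. f b \<in> carrier R) ==> a \<in> carrier R ==>
   koszul_d xs (\<lambda>b. a \<otimes> f b) b = a \<otimes> koszul_d xs f b"
proof (induct xs arbitrary: f b)
  case (Cons x xs)
  have cl: "\<And>h c. (\<And>b. h b \<in> carrier R) ==> koszul_d xs h c \<in> carrier R"
    using koszul_d_closed Cons.prems by simp
  have x: "x \<in> carrier R" using Cons by simp
  show ?case
  proof (cases b)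
    case (Cons s c)
    have e1: "koszul_d xs (\<lambda>e. a \<otimes> f (s # e)) c = a \<otimes> koszul_d xs (\<lambda>e. f (s # e)) c"
      by (rule Cons.hyps) (use Cons.prems in auto)
    have "f (False # c) \<in> carrier R" "koszul_d xs (\<lambda>e. f (s # e)) c \<in> carrier R" "a \<in> carrier R"
      using Cons.prems cl by auto
    then have "x \<otimes> (a \<otimes> f (False # c)) \<ominus> a \<otimes> koszul_d xs (\<lambda>e. f (s # e)) c
       = a \<otimes> (x \<otimes> f (False # c) \<ominus> koszul_d xs (\<lambda>e. f (s # e)) c)"
      using x by (intro koszul_identities(2)) simp_all
    then show ?thesis using e1 Cons by (cases s) simp_all
  qed (use Cons in simp)
qed simp

lemma koszul_d_neg:
  assumes "set xs \<subseteq> carrier R" "\<And>b. f b \<in> carrier R"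
  shows "koszul_d xs (\<lambda>b. \<ominus> f b) b = \<ominus> koszul_d xs f b"
proof -
  have "(\<lambda>b. \<ominus> f b) = (\<lambda>b. (\<ominus> \<one>) \<otimes> f b)" using assms(2) by (simp add: l_minus)
  then show ?thesis using koszul_d_smult[OF assms, of "\<ominus> \<one>"] koszul_d_closed[OF assms] by (simp add: l_minus)
qed

lemma koszul_d_diff:
  assumes "set xs \<subseteq> carrier R" "\<And>b. f b \<in> carrier R" "\<And>b. g b \<in> carrier R"
  shows "koszul_d xs (\<lambda>b. f b \<ominus> g b) b = koszul_d xs f b \<ominus> koszul_d xs g b"
  using koszul_d_add[OF assms(1,2), of "\<lambda>b. \<ominus> g b"] koszul_d_neg[OF assms(1,3)] assms(3)
  by (simp add: a_minus_def)

lemma koszul_d_zero: "set xs \<subseteq> carrier R ==> koszul_d xs (\<lambda>b. \<zero>) b = \<zero>"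
  using koszul_d_smult[of xs "\<lambda>b. \<zero>" \<zero> b] koszul_d_closed[of xs "\<lambda>b. \<zero>" b] by simp

lemma koszul_d_d:
  "set xs \<subseteq> carrier R ==> (\<And>b. f b \<in> carrier R) ==> koszul_d xs (koszul_d xs f) b = \<zero>"
proof (induct xs arbitrary: f b)
  case (Cons x xs)
  have xs: "set xs \<subseteq> carrier R" and x: "x \<in> carrier R" using Cons by auto
  have cl: "\<And>h c. (\<And>b. h b \<in> carrier R) ==> koszul_d xs h c \<in> carrier R"
    using koszul_d_closed xs by simp
  show ?case
  proof (cases b)
    case (Cons s c)
    let ?T = "\<lambda>e. f (True # e)" and ?F = "\<lambda>e. f (False # e)"
    have T: "\<And>b. ?T b \<in> carrier R" and F: "\<And>b. ?F b \<in> carrier R" using Cons.prems by auto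
    have "koszul_d xs (\<lambda>e. x \<otimes> ?F e \<ominus> koszul_d xs ?T e) c = x \<otimes> koszul_d xs ?F c \<ominus> \<zero>"
      using koszul_d_diff[OF xs, of "\<lambda>e. x \<otimes> ?F e" "koszul_d xs ?T" c] koszul_d_smult[OF xs F x] x F
        Cons.hyps[OF xs T] cl[OF T] by simp
    then show ?thesis using Cons Cons.hyps[OF xs F] cl[OF F] x
      by (cases s) (simp_all add: a_minus_def r_neg)
  qed simp
qed simp

lemma koszul_h_closed:
  "set ds \<subseteq> carrier R ==> (\<And>b. h b \<in> carrier R) ==> koszul_h ds h c \<in> carrier R"
  by (induct ds arbitrary: h c) (auto split: list.split)

lemma koszul_h_diff:
  "set ds \<subseteq> carrier R ==> (\<And>b. f b \<in> carrier R) ==> (\<And>b. g b \<in> carrier R) ==>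
   koszul_h ds (\<lambda>b. f b \<ominus> g b) c = koszul_h ds f c \<ominus> koszul_h ds g c"
proof (induct ds arbitrary: f g c)
  case (Cons d ds)
  have d: "d \<in> carrier R" and ds: "set ds \<subseteq> carrier R" using Cons by auto
  show ?case
  proof (cases c)
    case (Cons s e)
    have e1: "koszul_h ds (\<lambda>u. f (s # u) \<ominus> g (s # u)) e = koszul_h ds (\<lambda>u. f (s # u)) e \<ominus> koszul_h ds (\<lambda>u. g (s # u)) e"
      by (rule Cons.hyps) (use Cons.prems in auto)
    have "f (True # e) \<in> carrier R" "g (True # e) \<in> carrier R"
      "koszul_h ds (\<lambda>u. f (s # u)) e \<in> carrier R" "koszul_h ds (\<lambda>u. g (s # u)) e \<in> carrier R"
      using Cons.prems koszul_h_closed[OF ds] by auto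
    then have 1: "d \<otimes> (f (True # e) \<ominus> g (True # e)) \<oplus>
        (koszul_h ds (\<lambda>u. f (s # u)) e \<ominus> koszul_h ds (\<lambda>u. g (s # u)) e)
      = (d \<otimes> f (True # e) \<oplus> koszul_h ds (\<lambda>u. f (s # u)) e) \<ominus> (d \<otimes> g (True # e) \<oplus> koszul_h ds (\<lambda>u. g (s # u)) e)"
      and 2: "\<ominus> (koszul_h ds (\<lambda>u. f (s # u)) e \<ominus> koszul_h ds (\<lambda>u. g (s # u)) e)
      = (\<ominus> koszul_h ds (\<lambda>u. f (s # u)) e) \<ominus> (\<ominus> koszul_h ds (\<lambda>u. g (s # u)) e)"
      using d koszul_identities(3) koszul_identities(4)[OF d d _ _ d] by simp_all
    show ?thesis using 1 2 e1 Cons by (cases s) simp_all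
  qed (simp add: a_minus_def)
qed (simp add: a_minus_def)

lemma koszul_h_smult:
  "set ds \<subseteq> carrier R ==> (\<And>b. f b \<in> carrier R) ==> a \<in> carrier R ==>
   koszul_h ds (\<lambda>b. a \<otimes> f b) c = a \<otimes> koszul_h ds f c"
proof (induct ds arbitrary: f c)
  case (Cons d ds)
  have d: "d \<in> carrier R" and ds: "set ds \<subseteq> carrier R" using Cons by auto
  show ?case
  proof (cases c)
    case (Cons s e)
    have e1: "koszul_h ds (\<lambda>u. a \<otimes> f (s # u)) e = a \<otimes> koszul_h ds (\<lambda>u. f (s # u)) e"
      by (rule Cons.hyps) (use Cons.prems in auto)
    have "f (True # e) \<in> carrier R" "koszul_h ds (\<lambda>u. f (s # u)) e \<in> carrier R"
      using Cons.prems koszul_h_closed[OF ds] by auto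
    then have "d \<otimes> (a \<otimes> f (True # e)) \<oplus> a \<otimes> koszul_h ds (\<lambda>u. f (s # u)) e
      = a \<otimes> (d \<otimes> f (True # e) \<oplus> koszul_h ds (\<lambda>u. f (s # u)) e)"
      using d Cons.prems(3) by (intro koszul_identities(5)) simp_all
    then show ?thesis using e1 Cons Cons.prems(3) koszul_h_closed[OF ds, of "\<lambda>u. f (s # u)" e] Cons.prems
      by (cases s) (simp_all add: r_minus)
  qed (use Cons in simp)
qed simp

text \<open>Write \<open>r = \<Sum> c\<^sub>i x\<^sub>i\<close>; contraction with
  \<open>c\<^sub>1, \<dots>, c\<^sub>n\<close> is a homotopy between multiplication by \<open>r\<close> and zero.
  Consequently the ideal generated by \<open>xs\<close> annihilates the Koszul cohomology.\<close>

lemma koszul_homotopy: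
  assumes "set xs \<subseteq> carrier R" "r \<in> Idl (set xs)"
  shows "\<exists>cs. length cs = length xs \<and> set cs \<subseteq> carrier R \<and>
    (\<forall>f b. (\<forall>b. f b \<in> carrier R) \<and> length b = length xs -->
       koszul_d xs (koszul_h cs f) b \<oplus> koszul_h cs (koszul_d xs f) b = r \<otimes> f b)"
  using assms
proof (induct xs arbitrary: r)
  case Nil
  then have "r = \<zero>" by (simp add: Idl_empty)
  then show ?case by (auto intro!: exI[of _ "[]"])
next
  case (Cons x xs)
  have xs: "set xs \<subseteq> carrier R" and x: "x \<in> carrier R" using Cons by auto
  have "r \<in> PIdl x <+> Idl (set xs)" using Cons.prems Idl_Cons[OF x xs] by simp
  then obtain c r' where c: "c \<in> carrier R" and r': "r' \<in> Idl (set xs)" and r: "r = c \<otimes> x \<oplus> r'"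
    unfolding sum_mem cgenideal_def by auto
  have r'c: "r' \<in> carrier R" using r' idl_carr[OF genideal_ideal[OF xs]] by simp
  obtain cs where cs: "length cs = length xs" "set cs \<subseteq> carrier R"
    and hom: "\<And>f b. (\<forall>b. f b \<in> carrier R) ==> length b = length xs ==>
       koszul_d xs (koszul_h cs f) b \<oplus> koszul_h cs (koszul_d xs f) b = r' \<otimes> f b"
    using Cons.hyps[OF xs r'] by auto
  have cld: "\<And>h c. (\<And>b. h b \<in> carrier R) ==> koszul_d xs h c \<in> carrier R"
    using koszul_d_closed xs by simp
  have clh: "koszul_h cs h c \<in> carrier R" if "\<And>b. h b \<in> carrier R" for h c
    using koszul_h_closed[OF cs(2) that] .
  have h_add: "koszul_h cs (\<lambda>b. f b \<ominus> g b) c = koszul_h cs f c \<ominus> koszul_h cs g c"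
    if "\<And>b. f b \<in> carrier R" "\<And>b. g b \<in> carrier R" for f g c
    using koszul_h_diff[OF cs(2) that] .
  have h_smult: "koszul_h cs (\<lambda>b. a \<otimes> f b) c = a \<otimes> koszul_h cs f c"
    if "\<And>b. f b \<in> carrier R" "a \<in> carrier R" for f a c
    using koszul_h_smult[OF cs(2) that] .
  show ?case
  proof (intro exI[of _ "c # cs"] conjI allI impI)
    show "length (c # cs) = length (x # xs)" "set (c # cs) \<subseteq> carrier R" using cs c by auto
    fix f :: "bool list => 'a" and b :: "bool list" assume "(\<forall>b. f b \<in> carrier R) \<and> length b = length (x # xs)"
    then have f: "\<And>b. f b \<in> carrier R" and "length b = Suc (length xs)" by auto
    then obtain s e where b: "b = s # e" and e: "length e = length xs" by (cases b) auto
    let ?T = "\<lambda>e. f (True # e)" and ?F = "\<lambda>e. f (False # e)"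
    let ?d = "koszul_d xs" and ?h = "koszul_h cs"
    have T: "\<And>b. ?T b \<in> carrier R" and F: "\<And>b. ?F b \<in> carrier R" using f by auto
    have hT: "?h ?T e \<in> carrier R" and hF: "?h ?F e \<in> carrier R"
      and dT: "?d ?T e \<in> carrier R" and dF: "?d ?F e \<in> carrier R" for e
      by (auto intro: clh cld T F)
    have dhT: "?d (?h ?T) e \<in> carrier R" and dhF: "?d (?h ?F) e \<in> carrier R"
      and hdT: "?h (?d ?T) e \<in> carrier R" and hdF: "?h (?d ?F) e \<in> carrier R" for e
      by (rule cld[OF hT] cld[OF hF] clh[OF dT] clh[OF dF])+
    show "koszul_d (x # xs) (koszul_h (c # cs) f) b \<oplus> koszul_h (c # cs) (koszul_d (x # xs) f) b = r \<otimes> f b"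
    proof (cases s)
      case True
      have "?d (\<lambda>e. \<ominus> ?h ?T e) e = \<ominus> ?d (?h ?T) e" by (rule koszul_d_neg[OF xs hT])
      moreover have "?h (\<lambda>e. x \<otimes> ?F e \<ominus> ?d ?T e) e = x \<otimes> ?h ?F e \<ominus> ?h (?d ?T) e"
        using h_add[of "\<lambda>e. x \<otimes> ?F e" "?d ?T"] h_smult[OF F x] F x dT by simp
      moreover have "?d (?h ?T) e \<oplus> ?h (?d ?T) e = r' \<otimes> ?T e" using hom[of ?T e] T e by simp
      moreover have "x \<otimes> (c \<otimes> ?T e \<oplus> ?h ?F e) \<ominus> (\<ominus> ?d (?h ?T) e) \<oplus> \<ominus> (x \<otimes> ?h ?F e \<ominus> ?h (?d ?T) e)
         = c \<otimes> x \<otimes> ?T e \<oplus> (?d (?h ?T) e \<oplus> ?h (?d ?T) e)"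
        using T[of e] hF[of e] c dhT[of e] hdT[of e] x
        by (rule koszul_homotopy_identity(1))
      ultimately show ?thesis
        using b True r T[of e] x c r'c by (simp add: l_distr)
    next
      case False
      have "?d (\<lambda>e. c \<otimes> ?T e \<oplus> ?h ?F e) e = c \<otimes> ?d ?T e \<oplus> ?d (?h ?F) e"
        using koszul_d_add[OF xs, of "\<lambda>e. c \<otimes> ?T e" "?h ?F"] koszul_d_smult[OF xs T c] T c hF by simp
      moreover have "?d (?h ?F) e \<oplus> ?h (?d ?F) e = r' \<otimes> ?F e" using hom[of ?F e] F e by simp
      moreover have "(c \<otimes> ?d ?T e \<oplus> ?d (?h ?F) e) \<oplus> (c \<otimes> (x \<otimes> ?F e \<ominus> ?d ?T e) \<oplus> ?h (?d ?F) e)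
        = c \<otimes> x \<otimes> ?F e \<oplus> (?d (?h ?F) e \<oplus> ?h (?d ?F) e)"
        using F[of e] dT[of e] c dhF[of e] hdF[of e] x
        by (rule koszul_homotopy_identity(2))
      ultimately show ?thesis
        using b False r F[of e] x c r'c by (simp add: l_distr)
    qed
  qed
qed

end

context cring
begin

lemma diff_identities:
  assumes "a \<in> carrier R" "b \<in> carrier R"
  shows "(a \<ominus> b) \<oplus> b = a" "b \<oplus> (a \<ominus> b) = a" "a \<oplus> \<ominus> (a \<ominus> b) = b" "(a \<oplus> b) \<ominus> a = b" "(a \<oplus> b) \<ominus> b = a"
proof -
  show 1: "(a \<ominus> b) \<oplus> b = a" using assms by (simp add: a_minus_def a_assoc l_neg)
  then show "b \<oplus> (a \<ominus> b) = a" using assms a_comm[of "a \<ominus> b" b] by simp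
  show "a \<oplus> \<ominus> (a \<ominus> b) = b" using assms by (simp add: a_minus_def minus_add r_neg2)
  show 2: "(a \<oplus> b) \<ominus> b = a" using assms by (simp add: a_minus_def a_assoc r_neg)
  show "(a \<oplus> b) \<ominus> a = b" using assms a_comm[of a b] by (simp add: a_minus_def a_assoc r_neg)
qed

text \<open>Vanishing of the Koszul cohomology in degree \<open>i\<close> with coefficients in the quotient
  \<open>L/K\<close>. Cochains are lifted to \<open>L\<close>, which avoids working with cosets.\<close>

definition koszul_vanish :: "'a list => int => 'a set => 'a set => bool" where
  "koszul_vanish xs i L K \<longleftrightarrow> (\<forall>f\<in>cochains (length xs) i L.
     koszul_d xs f \<in> cochains (length xs) (i + 1) K -->
     (\<exists>g\<in>cochains (length xs) (i - 1) L. (\<lambda>b. f b \<ominus> koszul_d xs g b) \<in> cochains (length xs) i K))"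

lemma koszul_vanish_neg: "set xs \<subseteq> carrier R ==> ideal L R ==> ideal K R ==> i < 0 ==> koszul_vanish xs i L K"
  unfolding koszul_vanish_def
proof (intro ballI impI)
  fix f assume a: "set xs \<subseteq> carrier R" "ideal L R" "ideal K R" "i < 0" "f \<in> cochains (length xs) i L"
  have "f b = \<zero>" for b using cochainsD0[OF a(5)] bdeg_nonneg[of b] a(4) by auto
  then have "(\<lambda>b. f b \<ominus> koszul_d xs (\<lambda>_. \<zero>) b) \<in> cochains (length xs) i K"
    using cochains_zero[OF a(3)] by (simp add: koszul_d_zero[OF a(1)] a_minus_def)
  then show "\<exists>g\<in>cochains (length xs) (i - 1) L. (\<lambda>b. f b \<ominus> koszul_d xs g b) \<in> cochains (length xs) i K"
    using cochains_zero[OF a(2)] by blast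
qed

text \<open>The sequence \<open>0 \<rightarrow> L/K \<rightarrow> L/K \<rightarrow> L/(yL + K) \<rightarrow> 0\<close>, with
  first map multiplication by \<open>y\<close>, shows that \<open>y\<close> acts injectively on the cohomology of
  \<open>L/K\<close> in degree \<open>i\<close>. But a power of \<open>y\<close> lies in the ideal generated by
  \<open>xs\<close> and acts as zero.\<close>

lemma koszul_vanish_step:
  assumes xs: "set xs \<subseteq> carrier R" and L: "ideal L R" and K: "ideal K R" and KL: "K \<subseteq> L"
    and y: "y \<in> carrier R" and nzd: "\<And>w. w \<in> L ==> y \<otimes> w \<in> K ==> w \<in> K"
    and yN: "y [^] (N::nat) \<in> Idl (set xs)"
    and van: "koszul_vanish xs (i - 1) L ((PIdl y) \<cdot> L <+> K)"
  shows "koszul_vanish xs i L K"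
proof -
  let ?n = "length xs" and ?d = "koszul_d xs" and ?K' = "(PIdl y) \<cdot> L <+> K"
  have yL: "ideal ((PIdl y) \<cdot> L) R" by (rule prod_ideal[OF cgenideal_ideal[OF y] L])
  have K': "ideal ?K' R" by (rule add_ideals[OF yL K])
  define cob where "cob f \<longleftrightarrow> (\<exists>g\<in>cochains ?n (i - 1) L. (\<lambda>b. f b \<ominus> ?d g b) \<in> cochains ?n i K)" for f
  \<comment> \<open>Injectivity of \<open>y\<close> on cohomology: if \<open>yf\<close> is the boundary of \<open>g\<close> modulo
    \<open>K\<close>, then \<open>g\<close> is a cocycle modulo \<open>yL + K\<close>, hence up to a boundary of the
    form \<open>ye\<close> modulo \<open>K\<close>, and \<open>f\<close> is the boundary of \<open>e\<close> modulo
    \<open>K\<close>.\<close>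
  have step: "cob f" if f: "f \<in> cochains ?n i L" and yf: "cob (\<lambda>b. y \<otimes> f b)" for f
  proof -
    obtain g where g: "g \<in> cochains ?n (i - 1) L" and gk: "(\<lambda>b. y \<otimes> f b \<ominus> ?d g b) \<in> cochains ?n i K"
      using yf unfolding cob_def by auto
    note fc = cochains_carr[OF f L] and gc = cochains_carr[OF g L]
    have dgc: "\<And>b. ?d g b \<in> carrier R" by (rule koszul_d_closed[OF xs gc])
    have dg: "?d g \<in> cochains ?n i L" using koszul_d_cochains[OF L xs g] by simp
    have "?d g \<in> cochains ?n (i - 1 + 1) ?K'"
    proof (rule cochainsI)
      fix b assume "length b = ?n" "bdeg b = i - 1 + 1"
      then have k: "y \<otimes> f b \<ominus> ?d g b \<in> K" using cochainsD[OF gk] by simp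
      have "y \<otimes> f b \<in> (PIdl y) \<cdot> L" using prod_principal_mem[OF y L] cochains_val[OF f L] by auto
      moreover have "?d g b = y \<otimes> f b \<oplus> (\<ominus> (y \<otimes> f b \<ominus> ?d g b))" using diff_identities(3)[of "y \<otimes> f b" "?d g b"] fc[of b] dgc[of b] y by simp
      ultimately show "?d g b \<in> ?K'" unfolding sum_mem using idl_neg[OF K k] by auto
    qed (use cochainsD0[OF dg] in simp)
    then obtain g' where g': "g' \<in> cochains ?n (i - 1 - 1) L"
      and gg: "(\<lambda>b. g b \<ominus> ?d g' b) \<in> cochains ?n (i - 1) ?K'"
      using van g unfolding koszul_vanish_def by auto
    note g'c = cochains_carr[OF g' L]
    have dg'c: "\<And>b. ?d g' b \<in> carrier R" by (rule koszul_d_closed[OF xs g'c])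
    have "\<exists>e k. e \<in> L \<and> k \<in> K \<and> g b \<ominus> ?d g' b = y \<otimes> e \<oplus> k \<and>
       (\<not> (length b = ?n \<and> bdeg b = i - 1) --> e = \<zero> \<and> k = \<zero>)" for b
    proof (cases "length b = ?n \<and> bdeg b = i - 1")
      case True
      then have "g b \<ominus> ?d g' b \<in> ?K'" using cochainsD[OF gg] by simp
      then obtain u k where "u \<in> (PIdl y) \<cdot> L" "k \<in> K" "g b \<ominus> ?d g' b = u \<oplus> k" unfolding sum_mem by auto
      then show ?thesis using True prod_principal_mem[OF y L, of u] by auto
    next
      case False
      then show ?thesis using cochainsD0[OF gg False] idl_zero[OF L] idl_zero[OF K] y by auto
    qed
    then obtain e k where ek: "\<And>b. e b \<in> L" "\<And>b. k b \<in> K" "\<And>b. g b \<ominus> ?d g' b = y \<otimes> e b \<oplus> k b"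
       "\<And>b. \<not> (length b = ?n \<and> bdeg b = i - 1) ==> e b = \<zero> \<and> k b = \<zero>" by metis
    have e: "e \<in> cochains ?n (i - 1) L" by (rule cochainsI) (use ek in auto)
    have k: "k \<in> cochains ?n (i - 1) K" by (rule cochainsI) (use ek in auto)
    note ec = cochains_carr[OF e L] and kc = cochains_carr[OF k K]
    have dec: "\<And>b. ?d e b \<in> carrier R" by (rule koszul_d_closed[OF xs ec])
    have dk: "?d k \<in> cochains ?n i K" using koszul_d_cochains[OF K xs k] by simp
    have dkc: "\<And>b. ?d k b \<in> carrier R" by (rule cochains_carr[OF dk K])
    have dgeq: "?d g b = y \<otimes> ?d e b \<oplus> ?d k b" for b
    proof -
      have "?d (\<lambda>b. g b \<ominus> ?d g' b) b = ?d g b"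
        using koszul_d_diff[OF xs gc dg'c] koszul_d_d[OF xs g'c] dgc[of b] by (simp add: a_minus_def)
      moreover have "(\<lambda>b. g b \<ominus> ?d g' b) = (\<lambda>b. y \<otimes> e b \<oplus> k b)" using ek(3) by auto
      moreover have "?d (\<lambda>b. y \<otimes> e b \<oplus> k b) b = y \<otimes> ?d e b \<oplus> ?d k b"
        using koszul_d_add[OF xs _ kc, of "\<lambda>b. y \<otimes> e b"] koszul_d_smult[OF xs ec y] y ec by simp
      ultimately show ?thesis by simp
    qed
    have de: "?d e \<in> cochains ?n i L" using koszul_d_cochains[OF L xs e] by simp
    have "(\<lambda>b. f b \<ominus> ?d e b) \<in> cochains ?n i K"
    proof (rule cochainsI)
      fix b assume b: "length b = ?n" "bdeg b = i"
      have "y \<otimes> (f b \<ominus> ?d e b) = (y \<otimes> f b \<ominus> ?d g b) \<oplus> ?d k b"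
        using dgeq[of b] fc[of b] dec[of b] dkc[of b] y by (simp add: ring_norm)
      moreover have "y \<otimes> f b \<ominus> ?d g b \<in> K" using cochainsD[OF gk] b by simp
      ultimately have "y \<otimes> (f b \<ominus> ?d e b) \<in> K" using idl_add[OF K] cochains_val[OF dk K] by simp
      then show "f b \<ominus> ?d e b \<in> K"
        using nzd idl_diff[OF L] cochains_val[OF f L] cochains_val[OF de L] by simp
    next
      fix b assume b: "\<not> (length b = ?n \<and> bdeg b = i)"
      then show "f b \<ominus> ?d e b = \<zero>" using cochainsD0[OF f b] cochainsD0[OF de b] by (simp add: a_minus_def)
    qed
    then show ?thesis unfolding cob_def using e by blast
  qed
  have pw: "cob f" if "f \<in> cochains ?n i L" "cob (\<lambda>b. y [^] (N::nat) \<otimes> f b)" for f N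
    using that(2)
  proof (induct N)
    case 0
    have "(\<lambda>b. \<one> \<otimes> f b) = f" using cochains_carr[OF that(1) L] by auto
    then show ?case using 0 by simp
  next
    case (Suc N)
    have "(\<lambda>b. y [^] Suc N \<otimes> f b) = (\<lambda>b. y \<otimes> (y [^] N \<otimes> f b))"
      using cochains_carr[OF that(1) L] y by (simp add: m_ac)
    then have "cob (\<lambda>b. y [^] N \<otimes> f b)"
      using step[OF cochains_smult[OF that(1) _ L, of "y [^] N"]] Suc.prems y by simp
    then show ?case by (rule Suc.hyps)
  qed
  show ?thesis
    unfolding koszul_vanish_def
  proof (intro ballI impI)
    fix f assume f: "f \<in> cochains ?n i L" and df: "?d f \<in> cochains ?n (i + 1) K"
    obtain cs where cs: "length cs = ?n" "set cs \<subseteq> carrier R"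
      and hom: "\<And>f b. (\<forall>b. f b \<in> carrier R) ==> length b = ?n ==>
         koszul_d xs (koszul_h cs f) b \<oplus> koszul_h cs (koszul_d xs f) b = y [^] N \<otimes> f b"
      using koszul_homotopy[OF xs yN] by auto
    note fc = cochains_carr[OF f L]
    have hf: "koszul_h cs f \<in> cochains ?n (i - 1) L" using koszul_h_cochains[OF L cs(2)] f cs(1) by simp
    have hdf: "koszul_h cs (?d f) \<in> cochains ?n i K" using koszul_h_cochains[OF K cs(2), of "?d f" "i + 1"] df cs(1) by simp
    have dhf: "?d (koszul_h cs f) \<in> cochains ?n i L" using koszul_d_cochains[OF L xs hf] by simp
    have ync: "y [^] N \<in> carrier R" using y by simp
    have ydiff: "(\<lambda>b. y [^] N \<otimes> f b \<ominus> ?d (koszul_h cs f) b) \<in> cochains ?n i K"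
    proof (rule cochainsI)
      fix b assume b: "length b = ?n" "bdeg b = i"
      have c: "?d (koszul_h cs f) b \<in> carrier R" "koszul_h cs (?d f) b \<in> carrier R"
        using cochains_carr[OF dhf L] cochains_carr[OF hdf K] by auto
      have "y [^] N \<otimes> f b \<ominus> ?d (koszul_h cs f) b = koszul_h cs (?d f) b"
        unfolding hom[of f b, OF allI[OF fc] b(1), symmetric] using c by (rule diff_identities(4))
      then show "y [^] N \<otimes> f b \<ominus> ?d (koszul_h cs f) b \<in> K" using cochains_val[OF hdf K] by simp
    next
      fix b assume b: "\<not> (length b = ?n \<and> bdeg b = i)"
      show "y [^] N \<otimes> f b \<ominus> ?d (koszul_h cs f) b = \<zero>"
        using cochainsD0[OF f b] cochainsD0[OF dhf b] ync by (simp add: a_minus_def)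
    qed
    have "cob (\<lambda>b. y [^] N \<otimes> f b)" unfolding cob_def using hf ydiff by blast
    then have "cob f" by (rule pw[OF f])
    then show "\<exists>g\<in>cochains ?n (i - 1) L. (\<lambda>b. f b \<ominus> ?d g b) \<in> cochains ?n i K"
      unfolding cob_def .
  qed
qed

text \<open>\<open>ys\<close> is a weakly regular sequence on \<open>L/K\<close> in the given order: each entry is a
  nonzerodivisor modulo \<open>K\<close> and the multiples of \<open>L\<close> by the earlier entries.\<close>

primrec reg_on :: "'a set => 'a set => 'a list => bool" where
  "reg_on L K [] = True"
| "reg_on L K (y # ys) = ((\<forall>w\<in>L. y \<otimes> w \<in> K --> w \<in> K) \<and> reg_on L ((PIdl y) \<cdot> L <+> K) ys)"

lemma koszul_vanish_of_regular:
  assumes xs: "set xs \<subseteq> carrier R" and L: "ideal L R"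
  shows "ideal K R ==> K \<subseteq> L ==> reg_on L K ys ==> set ys \<subseteq> carrier R ==>
    (\<And>y. y \<in> set ys ==> \<exists>N::nat. y [^] N \<in> Idl (set xs)) ==> i < int (length ys) ==> koszul_vanish xs i L K"
proof (induct ys arbitrary: K i)
  case Nil then show ?case using koszul_vanish_neg[OF xs L] by simp
next
  case (Cons y ys)
  have y: "y \<in> carrier R" using Cons.prems by simp
  have yL: "ideal ((PIdl y) \<cdot> L) R" by (rule prod_ideal[OF cgenideal_ideal[OF y] L])
  have K': "ideal ((PIdl y) \<cdot> L <+> K) R" by (rule add_ideals[OF yL Cons.prems(1)])
  have sub: "(PIdl y) \<cdot> L <+> K \<subseteq> L"
    by (rule sum_le[OF L prod_le2[OF cgenideal_ideal[OF y] L] Cons.prems(2)])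
  have "koszul_vanish xs (i - 1) L ((PIdl y) \<cdot> L <+> K)"
    by (rule Cons.hyps[OF K' sub]) (use Cons.prems in auto)
  moreover obtain N :: nat where "y [^] N \<in> Idl (set xs)" using Cons.prems(5)[of y] by auto
  ultimately show ?case
    using koszul_vanish_step[OF xs L Cons.prems(1,2) y] Cons.prems(3) by auto
qed

lemma koszul_d_mem:
  "set xs \<subseteq> carrier R ==> ideal L R ==> (\<And>b. f b \<in> L) ==> koszul_d xs f b \<in> (Idl (set xs)) \<cdot> L"
proof (induct xs arbitrary: f b)
  case Nil then show ?case using idl_zero[OF prod_ideal[OF genideal_ideal]] by simp
next
  case (Cons x xs)
  have xs: "set xs \<subseteq> carrier R" and x: "x \<in> carrier R" using Cons by auto
  have xxs: "set (x # xs) \<subseteq> carrier R" using Cons by simp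
  have I: "ideal ((Idl (set (x # xs))) \<cdot> L) R" by (rule prod_ideal[OF genideal_ideal[OF xxs] Cons.prems(2)])
  have "Idl (set xs) \<subseteq> Idl (set (x # xs))" by (rule subset_Idl_subset[OF xxs]) auto
  then have sub: "(Idl (set xs)) \<cdot> L \<subseteq> (Idl (set (x # xs))) \<cdot> L" by (rule prod_mono) simp
  have IH: "koszul_d xs (\<lambda>e. f (s # e)) c \<in> (Idl (set (x # xs))) \<cdot> L" for s c
    using subsetD[OF sub Cons.hyps[OF xs Cons.prems(2), of "\<lambda>e. f (s # e)" c]] Cons.prems by simp
  have "x \<in> Idl (set (x # xs))" using genideal_self[OF xxs] by auto
  then have "x \<otimes> f (False # c) \<in> (Idl (set (x # xs))) \<cdot> L" for c using Cons.prems by (intro prod_mem) auto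
  then show ?case using IH[simplified] idl_diff[OF I, simplified] idl_zero[OF I] by (auto split: list.split)
qed

text \<open>In the top degree the boundaries are the elements of \<open>(xs) L\<close>, so the top cohomology of
  \<open>L/K\<close> is \<open>L/((xs) L + K)\<close>. This is the half of that statement that produces a cochain;
  \<open>koszul_d_mem\<close> is the other half.\<close>

lemma koszul_top_surj:
  assumes L: "ideal L R"
  shows "set xs \<subseteq> carrier R ==> l \<in> (Idl (set xs)) \<cdot> L ==>
    \<exists>v\<in>cochains (length xs) (int (length xs) - 1) L.
      \<forall>b. koszul_d xs v b = (if b = replicate (length xs) True then l else \<zero>)"
proof (induct xs arbitrary: l)
  case Nil
  have "{\<zero>} \<cdot> L = {\<zero>}" using prod_comm[OF zeroideal L] ideal_prod_zero[OF L] by simp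
  then have "l = \<zero>" using Nil by (simp add: Idl_empty)
  then show ?case using cochains_zero[OF L] by (auto intro!: bexI[of _ "\<lambda>_. \<zero>"])
next
  case (Cons x xs)
  have xs: "set xs \<subseteq> carrier R" and x: "x \<in> carrier R" using Cons by auto
  let ?n = "length xs"
  have "(Idl (set (x # xs))) \<cdot> L = (PIdl x) \<cdot> L <+> (Idl (set xs)) \<cdot> L"
    using Idl_Cons[OF x xs] ideal_prod_distr(2)[OF L cgenideal_ideal[OF x] genideal_ideal[OF xs]] by simp
  then obtain l1 l2 where l1: "l1 \<in> L" and l2: "l2 \<in> (Idl (set xs)) \<cdot> L" and l: "l = x \<otimes> l1 \<oplus> l2"
    using Cons.prems(2) sum_mem[of l] prod_principal_mem[OF x L] by auto
  have l1c: "l1 \<in> carrier R" using l1 idl_carr[OF L] by simp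
  have l2c: "l2 \<in> carrier R" using l2 idl_carr[OF prod_ideal[OF genideal_ideal[OF xs] L]] by simp
  obtain v2 where v2: "v2 \<in> cochains ?n (int ?n - 1) L"
    and dv2: "\<And>b. koszul_d xs v2 b = (if b = replicate ?n True then l2 else \<zero>)"
    using Cons.hyps[OF xs l2] by auto
  let ?u = "\<lambda>b. if b = replicate ?n True then l1 else \<zero>"
  have u: "?u \<in> cochains ?n (int ?n) L"
    by (rule cochainsI) (auto simp: l1 idl_zero[OF L] bdeg_replicate)
  have du: "koszul_d xs ?u c = \<zero>" for c
  proof (cases "length c = ?n \<and> bdeg c = int ?n + 1")
    case True then show ?thesis using bdeg_le[of c] by simp
  next
    case False show ?thesis by (rule cochainsD0[OF koszul_d_cochains[OF L xs u] False])
  qed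
  let ?v = "\<lambda>b. case b of [] => \<zero> | s # c => if s then \<ominus> v2 c else ?u c"
  have v: "?v \<in> cochains (Suc ?n) (int ?n) L"
    by (rule cochains_Cons[OF u cochains_neg[OF v2 L]])
  have dnv2: "koszul_d xs (\<lambda>e. \<ominus> v2 e) c = \<ominus> koszul_d xs v2 c" for c
    by (rule koszul_d_neg[OF xs cochains_carr[OF v2 L]])
  have "koszul_d (x # xs) ?v b = (if b = replicate (length (x # xs)) True then l else \<zero>)" for b
  proof (cases b)
    case (Cons s c)
    show ?thesis
    proof (cases s)
      case True
      then show ?thesis using Cons dnv2 dv2 l x l1c l2c by (simp add: a_minus_def)
    next
      case False
      then show ?thesis using Cons du by simp
    qed
  qed simp
  then show ?case using v by (intro bexI[of _ ?v]) auto
qed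

text \<open>Weak regularity of the reversed sequence. The recursion removes the entry that is tested last, in accordance
  with the recursion for the Koszul complex.\<close>

primrec rreg_on :: "'a set => 'a set => 'a list => bool" where
  "rreg_on L K [] = True"
| "rreg_on L K (x # xs) = ((\<forall>w\<in>L. x \<otimes> w \<in> (Idl (set xs)) \<cdot> L <+> K --> w \<in> (Idl (set xs)) \<cdot> L <+> K) \<and> rreg_on L K xs)"

end

context noeth_local
begin

text \<open>Nakayama's lemma for submodules \<open>B \<subseteq> Z\<close> of a finite free module, with
  \<open>Z = xZ + B\<close>: at one coordinate it is Nakayama's lemma for ideals, and the elements vanishing at
  this coordinate satisfy the same hypotheses with a smaller support.\<close>

lemma nakayama_functions:
  assumes "finite \<Omega>" and x: "x \<in> \<mm>"
    and "\<And>f b. f \<in> Z ==> f b \<in> carrier R" "\<And>f b. f \<in> Z ==> b \<notin> \<Omega> ==> f b = \<zero>"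
    and "\<And>f g. f \<in> Z ==> g \<in> Z ==> (\<lambda>b. f b \<oplus> g b) \<in> Z" "\<And>f a. f \<in> Z ==> a \<in> carrier R ==> (\<lambda>b. a \<otimes> f b) \<in> Z"
    and "B \<subseteq> Z" "(\<lambda>_. \<zero>) \<in> B"
    and "\<And>f g. f \<in> B ==> g \<in> B ==> (\<lambda>b. f b \<oplus> g b) \<in> B" "\<And>f a. f \<in> B ==> a \<in> carrier R ==> (\<lambda>b. a \<otimes> f b) \<in> B"
    and "\<And>z. z \<in> Z ==> \<exists>a\<in>Z. (\<lambda>b. z b \<ominus> x \<otimes> a b) \<in> B"
  shows "Z \<subseteq> B"
  using assms(1,3-)
proof (induct \<Omega> arbitrary: Z B)
  case empty
  show ?case
  proof
    fix z assume "z \<in> Z"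
    then have "z = (\<lambda>_. \<zero>)" using empty(2) by auto
    then show "z \<in> B" using empty by simp
  qed
next
  case (insert \<omega> \<Omega>)
  note Zc = insert.prems(1) and Z0 = insert.prems(2) and Za = insert.prems(3) and Zs = insert.prems(4)
    and BZ = insert.prems(5) and B0 = insert.prems(6) and Ba = insert.prems(7) and Bs = insert.prems(8)
    and gen = insert.prems(9)
  have xc: "x \<in> carrier R" using idl_carr[OF mid x] .
  have Zn: "(\<lambda>b. f b \<ominus> g b) \<in> Z" if "f \<in> Z" "g \<in> Z" for f g
  proof -
    have "(\<lambda>b. f b \<ominus> g b) = (\<lambda>b. f b \<oplus> (\<ominus> \<one>) \<otimes> g b)" using Zc[OF that(2)] by (simp add: l_minus a_minus_def)
    then show ?thesis using Za[OF that(1) Zs[OF that(2), of "\<ominus> \<one>"]] by simp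
  qed
  let ?pZ = "(\<lambda>f. f \<omega>) ` Z" and ?pB = "(\<lambda>f. f \<omega>) ` B"
  have pZ: "ideal ?pZ R"
  proof (rule idealI')
    show "?pZ \<subseteq> carrier R" using Zc by auto
    show "\<zero> \<in> ?pZ" using B0 BZ by (auto intro!: image_eqI[of _ _ "\<lambda>_. \<zero>"])
    show "u \<oplus> v \<in> ?pZ" if "u \<in> ?pZ" "v \<in> ?pZ" for u v using that Za by (auto intro!: image_eqI)
    show "a \<otimes> u \<in> ?pZ" if "a \<in> carrier R" "u \<in> ?pZ" for a u using that Zs by (auto intro!: image_eqI)
  qed
  have pB: "ideal ?pB R"
  proof (rule idealI')
    show "?pB \<subseteq> carrier R" using Zc BZ by auto
    show "\<zero> \<in> ?pB" using B0 by (auto intro!: image_eqI[of _ _ "\<lambda>_. \<zero>"])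
    show "u \<oplus> v \<in> ?pB" if "u \<in> ?pB" "v \<in> ?pB" for u v using that Ba by (auto intro!: image_eqI)
    show "a \<otimes> u \<in> ?pB" if "a \<in> carrier R" "u \<in> ?pB" for a u using that Bs by (auto intro!: image_eqI)
  qed
  have "?pZ \<subseteq> \<mm> \<cdot> ?pZ <+> ?pB"
  proof
    fix u assume "u \<in> ?pZ"
    then obtain z where z: "z \<in> Z" "u = z \<omega>" by auto
    obtain a where a: "a \<in> Z" "(\<lambda>b. z b \<ominus> x \<otimes> a b) \<in> B" using gen[OF z(1)] by auto
    have "u = x \<otimes> a \<omega> \<oplus> (z \<omega> \<ominus> x \<otimes> a \<omega>)" using z Zc[OF z(1), of \<omega>] Zc[OF a(1), of \<omega>] xc by (simp add: ring_norm)
    moreover have "x \<otimes> a \<omega> \<in> \<mm> \<cdot> ?pZ" using x a by (intro prod_mem) auto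
    moreover have "z \<omega> \<ominus> x \<otimes> a \<omega> \<in> ?pB" using a(2) by (rule image_eqI[rotated]) simp
    ultimately show "u \<in> \<mm> \<cdot> ?pZ <+> ?pB" unfolding sum_mem by blast
  qed
  moreover have "?pB \<subseteq> ?pZ" using BZ by auto
  ultimately have pe: "?pZ = ?pB" using nakayama[OF pZ pB] by simp
  define Z1 where "Z1 = {z \<in> Z. z \<omega> = \<zero>}"
  define B1 where "B1 = {z \<in> B. z \<omega> = \<zero>}"
  have "Z1 \<subseteq> B1"
  proof (rule insert.hyps(3))
    show "f b \<in> carrier R" if "f \<in> Z1" for f b using that Zc unfolding Z1_def by simp
    show "f b = \<zero>" if "f \<in> Z1" "b \<notin> \<Omega>" for f b using that Z0 unfolding Z1_def by (cases "b = \<omega>") auto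
    show "(\<lambda>b. f b \<oplus> g b) \<in> Z1" if "f \<in> Z1" "g \<in> Z1" for f g using that Za unfolding Z1_def by simp
    show "(\<lambda>b. a \<otimes> f b) \<in> Z1" if "f \<in> Z1" "a \<in> carrier R" for f a using that Zs unfolding Z1_def by simp
    show "B1 \<subseteq> Z1" using BZ unfolding B1_def Z1_def by auto
    show "(\<lambda>_. \<zero>) \<in> B1" using B0 unfolding B1_def by simp
    show "(\<lambda>b. f b \<oplus> g b) \<in> B1" if "f \<in> B1" "g \<in> B1" for f g using that Ba unfolding B1_def by simp
    show "(\<lambda>b. a \<otimes> f b) \<in> B1" if "f \<in> B1" "a \<in> carrier R" for f a using that Bs unfolding B1_def by simp
    fix z assume "z \<in> Z1"
    then have z: "z \<in> Z" "z \<omega> = \<zero>" unfolding Z1_def by auto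
    obtain a where a: "a \<in> Z" "(\<lambda>b. z b \<ominus> x \<otimes> a b) \<in> B" using gen[OF z(1)] by auto
    have "a \<omega> \<in> ?pB" unfolding pe[symmetric] using a by simp
    then obtain b' where b': "b' \<in> B" "a \<omega> = b' \<omega>" by auto
    have b'Z: "b' \<in> Z" using b' BZ by auto
    let ?a = "\<lambda>b. a b \<ominus> b' b"
    have a1: "?a \<in> Z1" unfolding Z1_def using Zn[OF a(1) b'Z] b'(2) Zc[OF b'Z, of \<omega>] by (simp add: a_minus_def r_neg)
    have "(\<lambda>b. (z b \<ominus> x \<otimes> a b) \<oplus> x \<otimes> b' b) \<in> B" using Ba[OF a(2) Bs[OF b'(1) xc]] by simp
    moreover have eq: "(z b \<ominus> x \<otimes> a b) \<oplus> x \<otimes> b' b = z b \<ominus> x \<otimes> ?a b" for b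
      using Zc[OF z(1), of b] Zc[OF a(1), of b] Zc[OF b'Z, of b] xc by (simp add: ring_norm)
    ultimately have "(\<lambda>b. z b \<ominus> x \<otimes> ?a b) \<in> B" by simp
    moreover have "?a \<omega> = \<zero>" using a1 unfolding Z1_def by simp
    then have "z \<omega> \<ominus> x \<otimes> ?a \<omega> = \<zero>" using z(2) xc by (simp add: a_minus_def)
    ultimately show "\<exists>a\<in>Z1. (\<lambda>b. z b \<ominus> x \<otimes> a b) \<in> B1" using a1 unfolding B1_def by (intro bexI[of _ ?a]) auto
  qed
  show ?case
  proof
    fix z assume z: "z \<in> Z"
    have "z \<omega> \<in> ?pB" unfolding pe[symmetric] using z by simp
    then obtain b' where b': "b' \<in> B" "z \<omega> = b' \<omega>" by auto
    have b'Z: "b' \<in> Z" using b' BZ by auto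
    have "(\<lambda>b. z b \<ominus> b' b) \<in> Z1" unfolding Z1_def using Zn[OF z b'Z] b'(2) Zc[OF b'Z, of \<omega>] by (simp add: a_minus_def r_neg)
    then have "(\<lambda>b. z b \<ominus> b' b) \<in> B" using \<open>Z1 \<subseteq> B1\<close> unfolding B1_def by auto
    then have "(\<lambda>b. (z b \<ominus> b' b) \<oplus> b' b) \<in> B" by (rule Ba[OF _ b'(1)])
    moreover have "(z b \<ominus> b' b) \<oplus> b' b = z b" for b using Zc[OF z, of b] Zc[OF b'Z, of b] by (rule diff_identities(1))
    ultimately show "z \<in> B" by simp
  qed
qed

lemma finite_bool_lists: "finite {b :: bool list. length b = n}"
  using finite_lists_length_eq[of "UNIV :: bool set" n] by simp

text \<open>The mapping cone gives an exact sequence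
  \<open>H^i(xs) \<rightarrow> H^i(xs) \<rightarrow> H^(i+1)(x # xs)\<close> whose first map is multiplication by
  \<open>x\<close>. If the last term vanishes, Nakayama's lemma kills the first.\<close>

lemma koszul_vanish_tl:
  assumes xs: "set xs \<subseteq> carrier R" and x: "x \<in> \<mm>" and L: "ideal L R" and K: "ideal K R" and KL: "K \<subseteq> L"
    and van: "koszul_vanish (x # xs) (i + 1) L K"
  shows "koszul_vanish xs i L K"
proof -
  let ?n = "length xs" and ?d = "koszul_d xs"
  have xc: "x \<in> carrier R" using idl_carr[OF mid x] .
  let ?Z = "{f \<in> cochains ?n i L. ?d f \<in> cochains ?n (i + 1) K}"
  let ?B = "{f \<in> cochains ?n i L. \<exists>g\<in>cochains ?n (i - 1) L. (\<lambda>b. f b \<ominus> ?d g b) \<in> cochains ?n i K}"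
  note lin = koszul_d_add[OF xs] koszul_d_smult[OF xs] koszul_d_diff[OF xs] koszul_d_neg[OF xs]
  have BZ: "?B \<subseteq> ?Z"
  proof
    fix f assume "f \<in> ?B"
    then obtain g where f: "f \<in> cochains ?n i L" and g: "g \<in> cochains ?n (i - 1) L"
      and fg: "(\<lambda>b. f b \<ominus> ?d g b) \<in> cochains ?n i K" by auto
    note fc = cochains_carr[OF f L] and gc = cochains_carr[OF g L]
    have dgc: "\<And>b. ?d g b \<in> carrier R" by (rule koszul_d_closed[OF xs gc])
    have "?d (\<lambda>b. f b \<ominus> ?d g b) = ?d f"
      using lin(3)[OF fc dgc] koszul_d_d[OF xs gc] koszul_d_closed[OF xs fc] by (auto simp: a_minus_def)
    then have "?d f \<in> cochains ?n (i + 1) K" using koszul_d_cochains[OF K xs fg] by simp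
    then show "f \<in> ?Z" using f by simp
  qed
  have "?Z \<subseteq> ?B"
  proof (rule nakayama_functions[OF finite_bool_lists[of ?n] x])
    show "f b \<in> carrier R" if "f \<in> ?Z" for f b using that cochains_carr[OF _ L, of f] by auto
    show "f b = \<zero>" if "f \<in> ?Z" "b \<notin> {b. length b = ?n}" for f b using that cochainsD0[of f ?n i L b] by simp
    show "(\<lambda>b. f b \<oplus> g b) \<in> ?Z" if "f \<in> ?Z" "g \<in> ?Z" for f g
    proof -
      have f: "f \<in> cochains ?n i L" and g: "g \<in> cochains ?n i L" using that by auto
      have "?d (\<lambda>b. f b \<oplus> g b) = (\<lambda>b. ?d f b \<oplus> ?d g b)"
        using lin(1)[OF cochains_carr[OF f L] cochains_carr[OF g L]] by auto
      then show ?thesis using that cochains_add[OF _ _ L] cochains_add[OF _ _ K] by simp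
    qed
    show "(\<lambda>b. a \<otimes> f b) \<in> ?Z" if "f \<in> ?Z" "a \<in> carrier R" for f a
    proof -
      have f: "f \<in> cochains ?n i L" using that by auto
      have "?d (\<lambda>b. a \<otimes> f b) = (\<lambda>b. a \<otimes> ?d f b)"
        using lin(2)[OF cochains_carr[OF f L] that(2)] by auto
      then show ?thesis using that cochains_smult[OF _ that(2) L] cochains_smult[OF _ that(2) K] by simp
    qed
    show "?B \<subseteq> ?Z" by (rule BZ)
    show "(\<lambda>_. \<zero>) \<in> ?B"
      using cochains_zero[OF L] cochains_zero[OF K] koszul_d_zero[OF xs]
      by (auto intro!: bexI[of _ "\<lambda>_. \<zero>"] simp: a_minus_def)
    show "(\<lambda>b. f b \<oplus> g b) \<in> ?B" if fg: "f \<in> ?B" "g \<in> ?B" for f g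
    proof -
      obtain f' g' where f: "f \<in> cochains ?n i L" and g: "g \<in> cochains ?n i L"
        and f': "f' \<in> cochains ?n (i - 1) L" "(\<lambda>b. f b \<ominus> ?d f' b) \<in> cochains ?n i K"
        and g': "g' \<in> cochains ?n (i - 1) L" "(\<lambda>b. g b \<ominus> ?d g' b) \<in> cochains ?n i K"
        using fg by auto
      note c = cochains_carr[OF f L] cochains_carr[OF g L] cochains_carr[OF f'(1) L] cochains_carr[OF g'(1) L]
      have dc: "?d f' b \<in> carrier R" "?d g' b \<in> carrier R" for b
        by (rule koszul_d_closed[OF xs c(3)] koszul_d_closed[OF xs c(4)])+
      have "(\<lambda>b. (f b \<ominus> ?d f' b) \<oplus> (g b \<ominus> ?d g' b)) = (\<lambda>b. (f b \<oplus> g b) \<ominus> ?d (\<lambda>b. f' b \<oplus> g' b) b)"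
      proof
        fix b show "(f b \<ominus> ?d f' b) \<oplus> (g b \<ominus> ?d g' b) = (f b \<oplus> g b) \<ominus> ?d (\<lambda>b. f' b \<oplus> g' b) b"
          unfolding lin(1)[OF c(3,4)]
          using c(1,2)[of b] dc[of b] by (simp add: ring_norm)
      qed
      then have "(\<lambda>b. (f b \<oplus> g b) \<ominus> ?d (\<lambda>b. f' b \<oplus> g' b) b) \<in> cochains ?n i K"
        using cochains_add[OF f'(2) g'(2) K] by simp
      then show ?thesis using cochains_add[OF f g L] cochains_add[OF f'(1) g'(1) L] by auto
    qed
    show "(\<lambda>b. a \<otimes> f b) \<in> ?B" if fB: "f \<in> ?B" and a: "a \<in> carrier R" for f a
    proof -
      obtain f' where f: "f \<in> cochains ?n i L"
        and f': "f' \<in> cochains ?n (i - 1) L" "(\<lambda>b. f b \<ominus> ?d f' b) \<in> cochains ?n i K"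
        using fB by auto
      note c = cochains_carr[OF f L] cochains_carr[OF f'(1) L]
      have dc: "?d f' b \<in> carrier R" for b by (rule koszul_d_closed[OF xs c(2)])
      have "(\<lambda>b. a \<otimes> (f b \<ominus> ?d f' b)) = (\<lambda>b. a \<otimes> f b \<ominus> ?d (\<lambda>b. a \<otimes> f' b) b)"
      proof
        fix b show "a \<otimes> (f b \<ominus> ?d f' b) = a \<otimes> f b \<ominus> ?d (\<lambda>b. a \<otimes> f' b) b"
          unfolding lin(2)[OF c(2) a]
          using c(1)[of b] dc[of b] a by (simp add: ring_norm)
      qed
      then have "(\<lambda>b. a \<otimes> f b \<ominus> ?d (\<lambda>b. a \<otimes> f' b) b) \<in> cochains ?n i K"
        using cochains_smult[OF f'(2) a K] by simp
      then show ?thesis using cochains_smult[OF f a L] cochains_smult[OF f'(1) a L] by auto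
    qed
    fix u assume "u \<in> ?Z"
    then have u: "u \<in> cochains ?n i L" and du: "?d u \<in> cochains ?n (i + 1) K" by auto
    note uc = cochains_carr[OF u L]
    let ?v = "\<lambda>b. case b of [] => \<zero> | s # c => if s then u c else \<zero>"
    have v: "?v \<in> cochains (Suc ?n) (i + 1) L"
      using cochains_Cons[OF cochains_zero[OF L], of u ?n "i + 1"] u by simp
    have "koszul_d (x # xs) ?v = (\<lambda>b. case b of [] => \<zero> | s # c => if s then \<ominus> ?d u c else \<zero>)"
      using koszul_d_closed[OF xs uc] xc koszul_d_zero[OF xs] by (auto simp: a_minus_def split: list.split)
    moreover have "\<dots> \<in> cochains (Suc ?n) (i + 1 + 1) K"
      by (rule cochains_Cons[OF cochains_zero[OF K]]) (use cochains_neg[OF du K] in \<open>simp add: add.commute\<close>)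
    ultimately obtain w where w: "w \<in> cochains (Suc ?n) i L"
      and vw: "(\<lambda>b. ?v b \<ominus> koszul_d (x # xs) w b) \<in> cochains (Suc ?n) (i + 1) K"
      using van v unfolding koszul_vanish_def by (auto simp del: koszul_d.simps)
    let ?a = "\<lambda>b. w (False # b)" and ?b = "\<lambda>b. w (True # b)"
    have a: "?a \<in> cochains ?n i L" by (rule cochains_False[OF w])
    have b: "?b \<in> cochains ?n (i - 1) L" by (rule cochains_True[OF w])
    note ac = cochains_carr[OF a L] and bc = cochains_carr[OF b L]
    have dac: "?d ?a e \<in> carrier R" and dbc: "?d ?b e \<in> carrier R" for e
      by (rule koszul_d_closed[OF xs ac] koszul_d_closed[OF xs bc])+
    have "(\<lambda>c. \<zero> \<ominus> ?d ?a c) \<in> cochains ?n (i + 1) K" using cochains_False[OF vw] by simp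
    then have "(\<lambda>c. \<ominus> (\<zero> \<ominus> ?d ?a c)) \<in> cochains ?n (i + 1) K" by (rule cochains_neg[OF _ K])
    then have "?d ?a \<in> cochains ?n (i + 1) K" using dac by (simp add: a_minus_def)
    then have aZ: "?a \<in> ?Z" using a by simp
    have 1: "(\<lambda>c. u c \<ominus> (x \<otimes> ?a c \<ominus> ?d ?b c)) \<in> cochains ?n i K" using cochains_True[OF vw] by simp
    have 2: "u c \<ominus> (x \<otimes> ?a c \<ominus> ?d ?b c) = (u c \<ominus> x \<otimes> ?a c) \<ominus> ?d (\<lambda>e. \<ominus> ?b e) c" for c
      unfolding lin(4)[OF bc] using uc[of c] ac[of c] dbc[of c] xc by (simp add: ring_norm)
    have "(\<lambda>c. u c \<ominus> x \<otimes> ?a c) \<in> cochains ?n i L"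
      by (rule cochains_diff[OF u cochains_smult[OF a xc L] L])
    then have "(\<lambda>c. u c \<ominus> x \<otimes> ?a c) \<in> ?B" using 1 cochains_neg[OF b L] unfolding 2 by auto
    then show "\<exists>a\<in>?Z. (\<lambda>b. u b \<ominus> x \<otimes> a b) \<in> ?B" using aZ by (rule bexI)
  qed
  then show ?thesis unfolding koszul_vanish_def by auto
qed

text \<open>With \<open>n\<close> the length of \<open>xs\<close>, the mapping cone identifies the elements of
  \<open>H^n(xs) = L/((xs) L + K)\<close> annihilated by \<open>x\<close> with the image of
  \<open>H^n(x # xs)\<close>, which is zero.\<close>

lemma rreg_of_koszul_vanish:
  assumes L: "ideal L R" and K: "ideal K R" and KL: "K \<subseteq> L"
  shows "set xs \<subseteq> \<mm> ==> (\<And>i. i < int (length xs) ==> koszul_vanish xs i L K) ==> rreg_on L K xs"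
proof (induct xs)
  case (Cons x xs)
  let ?n = "length xs" and ?d = "koszul_d xs" and ?top = "replicate (length xs) True"
  have x: "x \<in> \<mm>" and xsm: "set xs \<subseteq> \<mm>" using Cons.prems by auto
  have xs: "set xs \<subseteq> carrier R" using xsm idl_carr[OF mid] by auto
  have xc: "x \<in> carrier R" using idl_carr[OF mid x] .
  have "rreg_on L K xs"
  proof (rule Cons.hyps[OF xsm])
    fix i assume "i < int ?n"
    then have "koszul_vanish (x # xs) (i + 1) L K" by (intro Cons.prems(2)) simp
    then show "koszul_vanish xs i L K" by (rule koszul_vanish_tl[OF xs x L K KL])
  qed
  moreover have "w \<in> (Idl (set xs)) \<cdot> L <+> K" if w: "w \<in> L" and xw: "x \<otimes> w \<in> (Idl (set xs)) \<cdot> L <+> K" for w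
  proof -
    have wc: "w \<in> carrier R" using idl_carr[OF L w] .
    obtain l k where l: "l \<in> (Idl (set xs)) \<cdot> L" and k: "k \<in> K" and xwe: "x \<otimes> w = l \<oplus> k"
      using xw unfolding sum_mem by auto
    have lc: "l \<in> carrier R" "k \<in> carrier R"
      using idl_carr[OF prod_ideal[OF genideal_ideal[OF xs] L] l] idl_carr[OF K k] by auto
    obtain v where v: "v \<in> cochains ?n (int ?n - 1) L"
      and dv: "\<And>b. ?d v b = (if b = ?top then l else \<zero>)"
      using koszul_top_surj[OF L xs l] by auto
    let ?u = "\<lambda>b. if b = ?top then w else \<zero>"
    have u: "?u \<in> cochains ?n (int ?n) L"
      by (rule cochainsI) (auto simp: w idl_zero[OF L] bdeg_replicate)
    have du: "?d ?u c = \<zero>" for c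
    proof (cases "length c = ?n \<and> bdeg c = int ?n + 1")
      case True then show ?thesis using bdeg_le[of c] by simp
    next
      case False show ?thesis by (rule cochainsD0[OF koszul_d_cochains[OF L xs u] False])
    qed
    let ?f = "\<lambda>b. case b of [] => \<zero> | s # c => if s then v c else ?u c"
    have f: "?f \<in> cochains (Suc ?n) (int ?n) L" by (rule cochains_Cons[OF u v])
    let ?k = "\<lambda>b. if b = ?top then k else \<zero>"
    have kc: "?k \<in> cochains ?n (int ?n + 1 - 1) K"
      by (rule cochainsI) (auto simp: k idl_zero[OF K] bdeg_replicate)
    have "koszul_d (x # xs) ?f = (\<lambda>b. case b of [] => \<zero> | s # c => if s then ?k c else \<zero>)"
    proof
      fix b
      have "x \<otimes> w \<ominus> l = k" unfolding xwe using lc by (simp add: ring_norm)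
      then show "koszul_d (x # xs) ?f b = (case b of [] => \<zero> | s # c => if s then ?k c else \<zero>)"
        using du dv xc by (auto simp: a_minus_def split: list.split)
    qed
    moreover have "\<dots> \<in> cochains (Suc ?n) (int ?n + 1) K" by (rule cochains_Cons[OF cochains_zero[OF K] kc])
    moreover have "koszul_vanish (x # xs) (int ?n) L K" by (rule Cons.prems(2)) simp
    ultimately obtain g where g: "g \<in> cochains (Suc ?n) (int ?n - 1) L"
      and fg: "(\<lambda>b. ?f b \<ominus> koszul_d (x # xs) g b) \<in> cochains (Suc ?n) (int ?n) K"
      using f unfolding koszul_vanish_def by (auto simp del: koszul_d.simps)
    let ?a = "\<lambda>b. g (False # b)"
    have aL: "\<And>b. ?a b \<in> L" using cochains_val[OF g L] by simp
    have "(\<lambda>c. ?u c \<ominus> ?d ?a c) \<in> cochains ?n (int ?n) K" using cochains_False[OF fg] by simp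
    then have "?u ?top \<ominus> ?d ?a ?top \<in> K" by (rule cochainsD) (simp_all add: bdeg_replicate)
    then have wk: "w \<ominus> ?d ?a ?top \<in> K" by simp
    have da: "?d ?a ?top \<in> (Idl (set xs)) \<cdot> L" by (rule koszul_d_mem[OF xs L aL])
    have "?d ?a ?top \<in> carrier R" using idl_carr[OF prod_ideal[OF genideal_ideal[OF xs] L] da] .
    then have "w = ?d ?a ?top \<oplus> (w \<ominus> ?d ?a ?top)" using wc by (simp add: ring_norm)
    then show ?thesis unfolding sum_mem using wk da by blast
  qed
  ultimately show ?case by simp
qed simp

text \<open>A regular sequence whose entries have powers in \<open>(xs)\<close> forces the vanishing of the Koszul
  cohomology of \<open>xs\<close> below its length, and this vanishing forces the regularity of \<open>xs\<close>
  in the order in which \<open>xs\<close> is given. Thus a single long regular sequence makes every system of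
  parameters regular in every order.\<close>

lemma rreg_of_parameters:
  assumes L: "ideal L R" and K: "ideal K R" and KL: "K \<subseteq> L"
    and "reg_on L K ys" "set ys \<subseteq> \<mm>" "length xs \<le> length ys"
    and "set xs \<subseteq> \<mm>" "\<mm> \<subseteq> ring_radical R (Idl (set xs))"
  shows "rreg_on L K xs"
proof (rule rreg_of_koszul_vanish[OF L K KL assms(7)])
  have xs: "set xs \<subseteq> carrier R" using assms(7) idl_carr[OF mid] by auto
  fix i assume i: "i < int (length xs)"
  show "koszul_vanish xs i L K"
  proof (rule koszul_vanish_of_regular[OF xs L K KL assms(4)])
    show "set ys \<subseteq> carrier R" using assms(5) idl_carr[OF mid] by auto
    show "\<exists>N::nat. y [^] N \<in> Idl (set xs)" if "y \<in> set ys" for y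
      using assms(5,8) that unfolding ring_radical_def by auto
    show "i < int (length ys)" using i assms(6) by simp
  qed
qed

end

section \<open>Forms in a regular sequence\<close>

declare ideal_pow.simps(2) [simp del]

definition multi_indices :: "nat => nat => nat list set" where
  "multi_indices n k = {\<alpha>. length \<alpha> = n \<and> sum_list \<alpha> = k}"

lemma multi_indices_0: "\<alpha> \<in> multi_indices n k ==> 0 # \<alpha> \<in> multi_indices (Suc n) k"
  by (simp add: multi_indices_def)

lemma multi_indices_Suc: "\<alpha> \<in> multi_indices (Suc n) k ==> Suc (hd \<alpha>) # tl \<alpha> \<in> multi_indices (Suc n) (Suc k)"
  by (cases \<alpha>) (auto simp: multi_indices_def)

lemma multi_indices_cases:
  assumes "\<beta> \<in> multi_indices (Suc n) k"
  obtains \<alpha> where "\<beta> = 0 # \<alpha>" "\<alpha> \<in> multi_indices n k"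
  | \<alpha> k' where "k = Suc k'" "\<beta> = Suc (hd \<alpha>) # tl \<alpha>" "\<alpha> \<in> multi_indices (Suc n) k'"
proof (cases \<beta>)
  case Nil then show ?thesis using assms by (simp add: multi_indices_def)
next
  case (Cons a \<gamma>)
  show ?thesis
  proof (cases a)
    case 0 then show ?thesis using that(1)[of \<gamma>] Cons assms by (simp add: multi_indices_def)
  next
    case (Suc a')
    then show ?thesis using that(2)[of "a' + sum_list \<gamma>" "a' # \<gamma>"] Cons assms by (auto simp: multi_indices_def)
  qed
qed

context cring
begin

text \<open>The form of degree \<open>k\<close> in the elements of the list with coefficient \<open>c \<alpha>\<close> at
  the monomial with exponents \<open>\<alpha>\<close>: either the first element divides the monomial, or its
  exponent is zero. Only the values of \<open>c\<close> at multi-indices of degree \<open>k\<close> matter.\<close>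

fun form :: "'a list => nat => (nat list => 'a) => 'a" where
  "form [] 0 c = c []"
| "form [] (Suc k) c = \<zero>"
| "form (x # xs) 0 c = form xs 0 (\<lambda>\<alpha>. c (0 # \<alpha>))"
| "form (x # xs) (Suc k) c = x \<otimes> form (x # xs) k (\<lambda>\<alpha>. c (Suc (hd \<alpha>) # tl \<alpha>)) \<oplus> form xs (Suc k) (\<lambda>\<alpha>. c (0 # \<alpha>))"

lemma pow_Idl: "set xs \<subseteq> carrier R ==> ideal (ideal_pow R (Idl (set xs)) k) R"
  by (rule pow_ideal[OF genideal_ideal])

lemma powD_Idl: "set xs \<subseteq> carrier R ==> ideal D R ==> ideal (ideal_pow R (Idl (set xs)) k \<cdot> D) R"
  by (rule prod_ideal[OF pow_Idl])

lemma Idl_tl_le: "set (x # xs) \<subseteq> carrier R ==> Idl (set xs) \<subseteq> Idl (set (x # xs))"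
  by (rule subset_Idl_subset) auto

lemma hd_in_Idl: "set (x # xs) \<subseteq> carrier R ==> x \<in> Idl (set (x # xs))"
  using genideal_self[of "set (x # xs)"] by auto

lemma powD_tl_le: "set (x # xs) \<subseteq> carrier R ==>
  ideal_pow R (Idl (set xs)) k \<cdot> D \<subseteq> ideal_pow R (Idl (set (x # xs))) k \<cdot> D"
  by (rule prod_mono[OF pow_mono[OF Idl_tl_le]]) simp_all

lemma powD_Suc: "ideal Q R ==> ideal D R ==> ideal_pow R Q (Suc k) \<cdot> D = Q \<cdot> (ideal_pow R Q k \<cdot> D)"
  by (simp add: prod_assoc pow_ideal ideal_pow.simps(2))

lemma powD_Suc': "ideal Q R ==> ideal D R ==> ideal_pow R Q (Suc k) \<cdot> D = ideal_pow R Q k \<cdot> (Q \<cdot> D)"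
  using powD_Suc[of Q D k] prod_lcomm[of Q "ideal_pow R Q k" D] pow_ideal[of Q k] by simp

lemma powD_carrier: "ideal Q R ==> ideal_pow R Q k \<cdot> carrier R = ideal_pow R Q k"
  by (rule ideal_prod_one[OF pow_ideal])

lemma powD_0: "ideal D R ==> ideal_pow R Q 0 \<cdot> D = D"
  by (simp add: prod_one)

lemma form_closed: "set xs \<subseteq> carrier R ==> (\<And>\<alpha>. c \<alpha> \<in> carrier R) ==> form xs k c \<in> carrier R"
  by (induct xs k c rule: form.induct) auto

lemma form_add: "set xs \<subseteq> carrier R ==> (\<And>\<alpha>. c \<alpha> \<in> carrier R) ==> (\<And>\<alpha>. d \<alpha> \<in> carrier R) ==>
   form xs k (\<lambda>\<alpha>. c \<alpha> \<oplus> d \<alpha>) = form xs k c \<oplus> form xs k d"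
proof (induct xs k c arbitrary: d rule: form.induct)
  case (4 x xs k c)
  have xs: "set (x # xs) \<subseteq> carrier R" "set xs \<subseteq> carrier R" using 4 by auto
  have cl: "form (x # xs) k (\<lambda>\<alpha>. c (Suc (hd \<alpha>) # tl \<alpha>)) \<in> carrier R" "form (x # xs) k (\<lambda>\<alpha>. d (Suc (hd \<alpha>) # tl \<alpha>)) \<in> carrier R"
    "form xs (Suc k) (\<lambda>\<alpha>. c (0 # \<alpha>)) \<in> carrier R" "form xs (Suc k) (\<lambda>\<alpha>. d (0 # \<alpha>)) \<in> carrier R"
    by (rule form_closed[OF xs(1)] form_closed[OF xs(2)], simp add: 4)+
  have "form (x # xs) k (\<lambda>\<alpha>. c (Suc (hd \<alpha>) # tl \<alpha>) \<oplus> d (Suc (hd \<alpha>) # tl \<alpha>)) =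
     form (x # xs) k (\<lambda>\<alpha>. c (Suc (hd \<alpha>) # tl \<alpha>)) \<oplus> form (x # xs) k (\<lambda>\<alpha>. d (Suc (hd \<alpha>) # tl \<alpha>))"
    by (rule 4(1)) (use 4 in auto)
  moreover have "form xs (Suc k) (\<lambda>\<alpha>. c (0 # \<alpha>) \<oplus> d (0 # \<alpha>)) = form xs (Suc k) (\<lambda>\<alpha>. c (0 # \<alpha>)) \<oplus> form xs (Suc k) (\<lambda>\<alpha>. d (0 # \<alpha>))"
    by (rule 4(2)) (use 4 in auto)
  ultimately show ?case using cl xs by (simp add: r_distr a_ac)
qed auto

lemma form_smult: "set xs \<subseteq> carrier R ==> (\<And>\<alpha>. c \<alpha> \<in> carrier R) ==> a \<in> carrier R ==>
   form xs k (\<lambda>\<alpha>. a \<otimes> c \<alpha>) = a \<otimes> form xs k c"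
proof (induct xs k c rule: form.induct)
  case (4 x xs k c)
  have xs: "set (x # xs) \<subseteq> carrier R" "set xs \<subseteq> carrier R" using 4 by auto
  have cl: "form (x # xs) k (\<lambda>\<alpha>. c (Suc (hd \<alpha>) # tl \<alpha>)) \<in> carrier R"
    "form xs (Suc k) (\<lambda>\<alpha>. c (0 # \<alpha>)) \<in> carrier R"
    by (rule form_closed[OF xs(1)] form_closed[OF xs(2)], simp add: 4)+
  have "form (x # xs) k (\<lambda>\<alpha>. a \<otimes> c (Suc (hd \<alpha>) # tl \<alpha>)) = a \<otimes> form (x # xs) k (\<lambda>\<alpha>. c (Suc (hd \<alpha>) # tl \<alpha>))"
    by (rule 4(1)) (use 4 in auto)
  moreover have "form xs (Suc k) (\<lambda>\<alpha>. a \<otimes> c (0 # \<alpha>)) = a \<otimes> form xs (Suc k) (\<lambda>\<alpha>. c (0 # \<alpha>))"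
    by (rule 4(2)) (use 4 in auto)
  ultimately show ?case using cl xs 4(5) by (simp add: r_distr m_lcomm)
qed auto

lemma form_diff:
  assumes "set xs \<subseteq> carrier R" "\<And>\<alpha>. c \<alpha> \<in> carrier R" "\<And>\<alpha>. d \<alpha> \<in> carrier R"
  shows "form xs k (\<lambda>\<alpha>. c \<alpha> \<ominus> d \<alpha>) = form xs k c \<ominus> form xs k d"
proof -
  have "(\<lambda>\<alpha>. c \<alpha> \<ominus> d \<alpha>) = (\<lambda>\<alpha>. c \<alpha> \<oplus> (\<ominus> \<one>) \<otimes> d \<alpha>)" using assms(3) by (simp add: a_minus_def l_minus)
  then show ?thesis using form_add[OF assms(1,2), of "\<lambda>\<alpha>. (\<ominus> \<one>) \<otimes> d \<alpha>"] form_smult[OF assms(1,3), of "\<ominus> \<one>"]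
      form_closed[OF assms(1,3)] assms(3) by (simp add: a_minus_def l_minus)
qed

lemma form_zero: "set xs \<subseteq> carrier R ==> form xs k (\<lambda>_. \<zero>) = \<zero>"
  using form_smult[of xs "\<lambda>_. \<zero>" \<zero> k] form_closed[of xs "\<lambda>_. \<zero>" k] by simp

lemma form_finsum:
  assumes "set xs \<subseteq> carrier R" "\<And>r \<alpha>. c r \<alpha> \<in> carrier R" "\<And>r. r < s ==> m r \<in> carrier R"
  shows "(\<Oplus>r\<in>{..<s}. form xs k (c r) \<otimes> m r) = form xs k (\<lambda>\<alpha>. \<Oplus>r\<in>{..<s::nat}. c r \<alpha> \<otimes> m r)"
  using assms(3)
proof (induct s)
  case 0 then show ?case using form_zero[OF assms(1)] by simp
next
  case (Suc s)
  have m: "\<And>r. r < s ==> m r \<in> carrier R" "m s \<in> carrier R" using Suc by auto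
  have ins: "{..<Suc s} = insert s {..<s}" by auto
  have fc: "form xs k (c r) \<in> carrier R" for r by (rule form_closed[OF assms(1,2)])
  have "(\<Oplus>r\<in>{..<Suc s}. form xs k (c r) \<otimes> m r) = form xs k (c s) \<otimes> m s \<oplus> (\<Oplus>r\<in>{..<s}. form xs k (c r) \<otimes> m r)"
    unfolding ins using m fc by (intro finsum_insert) auto
  also have "\<dots> = form xs k (\<lambda>\<alpha>. m s \<otimes> c s \<alpha>) \<oplus> form xs k (\<lambda>\<alpha>. \<Oplus>r\<in>{..<s}. c r \<alpha> \<otimes> m r)"
    using Suc.hyps[OF m(1)] form_smult[OF assms(1), of "c s" "m s" k] assms(2) m(2) fc by (simp add: m_comm)
  also have "\<dots> = form xs k (\<lambda>\<alpha>. m s \<otimes> c s \<alpha> \<oplus> (\<Oplus>r\<in>{..<s}. c r \<alpha> \<otimes> m r))"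
    by (rule form_add[symmetric, OF assms(1)]) (use m assms(2) in \<open>auto intro!: finsum_closed\<close>)
  also have "(\<lambda>\<alpha>. m s \<otimes> c s \<alpha> \<oplus> (\<Oplus>r\<in>{..<s}. c r \<alpha> \<otimes> m r)) = (\<lambda>\<alpha>. \<Oplus>r\<in>{..<Suc s}. c r \<alpha> \<otimes> m r)"
  proof
    fix \<alpha> show "m s \<otimes> c s \<alpha> \<oplus> (\<Oplus>r\<in>{..<s}. c r \<alpha> \<otimes> m r) = (\<Oplus>r\<in>{..<Suc s}. c r \<alpha> \<otimes> m r)"
      unfolding ins using m assms(2) finsum_insert[of "{..<s}" s "\<lambda>r. c r \<alpha> \<otimes> m r"] by (auto simp: m_comm)
  qed
  finally show ?case .
qed

lemma form_mem:
  assumes D: "ideal D R"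
  shows "set xs \<subseteq> carrier R ==> (\<And>\<alpha>. \<alpha> \<in> multi_indices (length xs) k ==> c \<alpha> \<in> D) ==>
    form xs k c \<in> ideal_pow R (Idl (set xs)) k \<cdot> D"
proof (induct xs k c rule: form.induct)
  case (1 c) then show ?case using prod_one[OF D] by (simp add: multi_indices_def)
next
  case (2 k c) then show ?case using idl_zero[OF powD_Idl[OF _ D, of "[]" "Suc k"]] by simp
next
  case (3 x xs c)
  have "form xs 0 (\<lambda>\<alpha>. c (0 # \<alpha>)) \<in> ideal_pow R (Idl (set xs)) 0 \<cdot> D"
    by (rule 3(1)) (use 3 multi_indices_0 in auto)
  then show ?case using prod_one[OF D] by simp
next
  case (4 x xs k c)
  let ?Q = "Idl (set (x # xs))"
  have xs: "set xs \<subseteq> carrier R" using 4 by auto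
  have Q: "ideal ?Q R" using 4 by (intro genideal_ideal) auto
  have "form (x # xs) k (\<lambda>\<alpha>. c (Suc (hd \<alpha>) # tl \<alpha>)) \<in> ideal_pow R ?Q k \<cdot> D"
    by (rule 4(1)) (use 4(3,4) multi_indices_Suc in auto)
  then have "x \<otimes> form (x # xs) k (\<lambda>\<alpha>. c (Suc (hd \<alpha>) # tl \<alpha>)) \<in> ideal_pow R ?Q (Suc k) \<cdot> D"
    unfolding powD_Suc[OF Q D] using hd_in_Idl[OF 4(3)] by (rule prod_mem[rotated])
  moreover have "form xs (Suc k) (\<lambda>\<alpha>. c (0 # \<alpha>)) \<in> ideal_pow R (Idl (set xs)) (Suc k) \<cdot> D"
    by (rule 4(2)) (use 4(4) xs multi_indices_0 in auto)
  then have "form xs (Suc k) (\<lambda>\<alpha>. c (0 # \<alpha>)) \<in> ideal_pow R ?Q (Suc k) \<cdot> D"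
    using powD_tl_le[OF 4(3)] by blast
  ultimately show ?case unfolding form.simps(4) by (rule idl_add[OF powD_Idl[OF 4(3) D]])
qed

text \<open>With \<open>Q = (x) + q\<close> every element of \<open>Q^(k+1)\<close> is \<open>x\<close> times an element of
  \<open>Q^k\<close> plus an element of \<open>q^(k+1)\<close>; the product with \<open>D\<close> is carried
  along.\<close>

lemma powD_split:
  assumes xs: "set (x # xs) \<subseteq> carrier R" and D: "ideal D R"
    and y: "y \<in> ideal_pow R (Idl (set (x # xs))) (Suc k) \<cdot> D"
  shows "\<exists>u\<in>ideal_pow R (Idl (set (x # xs))) k \<cdot> D. \<exists>v\<in>ideal_pow R (Idl (set xs)) (Suc k) \<cdot> D. y = x \<otimes> u \<oplus> v"
proof -
  let ?Q = "Idl (set (x # xs))" and ?q = "Idl (set xs)"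
  have x: "x \<in> carrier R" and xs': "set xs \<subseteq> carrier R" using xs by auto
  have Q: "ideal ?Q R" and q: "ideal ?q R" using xs xs' genideal_ideal by blast+
  have px: "ideal (PIdl x) R" by (rule cgenideal_ideal[OF x])
  have Qk: "ideal (ideal_pow R ?Q k \<cdot> D) R" for k by (rule powD_Idl[OF xs D])
  have qk: "ideal (ideal_pow R ?q k \<cdot> D) R" for k by (rule powD_Idl[OF xs' D])
  have Qe: "?Q = PIdl x <+> ?q" using Idl_Cons[OF x xs'] by simp
  define T where "T k = (PIdl x) \<cdot> (ideal_pow R ?Q k \<cdot> D) <+> ideal_pow R ?q (Suc k) \<cdot> D" for k
  have T: "ideal (T k) R" for k unfolding T_def by (rule add_ideals[OF prod_ideal[OF px Qk] qk])
  have sub: "ideal_pow R ?Q (Suc k) \<cdot> D \<subseteq> T k" for k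
  proof (induct k)
    case 0
    have "ideal_pow R ?Q (Suc 0) \<cdot> D = (PIdl x) \<cdot> D <+> ?q \<cdot> D"
      using Qe ideal_prod_distr(2)[OF D px q] pow_one[OF Q] by simp
    then show ?case unfolding T_def using powD_0[OF D] pow_one[OF q] by simp
  next
    case (Suc k)
    have 1: "ideal_pow R ?Q (Suc (Suc k)) \<cdot> D = (PIdl x) \<cdot> (ideal_pow R ?Q (Suc k) \<cdot> D) <+> ?q \<cdot> (ideal_pow R ?Q (Suc k) \<cdot> D)"
      unfolding powD_Suc[OF Q D, of "Suc k"] by (subst (1) Qe) (rule ideal_prod_distr(2)[OF Qk px q])
    have "?q \<cdot> (ideal_pow R ?Q (Suc k) \<cdot> D) \<subseteq> T (Suc k)"
    proof (rule prod_le[OF T])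
      fix i j assume i: "i \<in> ?q" and "j \<in> ideal_pow R ?Q (Suc k) \<cdot> D"
      then have "j \<in> T k" using Suc by blast
      then obtain j1 v where "j1 \<in> (PIdl x) \<cdot> (ideal_pow R ?Q k \<cdot> D)" and v: "v \<in> ideal_pow R ?q (Suc k) \<cdot> D"
        and j: "j = j1 \<oplus> v" unfolding T_def sum_mem by blast
      then obtain u where u: "u \<in> ideal_pow R ?Q k \<cdot> D" and j1: "j1 = x \<otimes> u"
        using prod_principal_mem[OF x Qk] by blast
      have c: "i \<in> carrier R" "u \<in> carrier R" "v \<in> carrier R"
        using idl_carr[OF q i] idl_carr[OF Qk u] idl_carr[OF qk v] by auto
      have "i \<otimes> j = x \<otimes> (i \<otimes> u) \<oplus> i \<otimes> v" unfolding j j1 using c x by (simp add: r_distr m_lcomm)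
      moreover have "i \<otimes> u \<in> ideal_pow R ?Q (Suc k) \<cdot> D"
        unfolding powD_Suc[OF Q D] using subsetD[OF Idl_tl_le[OF xs] i] u by (rule prod_mem)
      moreover have "i \<otimes> v \<in> ideal_pow R ?q (Suc (Suc k)) \<cdot> D"
        unfolding powD_Suc[OF q D, of "Suc k"] using i v by (rule prod_mem)
      ultimately show "i \<otimes> j \<in> T (Suc k)" unfolding T_def sum_mem using prod_principal_mem[OF x Qk] by blast
    qed
    moreover have "(PIdl x) \<cdot> (ideal_pow R ?Q (Suc k) \<cdot> D) \<subseteq> T (Suc k)"
      unfolding T_def by (rule sum_ge1[OF prod_ideal[OF px Qk] qk])
    ultimately show ?case unfolding 1 using sum_le[OF T] by blast
  qed
  then have "y \<in> T k" using y by blast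
  then obtain a v where "a \<in> (PIdl x) \<cdot> (ideal_pow R ?Q k \<cdot> D)" "v \<in> ideal_pow R ?q (Suc k) \<cdot> D" "y = a \<oplus> v"
    unfolding T_def sum_mem by blast
  then show ?thesis using prod_principal_mem[OF x Qk, of a] by blast
qed

lemma form_ex:
  assumes D: "ideal D R"
  shows "set xs \<subseteq> carrier R ==> y \<in> ideal_pow R (Idl (set xs)) k \<cdot> D ==>
    \<exists>c. (\<forall>\<alpha>. c \<alpha> \<in> D) \<and> y = form xs k c"
proof (induct xs arbitrary: y k)
  case Nil
  show ?case
  proof (cases k)
    case 0 then show ?thesis using Nil prod_one[OF D] by (auto intro!: exI[of _ "\<lambda>_. y"])
  next
    case (Suc k')
    have z: "ideal {\<zero>} R" by (rule zeroideal)
    have "ideal_pow R {\<zero>} (Suc k') \<cdot> D \<subseteq> {\<zero>}"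
      using prod_le1[OF pow_ideal[OF z, of "Suc k'"] D] prod_le1[OF z pow_ideal[OF z], of k']
      by (simp add: ideal_pow.simps(2))
    then have "y = \<zero>" using Nil Suc by (auto simp: Idl_empty)
    then show ?thesis using Suc idl_zero[OF D] by (auto intro!: exI[of _ "\<lambda>_. \<zero>"])
  qed
next
  case (Cons x xs)
  have xs: "set xs \<subseteq> carrier R" using Cons by auto
  show ?case using Cons.prems(2)
  proof (induct k arbitrary: y)
    case 0
    then have "y \<in> ideal_pow R (Idl (set xs)) 0 \<cdot> D" by simp
    then obtain c where c: "\<And>\<alpha>. c \<alpha> \<in> D" "y = form xs 0 c" using Cons.hyps[OF xs] by blast
    then have "y = form (x # xs) 0 (\<lambda>\<beta>. c (tl \<beta>))" by simp
    then show ?case using c(1) by (intro exI[of _ "\<lambda>\<beta>. c (tl \<beta>)"]) simp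
  next
    case (Suc k)
    obtain u v where u: "u \<in> ideal_pow R (Idl (set (x # xs))) k \<cdot> D" and v: "v \<in> ideal_pow R (Idl (set xs)) (Suc k) \<cdot> D"
      and y: "y = x \<otimes> u \<oplus> v" using powD_split[OF Cons.prems(1) D Suc.prems] by blast
    obtain c where c: "\<And>\<alpha>. c \<alpha> \<in> D" "u = form (x # xs) k c" using Suc.hyps[OF u] by blast
    obtain d where d: "\<And>\<alpha>. d \<alpha> \<in> D" "v = form xs (Suc k) d" using Cons.hyps[OF xs v] by blast
    let ?e = "\<lambda>\<beta>. case \<beta> of [] => \<zero> | b # \<gamma> => (case b of 0 => d \<gamma> | Suc b' => c (b' # \<gamma>))"
    have e: "?e \<beta> \<in> D" for \<beta> using c(1) d(1) idl_zero[OF D] by (auto split: list.split nat.split)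
    have cong: "form zs l f = form zs l g" if "\<And>\<alpha>. \<alpha> \<in> multi_indices (length zs) l ==> f \<alpha> = g \<alpha>" for zs l f g
      using that
    proof (induct zs l f arbitrary: g rule: form.induct)
      case (3 x xs c) then show ?case using multi_indices_0 by simp
    next
      case (4 x xs k c)
      have "form (x # xs) k (\<lambda>\<alpha>. c (Suc (hd \<alpha>) # tl \<alpha>)) = form (x # xs) k (\<lambda>\<alpha>. g (Suc (hd \<alpha>) # tl \<alpha>))"
        by (rule 4(1)) (use 4(3) multi_indices_Suc in auto)
      moreover have "form xs (Suc k) (\<lambda>\<alpha>. c (0 # \<alpha>)) = form xs (Suc k) (\<lambda>\<alpha>. g (0 # \<alpha>))"
        by (rule 4(2)) (use 4(3) multi_indices_0 in auto)
      ultimately show ?case by simp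
    qed (auto simp: multi_indices_def)
    have "form (x # xs) k (\<lambda>\<alpha>. ?e (Suc (hd \<alpha>) # tl \<alpha>)) = form (x # xs) k c"
    proof (rule cong)
      fix \<alpha> assume "\<alpha> \<in> multi_indices (length (x # xs)) k"
      then show "?e (Suc (hd \<alpha>) # tl \<alpha>) = c \<alpha>" by (cases \<alpha>) (auto simp: multi_indices_def)
    qed
    then have "y = form (x # xs) (Suc k) ?e" using y c(2) d(2) by simp
    then show ?case using e by (intro exI[of _ ?e] conjI allI)
  qed
qed

text \<open>Regularity of the reversed sequence. A sequence that is regular in every order may be read in this direction,
  which suits the recursive treatment of forms.\<close>

primrec rseq :: "'a list => bool" where
  "rseq [] = True"
| "rseq (x # xs) = ((\<forall>w\<in>carrier R. x \<otimes> w \<in> Idl (set xs) --> w \<in> Idl (set xs)) \<and> rseq xs)"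

text \<open>A form of degree \<open>k\<close> that lies in \<open>(xs)^(k+1)\<close> has all its coefficients in
  \<open>(xs)\<close>: the associated graded ring is a polynomial ring over \<open>A/(xs)\<close>.\<close>

definition quasi_regular :: "'a list => bool" where
  "quasi_regular xs \<longleftrightarrow> (\<forall>k c. (\<forall>\<alpha>. c \<alpha> \<in> carrier R) \<and> form xs k c \<in> ideal_pow R (Idl (set xs)) (Suc k)
     --> (\<forall>\<alpha>\<in>multi_indices (length xs) k. c \<alpha> \<in> Idl (set xs)))"

lemma quasi_regularD:
  assumes "quasi_regular xs" "\<And>\<alpha>. c \<alpha> \<in> carrier R" "form xs k c \<in> ideal_pow R (Idl (set xs)) (Suc k)"
    "\<alpha> \<in> multi_indices (length xs) k"
  shows "c \<alpha> \<in> Idl (set xs)"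
  using assms(1)[unfolded quasi_regular_def, THEN spec[of _ k], THEN spec[of _ c]] assms(2-4) by simp

text \<open>Since the associated graded ring of \<open>q = (xs)\<close> is a polynomial ring over \<open>A/q\<close>, on
  which \<open>x\<close> is a nonzerodivisor, \<open>x\<close> is a nonzerodivisor modulo all powers of
  \<open>q\<close>.\<close>

lemma nzd_mod_pow:
  assumes xs: "set (x # xs) \<subseteq> carrier R" and qr: "quasi_regular xs"
    and nzd: "\<And>w. w \<in> carrier R ==> x \<otimes> w \<in> Idl (set xs) ==> w \<in> Idl (set xs)"
  shows "w \<in> carrier R ==> x \<otimes> w \<in> ideal_pow R (Idl (set xs)) k ==> w \<in> ideal_pow R (Idl (set xs)) k"
proof (induct k)
  case (Suc k)
  let ?q = "Idl (set xs)"
  have x: "x \<in> carrier R" and xs': "set xs \<subseteq> carrier R" using xs by auto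
  have q: "ideal ?q R" by (rule genideal_ideal[OF xs'])
  have "x \<otimes> w \<in> ideal_pow R ?q k" using Suc.prems(2) pow_Suc_le[OF q] by blast
  then have "w \<in> ideal_pow R ?q k \<cdot> carrier R" using Suc.hyps Suc.prems(1) powD_carrier[OF q] by simp
  then obtain c where c: "\<And>\<alpha>. c \<alpha> \<in> carrier R" "w = form xs k c" using form_ex[OF oneideal xs'] by blast
  have "form xs k (\<lambda>\<alpha>. x \<otimes> c \<alpha>) \<in> ideal_pow R ?q (Suc k)"
    using form_smult[OF xs' c(1) x] c(2) Suc.prems(2) by simp
  then have "x \<otimes> c \<alpha> \<in> ?q" if "\<alpha> \<in> multi_indices (length xs) k" for \<alpha>
    using quasi_regularD[OF qr, of "\<lambda>\<alpha>. x \<otimes> c \<alpha>" k \<alpha>] that x c(1) by simp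
  then have "c \<alpha> \<in> ?q" if "\<alpha> \<in> multi_indices (length xs) k" for \<alpha> using nzd[OF c(1)] that by simp
  then have "w \<in> ideal_pow R ?q k \<cdot> ?q" unfolding c(2) by (rule form_mem[OF q xs'])
  then show ?case using prod_comm[OF pow_ideal[OF q] q] by (simp add: ideal_pow.simps(2))
qed simp

end

text \<open>The hypothesis on \<open>q \<inter> C\<close>, with \<open>q\<close> generated by the tail, says that elements
  of \<open>C\<close> divisible by the tail are divisible inside \<open>L\<close>; multiplied by the head, the
  quotients fall into \<open>D\<close>. For \<open>C = L = A\<close> this is automatic and yields the classical
  fact that regular sequences are quasi-regular. In the application \<open>L = J\<close>, while \<open>C\<close>
  and \<open>D\<close> are two successive ideals of the chain between \<open>J\<^sup>2\<close> and
  \<open>J Q\<close>.\<close>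

locale form_setting = cring R for R (structure) +
  fixes x :: 'a and xs :: "'a list" and C D L :: "'a set"
  assumes xxs: "set (x # xs) \<subseteq> carrier R"
    and qr_tl: "quasi_regular xs"
    and nzd_hd: "\<And>w. w \<in> carrier R ==> x \<otimes> w \<in> Idl (set xs) ==> w \<in> Idl (set xs)"
    and C: "ideal C R" and D: "ideal D R" and L: "ideal L R"
    and DC: "D \<subseteq> C" and QLD: "(Idl (set (x # xs))) \<cdot> L \<subseteq> D"
    and qCL: "Idl (set xs) \<inter> C \<subseteq> (Idl (set xs)) \<cdot> L"
begin

abbreviation (input) "Q \<equiv> Idl (set (x # xs))"
abbreviation (input) "q \<equiv> Idl (set xs)"

lemma xc: "x \<in> carrier R" and xsc: "set xs \<subseteq> carrier R" using xxs by auto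

lemma Qid: "ideal Q R" by (rule genideal_ideal[OF xxs])
lemma qid: "ideal q R" by (rule genideal_ideal[OF xsc])

lemma qL_D: "q \<cdot> L \<subseteq> D" using prod_mono[OF Idl_tl_le[OF xxs], of L L] QLD by blast

lemma xL_D: "l \<in> L ==> x \<otimes> l \<in> D" using prod_mem[OF hd_in_Idl[OF xxs]] QLD by blast

lemma nzd_pow: "w \<in> carrier R ==> x \<otimes> w \<in> ideal_pow R q k ==> w \<in> ideal_pow R q k"
  by (rule nzd_mod_pow[OF xxs qr_tl]) (auto intro: nzd_hd)

lemma tail_form_coeffs:
  assumes "\<And>\<alpha>. c \<alpha> \<in> C" "form xs k c \<in> ideal_pow R q (Suc k)" "\<alpha> \<in> multi_indices (length xs) k"
  shows "c \<alpha> \<in> q \<cdot> L"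
proof -
  have "\<And>\<alpha>. c \<alpha> \<in> carrier R" using assms(1) idl_carr[OF C] by simp
  then have "c \<alpha> \<in> q" using quasi_regularD[OF qr_tl _ assms(2,3)] by simp
  then show ?thesis using qCL assms(1) by blast
qed

text \<open>Write \<open>u = xF + f\<close>. Then \<open>xF\<close> lies in \<open>q^(j+1)\<close>, hence so does
  \<open>F\<close>, and by induction \<open>F\<close> is a form with coefficients in \<open>L\<close>. So
  \<open>u\<close> is a form in the tail with coefficients in \<open>C\<close>, and as \<open>u\<close> lies in
  the next power of \<open>q\<close>, these coefficients are in \<open>q \<inter> C\<close>.\<close>

lemma tail_intersection:
  "u \<in> ideal_pow R Q j \<cdot> C ==> u \<in> ideal_pow R q (Suc j) ==> u \<in> ideal_pow R q (Suc j) \<cdot> L"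
proof (induct j arbitrary: u)
  case 0
  then show ?case using powD_0[OF C] pow_one[OF qid] qCL by auto
next
  case (Suc j)
  obtain F f where F: "F \<in> ideal_pow R Q j \<cdot> C" and f: "f \<in> ideal_pow R q (Suc j) \<cdot> C" and u: "u = x \<otimes> F \<oplus> f"
    using powD_split[OF xxs C Suc.prems(1)] by blast
  have Fc: "F \<in> carrier R" using idl_carr[OF powD_Idl[OF xxs C] F] .
  have f': "f \<in> ideal_pow R q (Suc j)" using f prod_le1[OF pow_ideal[OF qid] C] by blast
  have "u \<in> ideal_pow R q (Suc j)" using Suc.prems(2) pow_Suc_le[OF qid] by blast
  then have "x \<otimes> F \<in> ideal_pow R q (Suc j)"
    using idl_addD[OF pow_ideal[OF qid] _ f'] u Fc xc by simp
  then have "F \<in> ideal_pow R q (Suc j)" by (rule nzd_pow[OF Fc])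
  then have "F \<in> ideal_pow R q (Suc j) \<cdot> L" using Suc.hyps F by blast
  then obtain g where g: "\<And>\<alpha>. g \<alpha> \<in> L" "F = form xs (Suc j) g" using form_ex[OF L xsc] by blast
  obtain h where h: "\<And>\<alpha>. h \<alpha> \<in> C" "f = form xs (Suc j) h" using form_ex[OF C xsc f] by blast
  have gc: "\<And>\<alpha>. g \<alpha> \<in> carrier R" and hc: "\<And>\<alpha>. h \<alpha> \<in> carrier R" using g h idl_carr L C by blast+
  have ue: "u = form xs (Suc j) (\<lambda>\<alpha>. x \<otimes> g \<alpha> \<oplus> h \<alpha>)"
    using u g(2) h(2) form_add[OF xsc, of "\<lambda>\<alpha>. x \<otimes> g \<alpha>" h] form_smult[OF xsc gc xc] gc hc xc by simp
  have C': "\<And>\<alpha>. x \<otimes> g \<alpha> \<oplus> h \<alpha> \<in> C" using idl_add[OF C] subsetD[OF DC xL_D] g h by blast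
  have "u \<in> ideal_pow R q (Suc j) \<cdot> (q \<cdot> L)"
    unfolding ue by (rule form_mem[OF prod_ideal[OF qid L] xsc])
      (rule tail_form_coeffs[OF C'], use ue Suc.prems(2) in auto)
  then show ?case using powD_Suc'[OF qid L] by simp
qed

text \<open>Let \<open>xF + f = 0\<close> with \<open>f\<close> a form in the tail. Then \<open>F\<close> lies in
  \<open>q^(k+1) L \<subseteq> Q^k D\<close>; subtracting a form with coefficients in \<open>D\<close> settles the
  monomials divisible by \<open>x\<close>, by induction on the degree. Rewriting \<open>F\<close> as a form in the
  tail with coefficients \<open>g\<close> in \<open>L\<close> turns the equation into one between forms in the
  tail alone, with coefficients \<open>xg + c\<close>, which must lie in \<open>qL \<subseteq> D\<close>.\<close>

lemma form_coeffs_zero: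
  "(\<And>\<alpha>. c \<alpha> \<in> C) ==> form (x # xs) k c = \<zero> ==> \<beta> \<in> multi_indices (length (x # xs)) k ==> c \<beta> \<in> D"
proof (induct k arbitrary: c \<beta>)
  case 0
  obtain \<alpha> where \<alpha>: "\<beta> = 0 # \<alpha>" "\<alpha> \<in> multi_indices (length xs) 0"
    using 0(3) by (auto elim: multi_indices_cases)
  have "form xs 0 (\<lambda>\<alpha>. c (0 # \<alpha>)) \<in> ideal_pow R q (Suc 0)"
    using 0(2) idl_zero[OF pow_ideal[OF qid, of "Suc 0"]] by simp
  then have "c (0 # \<alpha>) \<in> q \<cdot> L" using tail_form_coeffs[of "\<lambda>\<alpha>. c (0 # \<alpha>)" 0 \<alpha>] 0(1) \<alpha> by blast
  then show ?case using \<alpha> qL_D by blast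
next
  case (Suc k)
  let ?c1 = "\<lambda>\<alpha>. c (Suc (hd \<alpha>) # tl \<alpha>)" and ?c0 = "\<lambda>\<alpha>. c (0 # \<alpha>)"
  define F where "F = form (x # xs) k ?c1"
  define f where "f = form xs (Suc k) ?c0"
  have cc: "\<And>\<alpha>. c \<alpha> \<in> carrier R" using Suc.prems(1) idl_carr[OF C] by blast
  have F: "F \<in> ideal_pow R Q k \<cdot> C" unfolding F_def by (rule form_mem[OF C xxs Suc.prems(1)])
  have f: "f \<in> ideal_pow R q (Suc k) \<cdot> C" unfolding f_def by (rule form_mem[OF C xsc Suc.prems(1)])
  have f': "f \<in> ideal_pow R q (Suc k)" using f prod_le1[OF pow_ideal[OF qid] C] by blast
  have Fc: "F \<in> carrier R" and fc: "f \<in> carrier R"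
    using idl_carr[OF powD_Idl[OF xxs C] F] idl_carr[OF powD_Idl[OF xsc C] f] by auto
  have eq: "x \<otimes> F \<oplus> f = \<zero>" using Suc.prems(2) unfolding F_def f_def by simp
  then have "x \<otimes> F \<in> ideal_pow R q (Suc k)"
    using idl_addD[OF pow_ideal[OF qid] _ f', of "x \<otimes> F"] idl_zero[OF pow_ideal[OF qid]] Fc xc by simp
  then have "F \<in> ideal_pow R q (Suc k)" by (rule nzd_pow[OF Fc])
  then have FL: "F \<in> ideal_pow R q (Suc k) \<cdot> L" by (rule tail_intersection[OF F])
  have "ideal_pow R q (Suc k) \<cdot> L \<subseteq> ideal_pow R Q k \<cdot> D"
    using powD_Suc'[OF Qid L, of k] powD_tl_le[OF xxs, of "Suc k" L] prod_mono[OF subset_refl QLD] by blast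
  then have "F \<in> ideal_pow R Q k \<cdot> D" using FL by blast
  then obtain e where e: "\<And>\<alpha>. e \<alpha> \<in> D" "F = form (x # xs) k e" using form_ex[OF D xxs] by blast
  have ec: "\<And>\<alpha>. e \<alpha> \<in> carrier R" using e idl_carr[OF D] by blast
  show ?case
  proof (rule multi_indices_cases[of \<beta> "length xs" "Suc k"])
    show "\<beta> \<in> multi_indices (Suc (length xs)) (Suc k)" using Suc.prems(3) by simp
  next
    fix \<alpha> k' assume a: "Suc k = Suc k'" "\<beta> = Suc (hd \<alpha>) # tl \<alpha>" "\<alpha> \<in> multi_indices (Suc (length xs)) k'"
    have "form (x # xs) k (\<lambda>\<alpha>. ?c1 \<alpha> \<ominus> e \<alpha>) = form (x # xs) k ?c1 \<ominus> form (x # xs) k e"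
      by (rule form_diff[OF xxs cc ec])
    then have "form (x # xs) k (\<lambda>\<alpha>. ?c1 \<alpha> \<ominus> e \<alpha>) = \<zero>"
      using Fc unfolding F_def[symmetric] e(2)[symmetric] by (simp add: a_minus_def r_neg)
    moreover have "?c1 \<alpha> \<ominus> e \<alpha> \<in> C" for \<alpha> using Suc.prems(1) subsetD[OF DC e(1)] by (rule idl_diff[OF C])
    ultimately have "?c1 \<alpha> \<ominus> e \<alpha> \<in> D" using Suc.hyps[of "\<lambda>\<alpha>. ?c1 \<alpha> \<ominus> e \<alpha>" \<alpha>] a by simp
    then show "c \<beta> \<in> D" using idl_diffD[OF D _ e(1) cc] a(2) by simp
  next
    fix \<alpha> assume a: "\<beta> = 0 # \<alpha>" "\<alpha> \<in> multi_indices (length xs) (Suc k)"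
    obtain g where g: "\<And>\<alpha>. g \<alpha> \<in> L" "F = form xs (Suc k) g" using form_ex[OF L xsc FL] by blast
    have gc: "\<And>\<alpha>. g \<alpha> \<in> carrier R" using g idl_carr[OF L] by blast
    have "form xs (Suc k) (\<lambda>\<alpha>. x \<otimes> g \<alpha> \<oplus> ?c0 \<alpha>) = x \<otimes> F \<oplus> f"
      unfolding f_def g(2) using form_add[OF xsc, of "\<lambda>\<alpha>. x \<otimes> g \<alpha>" ?c0] form_smult[OF xsc gc xc] gc cc xc by simp
    then have "form xs (Suc k) (\<lambda>\<alpha>. x \<otimes> g \<alpha> \<oplus> ?c0 \<alpha>) \<in> ideal_pow R q (Suc (Suc k))"
      using eq idl_zero[OF pow_ideal[OF qid]] by metis
    moreover have "x \<otimes> g \<alpha> \<oplus> ?c0 \<alpha> \<in> C" for \<alpha> using idl_add[OF C subsetD[OF DC xL_D[OF g(1)]] Suc.prems(1)] .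
    ultimately have "x \<otimes> g \<alpha> \<oplus> ?c0 \<alpha> \<in> q \<cdot> L" using a(2) by (intro tail_form_coeffs[of "\<lambda>\<alpha>. x \<otimes> g \<alpha> \<oplus> ?c0 \<alpha>"]) auto
    then have "?c0 \<alpha> \<oplus> x \<otimes> g \<alpha> \<in> D" using qL_D a_comm[OF m_closed[OF xc gc] cc] by auto
    then show "c \<beta> \<in> D" using idl_addD[OF D _ xL_D[OF g(1)] cc] a(1) by simp
  qed
qed

lemma form_coeffs:
  assumes c: "\<And>\<alpha>. c \<alpha> \<in> C" and mem: "form (x # xs) k c \<in> ideal_pow R Q k \<cdot> D"
    and \<beta>: "\<beta> \<in> multi_indices (length (x # xs)) k"
  shows "c \<beta> \<in> D"
proof -
  have cc: "\<And>\<alpha>. c \<alpha> \<in> carrier R" using c idl_carr[OF C] by blast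
  obtain e where e: "\<And>\<alpha>. e \<alpha> \<in> D" "form (x # xs) k c = form (x # xs) k e" using form_ex[OF D xxs mem] by blast
  have ec: "\<And>\<alpha>. e \<alpha> \<in> carrier R" using e idl_carr[OF D] by blast
  have "form (x # xs) k (\<lambda>\<alpha>. c \<alpha> \<ominus> e \<alpha>) = \<zero>"
    using form_diff[OF xxs cc ec, of k] e(2) form_closed[OF xxs ec] by (simp add: a_minus_def r_neg del: form.simps)
  moreover have "c \<alpha> \<ominus> e \<alpha> \<in> C" for \<alpha> using c subsetD[OF DC e(1)] by (rule idl_diff[OF C])
  ultimately have "c \<beta> \<ominus> e \<beta> \<in> D" using form_coeffs_zero[of "\<lambda>\<alpha>. c \<alpha> \<ominus> e \<alpha>" k \<beta>] \<beta> by blast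
  then show ?thesis using idl_diffD[OF D _ e(1) cc] by blast
qed

text \<open>Expand each \<open>F r\<close> into monomials. The coefficient of each monomial in the sum is a combination of
  the \<open>m r\<close> and lies in \<open>D\<close>, so independence of the \<open>m r\<close> modulo
  \<open>D\<close> applies monomial by monomial.\<close>

lemma form_independence:
  fixes s :: nat
  assumes m: "\<And>r. r < s ==> m r \<in> C" and P: "ideal P R"
    and ind: "\<And>c r. (\<And>r. c r \<in> carrier R) ==> (\<Oplus>r\<in>{..<s}. c r \<otimes> m r) \<in> D ==> r < s ==> c r \<in> P"
    and F: "\<And>r. r < s ==> F r \<in> ideal_pow R Q k"
    and sum: "(\<Oplus>r\<in>{..<s}. F r \<otimes> m r) \<in> ideal_pow R Q k \<cdot> D"
    and r: "r < s"
  shows "F r \<in> ideal_pow R Q k \<cdot> P"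
proof -
  have mc: "\<And>r. r < s ==> m r \<in> carrier R" using m idl_carr[OF C] by blast
  have "\<forall>r::nat. \<exists>c. (\<forall>\<alpha>. c \<alpha> \<in> carrier R) \<and> (r < s --> F r = form (x # xs) k c)"
  proof
    fix r show "\<exists>c. (\<forall>\<alpha>. c \<alpha> \<in> carrier R) \<and> (r < s --> F r = form (x # xs) k c)"
    proof (cases "r < s")
      case True
      then have "F r \<in> ideal_pow R Q k \<cdot> carrier R" using F powD_carrier[OF Qid] by simp
      then show ?thesis using form_ex[OF oneideal xxs] by blast
    next
      case False then show ?thesis by (intro exI[of _ "\<lambda>_. \<zero>"]) auto
    qed
  qed
  then obtain c where c: "\<And>r \<alpha>. c r \<alpha> \<in> carrier R" "\<And>r. r < s ==> F r = form (x # xs) k (c r)" by metis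
  have "(\<Oplus>r\<in>{..<s}. F r \<otimes> m r) = (\<Oplus>r\<in>{..<s}. form (x # xs) k (c r) \<otimes> m r)"
    by (rule finsum_cong') (use c mc form_closed[OF xxs c(1)] in \<open>auto simp del: form.simps\<close>)
  also have "\<dots> = form (x # xs) k (\<lambda>\<alpha>. \<Oplus>r\<in>{..<s}. c r \<alpha> \<otimes> m r)"
    by (rule form_finsum[of "x # xs" c s m k]) (use xxs c(1) mc in auto)
  finally have "form (x # xs) k (\<lambda>\<alpha>. \<Oplus>r\<in>{..<s}. c r \<alpha> \<otimes> m r) \<in> ideal_pow R Q k \<cdot> D" using sum by simp
  moreover have "(\<Oplus>r\<in>{..<s}. c r \<alpha> \<otimes> m r) \<in> C" for \<alpha>
    by (rule idl_finsum[OF C]) (use m c(1) idl_l[OF C] in auto)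
  ultimately have "(\<Oplus>r\<in>{..<s}. c r \<alpha> \<otimes> m r) \<in> D" if "\<alpha> \<in> multi_indices (length (x # xs)) k" for \<alpha>
    using form_coeffs[of "\<lambda>\<alpha>. \<Oplus>r\<in>{..<s}. c r \<alpha> \<otimes> m r" k \<alpha>] that by blast
  then have "c r \<alpha> \<in> P" if "\<alpha> \<in> multi_indices (length (x # xs)) k" for \<alpha>
    using ind[of "\<lambda>r. c r \<alpha>" r] c(1) r that by blast
  then show ?thesis unfolding c(2)[OF r] by (rule form_mem[OF P xxs])
qed

end

context cring
begin

lemma form_setting_carrier:
  assumes "set (x # xs) \<subseteq> carrier R" "quasi_regular xs" "rseq (x # xs)" "ideal D R" "Idl (set (x # xs)) \<subseteq> D"
  shows "form_setting R x xs (carrier R) D (carrier R)"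
proof (intro form_setting.intro form_setting_axioms.intro)
  have Q: "ideal (Idl (set (x # xs))) R" and q: "ideal (Idl (set xs)) R" using assms(1) by (auto intro: genideal_ideal)
  show "(Idl (set (x # xs))) \<cdot> carrier R \<subseteq> D" using ideal_prod_one[OF Q] assms(5) by simp
  show "Idl (set xs) \<inter> carrier R \<subseteq> (Idl (set xs)) \<cdot> carrier R" using ideal_prod_one[OF q] by auto
  show "D \<subseteq> carrier R" by (rule idl_sub[OF assms(4)])
  show "w \<in> Idl (set xs)" if "w \<in> carrier R" "x \<otimes> w \<in> Idl (set xs)" for w using assms(3) that by simp
qed (use assms oneideal cring_axioms in \<open>simp_all\<close>)

lemma rseq_quasi_regular: "set xs \<subseteq> carrier R ==> rseq xs ==> quasi_regular xs"
proof (induct xs)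
  case Nil
  show ?case unfolding quasi_regular_def
  proof (intro allI impI ballI)
    fix k :: nat and c :: "nat list => 'a" and \<alpha> :: "nat list" assume a: "(\<forall>\<alpha>. c \<alpha> \<in> carrier R) \<and> form [] k c \<in> ideal_pow R (Idl (set [])) (Suc k)"
      "\<alpha> \<in> multi_indices (length ([] :: 'a list)) k"
    then have "k = 0" "\<alpha> = []" by (auto simp: multi_indices_def)
    then show "c \<alpha> \<in> Idl (set [])" using a pow_one[OF zeroideal] by (simp add: Idl_empty)
  qed
next
  case (Cons x xs)
  have Q: "ideal (Idl (set (x # xs))) R" by (rule genideal_ideal[OF Cons.prems(1)])
  interpret form_setting R x xs "carrier R" "Idl (set (x # xs))" "carrier R"
    by (rule form_setting_carrier) (use Cons Q in auto)
  show ?case unfolding quasi_regular_def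
  proof (intro allI impI ballI)
    fix k :: nat and c :: "nat list => 'a" and \<alpha> :: "nat list" assume a: "(\<forall>\<alpha>. c \<alpha> \<in> carrier R) \<and> form (x # xs) k c \<in> ideal_pow R (Idl (set (x # xs))) (Suc k)"
      "\<alpha> \<in> multi_indices (length (x # xs)) k"
    have "ideal_pow R (Idl (set (x # xs))) (Suc k) = ideal_pow R (Idl (set (x # xs))) k \<cdot> (Idl (set (x # xs)))"
      using prod_comm[OF Q pow_ideal[OF Q]] by (simp add: ideal_pow.simps(2))
    then show "c \<alpha> \<in> Idl (set (x # xs))" using form_coeffs[of c k \<alpha>] a by (simp del: form.simps)
  qed
qed

text \<open>The fibre \<open>\<Oplus> Q^k/PQ^k\<close> is a polynomial ring over \<open>A/P\<close> with one variable for
  each element of the sequence; this separates the monomials divisible by the first variable from the others.\<close>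

lemma fibre_split:
  assumes xs: "set (x # xs) \<subseteq> carrier R" and rs: "rseq (x # xs)" and P: "ideal P R" and QP: "Idl (set (x # xs)) \<subseteq> P"
    and F: "F \<in> ideal_pow R (Idl (set (x # xs))) k" and f: "f \<in> ideal_pow R (Idl (set xs)) (Suc k)"
    and mem: "x \<otimes> F \<oplus> f \<in> ideal_pow R (Idl (set (x # xs))) (Suc k) \<cdot> P"
  shows "F \<in> ideal_pow R (Idl (set (x # xs))) k \<cdot> P" "f \<in> ideal_pow R (Idl (set xs)) (Suc k) \<cdot> P"
proof -
  let ?Q = "Idl (set (x # xs))" and ?q = "Idl (set xs)"
  have xs': "set xs \<subseteq> carrier R" using xs by auto
  have Q: "ideal ?Q R" and q: "ideal ?q R" by (rule genideal_ideal[OF xs], rule genideal_ideal[OF xs'])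
  have qr: "quasi_regular xs" by (rule rseq_quasi_regular[OF xs']) (use rs in simp)
  interpret form_setting R x xs "carrier R" P "carrier R"
    by (rule form_setting_carrier[OF xs qr rs P QP])
  have "F \<in> ideal_pow R ?Q k \<cdot> carrier R" using F powD_carrier[OF Q] by simp
  then obtain c where c: "\<And>\<alpha>. c \<alpha> \<in> carrier R" "F = form (x # xs) k c" using form_ex[OF oneideal xs] by blast
  have "f \<in> ideal_pow R ?q (Suc k) \<cdot> carrier R" using f powD_carrier[OF q, of "Suc k"] by simp
  then obtain d where d: "\<And>\<alpha>. d \<alpha> \<in> carrier R" "f = form xs (Suc k) d" using form_ex[OF oneideal xs'] by blast
  define e' where "e' \<beta> = (case \<beta> of [] => \<zero> | b # \<gamma> => (case b of 0 => d \<gamma> | Suc b' => c (b' # \<gamma>)))" for \<beta>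
  have e': "e' \<alpha> \<in> carrier R" "\<alpha> \<noteq> [] ==> e' (Suc (hd \<alpha>) # tl \<alpha>) = c \<alpha>" "e' (0 # \<alpha>) = d \<alpha>" for \<alpha>
    using c(1) d(1) unfolding e'_def by (auto split: list.split nat.split)
  let ?g = "\<lambda>\<alpha>. e' (Suc (hd \<alpha>) # tl \<alpha>)"
  have diff: "form (x # xs) k (\<lambda>\<alpha>. ?g \<alpha> \<ominus> c \<alpha>) = \<zero>"
  proof -
    have "form (x # xs) k (\<lambda>\<alpha>. ?g \<alpha> \<ominus> c \<alpha>) \<in> ideal_pow R (Idl (set (x # xs))) k \<cdot> {\<zero>}"
    proof (rule form_mem[OF zeroideal xs])
      fix \<alpha> assume "\<alpha> \<in> multi_indices (length (x # xs)) k"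
      then have "\<alpha> \<noteq> []" by (auto simp: multi_indices_def)
      then show "?g \<alpha> \<ominus> c \<alpha> \<in> {\<zero>}" using e'(2) c(1) by (simp add: a_minus_def r_neg)
    qed
    then show ?thesis using ideal_prod_zero[OF pow_ideal[OF Q]] by simp
  qed
  have "form (x # xs) k ?g \<ominus> form (x # xs) k c = \<zero>" using form_diff[OF xs e'(1) c(1), of k "\<lambda>\<alpha>. Suc (hd \<alpha>) # tl \<alpha>"] diff by simp
  then have "form (x # xs) k ?g = F" using form_closed[OF xs e'(1)] form_closed[OF xs c(1)] c(2)
      r_right_minus_eq[of "form (x # xs) k ?g" "form (x # xs) k c"] by (simp del: form.simps)
  then have "form (x # xs) (Suc k) e' = x \<otimes> F \<oplus> f" using d(2) e'(3) by simp
  then have co: "\<beta> \<in> multi_indices (length (x # xs)) (Suc k) ==> e' \<beta> \<in> P" for \<beta>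
    using form_coeffs[of e' "Suc k" \<beta>] e'(1) mem by simp
  show "F \<in> ideal_pow R ?Q k \<cdot> P"
    unfolding c(2)
  proof (rule form_mem[OF P xs])
    fix \<alpha> assume \<alpha>: "\<alpha> \<in> multi_indices (length (x # xs)) k"
    then have "\<alpha> \<noteq> []" by (auto simp: multi_indices_def)
    then show "c \<alpha> \<in> P" using co[of "Suc (hd \<alpha>) # tl \<alpha>"] multi_indices_Suc \<alpha> e'(2) by simp
  qed
  show "f \<in> ideal_pow R ?q (Suc k) \<cdot> P"
    unfolding d(2)
    by (rule form_mem[OF P xs']) (use co[of "0 # \<alpha>" for \<alpha>] multi_indices_0 e'(3) in simp)
qed

text \<open>A polynomial ring over a domain is a domain. With \<open>F = xF' + f\<close> and \<open>G = xG' + g\<close>,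
  where \<open>f\<close> and \<open>g\<close> do not involve the first variable, vanishing of the product
  \<open>FG\<close> in the fibre gives vanishing of \<open>fg\<close> and hence, by induction on the number of
  variables, of \<open>f\<close> or \<open>g\<close>. If \<open>f\<close> vanishes, then \<open>F = xF'\<close>,
  and \<open>F'G\<close> vanishes too, in smaller degree.\<close>

lemma fibre_domain:
  assumes P: "primeideal P R"
  shows "set xs \<subseteq> P ==> rseq xs ==> F \<in> ideal_pow R (Idl (set xs)) k ==> G \<in> ideal_pow R (Idl (set xs)) l ==>
    F \<otimes> G \<in> ideal_pow R (Idl (set xs)) (k + l) \<cdot> P ==>
    F \<in> ideal_pow R (Idl (set xs)) k \<cdot> P \<or> G \<in> ideal_pow R (Idl (set xs)) l \<cdot> P"
proof (induct xs arbitrary: F G k l)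
  case Nil
  have Pid: "ideal P R" using P primeideal.axioms(1) by blast
  have z: "ideal {\<zero>} R" by (rule zeroideal)
  have pz: "y \<in> ideal_pow R {\<zero>} j \<cdot> P" if y: "y \<in> ideal_pow R {\<zero>} j" and j: "j > 0" for y j
  proof -
    obtain j' where "j = Suc j'" using j by (cases j) auto
    then have "y = \<zero>" using y prod_le1[OF z pow_ideal[OF z], of j'] by (auto simp: ideal_pow.simps(2))
    then show ?thesis using idl_zero[OF prod_ideal[OF pow_ideal[OF z] Pid]] by simp
  qed
  show ?case
  proof (cases "k = 0 \<and> l = 0")
    case True
    then have "F \<in> carrier R" "G \<in> carrier R" "F \<otimes> G \<in> P" using Nil prod_one[OF Pid] by auto
    then show ?thesis using True primeideal.I_prime[OF P] prod_one[OF Pid] by simp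
  next
    case False
    then show ?thesis using pz[of F k] pz[of G l] Nil by (auto simp: Idl_empty)
  qed
next
  case (Cons x xs)
  let ?Q = "Idl (set (x # xs))" and ?q = "Idl (set xs)"
  have Pid: "ideal P R" using P primeideal.axioms(1) by blast
  have xxs: "set (x # xs) \<subseteq> carrier R" using Cons.prems(1) idl_sub[OF Pid] by blast
  have xs: "set xs \<subseteq> carrier R" and x: "x \<in> carrier R" using xxs by auto
  have Q: "ideal ?Q R" and q: "ideal ?q R" by (rule genideal_ideal[OF xxs], rule genideal_ideal[OF xs])
  have Qk: "ideal (ideal_pow R ?Q k) R" for k by (rule pow_ideal[OF Q])
  have QkP: "ideal (ideal_pow R ?Q k \<cdot> P) R" for k by (rule prod_ideal[OF Qk Pid])
  have QP: "?Q \<subseteq> P" by (rule genideal_minimal[OF Pid Cons.prems(1)])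
  have qQ: "ideal_pow R ?q k \<subseteq> ideal_pow R ?Q k" for k by (rule pow_mono[OF Idl_tl_le[OF xxs]])
  note split = fibre_split[OF xxs Cons.prems(2) Pid QP]
  have xQ: "x \<otimes> u \<in> ideal_pow R ?Q (Suc k) \<cdot> P" if "u \<in> ideal_pow R ?Q k \<cdot> P" for u k
    unfolding powD_Suc[OF Q Pid] using hd_in_Idl[OF xxs] that by (rule prod_mem)
  have mult: "u \<otimes> v \<in> ideal_pow R ?Q (i + j)" if "u \<in> ideal_pow R ?Q i" "v \<in> ideal_pow R ?Q j" for u v i j
    unfolding pow_add[OF Q] using that by (rule prod_mem)
  have multq: "u \<otimes> v \<in> ideal_pow R ?q (i + j)" if "u \<in> ideal_pow R ?q i" "v \<in> ideal_pow R ?q j" for u v i j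
    unfolding pow_add[OF q] using that by (rule prod_mem)
  have multP: "u \<otimes> v \<in> ideal_pow R ?Q (i + j) \<cdot> P" if u: "u \<in> ideal_pow R ?Q i \<cdot> P" and v: "v \<in> ideal_pow R ?Q j" for u v i j
  proof -
    have "u \<otimes> v \<in> (ideal_pow R ?Q i \<cdot> P) \<cdot> ideal_pow R ?Q j" using u v by (rule prod_mem)
    also have "\<dots> = ideal_pow R ?Q (i + j) \<cdot> P"
      unfolding pow_add[OF Q] prod_assoc[OF Qk Pid Qk] prod_assoc[OF Qk Qk Pid] prod_comm[OF Pid Qk] ..
    finally show ?thesis .
  qed
  have decomp: "\<exists>F' f. F = x \<otimes> F' \<oplus> f \<and> f \<in> ideal_pow R ?q k \<and> F' \<in> carrier R \<and>
      (case k of 0 => F' = \<zero> | Suc k' => F' \<in> ideal_pow R ?Q k')" if F: "F \<in> ideal_pow R ?Q k" for F k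
  proof (cases k)
    case 0
    then show ?thesis using F x by (intro exI[of _ \<zero>] exI[of _ F]) auto
  next
    case (Suc k')
    have "F \<in> ideal_pow R ?Q (Suc k') \<cdot> carrier R" using F Suc powD_carrier[OF Q, of "Suc k'"] by simp
    then obtain u v where "u \<in> ideal_pow R ?Q k' \<cdot> carrier R" "v \<in> ideal_pow R ?q (Suc k') \<cdot> carrier R" "F = x \<otimes> u \<oplus> v"
      using powD_split[OF xxs oneideal] by blast
    then have "u \<in> ideal_pow R ?Q k'" "v \<in> ideal_pow R ?q (Suc k')" "F = x \<otimes> u \<oplus> v"
      using powD_carrier[OF Q, of k'] powD_carrier[OF q, of "Suc k'"] by simp_all
    then show ?thesis using Suc idl_carr[OF Qk, of u k'] by (intro exI[of _ u] exI[of _ v]) simp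
  qed
  show ?case using Cons.prems(3,4,5)
  proof (induct "k + l" arbitrary: F G k l)
    case 0
    then have "F \<in> carrier R" "G \<in> carrier R" "F \<otimes> G \<in> P" using prod_one[OF Pid] by auto
    then show ?case using 0 primeideal.I_prime[OF P] prod_one[OF Pid] by simp
  next
    case (Suc n)
    note kl = Suc.hyps(2)
    obtain F' f where Fe: "F = x \<otimes> F' \<oplus> f" and f: "f \<in> ideal_pow R ?q k" and F'c: "F' \<in> carrier R"
      and F': "case k of 0 => F' = \<zero> | Suc k' => F' \<in> ideal_pow R ?Q k'" using decomp[OF Suc.prems(1)] by blast
    obtain G' g where Ge: "G = x \<otimes> G' \<oplus> g" and g: "g \<in> ideal_pow R ?q l" and G'c: "G' \<in> carrier R"
      and G': "case l of 0 => G' = \<zero> | Suc k' => G' \<in> ideal_pow R ?Q k'" using decomp[OF Suc.prems(2)] by blast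
    have fc: "f \<in> carrier R" and gc: "g \<in> carrier R" using idl_carr[OF pow_ideal[OF q]] f g by blast+
    have Fc: "F \<in> carrier R" and Gc: "G \<in> carrier R" using idl_carr[OF Qk] Suc.prems by blast+
    have fQ: "f \<in> ideal_pow R ?Q k" and gQ: "g \<in> ideal_pow R ?Q l" using f g qQ by blast+
    have F'G: "F' \<otimes> G \<in> ideal_pow R ?Q n"
    proof (cases k)
      case 0 then show ?thesis using F' Gc idl_zero[OF Qk] by simp
    next
      case (Suc k') then show ?thesis using F' mult[of F' k' G l] Suc.prems(2) kl by simp
    qed
    have fG': "f \<otimes> G' \<in> ideal_pow R ?Q n"
    proof (cases l)
      case 0 then show ?thesis using G' fc idl_zero[OF Qk] by simp
    next
      case (Suc l') then show ?thesis using G' mult[OF fQ, of G' l'] kl by simp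
    qed
    \<comment> \<open>The final case: \<open>f\<close> vanishes in the fibre, and \<open>x\<close> can be cancelled. By symmetry it is
      needed for both factors.\<close>
    have one: "F1 \<in> ideal_pow R ?Q k1 \<cdot> P \<or> G1 \<in> ideal_pow R ?Q l1 \<cdot> P"
      if "Suc n = k1 + l1" "F1 = x \<otimes> F1' \<oplus> f1" "f1 \<in> ideal_pow R ?q k1 \<cdot> P" "F1' \<in> carrier R"
        "case k1 of 0 => F1' = \<zero> | Suc k' => F1' \<in> ideal_pow R ?Q k'" "G1 \<in> ideal_pow R ?Q l1"
        "F1 \<otimes> G1 \<in> ideal_pow R ?Q (k1 + l1) \<cdot> P" for F1 F1' f1 G1 k1 l1
    proof -
      have f1: "f1 \<in> ideal_pow R ?Q k1 \<cdot> P" using that(3) powD_tl_le[OF xxs] by blast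
      have f1c: "f1 \<in> carrier R" using idl_carr[OF QkP f1] .
      have G1c: "G1 \<in> carrier R" using idl_carr[OF Qk that(6)] .
      show ?thesis
      proof (cases k1)
        case 0
        then have "F1 = f1" using that(2,5) f1c x by simp
        then show ?thesis using f1 by simp
      next
        case (Suc k')
        have F1': "F1' \<in> ideal_pow R ?Q k'" using that(5) Suc by simp
        have "F1 \<otimes> G1 = x \<otimes> (F1' \<otimes> G1) \<oplus> f1 \<otimes> G1"
          unfolding that(2) using x that(4) f1c G1c by (simp add: l_distr m_assoc)
        moreover have "f1 \<otimes> G1 \<in> ideal_pow R ?Q (k1 + l1) \<cdot> P" by (rule multP[OF f1 that(6)])
        ultimately have "x \<otimes> (F1' \<otimes> G1) \<in> ideal_pow R ?Q (k1 + l1) \<cdot> P"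
          using idl_addD[OF QkP, where a = "x \<otimes> (F1' \<otimes> G1)" and b = "f1 \<otimes> G1"] that(7) x that(4) G1c by simp
        moreover have nkl: "n = k' + l1" using that(1) Suc by simp
        ultimately have "x \<otimes> (F1' \<otimes> G1) \<oplus> \<zero> \<in> ideal_pow R ?Q (Suc n) \<cdot> P"
          using Suc x that(4) G1c by simp
        moreover have "F1' \<otimes> G1 \<in> ideal_pow R ?Q n" using mult[OF F1' that(6)] nkl by simp
        moreover have "\<zero> \<in> ideal_pow R ?q (Suc n)" by (rule idl_zero[OF pow_ideal[OF q]])
        ultimately have "F1' \<otimes> G1 \<in> ideal_pow R ?Q n \<cdot> P" using split(1) by blast
        then have "F1' \<in> ideal_pow R ?Q k' \<cdot> P \<or> G1 \<in> ideal_pow R ?Q l1 \<cdot> P"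
          using Suc.hyps(1)[of k' l1 F1' G1] nkl F1' that(6) by simp
        then show ?thesis
        proof
          assume "F1' \<in> ideal_pow R ?Q k' \<cdot> P"
          then have "x \<otimes> F1' \<in> ideal_pow R ?Q k1 \<cdot> P" using xQ Suc by blast
          then show ?thesis unfolding that(2) using idl_add[OF QkP _ f1] by blast
        qed simp
      qed
    qed
    have "F \<otimes> G = x \<otimes> (F' \<otimes> G \<oplus> f \<otimes> G') \<oplus> f \<otimes> g"
    proof -
      have "F \<otimes> G = x \<otimes> (F' \<otimes> G) \<oplus> f \<otimes> G" using Fe x F'c fc Gc by (simp add: l_distr m_assoc)
      also have "f \<otimes> G = x \<otimes> (f \<otimes> G') \<oplus> f \<otimes> g" using Ge x G'c fc gc by (simp add: r_distr m_lcomm)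
      finally show ?thesis using x F'c fc Gc G'c gc by (simp add: r_distr a_assoc)
    qed
    then have "x \<otimes> (F' \<otimes> G \<oplus> f \<otimes> G') \<oplus> f \<otimes> g \<in> ideal_pow R ?Q (Suc n) \<cdot> P" using Suc.prems(3) kl by simp
    moreover have "F' \<otimes> G \<oplus> f \<otimes> G' \<in> ideal_pow R ?Q n" by (rule idl_add[OF Qk F'G fG'])
    moreover have "f \<otimes> g \<in> ideal_pow R ?q (Suc n)" using multq[OF f g] kl by simp
    ultimately have "f \<otimes> g \<in> ideal_pow R ?q (Suc n) \<cdot> P"
      using split(2)[of "F' \<otimes> G \<oplus> f \<otimes> G'" n "f \<otimes> g"] by simp
    then have "f \<otimes> g \<in> ideal_pow R ?q (k + l) \<cdot> P" using kl by simp
    then have "f \<in> ideal_pow R ?q k \<cdot> P \<or> g \<in> ideal_pow R ?q l \<cdot> P"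
      using Cons.hyps[of f k g l] Cons.prems(1,2) f g by simp
    then show ?case
    proof
      assume "f \<in> ideal_pow R ?q k \<cdot> P"
      then show ?thesis using one[OF kl Fe _ F'c F' Suc.prems(2,3)] by blast
    next
      assume "g \<in> ideal_pow R ?q l \<cdot> P"
      moreover have "G \<otimes> F \<in> ideal_pow R ?Q (l + k) \<cdot> P" using Suc.prems(3) Fc Gc by (simp add: m_comm add.commute)
      ultimately show ?thesis using one[OF _ Ge _ G'c G' Suc.prems(1)] kl by (simp add: add.commute disj_commute)
    qed
  qed
qed

end

section \<open>Subquotients of a ring\<close>

text \<open>The quotient of an additive subgroup \<open>E\<close> of a ring by a subgroup \<open>N\<close>, both stable
  under multiplication by a subset \<open>T\<close>. The residue field, the Sally module and the fibre of the Rees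
  algebra arise in this way.\<close>

locale subquotient = cring R for R (structure) +
  fixes E N T :: "'a set"
  assumes E_sub: "E \<subseteq> carrier R" and NE: "N \<subseteq> E" and T_sub: "T \<subseteq> carrier R"
    and N_zero: "\<zero> \<in> N" and N_diff: "\<And>x y. x \<in> N ==> y \<in> N ==> x \<ominus> y \<in> N"
    and E_diff: "\<And>x y. x \<in> E ==> y \<in> E ==> x \<ominus> y \<in> E"
    and N_smult: "\<And>t x. t \<in> T ==> x \<in> N ==> t \<otimes> x \<in> N"
    and E_smult: "\<And>t x. t \<in> T ==> x \<in> E ==> t \<otimes> x \<in> E"
begin

lemma N_sub: "N \<subseteq> carrier R" using NE E_sub by blast

lemma N_neg: "x \<in> N ==> \<ominus> x \<in> N"
  using N_diff[OF N_zero, of x] N_sub by (auto simp: a_minus_def)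

lemma N_add: "x \<in> N ==> y \<in> N ==> x \<oplus> y \<in> N"
  using N_diff[OF _ N_neg, of x y] N_sub by (auto simp: a_minus_def)

lemma E_zero: "\<zero> \<in> E" using N_zero NE by blast

lemma E_neg: "x \<in> E ==> \<ominus> x \<in> E"
  using E_diff[OF E_zero, of x] E_sub by (auto simp: a_minus_def)

lemma E_add: "x \<in> E ==> y \<in> E ==> x \<oplus> y \<in> E"
  using E_diff[OF _ E_neg, of x y] E_sub by (auto simp: a_minus_def)

definition cls :: "'a => 'a set" where "cls f = N +> f"

abbreviation (input) "qm \<equiv> quot_module (self_module R E) N"

lemma cls_mem: "x \<in> cls f \<longleftrightarrow> (\<exists>n\<in>N. x = n \<oplus> f)"
  unfolding cls_def a_r_coset_def' by auto

lemma cls_eq_iff: "f \<in> carrier R ==> g \<in> carrier R ==> cls f = cls g \<longleftrightarrow> f \<ominus> g \<in> N"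
proof
  assume f: "f \<in> carrier R" and g: "g \<in> carrier R"
  {
    assume "cls f = cls g"
    moreover have "f \<in> cls f" unfolding cls_mem using N_zero f by (intro bexI[of _ \<zero>]) auto
    ultimately have "f \<in> cls g" by simp
    then obtain n where n: "n \<in> N" "f = n \<oplus> g" unfolding cls_mem by blast
    then show "f \<ominus> g \<in> N" using diff_identities(5)[of n g] g N_sub by auto
  }
  assume fg: "f \<ominus> g \<in> N"
  have *: "cls u \<subseteq> cls v" if u: "u \<in> carrier R" and v: "v \<in> carrier R" and uv: "u \<ominus> v \<in> N" for u v
  proof
    fix x assume "x \<in> cls u"
    then obtain n where n: "n \<in> N" "x = n \<oplus> u" unfolding cls_mem by blast
    have nc: "n \<in> carrier R" using n N_sub by blast
    have "x = (n \<oplus> (u \<ominus> v)) \<oplus> v" using n(2) nc u v diff_identities(1)[OF u v] by (simp add: a_assoc)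
    then show "x \<in> cls v" unfolding cls_mem using N_add[OF n(1) uv] by blast
  qed
  have "g \<ominus> f = \<ominus> (f \<ominus> g)" using f g by (simp add: a_minus_def minus_add a_comm)
  then have "g \<ominus> f \<in> N" using N_neg[OF fg] by simp
  then show "cls f = cls g" using *[OF f g fg] *[OF g f] by blast
qed

lemma cls_zero_iff: "f \<in> carrier R ==> cls f = cls \<zero> \<longleftrightarrow> f \<in> N"
  using cls_eq_iff[of f \<zero>] by (simp add: a_minus_def)

lemma qm_zero: "\<zero>\<^bsub>qm\<^esub> = cls \<zero>"
proof -
  have "N = cls \<zero>" unfolding set_eq_iff cls_mem using N_sub by (metis r_zero subsetD)
  then show ?thesis by (simp add: quot_module_def)
qed

lemma qm_carrier: "carrier qm = cls ` E"
  unfolding quot_module_def cls_def A_RCOSETS_def' self_module_def a_r_coset_def' by auto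

lemma qm_add: "f \<in> carrier R ==> g \<in> carrier R ==> cls f \<oplus>\<^bsub>qm\<^esub> cls g = cls (f \<oplus> g)"
proof
  assume f: "f \<in> carrier R" and g: "g \<in> carrier R"
  have e: "cls f \<oplus>\<^bsub>qm\<^esub> cls g = {a \<oplus> b | a b. a \<in> cls f \<and> b \<in> cls g}"
    unfolding quot_module_def set_add_def' self_module_def by auto
  show "cls f \<oplus>\<^bsub>qm\<^esub> cls g \<subseteq> cls (f \<oplus> g)"
  proof
    fix x assume "x \<in> cls f \<oplus>\<^bsub>qm\<^esub> cls g"
    then obtain n m where n: "n \<in> N" and m: "m \<in> N" and x: "x = (n \<oplus> f) \<oplus> (m \<oplus> g)" unfolding e cls_mem by blast
    have "n \<in> carrier R" "m \<in> carrier R" using n m N_sub by auto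
    then have "x = (n \<oplus> m) \<oplus> (f \<oplus> g)" using x f g by (simp add: a_ac)
    then show "x \<in> cls (f \<oplus> g)" unfolding cls_mem using N_add[OF n m] by blast
  qed
  show "cls (f \<oplus> g) \<subseteq> cls f \<oplus>\<^bsub>qm\<^esub> cls g"
  proof
    fix x assume "x \<in> cls (f \<oplus> g)"
    then obtain n where n: "n \<in> N" and x: "x = n \<oplus> (f \<oplus> g)" unfolding cls_mem by blast
    have nc: "n \<in> carrier R" using n N_sub by auto
    have "x = (n \<oplus> f) \<oplus> (\<zero> \<oplus> g)" using x f g nc by (simp add: a_assoc)
    then show "x \<in> cls f \<oplus>\<^bsub>qm\<^esub> cls g" unfolding e cls_mem using n N_zero by blast
  qed
qed

lemma qm_smult: "t \<in> T ==> f \<in> E ==> t \<odot>\<^bsub>qm\<^esub> cls f = cls (t \<otimes> f)"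
proof -
  assume t: "t \<in> T" and f: "f \<in> E"
  have tc: "t \<in> carrier R" and fc: "f \<in> carrier R" using t f T_sub E_sub by auto
  have e: "t \<odot>\<^bsub>qm\<^esub> cls f = (\<Union>x\<in>cls f. cls (t \<otimes> x))"
    unfolding quot_module_def self_module_def cls_def a_r_coset_def' by auto
  have "cls (t \<otimes> x) = cls (t \<otimes> f)" if x: "x \<in> cls f" for x
  proof -
    obtain n where n: "n \<in> N" "x = n \<oplus> f" using x unfolding cls_mem by blast
    have nc: "n \<in> carrier R" using n N_sub by auto
    have "t \<otimes> x \<ominus> t \<otimes> f = t \<otimes> n"
      using n tc fc nc diff_identities(5)[of "t \<otimes> n" "t \<otimes> f"] by (simp add: r_distr)
    then have "t \<otimes> x \<ominus> t \<otimes> f \<in> N" using N_smult[OF t n(1)] by simp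
    then show ?thesis using cls_eq_iff[of "t \<otimes> x" "t \<otimes> f"] n tc fc nc by simp
  qed
  moreover have "f \<in> cls f" unfolding cls_mem using N_zero fc by (intro bexI[of _ \<zero>]) auto
  ultimately show ?thesis unfolding e by blast
qed

end

section \<open>Depth of maximal Cohen-Macaulay modules\<close>

context cring
begin

definition basis_vec :: "nat => nat => nat => 'a" where
  "basis_vec n j = (\<lambda>i\<in>{..<n}. if i = j then \<one> else \<zero>)"

definition lin :: "nat => (nat => 'a) => (nat => 'a) => 'a" where
  "lin n u z = (\<Oplus>j\<in>{..<n}. z j \<otimes> u j)"

lemma free_carrier: "carrier (free_mod R n) = {..<n} \<rightarrow>\<^sub>E carrier R"
  by (simp add: mod_power_def self_module_def)

lemma free_add: "f \<oplus>\<^bsub>free_mod R n\<^esub> g = (\<lambda>i\<in>{..<n}. f i \<oplus> g i)"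
  by (simp add: mod_power_def self_module_def)

lemma free_smult: "r \<odot>\<^bsub>free_mod R n\<^esub> f = (\<lambda>i\<in>{..<n}. r \<otimes> f i)"
  by (simp add: mod_power_def self_module_def)

lemma free_zero: "\<zero>\<^bsub>free_mod R n\<^esub> = (\<lambda>i\<in>{..<n}. \<zero>)"
  by (simp add: mod_power_def self_module_def)

lemma free_carrD: "z \<in> carrier (free_mod R n) ==> j < n ==> z j \<in> carrier R"
  unfolding free_carrier by auto

lemma basis_vec_carr: "basis_vec n j \<in> carrier (free_mod R n)"
  unfolding free_carrier basis_vec_def by auto

lemma free_zero_carr: "(\<lambda>i\<in>{..<n}. \<zero>) \<in> carrier (free_mod R n)"
  unfolding free_carrier by auto

lemma free_induct:
  assumes z: "z \<in> carrier (free_mod R n)" and P0: "P (\<lambda>i\<in>{..<n}. \<zero>)"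
    and step: "\<And>x r j. x \<in> carrier (free_mod R n) ==> P x ==> j < n ==> r \<in> carrier R ==>
       P (x \<oplus>\<^bsub>free_mod R n\<^esub> r \<odot>\<^bsub>free_mod R n\<^esub> basis_vec n j)"
  shows "P z"
proof -
  let ?z = "\<lambda>m. \<lambda>i\<in>{..<n}. if i < m then z i else \<zero>"
  have zc: "\<And>j. j < n ==> z j \<in> carrier R" using free_carrD[OF z] .
  have "m \<le> n ==> P (?z m)" for m
  proof (induct m)
    case 0
    have "?z 0 = (\<lambda>i\<in>{..<n}. \<zero>)" by (rule restrict_ext) simp
    then show ?case using P0 by (simp only:)
  next
    case (Suc m)
    have zm: "?z m \<in> carrier (free_mod R n)" unfolding free_carrier using zc by auto
    have m: "m < n" and Pm: "P (?z m)" using Suc.prems by (simp, intro Suc.hyps) simp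
    have "P (?z m \<oplus>\<^bsub>free_mod R n\<^esub> z m \<odot>\<^bsub>free_mod R n\<^esub> basis_vec n m)"
      by (rule step[OF zm Pm m zc[OF m]])
    moreover have "?z m \<oplus>\<^bsub>free_mod R n\<^esub> z m \<odot>\<^bsub>free_mod R n\<^esub> basis_vec n m = ?z (Suc m)"
      unfolding free_add free_smult basis_vec_def
      by (rule restrict_ext) (use zc Suc in \<open>auto simp: less_Suc_eq\<close>)
    ultimately show ?case by (simp only:)
  qed
  from this[of n] have "P (?z n)" by simp
  moreover have "?z n = z"
  proof
    fix i show "?z n i = z i" using z unfolding free_carrier by (cases "i < n") (auto simp: PiE_def extensional_def)
  qed
  ultimately show ?thesis by simp
qed

lemma lin_zero: "\<forall>j<n. u j \<in> carrier R ==> lin n u (\<lambda>i\<in>{..<n}. \<zero>) = \<zero>"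
  unfolding lin_def by (rule add.finprod_one_eqI) simp

lemma lin_closed: "\<forall>j<n. u j \<in> carrier R ==> z \<in> carrier (free_mod R n) ==> lin n u z \<in> carrier R"
  unfolding lin_def by (intro finsum_closed) (auto dest: free_carrD)

lemma lin_mem: "ideal L R ==> \<forall>j<n. u j \<in> L ==> z \<in> carrier (free_mod R n) ==> lin n u z \<in> L"
  unfolding lin_def by (rule idl_finsum) (auto dest: free_carrD intro: idl_l)

lemma lin_add: "\<forall>j<n. u j \<in> carrier R ==> z \<in> carrier (free_mod R n) ==> w \<in> carrier (free_mod R n) ==>
   lin n u (z \<oplus>\<^bsub>free_mod R n\<^esub> w) = lin n u z \<oplus> lin n u w"
proof -
  assume u: "\<forall>j<n. u j \<in> carrier R" and z: "z \<in> carrier (free_mod R n)" and w: "w \<in> carrier (free_mod R n)"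
  have "lin n u (z \<oplus>\<^bsub>free_mod R n\<^esub> w) = (\<Oplus>j\<in>{..<n}. z j \<otimes> u j \<oplus> w j \<otimes> u j)"
    unfolding lin_def free_add by (rule finsum_cong') (use u free_carrD[OF z] free_carrD[OF w] in \<open>auto simp: l_distr\<close>)
  then show ?thesis unfolding lin_def
    using u free_carrD[OF z] free_carrD[OF w] by (simp add: finsum_addf Pi_def)
qed

lemma lin_smult: "\<forall>j<n. u j \<in> carrier R ==> z \<in> carrier (free_mod R n) ==> r \<in> carrier R ==>
   lin n u (r \<odot>\<^bsub>free_mod R n\<^esub> z) = r \<otimes> lin n u z"
proof -
  assume u: "\<forall>j<n. u j \<in> carrier R" and z: "z \<in> carrier (free_mod R n)" and r: "r \<in> carrier R"
  have "lin n u (r \<odot>\<^bsub>free_mod R n\<^esub> z) = (\<Oplus>j\<in>{..<n}. r \<otimes> (z j \<otimes> u j))"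
    unfolding lin_def free_smult by (rule finsum_cong') (use u r free_carrD[OF z] in \<open>auto simp: m_assoc\<close>)
  then show ?thesis unfolding lin_def
    using u r free_carrD[OF z] by (simp add: finsum_rdistr Pi_def)
qed

lemma lin_basis: "\<forall>j<n. u j \<in> carrier R ==> t < n ==> lin n u (basis_vec n t) = u t"
proof -
  assume u: "\<forall>j<n. u j \<in> carrier R" and t: "t < n"
  have "lin n u (basis_vec n t) = (\<Oplus>j\<in>{..<n}. if t = j then u j else \<zero>)"
    unfolding lin_def basis_vec_def by (rule finsum_cong') (use u in auto)
  then show ?thesis using u t finsum_singleton[of t "{..<n}" u] by auto
qed

text \<open>Applied to differences: linear maps out of a free module that agree modulo \<open>K\<close> on the basis agree
  modulo \<open>K\<close>.\<close>

lemma lin_unique_mod: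
  assumes K: "ideal K R" and z: "z \<in> carrier (free_mod R n)"
    and hc: "\<And>x. x \<in> carrier (free_mod R n) ==> h x \<in> carrier R"
    and hadd: "\<And>x y. x \<in> carrier (free_mod R n) ==> y \<in> carrier (free_mod R n) ==> h (x \<oplus>\<^bsub>free_mod R n\<^esub> y) = h x \<oplus> h y"
    and hsm: "\<And>r x. r \<in> carrier R ==> x \<in> carrier (free_mod R n) ==> h (r \<odot>\<^bsub>free_mod R n\<^esub> x) = r \<otimes> h x"
    and hK: "\<And>t. t < n ==> h (basis_vec n t) \<in> K"
  shows "h z \<in> K"
proof (rule free_induct[OF z])
  have "(\<lambda>i\<in>{..<n}. \<zero>) = \<zero> \<odot>\<^bsub>free_mod R n\<^esub> (\<lambda>i\<in>{..<n}. \<zero>)" unfolding free_smult by auto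
  then have "h (\<lambda>i\<in>{..<n}. \<zero>) = \<zero> \<otimes> h (\<lambda>i\<in>{..<n}. \<zero>)" using hsm[OF zero_closed free_zero_carr] by simp
  then have "h (\<lambda>i\<in>{..<n}. \<zero>) = \<zero>" using hc[OF free_zero_carr] by simp
  then show "h (\<lambda>i\<in>{..<n}. \<zero>) \<in> K" using idl_zero[OF K] by simp
next
  fix x r j assume a: "x \<in> carrier (free_mod R n)" "h x \<in> K" "j < n" "r \<in> carrier R"
  have "r \<odot>\<^bsub>free_mod R n\<^esub> basis_vec n j \<in> carrier (free_mod R n)"
    using a free_carrD[OF basis_vec_carr] unfolding free_smult free_carrier by auto
  then have "h (x \<oplus>\<^bsub>free_mod R n\<^esub> r \<odot>\<^bsub>free_mod R n\<^esub> basis_vec n j) = h x \<oplus> r \<otimes> h (basis_vec n j)"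
    using hadd a hsm[OF a(4) basis_vec_carr] by simp
  then show "h (x \<oplus>\<^bsub>free_mod R n\<^esub> r \<odot>\<^bsub>free_mod R n\<^esub> basis_vec n j) \<in> K"
    using idl_add[OF K a(2) idl_l[OF K hK[OF a(3)] a(4)]] by simp
qed

end

context noeth_local
begin

abbreviation (input) "resfield \<equiv> quot_module (self_module R (carrier R)) \<mm>"

lemma resfield_subquotient: "subquotient R (carrier R) \<mm> (carrier R)"
  by unfold_locales (use idl_sub[OF mid] idl_zero[OF mid] idl_diff[OF mid] idl_l[OF mid] in auto)

end

text \<open>With a fixed free resolution of the residue field, the modules \<open>Ext^i(A/\<mm>, L/K)\<close> are computed
  for all subquotients \<open>L/K\<close> of the ring at once. As for the Koszul complex, cochains are lifted to
  \<open>L\<close>; they are given by their values on the bases of the free modules.\<close>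

locale residue_resolution = noeth_local +
  fixes b :: "nat => nat" and \<phi> :: "nat => (nat => 'a) => (nat => 'a)" and \<epsilon> :: "(nat => 'a) => 'a set"
  assumes res: "free_resolution R b \<phi> \<epsilon> resfield"
begin

abbreviation (input) "FF i \<equiv> free_mod R (b i)"

lemma phi_hom: "\<phi> i \<in> mod_hom R (FF (Suc i)) (FF i)"
  using res unfolding free_resolution_def by simp

lemma phi_closed: "z \<in> carrier (FF (Suc i)) ==> \<phi> i z \<in> carrier (FF i)"
  using phi_hom[of i] unfolding mod_hom_def by auto

lemma phi_add: "x \<in> carrier (FF (Suc i)) ==> y \<in> carrier (FF (Suc i)) ==> \<phi> i (x \<oplus>\<^bsub>FF (Suc i)\<^esub> y) = \<phi> i x \<oplus>\<^bsub>FF i\<^esub> \<phi> i y"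
  using phi_hom[of i] unfolding mod_hom_def by simp

lemma phi_smult: "r \<in> carrier R ==> x \<in> carrier (FF (Suc i)) ==> \<phi> i (r \<odot>\<^bsub>FF (Suc i)\<^esub> x) = r \<odot>\<^bsub>FF i\<^esub> \<phi> i x"
  using phi_hom[of i] unfolding mod_hom_def by simp

lemma phi_phi: "z \<in> carrier (FF (Suc (Suc i))) ==> \<phi> i (\<phi> (Suc i) z) = (\<lambda>j\<in>{..<b i}. \<zero>)"
proof -
  assume z: "z \<in> carrier (FF (Suc (Suc i)))"
  have "\<phi> (Suc i) ` carrier (FF (Suc (Suc i))) = {x \<in> carrier (FF (Suc i)). \<phi> i x = \<zero>\<^bsub>FF i\<^esub>}"
    using res unfolding free_resolution_def by simp
  then show ?thesis using z unfolding free_zero by blast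
qed

lemma lin_phi_closed:
  "\<forall>t<b i. u t \<in> carrier R ==> z \<in> carrier (FF (Suc i)) ==> lin (b i) u (\<phi> i z) \<in> carrier R"
  by (rule lin_closed) (auto intro: phi_closed)

lemma lin_phi_mod:
  assumes K: "ideal K R" and u: "\<forall>t<b i. u t \<in> carrier R" and v: "\<forall>t<b (Suc i). v t \<in> carrier R"
    and eq: "\<forall>t<b (Suc i). lin (b i) u (\<phi> i (basis_vec (b (Suc i)) t)) \<ominus> v t \<in> K"
    and z: "z \<in> carrier (FF (Suc i))"
  shows "lin (b i) u (\<phi> i z) \<ominus> lin (b (Suc i)) v z \<in> K"
proof (rule lin_unique_mod[OF K z])
  fix x assume x: "x \<in> carrier (FF (Suc i))"
  show "lin (b i) u (\<phi> i x) \<ominus> lin (b (Suc i)) v x \<in> carrier R"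
    using lin_phi_closed[OF u x] lin_closed[OF v x] by simp
next
  fix x y assume x: "x \<in> carrier (FF (Suc i))" and y: "y \<in> carrier (FF (Suc i))"
  show "lin (b i) u (\<phi> i (x \<oplus>\<^bsub>FF (Suc i)\<^esub> y)) \<ominus> lin (b (Suc i)) v (x \<oplus>\<^bsub>FF (Suc i)\<^esub> y) =
     (lin (b i) u (\<phi> i x) \<ominus> lin (b (Suc i)) v x) \<oplus> (lin (b i) u (\<phi> i y) \<ominus> lin (b (Suc i)) v y)"
    unfolding phi_add[OF x y] lin_add[OF u phi_closed[OF x] phi_closed[OF y]] lin_add[OF v x y]
    using lin_phi_closed[OF u x] lin_closed[OF v x] lin_phi_closed[OF u y] lin_closed[OF v y]
    by (simp add: a_minus_def minus_add a_ac)
next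
  fix r x assume r: "r \<in> carrier R" and x: "x \<in> carrier (FF (Suc i))"
  show "lin (b i) u (\<phi> i (r \<odot>\<^bsub>FF (Suc i)\<^esub> x)) \<ominus> lin (b (Suc i)) v (r \<odot>\<^bsub>FF (Suc i)\<^esub> x) =
     r \<otimes> (lin (b i) u (\<phi> i x) \<ominus> lin (b (Suc i)) v x)"
    unfolding phi_smult[OF r x] lin_smult[OF u phi_closed[OF x] r] lin_smult[OF v x r]
    using r lin_phi_closed[OF u x] lin_closed[OF v x] by (simp add: a_minus_def r_distr r_minus)
next
  fix t assume t: "t < b (Suc i)"
  show "lin (b i) u (\<phi> i (basis_vec (b (Suc i)) t)) \<ominus> lin (b (Suc i)) v (basis_vec (b (Suc i)) t) \<in> K"
    unfolding lin_basis[OF v t] using eq t by simp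
qed

definition cocycle :: "nat => 'a set => 'a set => (nat => 'a) => bool" where
  "cocycle i L K u \<longleftrightarrow> (\<forall>t<b i. u t \<in> L) \<and> (\<forall>z\<in>carrier (FF (Suc i)). lin (b i) u (\<phi> i z) \<in> K)"

definition coboundary :: "nat => 'a set => 'a set => (nat => 'a) => bool" where
  "coboundary i L K u \<longleftrightarrow> (case i of 0 => \<forall>t<b 0. u t \<in> K
     | Suc j => \<exists>g. (\<forall>t<b j. g t \<in> L) \<and> (\<forall>t<b (Suc j). u t \<ominus> lin (b j) g (\<phi> j (basis_vec (b (Suc j)) t)) \<in> K))"

definition ext_vanish :: "nat => 'a set => 'a set => bool" where
  "ext_vanish i L K \<longleftrightarrow> (\<forall>u. cocycle i L K u --> coboundary i L K u)"

text \<open>The long exact sequence of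
  \<open>0 \<rightarrow> L/K \<rightarrow> L/K \<rightarrow> L/(yL + K) \<rightarrow> 0\<close>, with first map
  multiplication by \<open>y\<close>: a cocycle \<open>u\<close> with values in \<open>L/(yL + K)\<close> has
  coboundary \<open>yv\<close>, and \<open>v\<close> is a cocycle of degree one more. If \<open>v\<close> is the
  coboundary of \<open>g\<close>, then \<open>u - yg\<close> is a cocycle with values in \<open>L/K\<close>.\<close>

lemma ext_vanish_step:
  assumes L: "ideal L R" and K: "ideal K R" and KL: "K \<subseteq> L"
    and y: "y \<in> carrier R" and nzd: "\<And>w. w \<in> L ==> y \<otimes> w \<in> K ==> w \<in> K"
    and W0: "ext_vanish i L K" and W1: "ext_vanish (Suc i) L K"
  shows "ext_vanish i L ((PIdl y) \<cdot> L <+> K)"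
  unfolding ext_vanish_def
proof (intro allI impI)
  let ?K' = "(PIdl y) \<cdot> L <+> K"
  have yL: "ideal ((PIdl y) \<cdot> L) R" by (rule prod_ideal[OF cgenideal_ideal[OF y] L])
  have K': "ideal ?K' R" by (rule add_ideals[OF yL K])
  have yLK': "y \<otimes> l \<in> ?K'" if "l \<in> L" for l
    using subsetD[OF sum_ge1[OF yL K]] prod_principal_mem[OF y L] that by blast
  have KK': "K \<subseteq> ?K'" by (rule sum_ge2[OF yL K])
  fix u assume "cocycle i L ?K' u"
  then have uL: "\<And>t. t < b i ==> u t \<in> L" and uK: "\<And>z. z \<in> carrier (FF (Suc i)) ==> lin (b i) u (\<phi> i z) \<in> ?K'"
    unfolding cocycle_def by auto
  have uc: "\<forall>t<b i. u t \<in> carrier R" using uL idl_carr[OF L] by simp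
  let ?e = "\<lambda>t. basis_vec (b (Suc i)) t"
  have "\<exists>l\<in>L. lin (b i) u (\<phi> i (?e t)) \<ominus> y \<otimes> l \<in> K" for t
  proof -
    obtain a k where a: "a \<in> (PIdl y) \<cdot> L" and k: "k \<in> K" and e: "lin (b i) u (\<phi> i (?e t)) = a \<oplus> k"
      using uK[OF basis_vec_carr, of t] unfolding sum_mem by blast
    obtain l where l: "l \<in> L" "a = y \<otimes> l" using a prod_principal_mem[OF y L] by blast
    have "a \<oplus> k \<ominus> a = k" using l idl_carr[OF L] idl_carr[OF K k] y diff_identities(4) by simp
    then show ?thesis using l k e by (intro bexI[of _ l]) simp_all
  qed
  then obtain v where vL: "\<And>t. v t \<in> L" and vK: "\<And>t. lin (b i) u (\<phi> i (?e t)) \<ominus> y \<otimes> v t \<in> K" by metis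
  have vc1: "\<And>t. v t \<in> carrier R" using vL idl_carr[OF L] by simp
  then have vc: "\<forall>t<b (Suc i). v t \<in> carrier R" by simp
  have vL': "\<forall>t<b (Suc i). v t \<in> L" using vL by simp
  have yv: "lin (b (Suc i)) (\<lambda>t. y \<otimes> v t) z = y \<otimes> lin (b (Suc i)) v z" if z: "z \<in> carrier (FF (Suc i))" for z
  proof -
    have "lin (b (Suc i)) (\<lambda>t. y \<otimes> v t) z = (\<Oplus>j\<in>{..<b (Suc i)}. y \<otimes> (z j \<otimes> v j))"
      unfolding lin_def by (rule finsum_cong') (use vc y free_carrD[OF z] in \<open>auto simp: m_lcomm\<close>)
    then show ?thesis unfolding lin_def using vc y free_carrD[OF z] by (simp add: finsum_rdistr Pi_def)
  qed
  have "cocycle (Suc i) L K v"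
    unfolding cocycle_def
  proof (intro conjI allI impI ballI)
    fix z assume z: "z \<in> carrier (FF (Suc (Suc i)))"
    let ?w = "\<phi> (Suc i) z"
    have w: "?w \<in> carrier (FF (Suc i))" by (rule phi_closed[OF z])
    have lc: "lin (b (Suc i)) v ?w \<in> carrier R" by (rule lin_closed[OF vc w])
    have "lin (b i) u (\<phi> i ?w) \<ominus> lin (b (Suc i)) (\<lambda>t. y \<otimes> v t) ?w \<in> K"
      by (rule lin_phi_mod[OF K uc _ _ w]) (use y vc vK in auto)
    moreover have "lin (b i) u (\<phi> i ?w) = \<zero>" unfolding phi_phi[OF z] by (rule lin_zero[OF uc])
    ultimately have "\<zero> \<ominus> y \<otimes> lin (b (Suc i)) v ?w \<in> K" using yv[OF w] by simp
    then have "\<ominus> (\<zero> \<ominus> y \<otimes> lin (b (Suc i)) v ?w) \<in> K" by (rule idl_neg[OF K])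
    then have "y \<otimes> lin (b (Suc i)) v ?w \<in> K" using lc y by (simp add: a_minus_def)
    then show "lin (b (Suc i)) v ?w \<in> K" using nzd lin_mem[OF L vL' w] by blast
  qed (rule vL)
  then have "coboundary (Suc i) L K v" using W1 unfolding ext_vanish_def by blast
  then obtain g where gL: "\<And>t. t < b i ==> g t \<in> L"
    and gK: "\<And>t. t < b (Suc i) ==> v t \<ominus> lin (b i) g (\<phi> i (?e t)) \<in> K" unfolding coboundary_def by auto
  have gc: "\<forall>t<b i. g t \<in> carrier R" using gL idl_carr[OF L] by simp
  let ?u = "\<lambda>t. u t \<ominus> y \<otimes> g t"
  have u'c: "\<forall>t<b i. ?u t \<in> carrier R" using uc gc y by simp
  have lin_u': "lin (b i) ?u z = lin (b i) u z \<ominus> y \<otimes> lin (b i) g z" if z: "z \<in> carrier (FF i)" for z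
  proof -
    have "y \<otimes> lin (b i) g z = (\<Oplus>j\<in>{..<b i}. y \<otimes> (z j \<otimes> g j))"
      unfolding lin_def using gc y free_carrD[OF z] by (simp add: finsum_rdistr Pi_def)
    moreover have "lin (b i) u z = (\<Oplus>j\<in>{..<b i}. z j \<otimes> ?u j \<oplus> y \<otimes> (z j \<otimes> g j))"
      unfolding lin_def
    proof (rule finsum_cong')
      fix j assume "j \<in> {..<b i}"
      then have c: "u j \<in> carrier R" "g j \<in> carrier R" "z j \<in> carrier R" using uc gc free_carrD[OF z] by auto
      have "z j \<otimes> u j = z j \<otimes> ((u j \<ominus> y \<otimes> g j) \<oplus> y \<otimes> g j)" using diff_identities(1)[of "u j" "y \<otimes> g j"] c y by simp
      then show "z j \<otimes> u j = z j \<otimes> ?u j \<oplus> y \<otimes> (z j \<otimes> g j)" using c y by (simp add: r_distr m_lcomm)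
    qed (use uc gc y free_carrD[OF z] in auto)
    moreover have "\<dots> = lin (b i) ?u z \<oplus> (\<Oplus>j\<in>{..<b i}. y \<otimes> (z j \<otimes> g j))"
      unfolding lin_def using uc gc y free_carrD[OF z] by (intro finsum_addf) auto
    moreover have "(\<Oplus>j\<in>{..<b i}. y \<otimes> (z j \<otimes> g j)) \<in> carrier R"
      using gc y free_carrD[OF z] by (intro finsum_closed) auto
    ultimately show ?thesis using diff_identities(5)[of "lin (b i) ?u z" "y \<otimes> lin (b i) g z"]
        lin_closed[OF u'c z] lin_closed[OF gc z] y by simp
  qed
  have "cocycle i L K ?u"
    unfolding cocycle_def
  proof (intro conjI allI impI ballI)
    show "?u t \<in> L" if "t < b i" for t using uL[OF that] idl_l[OF L gL[OF that] y] by (rule idl_diff[OF L])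
    fix z assume z: "z \<in> carrier (FF (Suc i))"
    have "lin (b i) ?u (\<phi> i z) \<ominus> lin (b (Suc i)) (\<lambda>_. \<zero>) z \<in> K"
    proof (rule lin_phi_mod[OF K u'c _ _ z], simp, intro allI impI)
      fix t assume t: "t < b (Suc i)"
      let ?A = "lin (b i) u (\<phi> i (?e t))" and ?G = "lin (b i) g (\<phi> i (?e t))"
      have ec: "\<phi> i (?e t) \<in> carrier (FF i)" by (rule phi_closed[OF basis_vec_carr])
      have c: "?A \<in> carrier R" "?G \<in> carrier R" using lin_closed[OF uc ec] lin_closed[OF gc ec] by auto
      have "?A \<ominus> y \<otimes> ?G = (?A \<ominus> y \<otimes> v t) \<oplus> y \<otimes> (v t \<ominus> ?G)"
        using c vc1[of t] y by (simp add: a_minus_def r_distr r_minus a_assoc r_neg1)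
      moreover have "(?A \<ominus> y \<otimes> v t) \<oplus> y \<otimes> (v t \<ominus> ?G) \<in> K"
        using idl_add[OF K vK[of t] idl_l[OF K gK[OF t] y]] .
      ultimately have "lin (b i) ?u (\<phi> i (?e t)) \<in> K" using lin_u'[OF ec] by simp
      then show "lin (b i) ?u (\<phi> i (?e t)) \<ominus> \<zero> \<in> K" using idl_carr[OF K] by (simp add: a_minus_def)
    qed
    moreover have "lin (b (Suc i)) (\<lambda>_. \<zero>) z = \<zero>"
      unfolding lin_def by (rule add.finprod_one_eqI) (use free_carrD[OF z] in auto)
    ultimately show "lin (b i) ?u (\<phi> i z) \<in> K" using lin_phi_closed[OF u'c z] by (simp add: a_minus_def)
  qed
  then have cb: "coboundary i L K ?u" using W0 unfolding ext_vanish_def by blast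
  show "coboundary i L ?K' u"
  proof (cases i)
    case 0
    have "u t \<in> ?K'" if t: "t < b 0" for t
    proof -
      have "?u t \<in> ?K'" using cb t KK' unfolding coboundary_def 0 by auto
      then show ?thesis by (rule idl_diffD[OF K']) (use yLK' gL uc t 0 in auto)
    qed
    then show ?thesis unfolding coboundary_def 0 by simp
  next
    case (Suc j)
    obtain g' where g': "\<And>t. t < b j ==> g' t \<in> L"
      and gg: "\<And>t. t < b i ==> ?u t \<ominus> lin (b j) g' (\<phi> j (basis_vec (b i) t)) \<in> K"
      using cb unfolding coboundary_def Suc by auto
    have g'c: "\<forall>t<b j. g' t \<in> carrier R" using g' idl_carr[OF L] by simp
    have "u t \<ominus> lin (b j) g' (\<phi> j (basis_vec (b i) t)) \<in> ?K'" if t: "t < b i" for t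
    proof -
      let ?G = "lin (b j) g' (\<phi> j (basis_vec (b i) t))"
      have c: "?G \<in> carrier R" using lin_phi_closed[OF g'c, of "basis_vec (b i) t"] basis_vec_carr Suc by simp
      have "u t \<ominus> ?G = (?u t \<ominus> ?G) \<oplus> y \<otimes> g t"
        using c uc[rule_format, OF t] gc[rule_format, OF t] y by (simp add: a_minus_def a_ac r_neg2)
      moreover have "\<dots> \<in> ?K'" using idl_add[OF K' subsetD[OF KK' gg[OF t]] yLK'[OF gL[OF t]]] .
      ultimately show ?thesis by simp
    qed
    then show ?thesis unfolding coboundary_def Suc using g' Suc by auto
  qed
qed

text \<open>In degree zero the group is \<open>Hom(A/\<mm>, L/K)\<close>, which is the socle of \<open>L/K\<close>: an
  element \<open>w\<close> annihilated by \<open>\<mm>\<close> modulo \<open>K\<close> defines the cocycle that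
  sends \<open>z\<close> to \<open>\<epsilon>(z) w\<close>.\<close>

lemma ext_vanish_socle:
  assumes K: "ideal K R" and L: "ideal L R" and W: "ext_vanish 0 L K" and w: "w \<in> L" and mw: "\<And>a. a \<in> \<mm> ==> a \<otimes> w \<in> K"
  shows "w \<in> K"
proof -
  interpret k: subquotient R "carrier R" \<mm> "carrier R" by (rule resfield_subquotient)
  have wc: "w \<in> carrier R" using idl_carr[OF L w] .
  have eps: "\<epsilon> \<in> mod_hom R (FF 0) resfield" and surj: "\<epsilon> ` carrier (FF 0) = carrier resfield"
    and ex: "\<phi> 0 ` carrier (FF 1) = {x \<in> carrier (FF 0). \<epsilon> x = \<zero>\<^bsub>resfield\<^esub>}"
    using res unfolding free_resolution_def by auto
  have "\<exists>r\<in>carrier R. \<epsilon> (basis_vec (b 0) t) = k.cls r" for t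
    using eps basis_vec_carr[of "b 0" t] unfolding mod_hom_def k.qm_carrier by blast
  then obtain r where rc1: "\<And>t. r t \<in> carrier R" and re: "\<And>t. \<epsilon> (basis_vec (b 0) t) = k.cls (r t)" by metis
  have rc: "\<forall>t<b 0. r t \<in> carrier R" using rc1 by simp
  have er: "\<epsilon> z = k.cls (lin (b 0) r z)" if z: "z \<in> carrier (FF 0)" for z
  proof (rule free_induct[OF z])
    let ?z = "\<lambda>i\<in>{..<b 0}. \<zero>"
    have ez: "\<zero> \<odot>\<^bsub>FF 0\<^esub> ?z = ?z" unfolding free_smult by auto
    have "\<epsilon> (\<zero> \<odot>\<^bsub>FF 0\<^esub> ?z) = \<zero> \<odot>\<^bsub>resfield\<^esub> \<epsilon> ?z"
      using eps free_zero_carr[of "b 0"] zero_closed unfolding mod_hom_def by blast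
    then have "\<epsilon> ?z = \<zero> \<odot>\<^bsub>resfield\<^esub> \<epsilon> ?z" by (simp only: ez)
    moreover obtain a where "a \<in> carrier R" "\<epsilon> ?z = k.cls a"
      using eps free_zero_carr[of "b 0"] unfolding mod_hom_def k.qm_carrier by blast
    ultimately have "\<epsilon> ?z = k.cls \<zero>" using k.qm_smult[of \<zero> a] by simp
    then show "\<epsilon> ?z = k.cls (lin (b 0) r ?z)" using lin_zero[OF rc] by simp
  next
    fix x a j assume a: "x \<in> carrier (FF 0)" "\<epsilon> x = k.cls (lin (b 0) r x)" "j < b 0" "a \<in> carrier R"
    have sc: "a \<odot>\<^bsub>FF 0\<^esub> basis_vec (b 0) j \<in> carrier (FF 0)"
      using a free_carrD[OF basis_vec_carr] unfolding free_smult free_carrier by auto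
    have "\<epsilon> (a \<odot>\<^bsub>FF 0\<^esub> basis_vec (b 0) j) = a \<odot>\<^bsub>resfield\<^esub> \<epsilon> (basis_vec (b 0) j)"
      using eps a(4) basis_vec_carr[of "b 0" j] unfolding mod_hom_def by simp
    then have e1: "\<epsilon> (a \<odot>\<^bsub>FF 0\<^esub> basis_vec (b 0) j) = k.cls (a \<otimes> r j)" using re k.qm_smult[OF a(4) rc1] by simp
    have "\<epsilon> (x \<oplus>\<^bsub>FF 0\<^esub> a \<odot>\<^bsub>FF 0\<^esub> basis_vec (b 0) j) = \<epsilon> x \<oplus>\<^bsub>resfield\<^esub> \<epsilon> (a \<odot>\<^bsub>FF 0\<^esub> basis_vec (b 0) j)"
      using eps a(1) sc unfolding mod_hom_def by simp
    also have "\<dots> = k.cls (lin (b 0) r x \<oplus> a \<otimes> r j)"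
      unfolding e1 a(2) by (rule k.qm_add) (use lin_closed[OF rc a(1)] rc1 a in auto)
    also have "lin (b 0) r x \<oplus> a \<otimes> r j = lin (b 0) r (x \<oplus>\<^bsub>FF 0\<^esub> a \<odot>\<^bsub>FF 0\<^esub> basis_vec (b 0) j)"
      using lin_add[OF rc a(1) sc] lin_smult[OF rc basis_vec_carr a(4)] lin_basis[OF rc a(3)] by simp
    finally show "\<epsilon> (x \<oplus>\<^bsub>FF 0\<^esub> a \<odot>\<^bsub>FF 0\<^esub> basis_vec (b 0) j) = k.cls (lin (b 0) r (x \<oplus>\<^bsub>FF 0\<^esub> a \<odot>\<^bsub>FF 0\<^esub> basis_vec (b 0) j))" .
  qed
  have rw: "lin (b 0) (\<lambda>t. r t \<otimes> w) z = lin (b 0) r z \<otimes> w" if z: "z \<in> carrier (FF 0)" for z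
  proof -
    have "lin (b 0) (\<lambda>t. r t \<otimes> w) z = (\<Oplus>j\<in>{..<b 0}. (z j \<otimes> r j) \<otimes> w)"
      unfolding lin_def by (rule finsum_cong') (use rc wc free_carrD[OF z] in \<open>auto simp: m_assoc\<close>)
    then show ?thesis unfolding lin_def using rc wc free_carrD[OF z] by (simp add: finsum_ldistr Pi_def)
  qed
  have "cocycle 0 L K (\<lambda>t. r t \<otimes> w)"
    unfolding cocycle_def
  proof (intro conjI allI impI ballI)
    show "r t \<otimes> w \<in> L" for t using idl_l[OF L w rc1] .
    fix z assume z: "z \<in> carrier (FF (Suc 0))"
    have pc: "\<phi> 0 z \<in> carrier (FF 0)" by (rule phi_closed[OF z])
    have "\<epsilon> (\<phi> 0 z) = k.cls \<zero>" using ex z k.qm_zero by auto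
    then have "lin (b 0) r (\<phi> 0 z) \<in> \<mm>" using er[OF pc] k.cls_zero_iff lin_closed[OF rc pc] by simp
    then show "lin (b 0) (\<lambda>t. r t \<otimes> w) (\<phi> 0 z) \<in> K" unfolding rw[OF pc] by (rule mw)
  qed
  then have rK: "\<forall>t<b 0. r t \<otimes> w \<in> K" using W unfolding ext_vanish_def coboundary_def by auto
  obtain z where z: "z \<in> carrier (FF 0)" "\<epsilon> z = k.cls \<one>"
    using surj k.qm_carrier one_closed by (metis (no_types, lifting) image_iff)
  have lc: "lin (b 0) r z \<in> carrier R" by (rule lin_closed[OF rc z(1)])
  then have "lin (b 0) r z \<ominus> \<one> \<in> \<mm>" using er[OF z(1)] z(2) k.cls_eq_iff[OF lc one_closed] by simp
  then have "(lin (b 0) r z \<ominus> \<one>) \<otimes> w \<in> K" by (rule mw)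
  moreover have "lin (b 0) r z \<otimes> w \<in> K" unfolding rw[OF z(1), symmetric] by (rule lin_mem[OF K rK z(1)])
  ultimately have "lin (b 0) r z \<otimes> w \<ominus> (lin (b 0) r z \<ominus> \<one>) \<otimes> w \<in> K" by (rule idl_diff[OF K, rotated])
  moreover have "lin (b 0) r z \<otimes> w \<ominus> (lin (b 0) r z \<ominus> \<one>) \<otimes> w = w"
    using lc wc by (simp add: a_minus_def l_distr l_minus minus_add r_neg2)
  ultimately show ?thesis by simp
qed

text \<open>The absence of socle elements provides a nonzerodivisor \<open>y \<in> \<mm>\<close>, and passing to
  \<open>L/(yL + K)\<close> costs one degree of vanishing.\<close>

lemma regular_of_ext_vanish:
  assumes L: "ideal L R"
  shows "ideal K R ==> K \<subseteq> L ==> (\<And>i. i < d ==> ext_vanish i L K) ==>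
    \<exists>ys. length ys = d \<and> set ys \<subseteq> \<mm> \<and> reg_on L K ys"
proof (induct d arbitrary: K)
  case 0 then show ?case by auto
next
  case (Suc d)
  have "\<exists>y\<in>\<mm>. \<forall>w\<in>L. y \<otimes> w \<in> K --> w \<in> K"
    by (rule ex_nonzerodivisor[OF L Suc.prems(1,2)]) (use ext_vanish_socle[OF Suc.prems(1) L Suc.prems(3)] in blast)
  then obtain y where y: "y \<in> \<mm>" and nzd: "\<And>w. w \<in> L ==> y \<otimes> w \<in> K ==> w \<in> K" by blast
  have yc: "y \<in> carrier R" using idl_carr[OF mid y] .
  have yL: "ideal ((PIdl y) \<cdot> L) R" by (rule prod_ideal[OF cgenideal_ideal[OF yc] L])
  have K': "ideal ((PIdl y) \<cdot> L <+> K) R" by (rule add_ideals[OF yL Suc.prems(1)])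
  have sub: "(PIdl y) \<cdot> L <+> K \<subseteq> L"
    by (rule sum_le[OF L prod_le2[OF cgenideal_ideal[OF yc] L] Suc.prems(2)])
  have "ext_vanish i L ((PIdl y) \<cdot> L <+> K)" if "i < d" for i
    using that by (intro ext_vanish_step[OF L Suc.prems(1,2) yc nzd]) (auto intro: Suc.prems(3))
  then obtain ys where "length ys = d" "set ys \<subseteq> \<mm>" "reg_on L ((PIdl y) \<cdot> L <+> K) ys"
    using Suc.hyps[OF K' sub] by blast
  then show ?case using y nzd by (intro exI[of _ "y # ys"]) auto
qed

text \<open>A homomorphism from a free module is determined by its values on the basis, and \<open>lin\<close> recovers it
  from them; this matches cosets of cocycles with their lifts.\<close>

lemma ext_vanish_of_Ext_zero:
  assumes I: "ideal I R"
    and van: "carrier (Ext_module R b \<phi> (self_module R I) i) = {\<zero>\<^bsub>Ext_module R b \<phi> (self_module R I) i\<^esub>}"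
  shows "ext_vanish i I {\<zero>}"
  unfolding ext_vanish_def
proof (intro allI impI)
  fix u assume "cocycle i I {\<zero>} u"
  then have uI: "\<forall>t<b i. u t \<in> I" and u0: "\<And>z. z \<in> carrier (FF (Suc i)) ==> lin (b i) u (\<phi> i z) = \<zero>"
    unfolding cocycle_def by auto
  have uc: "\<forall>t<b i. u t \<in> carrier R" using uI idl_carr[OF I] by simp
  let ?C = "self_module R I"
  let ?Z = "Ext_cocycles R b \<phi> ?C i" and ?B = "Ext_coboundaries R b \<phi> ?C i"
  have Cs: "carrier ?C = I" "\<zero>\<^bsub>?C\<^esub> = \<zero>" "\<And>x y. x \<oplus>\<^bsub>?C\<^esub> y = x \<oplus> y" "\<And>x y. x \<odot>\<^bsub>?C\<^esub> y = x \<otimes> y"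
    by (simp_all add: self_module_def)
  let ?f = "\<lambda>z\<in>carrier (FF i). lin (b i) u z"
  have addc: "x \<oplus>\<^bsub>FF i\<^esub> y \<in> carrier (FF i)" if "x \<in> carrier (FF i)" "y \<in> carrier (FF i)" for x y
    using that unfolding free_add free_carrier by auto
  have smc: "r \<odot>\<^bsub>FF i\<^esub> y \<in> carrier (FF i)" if "r \<in> carrier R" "y \<in> carrier (FF i)" for r y
    using that unfolding free_smult free_carrier by auto
  have fI: "?f \<in> carrier (FF i) \<rightarrow> I" using lin_mem[OF I uI] by auto
  have fh: "?f \<in> carrier (hom_module R (FF i) ?C)"
    unfolding hom_module_def mod_hom_def
    using fI addc smc lin_add[OF uc] lin_smult[OF uc] by (simp add: Cs)
  have "dual_diff R b \<phi> i ?f = \<zero>\<^bsub>hom_module R (FF (Suc i)) ?C\<^esub>"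
    unfolding dual_diff_def hom_module_def
    by (simp add: Cs) (rule restrict_ext, use u0 phi_closed in simp)
  then have fZ: "?f \<in> ?Z" unfolding Ext_cocycles_def using fh by simp
  let ?H = "(hom_module R (FF i) ?C)\<lparr>carrier := ?Z\<rparr>"
  let ?z = "\<zero>\<^bsub>hom_module R (FF i) ?C\<^esub>"
  have z: "?z = (\<lambda>x\<in>carrier (FF i). \<zero>)" by (simp add: hom_module_def Cs)
  have "?B +>\<^bsub>?H\<^esub> ?f \<in> carrier (Ext_module R b \<phi> ?C i)"
    unfolding Ext_module_def quot_module_def A_RCOSETS_def' using fZ by auto
  then have eq: "?B +>\<^bsub>?H\<^esub> ?f = ?B" unfolding van by (simp add: Ext_module_def quot_module_def)
  have zB: "?z \<in> ?B"
  proof (cases i)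
    case 0 then show ?thesis by (simp add: Ext_coboundaries_def)
  next
    case (Suc j)
    let ?g = "\<zero>\<^bsub>hom_module R (FF j) ?C\<^esub>"
    have addj: "x \<oplus>\<^bsub>FF j\<^esub> y \<in> carrier (FF j)" if "x \<in> carrier (FF j)" "y \<in> carrier (FF j)" for x y
      using that unfolding free_add free_carrier by auto
    have smj: "r \<odot>\<^bsub>FF j\<^esub> y \<in> carrier (FF j)" if "r \<in> carrier R" "y \<in> carrier (FF j)" for r y
      using that unfolding free_smult free_carrier by auto
    have "?g \<in> carrier (hom_module R (FF j) ?C)"
      unfolding hom_module_def mod_hom_def using addj smj idl_zero[OF I] by (auto simp: Cs)
    moreover have "?z = dual_diff R b \<phi> j ?g"
      unfolding dual_diff_def Suc hom_module_def
      by (simp add: Cs) (rule restrict_ext, use phi_closed[of _ j] in simp)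
    ultimately show ?thesis unfolding Ext_coboundaries_def Suc by auto
  qed
  have "?f = ?z \<oplus>\<^bsub>?H\<^esub> ?f"
    unfolding z by (rule ext) (use lin_closed[OF uc] in \<open>auto simp: hom_module_def Cs\<close>)
  then have "?f \<in> ?B +>\<^bsub>?H\<^esub> ?f" unfolding a_r_coset_def' using zB by blast
  then have fB: "?f \<in> ?B" unfolding eq .
  show "coboundary i I {\<zero>} u"
  proof (cases i)
    case 0
    have "?f = ?z" using fB unfolding Ext_coboundaries_def 0 by simp
    have "u t \<in> {\<zero>}" if t: "t < b 0" for t
    proof -
      have "?f (basis_vec (b 0) t) = \<zero>" unfolding \<open>?f = ?z\<close> z using basis_vec_carr[of "b 0" t] 0 by simp
      then show ?thesis using lin_basis[OF uc, of t] basis_vec_carr[of "b 0" t] t 0 by simp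
    qed
    then show ?thesis unfolding coboundary_def 0 by simp
  next
    case (Suc j)
    obtain g where g: "g \<in> carrier (hom_module R (FF j) ?C)" and fg: "?f = dual_diff R b \<phi> j g"
      using fB unfolding Ext_coboundaries_def Suc by auto
    have gh: "\<And>x. x \<in> carrier (FF j) ==> g x \<in> I"
      "\<And>x y. x \<in> carrier (FF j) ==> y \<in> carrier (FF j) ==> g (x \<oplus>\<^bsub>FF j\<^esub> y) = g x \<oplus> g y"
      "\<And>r x. r \<in> carrier R ==> x \<in> carrier (FF j) ==> g (r \<odot>\<^bsub>FF j\<^esub> x) = r \<otimes> g x"
      using g unfolding hom_module_def mod_hom_def by (auto simp: Cs)
    let ?gb = "\<lambda>t. g (basis_vec (b j) t)"
    have gbI: "\<And>t. ?gb t \<in> I" using gh(1) basis_vec_carr by blast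
    have gbc1: "\<And>t. ?gb t \<in> carrier R" using idl_carr[OF I gbI] .
    have gbc: "\<forall>t<b j. ?gb t \<in> carrier R" using gbc1 by simp
    have gl: "g x = lin (b j) ?gb x" if x: "x \<in> carrier (FF j)" for x
    proof -
      have "g x \<ominus> lin (b j) ?gb x \<in> {\<zero>}"
      proof (rule lin_unique_mod[OF zeroideal x])
        fix y assume y: "y \<in> carrier (FF j)"
        show "g y \<ominus> lin (b j) ?gb y \<in> carrier R" using idl_carr[OF I gh(1)[OF y]] lin_closed[OF gbc y] by simp
      next
        fix y y' assume y: "y \<in> carrier (FF j)" and y': "y' \<in> carrier (FF j)"
        show "g (y \<oplus>\<^bsub>FF j\<^esub> y') \<ominus> lin (b j) ?gb (y \<oplus>\<^bsub>FF j\<^esub> y') = (g y \<ominus> lin (b j) ?gb y) \<oplus> (g y' \<ominus> lin (b j) ?gb y')"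
          unfolding gh(2)[OF y y'] lin_add[OF gbc y y']
          using idl_carr[OF I gh(1)[OF y]] idl_carr[OF I gh(1)[OF y']] lin_closed[OF gbc y] lin_closed[OF gbc y']
          by (simp add: a_minus_def minus_add a_ac)
      next
        fix r y assume r: "r \<in> carrier R" and y: "y \<in> carrier (FF j)"
        show "g (r \<odot>\<^bsub>FF j\<^esub> y) \<ominus> lin (b j) ?gb (r \<odot>\<^bsub>FF j\<^esub> y) = r \<otimes> (g y \<ominus> lin (b j) ?gb y)"
          unfolding gh(3)[OF r y] lin_smult[OF gbc y r]
          using r idl_carr[OF I gh(1)[OF y]] lin_closed[OF gbc y] by (simp add: a_minus_def r_distr r_minus)
      next
        fix t assume t: "t < b j"
        show "g (basis_vec (b j) t) \<ominus> lin (b j) ?gb (basis_vec (b j) t) \<in> {\<zero>}"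
          unfolding lin_basis[OF gbc t] using gbc1[of t] by (simp add: a_minus_def r_neg)
      qed
      then show ?thesis using idl_carr[OF I gh(1)[OF x]] lin_closed[OF gbc x] r_right_minus_eq by simp
    qed
    have "u t \<ominus> lin (b j) ?gb (\<phi> j (basis_vec (b (Suc j)) t)) \<in> {\<zero>}" if t: "t < b (Suc j)" for t
    proof -
      have "?f (basis_vec (b (Suc j)) t) = dual_diff R b \<phi> j g (basis_vec (b (Suc j)) t)" unfolding fg ..
      then have "u t = g (\<phi> j (basis_vec (b (Suc j)) t))"
        using lin_basis[OF uc, of t] t basis_vec_carr[of "b (Suc j)" t] unfolding dual_diff_def Suc by simp
      moreover have "u t \<in> carrier R" using uc t Suc by simp
      ultimately show ?thesis using gl[OF phi_closed[OF basis_vec_carr], of t] by (simp add: a_minus_def r_neg)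
    qed
    then show ?thesis unfolding coboundary_def Suc using gbI by (auto intro!: exI[of _ ?gb])
  qed
qed

end

section \<open>Consequences for a canonical ideal and a system of parameters\<close>

context noeth_local
begin

lemma sum_zero_ideal: "ideal I R ==> I <+> {\<zero>} = I"
proof
  assume I: "ideal I R"
  show "I <+> {\<zero>} \<subseteq> I" by (rule sum_le[OF I]) (use idl_zero[OF I] in auto)
  show "I \<subseteq> I <+> {\<zero>}" by (rule sum_ge1[OF I zeroideal])
qed

lemma regular_seq_reg_on:
  "set pre \<subseteq> carrier R ==> set ys \<subseteq> carrier R ==>
   (\<And>i y. i < length ys ==> y \<in> carrier R ==> ys ! i \<otimes> y \<in> Idl (set (pre @ take i ys)) ==> y \<in> Idl (set (pre @ take i ys)))
   ==> reg_on (carrier R) (Idl (set pre)) ys"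
proof (induct ys arbitrary: pre)
  case (Cons y ys)
  have y: "y \<in> carrier R" using Cons by simp
  have e: "(PIdl y) \<cdot> carrier R <+> Idl (set pre) = Idl (set (pre @ [y]))"
    using Idl_Cons[OF y Cons.prems(1)] ideal_prod_one[OF cgenideal_ideal[OF y]] by simp
  have "reg_on (carrier R) (Idl (set (pre @ [y]))) ys"
  proof (rule Cons.hyps)
    show "set (pre @ [y]) \<subseteq> carrier R" "set ys \<subseteq> carrier R" using Cons by auto
    fix i w assume "i < length ys" "w \<in> carrier R" "ys ! i \<otimes> w \<in> Idl (set ((pre @ [y]) @ take i ys))"
    then show "w \<in> Idl (set ((pre @ [y]) @ take i ys))" using Cons.prems(3)[of "Suc i" w] by simp
  qed
  moreover have "\<forall>w\<in>carrier R. y \<otimes> w \<in> Idl (set pre) --> w \<in> Idl (set pre)" using Cons.prems(3)[of 0] by simp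
  ultimately show ?case using e by simp
qed simp

lemma rseq_of_rreg_on: "set xs \<subseteq> carrier R ==> rreg_on (carrier R) {\<zero>} xs ==> rseq xs"
proof (induct xs)
  case (Cons x xs)
  have I: "ideal (Idl (set xs)) R" using Cons by (intro genideal_ideal) auto
  have "(Idl (set xs)) \<cdot> carrier R <+> {\<zero>} = Idl (set xs)" using ideal_prod_one[OF I] sum_zero_ideal[OF I] by simp
  then show ?case using Cons by simp
qed simp

text \<open>Depth equal to dimension provides some regular sequence as long as the system of parameters, and then
  \<open>rreg_of_parameters\<close> applies.\<close>

lemma system_of_params_rseq:
  assumes CM: "CM_local_ring R \<mm>" and sop: "system_of_params R \<mm> xs" and pos: "xs \<noteq> []"
  shows "rseq xs"
proof -
  have xsm: "set xs \<subseteq> \<mm>" and rad: "ring_radical R (Idl (set xs)) = \<mm>" and dim: "enat (length xs) = krull_dim R"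
    using sop unfolding system_of_params_def by auto
  have xsc: "set xs \<subseteq> carrier R" using xsm idl_sub[OF mid] by blast
  have "\<exists>ys. regular_seq R \<mm> ys \<and> length xs \<le> length ys"
  proof (rule ccontr)
    assume "\<not> ?thesis"
    then have "\<And>ys. regular_seq R \<mm> ys ==> length ys \<le> length xs - 1" by fastforce
    then have "ring_depth R \<mm> \<le> enat (length xs - 1)" unfolding ring_depth_def by (intro SUP_least) auto
    moreover have "ring_depth R \<mm> = enat (length xs)" using CM dim unfolding CM_local_ring_def by simp
    ultimately show False using pos by (cases xs) auto
  qed
  then obtain ys where ys: "regular_seq R \<mm> ys" "length xs \<le> length ys" by blast
  have ysm: "set ys \<subseteq> \<mm>" using ys unfolding regular_seq_def by simp
  have "reg_on (carrier R) (Idl (set [])) ys"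
  proof (rule regular_seq_reg_on)
    show "set ys \<subseteq> carrier R" using ysm idl_sub[OF mid] by blast
    show "y \<in> Idl (set ([] @ take i ys))" if "i < length ys" "y \<in> carrier R" "ys ! i \<otimes> y \<in> Idl (set ([] @ take i ys))" for i y
      using ys(1) that unfolding regular_seq_def by simp
  qed simp
  then have "reg_on (carrier R) {\<zero>} ys" by (simp add: Idl_empty)
  then have "rreg_on (carrier R) {\<zero>} xs"
    using rreg_of_parameters[OF oneideal zeroideal _ _ ysm ys(2) xsm] rad by simp
  then show ?thesis by (rule rseq_of_rreg_on[OF xsc])
qed

text \<open>The vanishing of \<open>Ext^i(A/\<mm>, I)\<close> below the dimension makes the parameters regular on
  \<open>I\<close> with \<open>x\<close> as the last one, so \<open>x\<close> is a nonzerodivisor on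
  \<open>I/qI\<close>, where \<open>q\<close> is generated by \<open>xs\<close>. If
  \<open>w \<in> q \<inter> I\<close>, then \<open>xw \<in> qI\<close> because \<open>x \<in> I\<close>, and hence
  \<open>w \<in> qI\<close>.\<close>

lemma canonical_ideal_tail:
  assumes can: "canonical_ideal R \<mm> I" and sop: "system_of_params R \<mm> (x # xs)" and xI: "x \<in> I"
  shows "Idl (set xs) \<inter> I \<subseteq> (Idl (set xs)) \<cdot> I"
proof -
  have I: "ideal I R" using can unfolding canonical_ideal_def by simp
  have xsm: "set (x # xs) \<subseteq> \<mm>" and rad: "ring_radical R (Idl (set (x # xs))) = \<mm>" and dim: "enat (length (x # xs)) = krull_dim R"
    using sop unfolding system_of_params_def by auto
  have xsc: "set (x # xs) \<subseteq> carrier R" using xsm idl_sub[OF mid] by blast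
  have q: "ideal (Idl (set xs)) R" using xsc by (intro genideal_ideal) auto
  obtain b \<phi> \<epsilon> where res: "free_resolution R b \<phi> \<epsilon> (quot_module (self_module R (carrier R)) \<mm>)"
    and ext: "\<And>i. enat i \<noteq> krull_dim R ==>
      carrier (Ext_module R b \<phi> (self_module R I) i) = {\<zero>\<^bsub>Ext_module R b \<phi> (self_module R I) i\<^esub>}"
    using can unfolding canonical_ideal_def canonical_module_def Let_def by metis
  interpret residue_resolution R \<mm> b \<phi> \<epsilon> by unfold_locales (rule res)
  have "ext_vanish i I {\<zero>}" if "i < length (x # xs)" for i
    by (rule ext_vanish_of_Ext_zero[OF I ext]) (use that dim[symmetric] in simp)
  then obtain ys where ys: "length ys = length (x # xs)" "set ys \<subseteq> \<mm>" "reg_on I {\<zero>} ys"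
    using regular_of_ext_vanish[OF I zeroideal, of "length (x # xs)"] idl_zero[OF I] by blast
  have "rreg_on I {\<zero>} (x # xs)"
    using rreg_of_parameters[OF I zeroideal _ ys(3,2) _ xsm] ys(1) rad idl_zero[OF I] by simp
  then have nzd: "\<And>w. w \<in> I ==> x \<otimes> w \<in> (Idl (set xs)) \<cdot> I ==> w \<in> (Idl (set xs)) \<cdot> I"
    using sum_zero_ideal[OF prod_ideal[OF q I]] by simp
  show ?thesis
  proof
    fix w assume w: "w \<in> Idl (set xs) \<inter> I"
    have "w \<otimes> x \<in> (Idl (set xs)) \<cdot> I" using w xI by (intro prod_mem) auto
    moreover have "w \<otimes> x = x \<otimes> w" using w idl_carr[OF I] xI by (intro m_comm) auto
    ultimately show "w \<in> (Idl (set xs)) \<cdot> I" using nzd w by simp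
  qed
qed

text \<open>As \<open>x \<in> I\<close>, one has \<open>J = I + q\<close> and thus
  \<open>J\<^sup>2 \<subseteq> I + qJ\<close>. Subtracting a part in \<open>qJ\<close> from an element of
  \<open>q \<inter> J\<^sup>2\<close> leaves an element of \<open>q \<inter> I\<close>.\<close>

lemma square_tail:
  assumes I: "ideal I R" and xsc: "set (x # xs) \<subseteq> carrier R" and xI: "x \<in> I"
    and tail: "Idl (set xs) \<inter> I \<subseteq> (Idl (set xs)) \<cdot> I" and J: "J = I <+> Idl (set (x # xs))"
  shows "Idl (set xs) \<inter> ideal_pow R J 2 \<subseteq> (Idl (set xs)) \<cdot> J"
proof -
  let ?q = "Idl (set xs)"
  have q: "ideal ?q R" using xsc by (intro genideal_ideal) auto
  have Q: "ideal (Idl (set (x # xs))) R" by (rule genideal_ideal[OF xsc])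
  have Jid: "ideal J R" unfolding J by (rule add_ideals[OF I Q])
  have qQ: "?q \<subseteq> Idl (set (x # xs))" by (rule Idl_tl_le[OF xsc])
  have qJ: "?q \<subseteq> J" and IJ: "I \<subseteq> J" unfolding J using qQ sum_ge2[OF I Q] sum_ge1[OF I Q] by blast+
  have xc: "x \<in> carrier R" using xsc by simp
  have "Idl (set (x # xs)) = PIdl x <+> ?q" using Idl_Cons[OF xc, of "set xs"] xsc by simp
  moreover have "PIdl x \<subseteq> I" by (rule cgenideal_minimal[OF I xI])
  ultimately have "Idl (set (x # xs)) \<subseteq> I <+> ?q" using sum_mono[of "PIdl x" I ?q ?q] by simp
  then have JIq: "J \<subseteq> I <+> ?q" unfolding J by (rule sum_le[OF add_ideals[OF I q] sum_ge1[OF I q]])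
  let ?T = "I <+> ?q \<cdot> J"
  have qJid: "ideal (?q \<cdot> J) R" by (rule prod_ideal[OF q Jid])
  have T: "ideal (I <+> (?q \<cdot> J)) R" by (rule add_ideals[OF I qJid])
  have "ideal_pow R J 2 = J \<cdot> J" using ideal_prod_one[OF Jid] by (simp add: numeral_2_eq_2 ideal_pow.simps(2))
  moreover have "J \<cdot> J \<subseteq> I <+> (?q \<cdot> J)"
  proof (rule prod_le[OF T])
    fix i j assume "i \<in> J" and j: "j \<in> J"
    then obtain i' k where i': "i' \<in> I" and k: "k \<in> ?q" and i: "i = i' \<oplus> k" using JIq unfolding sum_mem[symmetric] by (metis subsetD sum_mem)
    have c: "i' \<in> carrier R" "k \<in> carrier R" "j \<in> carrier R" using i' k j idl_carr I q Jid by metis+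
    have "i \<otimes> j = i' \<otimes> j \<oplus> k \<otimes> j" unfolding i using c by (simp add: l_distr)
    then show "i \<otimes> j \<in> I <+> (?q \<cdot> J)" unfolding sum_mem using idl_r[OF I i' c(3)] prod_mem[OF k j] by blast
  qed
  ultimately have sq: "ideal_pow R J 2 \<subseteq> I <+> (?q \<cdot> J)" by simp
  show ?thesis
  proof
    fix w assume w: "w \<in> ?q \<inter> ideal_pow R J 2"
    then obtain i v where i: "i \<in> I" and v: "v \<in> ?q \<cdot> J" and e: "w = i \<oplus> v" using sq sum_mem by (metis IntD2 subsetD)
    have "v \<in> ?q" using v prod_le1[OF q Jid] by blast
    then have "i \<in> ?q" using idl_addD[OF q, of i v] w e idl_carr[OF I i] by simp
    then have "i \<in> ?q \<cdot> I" using tail i by blast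
    then have "i \<in> ?q \<cdot> J" using prod_mono[OF subset_refl IJ, of ?q] by blast
    then show "w \<in> ?q \<cdot> J" unfolding e using v by (rule idl_add[OF qJid])
  qed
qed

end

section \<open>Length of a localized module\<close>

text \<open>Submodules of the localization at \<open>U\<close> correspond to submodules closed under division by \<open>U\<close>.\<close>

definition saturated :: "('a, 'b) ring_scheme => 'a set => ('a, 'm, 'x) module_scheme => 'm set => bool" where
  "saturated R U M N \<longleftrightarrow> N \<subseteq> carrier M \<and> \<zero>\<^bsub>M\<^esub> \<in> N \<and> (\<forall>x\<in>N. \<forall>y\<in>N. x \<oplus>\<^bsub>M\<^esub> y \<in> N) \<and>
     (\<forall>r\<in>carrier R. \<forall>x\<in>N. r \<odot>\<^bsub>M\<^esub> x \<in> N) \<and> (\<forall>u\<in>U. \<forall>x\<in>carrier M. u \<odot>\<^bsub>M\<^esub> x \<in> N --> x \<in> N)"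

text \<open>In a step from \<open>N\<close> to \<open>N'\<close> of rank one any two elements are proportional modulo \<open>N\<close>, so that no
  saturated submodule lies strictly between.\<close>

definition rank_one_step :: "('a, 'b) ring_scheme => 'a set => ('a, 'm, 'x) module_scheme => 'm set => 'm set => bool" where
  "rank_one_step R U M N N' \<longleftrightarrow> N \<subset> N' \<and>
     (\<forall>c\<in>N' - N. \<forall>z\<in>N'. \<exists>u\<in>U. \<exists>t\<in>carrier R. u \<odot>\<^bsub>M\<^esub> z \<oplus>\<^bsub>M\<^esub> t \<odot>\<^bsub>M\<^esub> c \<in> N)"

text \<open>A composition series of the localization, described inside \<open>M\<close>. It certifies the length of the
  localized module without reference to fractions.\<close>

definition loc_series :: "('a, 'b) ring_scheme => 'a set => ('a, 'm, 'x) module_scheme => nat => bool" where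
  "loc_series R U M n \<longleftrightarrow> (\<exists>N. N 0 = {\<zero>\<^bsub>M\<^esub>} \<and> N n = carrier M \<and> (\<forall>j\<le>n. saturated R U M (N j)) \<and>
     (\<forall>j<n. rank_one_step R U M (N j) (N (Suc j))))"

text \<open>A saturated submodule \<open>D\<close> is mapped to the set of steps of the series in which it acquires new
  elements. Since the steps have rank one, a larger saturated submodule with the same set would be equal, so a
  strict chain yields a strict chain of subsets of \<open>{0, \<dots>, n - 1}\<close>.\<close>

lemma saturated_chain_length:
  assumes M: "module R M" and U: "U \<subseteq> carrier R" and N: "N 0 = {\<zero>\<^bsub>M\<^esub>}" "N n = carrier M"
    and step: "\<And>j. j < n ==> rank_one_step R U M (N j) (N (Suc j))"
    and C: "\<And>i. i \<le> r ==> saturated R U M (C i)" "\<And>i. i < r ==> C i \<subset> C (Suc i)"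
  shows "r \<le> n"
proof -
  interpret module R M by (rule M)
  define \<delta> where "\<delta> D = {j. j < n \<and> \<not> D \<inter> N (Suc j) \<subseteq> N j}" for D
  have fin: "finite (\<delta> D)" for D unfolding \<delta>_def by simp
  have strict: "\<delta> D \<subset> \<delta> D'" if D: "saturated R U M D" "saturated R U M D'" "D \<subset> D'" for D D'
  proof -
    have sub: "\<delta> D \<subseteq> \<delta> D'" unfolding \<delta>_def using D(3) by blast
    have "\<delta> D \<noteq> \<delta> D'"
    proof
      assume eq: "\<delta> D = \<delta> D'"
      have "j \<le> n ==> D' \<inter> N j \<subseteq> D" for j
      proof (induct j)
        case 0 then show ?case using N(1) D(1) unfolding saturated_def by auto
      next
        case (Suc j)
        show ?case
        proof
          fix z assume z: "z \<in> D' \<inter> N (Suc j)"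
          show "z \<in> D"
          proof (cases "z \<in> N j")
            case True then show ?thesis using Suc z by auto
          next
            case False
            then have "j \<in> \<delta> D'" unfolding \<delta>_def using z Suc by auto
            then have "j \<in> \<delta> D" unfolding eq .
            then obtain c where c: "c \<in> D" "c \<in> N (Suc j)" "c \<notin> N j" unfolding \<delta>_def by auto
            obtain u t where u: "u \<in> U" and t: "t \<in> carrier R" and ut: "u \<odot>\<^bsub>M\<^esub> z \<oplus>\<^bsub>M\<^esub> t \<odot>\<^bsub>M\<^esub> c \<in> N j"
              using step[of j] Suc.prems c z unfolding rank_one_step_def by (metis DiffI IntD2 Suc_le_lessD)
            have zc: "z \<in> carrier M" "c \<in> carrier M" using z c D unfolding saturated_def by auto
            have uc: "u \<in> carrier R" using u U by auto
            have cl: "u \<odot>\<^bsub>M\<^esub> z \<in> carrier M" "t \<odot>\<^bsub>M\<^esub> c \<in> carrier M" using uc t zc by auto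
            have "u \<odot>\<^bsub>M\<^esub> z \<in> D'" "t \<odot>\<^bsub>M\<^esub> c \<in> D'" using D z c uc t unfolding saturated_def by auto
            then have "u \<odot>\<^bsub>M\<^esub> z \<oplus>\<^bsub>M\<^esub> t \<odot>\<^bsub>M\<^esub> c \<in> D'" using D(2) unfolding saturated_def by simp
            then have 1: "u \<odot>\<^bsub>M\<^esub> z \<oplus>\<^bsub>M\<^esub> t \<odot>\<^bsub>M\<^esub> c \<in> D" using Suc ut by auto
            have "(\<ominus>\<^bsub>R\<^esub> t) \<odot>\<^bsub>M\<^esub> c \<in> D" using D(1) c(1) t unfolding saturated_def by simp
            then have "(u \<odot>\<^bsub>M\<^esub> z \<oplus>\<^bsub>M\<^esub> t \<odot>\<^bsub>M\<^esub> c) \<oplus>\<^bsub>M\<^esub> (\<ominus>\<^bsub>R\<^esub> t) \<odot>\<^bsub>M\<^esub> c \<in> D" using 1 D(1) unfolding saturated_def by simp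
            moreover have "(u \<odot>\<^bsub>M\<^esub> z \<oplus>\<^bsub>M\<^esub> t \<odot>\<^bsub>M\<^esub> c) \<oplus>\<^bsub>M\<^esub> (\<ominus>\<^bsub>R\<^esub> t) \<odot>\<^bsub>M\<^esub> c = u \<odot>\<^bsub>M\<^esub> z"
              using cl t zc by (simp add: smult_l_minus M.a_assoc M.r_neg)
            ultimately show ?thesis using D(1) u zc unfolding saturated_def by simp
          qed
        qed
      qed
      from this[of n] have "D' \<subseteq> D" using N(2) D(2) unfolding saturated_def by auto
      then show False using D(3) by auto
    qed
    then show ?thesis using sub by auto
  qed
  have "i \<le> r ==> i \<le> card (\<delta> (C i))" for i
  proof (induct i)
    case (Suc i)
    have "card (\<delta> (C i)) < card (\<delta> (C (Suc i)))"
      by (rule psubset_card_mono[OF fin strict]) (use C Suc in auto)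
    then show ?case using Suc by simp
  qed simp
  then have "r \<le> card (\<delta> (C r))" by simp
  also have "\<dots> \<le> card {..<n}" by (rule card_mono) (auto simp: \<delta>_def)
  finally show ?thesis by simp
qed

locale localization = module R M for R and M (structure) +
  fixes U
  assumes U_sub: "U \<subseteq> carrier R" and U_one: "\<one>\<^bsub>R\<^esub> \<in> U" and U_mult: "\<And>u v. u \<in> U ==> v \<in> U ==> u \<otimes>\<^bsub>R\<^esub> v \<in> U"
begin

abbreviation (input) "lfrac \<equiv> loc_frac M U"

lemma Uc: "u \<in> U ==> u \<in> carrier R" using U_sub by auto

lemma frac_mem: "(y, v) \<in> lfrac x u \<longleftrightarrow> y \<in> carrier M \<and> v \<in> U \<and>
    (\<exists>w\<in>U. (w \<otimes>\<^bsub>R\<^esub> v) \<odot> x = (w \<otimes>\<^bsub>R\<^esub> u) \<odot> y)" if "x \<in> carrier M" "u \<in> U"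
proof -
  have "w \<odot> (v \<odot> x) = (w \<otimes>\<^bsub>R\<^esub> v) \<odot> x" "w \<odot> (u \<odot> y) = (w \<otimes>\<^bsub>R\<^esub> u) \<odot> y"
    if "w \<in> U" "v \<in> U" "y \<in> carrier M" for w v y
    using that \<open>x \<in> carrier M\<close> \<open>u \<in> U\<close> by (simp_all add: smult_assoc1 Uc)
  then show ?thesis unfolding loc_frac_def by auto
qed

lemma smult_swap:
  assumes "a \<otimes>\<^bsub>R\<^esub> b = c" "(b \<odot> x) = (d \<odot> y)" "a \<in> carrier R" "b \<in> carrier R" "d \<in> carrier R"
    "x \<in> carrier M" "y \<in> carrier M"
  shows "c \<odot> x = (a \<otimes>\<^bsub>R\<^esub> d) \<odot> y"
  using assms by (metis smult_assoc1)

lemma frac_subset: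
  assumes x: "x \<in> carrier M" "u \<in> U" and y: "y \<in> carrier M" "v \<in> U" and w: "w \<in> U"
    and eq: "(w \<otimes>\<^bsub>R\<^esub> v) \<odot> x = (w \<otimes>\<^bsub>R\<^esub> u) \<odot> y"
  shows "lfrac x u \<subseteq> lfrac y v"
proof (rule subrelI)
  fix z t assume "(z, t) \<in> lfrac x u"
  then obtain w' where z: "z \<in> carrier M" "t \<in> U" and w': "w' \<in> U" and eq': "(w' \<otimes>\<^bsub>R\<^esub> t) \<odot> x = (w' \<otimes>\<^bsub>R\<^esub> u) \<odot> z"
    using frac_mem[OF x] by auto
  note c = Uc[OF x(2)] Uc[OF y(2)] Uc[OF w] Uc[OF w'] Uc[OF z(2)]
  let ?W = "(w \<otimes>\<^bsub>R\<^esub> w') \<otimes>\<^bsub>R\<^esub> u"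
  have "(?W \<otimes>\<^bsub>R\<^esub> t) \<odot> y = ((w' \<otimes>\<^bsub>R\<^esub> t) \<otimes>\<^bsub>R\<^esub> (w \<otimes>\<^bsub>R\<^esub> v)) \<odot> x"
    by (rule smult_swap[of _ "w \<otimes>\<^bsub>R\<^esub> u"]) (use c x y eq in \<open>simp_all add: R.m_ac\<close>)
  also have "\<dots> = ((w \<otimes>\<^bsub>R\<^esub> v) \<otimes>\<^bsub>R\<^esub> (w' \<otimes>\<^bsub>R\<^esub> u)) \<odot> z"
    by (rule smult_swap[of _ "w' \<otimes>\<^bsub>R\<^esub> t"]) (use c x z eq' in \<open>simp_all add: R.m_ac\<close>)
  also have "(w \<otimes>\<^bsub>R\<^esub> v) \<otimes>\<^bsub>R\<^esub> (w' \<otimes>\<^bsub>R\<^esub> u) = ?W \<otimes>\<^bsub>R\<^esub> v" using c by (simp add: R.m_ac)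
  finally show "(z, t) \<in> lfrac y v"
    unfolding frac_mem[OF y] using z U_mult w w' x(2) by blast
qed

lemma frac_eqI:
  assumes "x \<in> carrier M" "u \<in> U" "y \<in> carrier M" "v \<in> U" "w \<in> U"
    "(w \<otimes>\<^bsub>R\<^esub> v) \<odot> x = (w \<otimes>\<^bsub>R\<^esub> u) \<odot> y"
  shows "lfrac x u = lfrac y v"
  using frac_subset[OF assms] frac_subset[OF assms(3,4,1,2,5) assms(6)[symmetric]] by blast

lemma frac_self: "x \<in> carrier M ==> u \<in> U ==> (x, u) \<in> lfrac x u"
  using frac_mem[of x u x u] U_one by auto

lemma frac_eqD:
  assumes "x \<in> carrier M" "u \<in> U" "y \<in> carrier M" "v \<in> U" "lfrac x u = lfrac y v"
  shows "\<exists>w\<in>U. (w \<otimes>\<^bsub>R\<^esub> v) \<odot> x = (w \<otimes>\<^bsub>R\<^esub> u) \<odot> y"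
  using frac_self[OF assms(3,4)] frac_mem[OF assms(1,2), of y v] assms(5) by blast

lemma frac_cancel:
  assumes "x \<in> carrier M" "u \<in> U" "a \<in> U"
  shows "lfrac (a \<odot> x) (a \<otimes>\<^bsub>R\<^esub> u) = lfrac x u"
proof (rule frac_eqI[of _ _ _ _ "\<one>\<^bsub>R\<^esub>"])
  show "(\<one>\<^bsub>R\<^esub> \<otimes>\<^bsub>R\<^esub> u) \<odot> (a \<odot> x) = (\<one>\<^bsub>R\<^esub> \<otimes>\<^bsub>R\<^esub> (a \<otimes>\<^bsub>R\<^esub> u)) \<odot> x"
    using assms Uc by (simp add: smult_assoc1[symmetric] R.m_comm)
qed (use assms U_one U_mult Uc in auto)

abbreviation (input) "LM \<equiv> loc_module R U M"
abbreviation (input) "LR \<equiv> loc_ring R U"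

lemma LM_carrier: "carrier LM = {lfrac x u | x u. x \<in> carrier M \<and> u \<in> U}"
  by (simp add: loc_module_def)

lemma LM_zero: "\<zero>\<^bsub>LM\<^esub> = lfrac \<zero> \<one>\<^bsub>R\<^esub>"
  by (simp add: loc_module_def)

lemma LM_add:
  assumes x: "x \<in> carrier M" "u \<in> U" and y: "y \<in> carrier M" "v \<in> U"
  shows "lfrac x u \<oplus>\<^bsub>LM\<^esub> lfrac y v = lfrac (v \<odot> x \<oplus> u \<odot> y) (u \<otimes>\<^bsub>R\<^esub> v)"
proof -
  let ?F = "\<lambda>x u y v. lfrac (v \<odot> x \<oplus> u \<odot> y) (u \<otimes>\<^bsub>R\<^esub> v)"
  have e: "lfrac x u \<oplus>\<^bsub>LM\<^esub> lfrac y v = (\<Union>(x', u')\<in>lfrac x u. \<Union>(y', v')\<in>lfrac y v. ?F x' u' y' v')"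
    by (simp add: loc_module_def)
  have "?F x' u' y' v' = ?F x u y v" if a: "(x', u') \<in> lfrac x u" and b: "(y', v') \<in> lfrac y v" for x' u' y' v'
  proof -
    obtain w where x': "x' \<in> carrier M" "u' \<in> U" and w: "w \<in> U" and eq: "(w \<otimes>\<^bsub>R\<^esub> u') \<odot> x = (w \<otimes>\<^bsub>R\<^esub> u) \<odot> x'"
      using a frac_mem[OF x] by auto
    obtain w' where y': "y' \<in> carrier M" "v' \<in> U" and w': "w' \<in> U" and eq': "(w' \<otimes>\<^bsub>R\<^esub> v') \<odot> y = (w' \<otimes>\<^bsub>R\<^esub> v) \<odot> y'"
      using b frac_mem[OF y] by auto
    note c = Uc[OF x(2)] Uc[OF y(2)] Uc[OF w] Uc[OF w'] Uc[OF x'(2)] Uc[OF y'(2)]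
    let ?W = "w \<otimes>\<^bsub>R\<^esub> w'"
    have 1: "(?W \<otimes>\<^bsub>R\<^esub> (u \<otimes>\<^bsub>R\<^esub> v) \<otimes>\<^bsub>R\<^esub> v') \<odot> x' = ((w' \<otimes>\<^bsub>R\<^esub> (v \<otimes>\<^bsub>R\<^esub> v')) \<otimes>\<^bsub>R\<^esub> (w \<otimes>\<^bsub>R\<^esub> u')) \<odot> x"
      by (rule smult_swap[of _ "w \<otimes>\<^bsub>R\<^esub> u"]) (use c x x' eq in \<open>simp_all add: R.m_ac\<close>)
    have 2: "(?W \<otimes>\<^bsub>R\<^esub> (u \<otimes>\<^bsub>R\<^esub> v) \<otimes>\<^bsub>R\<^esub> u') \<odot> y' = ((w \<otimes>\<^bsub>R\<^esub> (u \<otimes>\<^bsub>R\<^esub> u')) \<otimes>\<^bsub>R\<^esub> (w' \<otimes>\<^bsub>R\<^esub> v')) \<odot> y"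
      by (rule smult_swap[of _ "w' \<otimes>\<^bsub>R\<^esub> v"]) (use c y y' eq' in \<open>simp_all add: R.m_ac\<close>)
    show ?thesis
    proof (rule frac_eqI[of _ _ _ _ ?W])
      have "(?W \<otimes>\<^bsub>R\<^esub> (u \<otimes>\<^bsub>R\<^esub> v)) \<odot> (v' \<odot> x' \<oplus> u' \<odot> y') =
         (?W \<otimes>\<^bsub>R\<^esub> (u \<otimes>\<^bsub>R\<^esub> v) \<otimes>\<^bsub>R\<^esub> v') \<odot> x' \<oplus> (?W \<otimes>\<^bsub>R\<^esub> (u \<otimes>\<^bsub>R\<^esub> v) \<otimes>\<^bsub>R\<^esub> u') \<odot> y'"
        using c x' y' by (simp add: smult_r_distr smult_assoc1)
      also have "\<dots> = (?W \<otimes>\<^bsub>R\<^esub> (u' \<otimes>\<^bsub>R\<^esub> v') \<otimes>\<^bsub>R\<^esub> v) \<odot> x \<oplus> (?W \<otimes>\<^bsub>R\<^esub> (u' \<otimes>\<^bsub>R\<^esub> v') \<otimes>\<^bsub>R\<^esub> u) \<odot> y"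
        unfolding 1 2 using c by (simp add: R.m_ac)
      also have "\<dots> = (?W \<otimes>\<^bsub>R\<^esub> (u' \<otimes>\<^bsub>R\<^esub> v')) \<odot> (v \<odot> x \<oplus> u \<odot> y)"
        using c x y by (simp add: smult_r_distr smult_assoc1)
      finally show "(?W \<otimes>\<^bsub>R\<^esub> (u \<otimes>\<^bsub>R\<^esub> v)) \<odot> (v' \<odot> x' \<oplus> u' \<odot> y') =
        (?W \<otimes>\<^bsub>R\<^esub> (u' \<otimes>\<^bsub>R\<^esub> v')) \<odot> (v \<odot> x \<oplus> u \<odot> y)" .
    qed (use c x y x' y' w w' U_mult in auto)
  qed
  then show ?thesis unfolding e using frac_self[OF x] frac_self[OF y] by fast
qed

lemma LR_frac_mem: "(r', s') \<in> loc_frac (self_module R (carrier R)) U r s \<longleftrightarrow>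
   r' \<in> carrier R \<and> s' \<in> U \<and> (\<exists>w\<in>U. w \<otimes>\<^bsub>R\<^esub> (s' \<otimes>\<^bsub>R\<^esub> r) = w \<otimes>\<^bsub>R\<^esub> (s \<otimes>\<^bsub>R\<^esub> r'))"
  unfolding loc_frac_def self_module_def by simp

lemma LM_smult:
  assumes r: "r \<in> carrier R" "s \<in> U" and x: "x \<in> carrier M" "u \<in> U"
  shows "loc_frac (self_module R (carrier R)) U r s \<odot>\<^bsub>LM\<^esub> lfrac x u = lfrac (r \<odot> x) (s \<otimes>\<^bsub>R\<^esub> u)"
proof -
  let ?G = "loc_frac (self_module R (carrier R)) U r s"
  let ?F = "\<lambda>r s x u. lfrac (r \<odot> x) (s \<otimes>\<^bsub>R\<^esub> u)"
  have e: "?G \<odot>\<^bsub>LM\<^esub> lfrac x u = (\<Union>(r', s')\<in>?G. \<Union>(x', u')\<in>lfrac x u. ?F r' s' x' u')"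
    by (simp add: loc_module_def)
  have "?F r' s' x' u' = ?F r s x u" if a: "(r', s') \<in> ?G" and b: "(x', u') \<in> lfrac x u" for r' s' x' u'
  proof -
    obtain w where r': "r' \<in> carrier R" "s' \<in> U" and w: "w \<in> U" and eq: "w \<otimes>\<^bsub>R\<^esub> (s' \<otimes>\<^bsub>R\<^esub> r) = w \<otimes>\<^bsub>R\<^esub> (s \<otimes>\<^bsub>R\<^esub> r')"
      using a LR_frac_mem by auto
    obtain w' where x': "x' \<in> carrier M" "u' \<in> U" and w': "w' \<in> U" and eq': "(w' \<otimes>\<^bsub>R\<^esub> u') \<odot> x = (w' \<otimes>\<^bsub>R\<^esub> u) \<odot> x'"
      using b frac_mem[OF x] by auto
    note c = r(1) r'(1) Uc[OF r(2)] Uc[OF x(2)] Uc[OF w] Uc[OF w'] Uc[OF x'(2)] Uc[OF r'(2)]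
    let ?W = "w \<otimes>\<^bsub>R\<^esub> w'"
    show ?thesis
    proof (rule frac_eqI[of _ _ _ _ ?W])
      have "(?W \<otimes>\<^bsub>R\<^esub> (s \<otimes>\<^bsub>R\<^esub> u)) \<odot> (r' \<odot> x') = (?W \<otimes>\<^bsub>R\<^esub> (s \<otimes>\<^bsub>R\<^esub> u) \<otimes>\<^bsub>R\<^esub> r') \<odot> x'"
        using c x' by (simp add: smult_assoc1)
      also have "\<dots> = ((w \<otimes>\<^bsub>R\<^esub> (s \<otimes>\<^bsub>R\<^esub> r')) \<otimes>\<^bsub>R\<^esub> (w' \<otimes>\<^bsub>R\<^esub> u')) \<odot> x"
        by (rule smult_swap[of _ "w' \<otimes>\<^bsub>R\<^esub> u"]) (use c x x' eq' in \<open>simp_all add: R.m_ac\<close>)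
      also have "(w \<otimes>\<^bsub>R\<^esub> (s \<otimes>\<^bsub>R\<^esub> r')) \<otimes>\<^bsub>R\<^esub> (w' \<otimes>\<^bsub>R\<^esub> u') = ?W \<otimes>\<^bsub>R\<^esub> (s' \<otimes>\<^bsub>R\<^esub> u') \<otimes>\<^bsub>R\<^esub> r"
        unfolding eq[symmetric] using c by (simp add: R.m_ac)
      also have "(?W \<otimes>\<^bsub>R\<^esub> (s' \<otimes>\<^bsub>R\<^esub> u') \<otimes>\<^bsub>R\<^esub> r) \<odot> x = (?W \<otimes>\<^bsub>R\<^esub> (s' \<otimes>\<^bsub>R\<^esub> u')) \<odot> (r \<odot> x)"
        using c x by (simp add: smult_assoc1)
      finally show "(?W \<otimes>\<^bsub>R\<^esub> (s \<otimes>\<^bsub>R\<^esub> u)) \<odot> (r' \<odot> x') = (?W \<otimes>\<^bsub>R\<^esub> (s' \<otimes>\<^bsub>R\<^esub> u')) \<odot> (r \<odot> x)" .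
    qed (use c x r x' r' w w' U_mult in auto)
  qed
  moreover have "(r, s) \<in> ?G" using LR_frac_mem r U_one by auto
  ultimately show ?thesis unfolding e using frac_self[OF x] by fast
qed

lemma LR_carrier: "carrier LR = {loc_frac (self_module R (carrier R)) U r s | r s. r \<in> carrier R \<and> s \<in> U}"
  by (simp add: loc_ring_def Let_def)

lemma LM_group: "group (add_monoid LM)"
proof (rule groupI, simp_all only: monoid.simps partial_object.simps)
  show cl: "X \<oplus>\<^bsub>LM\<^esub> Y \<in> carrier LM" if X: "X \<in> carrier LM" and Y: "Y \<in> carrier LM" for X Y
  proof -
    obtain x u y v where x: "x \<in> carrier M" "u \<in> U" and y: "y \<in> carrier M" "v \<in> U" and e: "X = lfrac x u" "Y = lfrac y v"
      using X Y unfolding LM_carrier by blast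
    have "v \<odot> x \<oplus> u \<odot> y \<in> carrier M" "u \<otimes>\<^bsub>R\<^esub> v \<in> U" using x y Uc U_mult by auto
    then show ?thesis unfolding e LM_add[OF x y] unfolding LM_carrier by blast
  qed
  show z: "\<zero>\<^bsub>LM\<^esub> \<in> carrier LM" unfolding LM_zero LM_carrier using U_one by blast
  show "X \<oplus>\<^bsub>LM\<^esub> Y \<oplus>\<^bsub>LM\<^esub> Z = X \<oplus>\<^bsub>LM\<^esub> (Y \<oplus>\<^bsub>LM\<^esub> Z)"
    if X: "X \<in> carrier LM" and Y: "Y \<in> carrier LM" and Z: "Z \<in> carrier LM" for X Y Z
  proof -
    obtain x u y v z w where x: "x \<in> carrier M" "u \<in> U" and y: "y \<in> carrier M" "v \<in> U" and z: "z \<in> carrier M" "w \<in> U"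
      and e: "X = lfrac x u" "Y = lfrac y v" "Z = lfrac z w"
      using X Y Z unfolding LM_carrier by blast
    note c = Uc[OF x(2)] Uc[OF y(2)] Uc[OF z(2)]
    have c1: "v \<odot> x \<oplus> u \<odot> y \<in> carrier M" "u \<otimes>\<^bsub>R\<^esub> v \<in> U" using x y Uc U_mult by auto
    have c2: "w \<odot> y \<oplus> v \<odot> z \<in> carrier M" "v \<otimes>\<^bsub>R\<^esub> w \<in> U" using z y Uc U_mult by auto
    show ?thesis unfolding e LM_add[OF x y] LM_add[OF y z] LM_add[OF c1 z] LM_add[OF x c2]
      using c x y z by (simp add: smult_r_distr smult_assoc1[symmetric] R.m_ac M.a_ac)
  qed
  show "\<zero>\<^bsub>LM\<^esub> \<oplus>\<^bsub>LM\<^esub> X = X" if X: "X \<in> carrier LM" for X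
  proof -
    obtain x u where x: "x \<in> carrier M" "u \<in> U" and e: "X = lfrac x u" using X unfolding LM_carrier by blast
    show ?thesis unfolding e LM_zero LM_add[OF M.zero_closed U_one x] using x Uc by simp
  qed
  show "\<exists>Y\<in>carrier LM. Y \<oplus>\<^bsub>LM\<^esub> X = \<zero>\<^bsub>LM\<^esub>" if X: "X \<in> carrier LM" for X
  proof -
    obtain x u where x: "x \<in> carrier M" "u \<in> U" and e: "X = lfrac x u" using X unfolding LM_carrier by blast
    have nx: "\<ominus> x \<in> carrier M" using x by simp
    have "lfrac (\<ominus> x) u \<oplus>\<^bsub>LM\<^esub> X = lfrac \<zero> (u \<otimes>\<^bsub>R\<^esub> u)"
      unfolding e LM_add[OF nx x(2) x] using x Uc by (simp add: smult_r_minus M.l_neg)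
    also have "\<dots> = \<zero>\<^bsub>LM\<^esub>" unfolding LM_zero
      by (rule frac_eqI[of _ _ _ _ "\<one>\<^bsub>R\<^esub>"]) (use U_one U_mult x Uc in auto)
    finally show ?thesis using nx x unfolding LM_carrier by blast
  qed
qed

lemma extension_submodule:
  assumes N: "saturated R U M N"
  shows "submodule {lfrac x u | x u. x \<in> N \<and> u \<in> U} LR LM"
proof -
  let ?H = "{lfrac x u | x u. x \<in> N \<and> u \<in> U}"
  interpret G: group "add_monoid LM" by (rule LM_group)
  have NM: "N \<subseteq> carrier M" using N unfolding saturated_def by simp
  have Nadd: "\<And>x y. x \<in> N ==> y \<in> N ==> x \<oplus> y \<in> N" and Nsm: "\<And>r x. r \<in> carrier R ==> x \<in> N ==> r \<odot> x \<in> N"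
    using N unfolding saturated_def by auto
  have Nneg: "\<ominus> x \<in> N" if "x \<in> N" for x
    using Nsm[OF _ that, of "\<ominus>\<^bsub>R\<^esub> \<one>\<^bsub>R\<^esub>"] that NM smult_l_minus[of "\<one>\<^bsub>R\<^esub>" x] by auto
  show ?thesis
  proof (intro submodule.intro submodule_axioms.intro)
    show "subgroup ?H (add_monoid LM)"
    proof (rule G.subgroupI)
      show "?H \<subseteq> carrier (add_monoid LM)" using NM by (auto simp: LM_carrier)
      show "?H \<noteq> {}" using N U_one unfolding saturated_def by auto
    next
      fix X assume "X \<in> ?H"
      then obtain x u where x: "x \<in> N" "u \<in> U" and X: "X = lfrac x u" by blast
      have xM: "x \<in> carrier M" and nx: "\<ominus> x \<in> carrier M" using x NM by auto
      have "lfrac (\<ominus> x) u \<oplus>\<^bsub>LM\<^esub> X = lfrac \<zero> (u \<otimes>\<^bsub>R\<^esub> u)"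
        unfolding X LM_add[OF nx x(2) xM x(2)] using xM x Uc by (simp add: smult_r_minus M.l_neg)
      also have "\<dots> = \<zero>\<^bsub>LM\<^esub>" unfolding LM_zero
        by (rule frac_eqI[of _ _ _ _ "\<one>\<^bsub>R\<^esub>"]) (use U_one U_mult x Uc in auto)
      finally have "inv\<^bsub>add_monoid LM\<^esub> X = lfrac (\<ominus> x) u"
        using G.inv_equality[of "lfrac (\<ominus> x) u" X] x xM nx X by (auto simp: LM_carrier)
      then show "inv\<^bsub>add_monoid LM\<^esub> X \<in> ?H" using Nneg x by blast
    next
      fix X Y assume "X \<in> ?H" "Y \<in> ?H"
      then obtain x u y v where x: "x \<in> N" "u \<in> U" and y: "y \<in> N" "v \<in> U" and e: "X = lfrac x u" "Y = lfrac y v" by blast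
      have c: "x \<in> carrier M" "y \<in> carrier M" using x y NM by auto
      have "v \<odot> x \<oplus> u \<odot> y \<in> N" "u \<otimes>\<^bsub>R\<^esub> v \<in> U" using x y Uc U_mult Nadd Nsm by auto
      then show "X \<otimes>\<^bsub>add_monoid LM\<^esub> Y \<in> ?H" unfolding e using LM_add[OF c(1) x(2) c(2) y(2)] by auto
    qed
    fix F X assume "F \<in> carrier LR" "X \<in> ?H"
    then obtain r s x u where r: "r \<in> carrier R" "s \<in> U" and x: "x \<in> N" "u \<in> U"
      and e: "F = loc_frac (self_module R (carrier R)) U r s" "X = lfrac x u" unfolding LR_carrier by blast
    have xM: "x \<in> carrier M" using x NM by auto
    have "r \<odot> x \<in> N" "s \<otimes>\<^bsub>R\<^esub> u \<in> U" using Nsm U_mult r x by auto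
    then show "F \<odot>\<^bsub>LM\<^esub> X \<in> ?H" unfolding e LM_smult[OF r xM x(2)] by blast
  qed
qed

lemma contraction_saturated:
  assumes N: "submodule N LR LM"
  shows "saturated R U M {x \<in> carrier M. lfrac x \<one>\<^bsub>R\<^esub> \<in> N}"
proof -
  interpret N: submodule N LR LM by (rule N)
  have sm: "loc_frac (self_module R (carrier R)) U r s \<odot>\<^bsub>LM\<^esub> X \<in> N" if "r \<in> carrier R" "s \<in> U" "X \<in> N" for r s X
    using that by (intro N.smult_closed) (auto simp: LR_carrier)
  show ?thesis
    unfolding saturated_def
  proof (intro conjI ballI impI)
    show "\<zero> \<in> {x \<in> carrier M. lfrac x \<one>\<^bsub>R\<^esub> \<in> N}" using N.one_closed by (simp add: LM_zero)
  next
    fix x y assume a: "x \<in> {x \<in> carrier M. lfrac x \<one>\<^bsub>R\<^esub> \<in> N}" "y \<in> {x \<in> carrier M. lfrac x \<one>\<^bsub>R\<^esub> \<in> N}"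
    then have "lfrac x \<one>\<^bsub>R\<^esub> \<oplus>\<^bsub>LM\<^esub> lfrac y \<one>\<^bsub>R\<^esub> \<in> N" using N.m_closed by simp
    then show "x \<oplus> y \<in> {x \<in> carrier M. lfrac x \<one>\<^bsub>R\<^esub> \<in> N}" using a LM_add[OF _ U_one _ U_one, of x y] by simp
  next
    fix r x assume a: "r \<in> carrier R" "x \<in> {x \<in> carrier M. lfrac x \<one>\<^bsub>R\<^esub> \<in> N}"
    then show "r \<odot> x \<in> {x \<in> carrier M. lfrac x \<one>\<^bsub>R\<^esub> \<in> N}"
      using sm[OF a(1) U_one, of "lfrac x \<one>\<^bsub>R\<^esub>"] LM_smult[OF a(1) U_one _ U_one, of x] by simp
  next
    fix u x assume u: "u \<in> U" and x: "x \<in> carrier M" and a: "u \<odot> x \<in> {x \<in> carrier M. lfrac x \<one>\<^bsub>R\<^esub> \<in> N}"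
    have ux: "u \<odot> x \<in> carrier M" using x Uc[OF u] by simp
    have "lfrac (\<one>\<^bsub>R\<^esub> \<odot> (u \<odot> x)) (u \<otimes>\<^bsub>R\<^esub> \<one>\<^bsub>R\<^esub>) \<in> N"
      using sm[OF _ u, of "\<one>\<^bsub>R\<^esub>" "lfrac (u \<odot> x) \<one>\<^bsub>R\<^esub>"] LM_smult[OF R.one_closed u ux U_one] a by simp
    then show "x \<in> {x \<in> carrier M. lfrac x \<one>\<^bsub>R\<^esub> \<in> N}" using frac_cancel[OF x U_one u] x ux by simp
  qed auto
qed

lemma contraction_strict:
  assumes N: "submodule N LR LM" and N': "submodule N' LR LM" and sub: "N \<subset> N'"
  shows "{x \<in> carrier M. lfrac x \<one>\<^bsub>R\<^esub> \<in> N} \<subset> {x \<in> carrier M. lfrac x \<one>\<^bsub>R\<^esub> \<in> N'}"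
proof -
  interpret N: submodule N LR LM by (rule N)
  interpret N': submodule N' LR LM by (rule N')
  obtain X where X: "X \<in> N'" "X \<notin> N" using sub by blast
  have "X \<in> carrier LM" using N'.subset X by auto
  then obtain x u where x: "x \<in> carrier M" "u \<in> U" and e: "X = lfrac x u" unfolding LM_carrier by blast
  have F: "loc_frac (self_module R (carrier R)) U u \<one>\<^bsub>R\<^esub> \<in> carrier LR" "loc_frac (self_module R (carrier R)) U \<one>\<^bsub>R\<^esub> u \<in> carrier LR"
    unfolding LR_carrier using x Uc U_one by blast+
  have "lfrac (u \<odot> x) (\<one>\<^bsub>R\<^esub> \<otimes>\<^bsub>R\<^esub> u) \<in> N'"
    using N'.smult_closed[OF F(1) X(1)] LM_smult[OF Uc[OF x(2)] U_one x] e by simp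
  then have "lfrac x \<one>\<^bsub>R\<^esub> \<in> N'" using frac_cancel[OF x(1) U_one x(2)] x Uc by simp
  moreover have "lfrac x \<one>\<^bsub>R\<^esub> \<notin> N"
  proof
    assume "lfrac x \<one>\<^bsub>R\<^esub> \<in> N"
    then have "lfrac (\<one>\<^bsub>R\<^esub> \<odot> x) (u \<otimes>\<^bsub>R\<^esub> \<one>\<^bsub>R\<^esub>) \<in> N"
      unfolding LM_smult[OF R.one_closed x(2) x(1) U_one, symmetric] by (rule N.smult_closed[OF F(2)])
    then show False using X e x Uc by simp
  qed
  ultimately show ?thesis using sub x by blast
qed

text \<open>Extension to the localization and contraction from it relate chains of submodules to chains of saturated
  submodules, so the series gives a chain of length \<open>n\<close>, and no chain is longer.\<close>

theorem loc_series_length: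
  assumes "loc_series R U M n"
  shows "module_length LR LM = enat n"
proof -
  obtain N where N: "N 0 = {\<zero>}" "N n = carrier M" and sat: "\<And>j. j \<le> n ==> saturated R U M (N j)"
    and step: "\<And>j. j < n ==> rank_one_step R U M (N j) (N (Suc j))"
    using assms unfolding loc_series_def by blast
  let ?P = "\<lambda>n. \<exists>N :: nat => _ set. (\<forall>i\<le>n. submodule (N i) LR LM) \<and> (\<forall>i<n. N i \<subset> N (Suc i))"
  have "?P n"
  proof (intro exI[of _ "\<lambda>j. {lfrac x u | x u. x \<in> N j \<and> u \<in> U}"] conjI allI impI)
    show "submodule {lfrac x u | x u. x \<in> N i \<and> u \<in> U} LR LM" if "i \<le> n" for i
      by (rule extension_submodule[OF sat[OF that]])
    fix i assume i: "i < n"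
    have sub: "N i \<subset> N (Suc i)" using step[OF i] unfolding rank_one_step_def by simp
    then obtain z where z: "z \<in> N (Suc i)" "z \<notin> N i" by blast
    have NM: "N (Suc i) \<subseteq> carrier M" using sat[of "Suc i"] i unfolding saturated_def by simp
    have "lfrac z \<one>\<^bsub>R\<^esub> \<notin> {lfrac x u | x u. x \<in> N i \<and> u \<in> U}"
    proof
      assume "lfrac z \<one>\<^bsub>R\<^esub> \<in> {lfrac x u | x u. x \<in> N i \<and> u \<in> U}"
      then obtain x u where x: "x \<in> N i" "u \<in> U" and e: "lfrac z \<one>\<^bsub>R\<^esub> = lfrac x u" by blast
      have c: "z \<in> carrier M" "x \<in> carrier M" using z x NM sub by auto
      obtain w where w: "w \<in> U" "(w \<otimes>\<^bsub>R\<^esub> u) \<odot> z = (w \<otimes>\<^bsub>R\<^esub> \<one>\<^bsub>R\<^esub>) \<odot> x"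
        using frac_eqD[OF c(1) U_one c(2) x(2) e] by blast
      have "(w \<otimes>\<^bsub>R\<^esub> \<one>\<^bsub>R\<^esub>) \<odot> x \<in> N i" using sat[of i] i x w Uc unfolding saturated_def by simp
      then have "(w \<otimes>\<^bsub>R\<^esub> u) \<odot> z \<in> N i" using w by simp
      then show False using sat[of i] i z c U_mult[OF w(1) x(2)] unfolding saturated_def by auto
    qed
    moreover have "lfrac z \<one>\<^bsub>R\<^esub> \<in> {lfrac x u | x u. x \<in> N (Suc i) \<and> u \<in> U}" using z U_one by blast
    ultimately show "{lfrac x u | x u. x \<in> N i \<and> u \<in> U} \<subset> {lfrac x u | x u. x \<in> N (Suc i) \<and> u \<in> U}"
      using sub by blast
  qed
  moreover have "r \<le> n" if r: "?P r" for r
  proof -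
    obtain C where C: "\<And>i. i \<le> r ==> submodule (C i) LR LM" "\<And>i. i < r ==> C i \<subset> C (Suc i)" using r by blast
    show ?thesis
    proof (rule saturated_chain_length[OF module_axioms U_sub N step])
      show "saturated R U M {x \<in> carrier M. lfrac x \<one>\<^bsub>R\<^esub> \<in> C i}" if "i \<le> r" for i
        by (rule contraction_saturated[OF C(1)[OF that]])
      show "{x \<in> carrier M. lfrac x \<one>\<^bsub>R\<^esub> \<in> C i} \<subset> {x \<in> carrier M. lfrac x \<one>\<^bsub>R\<^esub> \<in> C (Suc i)}" if "i < r" for i
        by (rule contraction_strict[OF C(1) C(1) C(2)[OF that]]) (use that in auto)
    qed
  qed
  ultimately show ?thesis
    unfolding module_length_def by (intro antisym SUP_least SUP_upper) auto
qed

end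

text \<open>The series of \<open>M'\<close> is pushed forward along \<open>f\<close>, and it is continued by the preimages
  under \<open>g\<close> of the subspaces of \<open>B^s\<close> spanned by the first coordinates. These are
  saturated since \<open>B\<close> is torsion-free, and the new steps have rank one since \<open>B\<close> has.\<close>

lemma loc_series_extension:
  fixes R and M (structure) and B
  assumes M: "module R M" and B: "module R B" and U: "U \<subseteq> carrier R"
    and tf: "\<And>u b. u \<in> U ==> b \<in> carrier B ==> u \<odot>\<^bsub>B\<^esub> b = \<zero>\<^bsub>B\<^esub> ==> b = \<zero>\<^bsub>B\<^esub>"
    and rk: "\<And>b y. b \<in> carrier B ==> b \<noteq> \<zero>\<^bsub>B\<^esub> ==> y \<in> carrier B ==> \<exists>u\<in>U. \<exists>t\<in>carrier R. u \<odot>\<^bsub>B\<^esub> y \<oplus>\<^bsub>B\<^esub> t \<odot>\<^bsub>B\<^esub> b = \<zero>\<^bsub>B\<^esub>"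
    and nz: "carrier B \<noteq> {\<zero>\<^bsub>B\<^esub>}"
    and M': "module R M'" and ser: "loc_series R U M' r"
    and f: "f \<in> mod_hom R M' M" "inj_on f (carrier M')"
    and g: "g \<in> mod_hom R M (mod_power B s)" "g ` carrier M = carrier (mod_power B s)"
    and ex: "f ` carrier M' = {x \<in> carrier M. g x = \<zero>\<^bsub>mod_power B s\<^esub>}"
  shows "loc_series R U M (r + s)"
proof -
  interpret M: module R M by (rule M)
  interpret B: module R B by (rule B)
  interpret M': module R M' by (rule M')
  let ?P = "mod_power B s"
  have Pc: "carrier ?P = {..<s} \<rightarrow>\<^sub>E carrier B" and Pz: "\<zero>\<^bsub>?P\<^esub> = (\<lambda>i\<in>{..<s}. \<zero>\<^bsub>B\<^esub>)"
    and Pa: "\<And>v w. v \<oplus>\<^bsub>?P\<^esub> w = (\<lambda>i\<in>{..<s}. v i \<oplus>\<^bsub>B\<^esub> w i)" and Ps: "\<And>a v. a \<odot>\<^bsub>?P\<^esub> v = (\<lambda>i\<in>{..<s}. a \<odot>\<^bsub>B\<^esub> v i)"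
    by (simp_all add: mod_power_def)
  have gP: "\<And>x. x \<in> carrier M ==> g x \<in> carrier ?P" and ga: "\<And>x y. x \<in> carrier M ==> y \<in> carrier M ==> g (x \<oplus> y) = g x \<oplus>\<^bsub>?P\<^esub> g y"
    and gs: "\<And>a x. a \<in> carrier R ==> x \<in> carrier M ==> g (a \<odot> x) = a \<odot>\<^bsub>?P\<^esub> g x"
    using g(1) unfolding mod_hom_def by auto
  have fM: "\<And>x. x \<in> carrier M' ==> f x \<in> carrier M" and fa: "\<And>x y. x \<in> carrier M' ==> y \<in> carrier M' ==> f (x \<oplus>\<^bsub>M'\<^esub> y) = f x \<oplus> f y"
    and fs: "\<And>a x. a \<in> carrier R ==> x \<in> carrier M' ==> f (a \<odot>\<^bsub>M'\<^esub> x) = a \<odot> f x"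
    using f(1) unfolding mod_hom_def by auto
  have gc: "g x i \<in> carrier B" if "x \<in> carrier M" "i < s" for x i using gP[OF that(1)] that(2) unfolding Pc by auto
  have gai: "g (x \<oplus> y) i = g x i \<oplus>\<^bsub>B\<^esub> g y i" if "x \<in> carrier M" "y \<in> carrier M" "i < s" for x y i using ga that Pa by simp
  have gsi: "g (a \<odot> x) i = a \<odot>\<^bsub>B\<^esub> g x i" if "a \<in> carrier R" "x \<in> carrier M" "i < s" for a x i using gs that Ps by simp
  have f0: "f \<zero>\<^bsub>M'\<^esub> = \<zero>"
    using fs[OF M.R.zero_closed M'.zero_closed] M.smult_l_null[OF fM[OF M'.zero_closed]] by simp
  have g0: "g \<zero> i = \<zero>\<^bsub>B\<^esub>" if "i < s" for i
    using gsi[OF M.R.zero_closed M.zero_closed that] B.smult_l_null[OF gc[OF M.zero_closed that]] by simp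
  obtain N where N: "N 0 = {\<zero>\<^bsub>M'\<^esub>}" "N r = carrier M'" and sat: "\<And>j. j \<le> r ==> saturated R U M' (N j)"
    and step: "\<And>j. j < r ==> rank_one_step R U M' (N j) (N (Suc j))"
    using ser unfolding loc_series_def by blast
  define G where "G k = {x \<in> carrier M. \<forall>i<s. k \<le> i --> g x i = \<zero>\<^bsub>B\<^esub>}" for k
  have G0: "f ` N r = G 0"
  proof -
    have "g x = \<zero>\<^bsub>?P\<^esub> \<longleftrightarrow> (\<forall>i<s. g x i = \<zero>\<^bsub>B\<^esub>)" if "x \<in> carrier M" for x
      using gP[OF that] unfolding Pz Pc by (auto simp: fun_eq_iff PiE_def extensional_def)
    then show ?thesis unfolding N(2) ex G_def by auto
  qed
  define N' where "N' j = (if j \<le> r then f ` N j else G (j - r))" for j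
  have N'G: "N' (r + k) = G k" for k unfolding N'_def using G0 by auto
  have satf: "saturated R U M (f ` N j)" if j: "j \<le> r" for j
  proof -
    note s = sat[OF j, unfolded saturated_def]
    show ?thesis
      unfolding saturated_def
    proof (intro conjI ballI impI)
      show "f ` N j \<subseteq> carrier M" using s fM by auto
      show "\<zero> \<in> f ` N j" using s f0 by (metis imageI)
      show "x \<oplus> y \<in> f ` N j" if "x \<in> f ` N j" "y \<in> f ` N j" for x y
        using that s fa by (auto simp: image_iff subset_iff) metis
      show "a \<odot> x \<in> f ` N j" if "a \<in> carrier R" "x \<in> f ` N j" for a x
        using that s fs by (auto simp: image_iff subset_iff) metis
      fix u x assume u: "u \<in> U" and x: "x \<in> carrier M" and ux: "u \<odot> x \<in> f ` N j"
      have uc: "u \<in> carrier R" using u U by auto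
      have "u \<odot> x \<in> f ` N r" using ux s N(2) by auto
      then have "u \<odot>\<^bsub>B\<^esub> g x i = \<zero>\<^bsub>B\<^esub>" if "i < s" for i unfolding G0 G_def using gsi[OF uc x that] that by auto
      then have "x \<in> G 0" unfolding G_def using tf[OF u gc[OF x]] x by auto
      then obtain y where y: "y \<in> carrier M'" "x = f y" unfolding G0[symmetric] N(2) by auto
      obtain z where z: "z \<in> N j" "u \<odot> x = f z" using ux by auto
      have "f (u \<odot>\<^bsub>M'\<^esub> y) = f z" using fs[OF uc y(1)] y z by simp
      then have "u \<odot>\<^bsub>M'\<^esub> y = z" using f(2) y z s uc by (intro inj_onD[OF f(2)]) auto
      then have "y \<in> N j" using s u y z by auto
      then show "x \<in> f ` N j" using y by simp
    qed
  qed
  have satG: "saturated R U M (G k)" for k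
    unfolding saturated_def
  proof (intro conjI ballI impI)
    show "G k \<subseteq> carrier M" unfolding G_def by auto
    show "\<zero> \<in> G k" unfolding G_def using g0 by auto
    show "x \<oplus> y \<in> G k" if "x \<in> G k" "y \<in> G k" for x y using that gai unfolding G_def by auto
    show "a \<odot> x \<in> G k" if "a \<in> carrier R" "x \<in> G k" for a x using that gsi unfolding G_def by auto
    fix u x assume u: "u \<in> U" and x: "x \<in> carrier M" and ux: "u \<odot> x \<in> G k"
    have uc: "u \<in> carrier R" using u U by auto
    have "g x i = \<zero>\<^bsub>B\<^esub>" if i: "i < s" "k \<le> i" for i
      by (rule tf[OF u gc[OF x i(1)]]) (use ux gsi[OF uc x i(1)] i in \<open>auto simp: G_def\<close>)
    then show "x \<in> G k" unfolding G_def using x by auto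
  qed
  have stepf: "rank_one_step R U M (f ` N j) (f ` N (Suc j))" if j: "j < r" for j
    unfolding rank_one_step_def
  proof (intro conjI ballI)
    have sub: "N j \<subset> N (Suc j)" using step[OF j] unfolding rank_one_step_def by simp
    have NM: "N (Suc j) \<subseteq> carrier M'" "N j \<subseteq> carrier M'" using sat[of "Suc j"] sat[of j] j unfolding saturated_def by auto
    show "f ` N j \<subset> f ` N (Suc j)"
      using sub inj_on_image_eq_iff[OF f(2) NM] by blast
    fix c z assume c: "c \<in> f ` N (Suc j) - f ` N j" and z: "z \<in> f ` N (Suc j)"
    then obtain c' z' where c': "c' \<in> N (Suc j) - N j" "c = f c'" and z': "z' \<in> N (Suc j)" "z = f z'" by blast
    obtain u t where u: "u \<in> U" and t: "t \<in> carrier R" and ut: "u \<odot>\<^bsub>M'\<^esub> z' \<oplus>\<^bsub>M'\<^esub> t \<odot>\<^bsub>M'\<^esub> c' \<in> N j"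
      using step[OF j] c'(1) z'(1) unfolding rank_one_step_def by blast
    have cc: "c' \<in> carrier M'" "z' \<in> carrier M'" "u \<in> carrier R" using c' z' NM u U by auto
    have "f (u \<odot>\<^bsub>M'\<^esub> z' \<oplus>\<^bsub>M'\<^esub> t \<odot>\<^bsub>M'\<^esub> c') = u \<odot> z \<oplus> t \<odot> c"
      unfolding c' z' using fa[of "u \<odot>\<^bsub>M'\<^esub> z'" "t \<odot>\<^bsub>M'\<^esub> c'"] fs cc t by simp
    then show "\<exists>u\<in>U. \<exists>t\<in>carrier R. u \<odot> z \<oplus> t \<odot> c \<in> f ` N j" using ut u t by (metis imageI)
  qed
  have stepG: "rank_one_step R U M (G k) (G (Suc k))" if k: "k < s" for k
    unfolding rank_one_step_def
  proof (intro conjI ballI)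
    obtain b where b: "b \<in> carrier B" "b \<noteq> \<zero>\<^bsub>B\<^esub>" using nz B.zero_closed by blast
    have "(\<lambda>i\<in>{..<s}. if i = k then b else \<zero>\<^bsub>B\<^esub>) \<in> carrier ?P" unfolding Pc using b by auto
    then obtain x where x: "x \<in> carrier M" "g x = (\<lambda>i\<in>{..<s}. if i = k then b else \<zero>\<^bsub>B\<^esub>)" using g(2) by (metis imageE)
    have "x \<in> G (Suc k)" "x \<notin> G k" unfolding G_def using x b k by auto
    moreover have "G k \<subseteq> G (Suc k)" unfolding G_def by auto
    ultimately show "G k \<subset> G (Suc k)" by blast
    fix c z assume c: "c \<in> G (Suc k) - G k" and z: "z \<in> G (Suc k)"
    have cz: "c \<in> carrier M" "z \<in> carrier M" using c z unfolding G_def by auto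
    have "g c k \<noteq> \<zero>\<^bsub>B\<^esub>"
    proof
      assume "g c k = \<zero>\<^bsub>B\<^esub>"
      then have "c \<in> G k" using c unfolding G_def by (auto simp: le_less Suc_le_eq)
      then show False using c by simp
    qed
    then obtain u t where u: "u \<in> U" and t: "t \<in> carrier R" and ut: "u \<odot>\<^bsub>B\<^esub> g z k \<oplus>\<^bsub>B\<^esub> t \<odot>\<^bsub>B\<^esub> g c k = \<zero>\<^bsub>B\<^esub>"
      using rk[OF gc[OF cz(1) k] _ gc[OF cz(2) k]] by blast
    have uc: "u \<in> carrier R" using u U by auto
    have "u \<odot> z \<oplus> t \<odot> c \<in> G k"
      unfolding G_def
    proof (intro CollectI conjI allI impI)
      show "u \<odot> z \<oplus> t \<odot> c \<in> carrier M" using uc t cz by simp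
      fix i assume i: "i < s" "k \<le> i"
      have e: "g (u \<odot> z \<oplus> t \<odot> c) i = u \<odot>\<^bsub>B\<^esub> g z i \<oplus>\<^bsub>B\<^esub> t \<odot>\<^bsub>B\<^esub> g c i"
        using gai[of "u \<odot> z" "t \<odot> c" i] gsi uc t cz i by simp
      show "g (u \<odot> z \<oplus> t \<odot> c) i = \<zero>\<^bsub>B\<^esub>"
      proof (cases "i = k")
        case True then show ?thesis using e ut by simp
      next
        case False
        then have "g z i = \<zero>\<^bsub>B\<^esub>" "g c i = \<zero>\<^bsub>B\<^esub>" using c z i unfolding G_def by auto
        then show ?thesis using e uc t by simp
      qed
    qed
    then show "\<exists>u\<in>U. \<exists>t\<in>carrier R. u \<odot> z \<oplus> t \<odot> c \<in> G k" using u t by blast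
  qed
  show ?thesis
    unfolding loc_series_def
  proof (intro exI[of _ N'] conjI allI impI)
    show "N' 0 = {\<zero>}" unfolding N'_def using N(1) f0 by simp
    show "N' (r + s) = carrier M" unfolding N'G G_def by auto
    show "saturated R U M (N' j)" for j unfolding N'_def using satf satG by auto
    fix j assume j: "j < r + s"
    show "rank_one_step R U M (N' j) (N' (Suc j))"
    proof (cases "j < r")
      case True then show ?thesis using stepf[OF True] unfolding N'_def by auto
    next
      case False
      then obtain k where k: "j = r + k" "k < s" using j by (metis add_less_cancel_left le_iff_add not_less)
      then show ?thesis using stepG[OF k(2)] N'G[of k] N'G[of "Suc k"] by simp
    qed
  qed
qed

lemma loc_series_zero:
  assumes "module R M" "carrier M = {\<zero>\<^bsub>M\<^esub>}"
  shows "loc_series R U M 0"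
proof -
  interpret module R M by (rule assms(1))
  have "saturated R U M {\<zero>\<^bsub>M\<^esub>}" unfolding saturated_def using assms(2) by auto
  then show ?thesis unfolding loc_series_def using assms(2) by (auto intro!: exI[of _ "\<lambda>_. {\<zero>\<^bsub>M\<^esub>}"])
qed

section \<open>Graded subgroups of a polynomial ring\<close>

locale poly_cring = cring R for R (structure)

sublocale poly_cring < UP: UP_cring R "UP R"
  by unfold_locales simp_all

context poly_cring
begin

abbreviation (input) "PP \<equiv> UP R"
abbreviation (input) "cf \<equiv> coeff (UP R)"
abbreviation (input) "mnm \<equiv> monom (UP R)"

text \<open>The graded subgroup of \<open>A[t]\<close> with prescribed homogeneous components.\<close>

definition pol :: "(nat => 'a set) => (nat => 'a) set" where
  "pol E = {f \<in> carrier PP. \<forall>i. cf f i \<in> E i}"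

lemma polD: "f \<in> pol E ==> f \<in> carrier PP" "f \<in> pol E ==> cf f i \<in> E i"
  by (auto simp: pol_def)

lemma pol_mono: "(\<And>i. E i \<subseteq> F i) ==> pol E \<subseteq> pol F"
  by (auto simp: pol_def)

lemma coeff_minus: "f \<in> carrier PP ==> g \<in> carrier PP ==> cf (f \<ominus>\<^bsub>PP\<^esub> g) i = cf f i \<ominus> cf g i"
  by (simp add: a_minus_def UP.coeff_add UP.coeff_a_inv a_minus_def)

lemma pol_zero: "(\<And>i. ideal (E i) R) ==> \<zero>\<^bsub>PP\<^esub> \<in> pol E"
  by (simp add: pol_def idl_zero)

lemma pol_add: "(\<And>i. ideal (E i) R) ==> f \<in> pol E ==> g \<in> pol E ==> f \<oplus>\<^bsub>PP\<^esub> g \<in> pol E"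
  by (simp add: pol_def idl_add)

lemma pol_diff: "(\<And>i. ideal (E i) R) ==> f \<in> pol E ==> g \<in> pol E ==> f \<ominus>\<^bsub>PP\<^esub> g \<in> pol E"
  by (simp add: pol_def coeff_minus idl_diff)

lemma pol_neg: "(\<And>i. ideal (E i) R) ==> f \<in> pol E ==> \<ominus>\<^bsub>PP\<^esub> f \<in> pol E"
  by (simp add: pol_def idl_neg)

lemma pol_mult:
  assumes G: "\<And>i. ideal (G i) R" and EF: "\<And>i j a b. a \<in> E i ==> b \<in> F j ==> a \<otimes> b \<in> G (i + j)"
    and f: "f \<in> pol E" and g: "g \<in> pol F"
  shows "f \<otimes>\<^bsub>PP\<^esub> g \<in> pol G"
  unfolding pol_def
proof (intro CollectI conjI allI)
  note fc = polD(1)[OF f] and gc = polD(1)[OF g]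
  show "f \<otimes>\<^bsub>PP\<^esub> g \<in> carrier PP" using fc gc by simp
  fix n
  have "(\<Oplus>i\<in>{..n}. cf f i \<otimes> cf g (n - i)) \<in> G n"
  proof (rule idl_finsum[OF G])
    fix i assume "i \<in> {..n}"
    then show "cf f i \<otimes> cf g (n - i) \<in> G n"
      using EF[OF polD(2)[OF f, of i] polD(2)[OF g, of "n - i"]] by simp
  qed simp
  then show "cf (f \<otimes>\<^bsub>PP\<^esub> g) n \<in> G n" using fc gc by simp
qed

lemma mon_pol: "(\<And>i. ideal (E i) R) ==> a \<in> E i ==> mnm a i \<in> pol E"
  using idl_carr[of "E i" a] by (simp add: pol_def idl_zero)

lemma mon_polD: "a \<in> carrier R ==> mnm a i \<in> pol E ==> a \<in> E i"
  using polD(2)[of "mnm a i" E i] by simp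

lemma finsum_mem_closed:
  assumes "\<zero>\<^bsub>PP\<^esub> \<in> X" "X \<subseteq> carrier PP" "\<And>f g. f \<in> X ==> g \<in> X ==> f \<oplus>\<^bsub>PP\<^esub> g \<in> X"
    "finite A" "\<And>i. i \<in> A ==> h i \<in> X"
  shows "finsum PP h A \<in> X"
  using assms(4,5)
proof (induct A)
  case (insert i A)
  then have "h \<in> A \<rightarrow> carrier PP" "h i \<in> carrier PP" using assms(2) by auto
  then show ?case using insert assms(3) by simp
qed (use assms in simp)

lemma components_mem:
  assumes f: "f \<in> carrier PP" and X: "\<zero>\<^bsub>PP\<^esub> \<in> X" "X \<subseteq> carrier PP" "\<And>f g. f \<in> X ==> g \<in> X ==> f \<oplus>\<^bsub>PP\<^esub> g \<in> X"
    and comp: "\<And>i. mnm (cf f i) i \<in> X"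
  shows "f \<in> X"
proof -
  have "(\<Oplus>\<^bsub>PP\<^esub>i\<in>{..deg R f}. mnm (cf f i) i) \<in> X"
    by (rule finsum_mem_closed[OF X]) (simp_all add: comp)
  then show ?thesis using UP.up_repr[OF f] by simp
qed

lemma coeff_mult_mon1:
  assumes p: "p \<in> carrier PP" and a: "a \<in> carrier R"
  shows "cf (p \<otimes>\<^bsub>PP\<^esub> mnm a 1) (Suc k) = cf p k \<otimes> a" "cf (p \<otimes>\<^bsub>PP\<^esub> mnm a 1) 0 = \<zero>"
proof -
  have "cf (p \<otimes>\<^bsub>PP\<^esub> mnm a 1) (Suc k) = (\<Oplus>i\<in>{..Suc k}. cf p i \<otimes> (if 1 = Suc k - i then a else \<zero>))"
    using p a by simp
  also have "\<dots> = (\<Oplus>i\<in>{..Suc k}. if k = i then cf p i \<otimes> a else \<zero>)"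
    by (rule finsum_cong') (use p a in auto)
  also have "\<dots> = cf p k \<otimes> a" using p a by (intro finsum_singleton) auto
  finally show "cf (p \<otimes>\<^bsub>PP\<^esub> mnm a 1) (Suc k) = cf p k \<otimes> a" .
  show "cf (p \<otimes>\<^bsub>PP\<^esub> mnm a 1) 0 = \<zero>" using p a by simp
qed

lemma rees_carrier: "carrier (rees R K) = pol (ideal_pow R K)"
  by (simp add: rees_def pol_def)

lemma rees_simps: "r \<oplus>\<^bsub>rees R K\<^esub> s = r \<oplus>\<^bsub>PP\<^esub> s" "r \<otimes>\<^bsub>rees R K\<^esub> s = r \<otimes>\<^bsub>PP\<^esub> s"
  "\<zero>\<^bsub>rees R K\<^esub> = \<zero>\<^bsub>PP\<^esub>" "\<one>\<^bsub>rees R K\<^esub> = \<one>\<^bsub>PP\<^esub>"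
  by (simp_all add: rees_def)

lemma pow_pol_mult: "ideal K R ==> f \<in> pol (ideal_pow R K) ==> g \<in> pol (ideal_pow R K) ==> f \<otimes>\<^bsub>PP\<^esub> g \<in> pol (ideal_pow R K)"
  by (rule pol_mult[of _ "ideal_pow R K" "ideal_pow R K"]) (auto simp: pow_ideal pow_add intro: prod_mem)

lemma one_pol: "ideal K R ==> \<one>\<^bsub>PP\<^esub> \<in> pol (ideal_pow R K)"
  by (simp add: pol_def idl_zero pow_ideal)

lemma rees_cring: assumes K: "ideal K R" shows "cring (rees R K)"
proof -
  note Ki = pow_ideal[OF K]
  have "subcring (pol (ideal_pow R K)) PP"
  proof (rule UP.P.subcringI')
    show "subring (pol (ideal_pow R K)) PP"
      by (rule UP.P.subringI) (use pol_neg[OF Ki] pol_add[OF Ki] pow_pol_mult[OF K] one_pol[OF K] polD in auto)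
  qed
  then have "cring (PP\<lparr>carrier := pol (ideal_pow R K)\<rparr>)" using UP.P.subcring_iff[of "pol (ideal_pow R K)"] polD by auto
  then show ?thesis by (simp add: rees_def pol_def)
qed

text \<open>The extended ideal is graded, with component \<open>K L^i\<close> in degree \<open>i\<close>; a product of
  elements of \<open>K\<close> and \<open>L^i\<close> is the coefficient of a product of monomials.\<close>

lemma rees_ext_eq:
  assumes K: "ideal K R" and L: "ideal L R"
  shows "rees_ext R K L = pol (\<lambda>i. K \<cdot> ideal_pow R L i)"
proof
  interpret T: cring "rees R L" by (rule rees_cring[OF L])
  note Li = pow_ideal[OF L]
  note KL = prod_ideal[OF K Li]
  have gens: "(\<lambda>a. mnm a 0) ` K \<subseteq> pol (\<lambda>i. K \<cdot> ideal_pow R L i)"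
    using mon_pol[of "\<lambda>i. K \<cdot> ideal_pow R L i" _ 0] KL ideal_prod_one[OF K] by auto
  have sub: "pol (\<lambda>i. K \<cdot> ideal_pow R L i) \<subseteq> carrier (rees R L)"
    unfolding rees_carrier by (rule pol_mono[OF prod_le2[OF K Li]])
  have tm: "t \<otimes>\<^bsub>PP\<^esub> f \<in> pol (\<lambda>i. K \<cdot> ideal_pow R L i)" if "t \<in> pol (ideal_pow R L)" "f \<in> pol (\<lambda>i. K \<cdot> ideal_pow R L i)" for t f
  proof (rule pol_mult[OF KL _ that])
    fix i j a b assume a: "a \<in> ideal_pow R L i" and b: "b \<in> K \<cdot> ideal_pow R L j"
    have "a \<otimes> b \<in> ideal_pow R L i \<cdot> (K \<cdot> ideal_pow R L j)" using a b by (rule prod_mem)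
    then show "a \<otimes> b \<in> K \<cdot> ideal_pow R L (i + j)"
      using prod_lcomm[OF Li K Li, of i j] pow_add[OF L, of i j] by simp
  qed
  have "ideal (pol (\<lambda>i. K \<cdot> ideal_pow R L i)) (rees R L)"
  proof (rule T.idealI')
    show "pol (\<lambda>i. K \<cdot> ideal_pow R L i) \<subseteq> carrier (rees R L)" by (rule sub)
  qed (use pol_zero[OF KL] pol_add[OF KL] tm in \<open>auto simp: rees_simps rees_carrier\<close>)
  then show "rees_ext R K L \<subseteq> pol (\<lambda>i. K \<cdot> ideal_pow R L i)"
    unfolding rees_ext_def using gens by (rule T.genideal_minimal)
  have gc: "(\<lambda>a. mnm a 0) ` K \<subseteq> carrier (rees R L)" using gens sub by blast
  have id: "ideal (rees_ext R K L) (rees R L)" unfolding rees_ext_def by (rule T.genideal_ideal[OF gc])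
  have self: "mnm a 0 \<in> rees_ext R K L" if "a \<in> K" for a unfolding rees_ext_def using T.genideal_self[OF gc] that by blast
  have sm: "mnm c i \<in> rees_ext R K L" if "c \<in> K \<cdot> ideal_pow R L i" for c i
    using that
  proof induct
    case (prod a l)
    have c: "a \<in> carrier R" "l \<in> carrier R" using prod idl_carr K Li by blast+
    have "mnm l i \<in> carrier (rees R L)" unfolding rees_carrier by (rule mon_pol[of "ideal_pow R L"]) (rule Li prod(2))+
    then have "mnm a 0 \<otimes>\<^bsub>rees R L\<^esub> mnm l i \<in> rees_ext R K L" by (rule T.idl_r[OF id self[OF prod(1)]])
    moreover have "mnm a 0 \<otimes>\<^bsub>PP\<^esub> mnm l i = mnm (a \<otimes> l) i" using UP.monom_mult[OF c, of 0 i] by simp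
    ultimately show ?case by (simp add: rees_simps)
  next
    case (sum u v)
    have "u \<in> carrier R" "v \<in> carrier R" using sum(1,3) idl_carr[OF KL] by blast+
    then show ?case using T.idl_add[OF id sum(2,4)] by (simp add: rees_simps)
  qed
  show "pol (\<lambda>i. K \<cdot> ideal_pow R L i) \<subseteq> rees_ext R K L"
  proof
    fix f assume f: "f \<in> pol (\<lambda>i. K \<cdot> ideal_pow R L i)"
    show "f \<in> rees_ext R K L"
    proof (rule components_mem[OF polD(1)[OF f]])
      show "\<zero>\<^bsub>PP\<^esub> \<in> rees_ext R K L" using T.idl_zero[OF id] by (simp add: rees_simps)
      show "rees_ext R K L \<subseteq> carrier PP" using T.idl_sub[OF id] polD unfolding rees_carrier by blast
      show "f \<oplus>\<^bsub>PP\<^esub> g \<in> rees_ext R K L" if "f \<in> rees_ext R K L" "g \<in> rees_ext R K L" for f g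
        using T.idl_add[OF id that] by (simp add: rees_simps)
      show "mnm (cf f i) i \<in> rees_ext R K L" for i by (rule sm[OF polD(2)[OF f]])
    qed
  qed
qed

end

text \<open>The Sally module, the powers of \<open>\<mm>\<close> times it and the fibre all have their operations given on
  representatives. Their module axioms are therefore inherited from the ring.\<close>

lemma (in subquotient) module_of_classes:
  assumes TR: "cring TR" "carrier TR = T" "\<And>r s. r \<oplus>\<^bsub>TR\<^esub> s = r \<oplus> s" "\<And>r s. r \<otimes>\<^bsub>TR\<^esub> s = r \<otimes> s" "\<one>\<^bsub>TR\<^esub> = \<one>"
    and M: "carrier M = cls ` E" "\<zero>\<^bsub>M\<^esub> = cls \<zero>"
      "\<And>f g. f \<in> E ==> g \<in> E ==> cls f \<oplus>\<^bsub>M\<^esub> cls g = cls (f \<oplus> g)"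
      "\<And>t f. t \<in> T ==> f \<in> E ==> t \<odot>\<^bsub>M\<^esub> cls f = cls (t \<otimes> f)"
  shows "module TR M"
proof (rule moduleI[OF TR(1)])
  have Ec: "f \<in> E ==> f \<in> carrier R" for f using E_sub by blast
  have Tc: "t \<in> T ==> t \<in> carrier R" for t using T_sub by blast
  have one: "\<one> \<in> T" using TR(1,2,5) cring.cring_simprules(6)[OF TR(1)] by simp
  have Tadd: "r \<oplus> s \<in> T" if "r \<in> T" "s \<in> T" for r s using that TR(2,3) cring.cring_simprules(1)[OF TR(1)] by metis
  have Tmult: "r \<otimes> s \<in> T" if "r \<in> T" "s \<in> T" for r s using that TR(2,4) cring.cring_simprules(5)[OF TR(1)] by metis
  show "abelian_group M"
  proof (rule abelian_groupI)
    show "X \<oplus>\<^bsub>M\<^esub> Y \<in> carrier M" if "X \<in> carrier M" "Y \<in> carrier M" for X Y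
      using that E_add unfolding M(1) by (auto simp: M(3))
    show "\<zero>\<^bsub>M\<^esub> \<in> carrier M" unfolding M(1,2) using E_zero by blast
    show "X \<oplus>\<^bsub>M\<^esub> Y \<oplus>\<^bsub>M\<^esub> Z = X \<oplus>\<^bsub>M\<^esub> (Y \<oplus>\<^bsub>M\<^esub> Z)" if "X \<in> carrier M" "Y \<in> carrier M" "Z \<in> carrier M" for X Y Z
      using that E_add unfolding M(1) by (auto simp: M(3) a_assoc Ec)
    show "X \<oplus>\<^bsub>M\<^esub> Y = Y \<oplus>\<^bsub>M\<^esub> X" if "X \<in> carrier M" "Y \<in> carrier M" for X Y
      using that unfolding M(1) by (auto simp: M(3) a_comm Ec)
    show "\<zero>\<^bsub>M\<^esub> \<oplus>\<^bsub>M\<^esub> X = X" if "X \<in> carrier M" for X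
      using that E_zero unfolding M(1,2) by (auto simp: M(3) Ec)
    fix X assume "X \<in> carrier M"
    then obtain f where f: "f \<in> E" "X = cls f" unfolding M(1) by blast
    have "cls (\<ominus> f) \<oplus>\<^bsub>M\<^esub> X = \<zero>\<^bsub>M\<^esub>" using f E_neg Ec by (simp add: M(2,3) l_neg)
    then show "\<exists>Y\<in>carrier M. Y \<oplus>\<^bsub>M\<^esub> X = \<zero>\<^bsub>M\<^esub>" unfolding M(1) using E_neg[OF f(1)] by blast
  qed
  show "a \<odot>\<^bsub>M\<^esub> X \<in> carrier M" if "a \<in> carrier TR" "X \<in> carrier M" for a X
    using that E_smult unfolding M(1) TR(2) by (auto simp: M(4))
  show "(a \<oplus>\<^bsub>TR\<^esub> b) \<odot>\<^bsub>M\<^esub> X = a \<odot>\<^bsub>M\<^esub> X \<oplus>\<^bsub>M\<^esub> b \<odot>\<^bsub>M\<^esub> X" if "a \<in> carrier TR" "b \<in> carrier TR" "X \<in> carrier M" for a b X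
    using that E_smult Tadd unfolding M(1) TR(2,3) by (auto simp: M(3,4) l_distr Ec Tc)
  show "a \<odot>\<^bsub>M\<^esub> (X \<oplus>\<^bsub>M\<^esub> Y) = a \<odot>\<^bsub>M\<^esub> X \<oplus>\<^bsub>M\<^esub> a \<odot>\<^bsub>M\<^esub> Y" if "a \<in> carrier TR" "X \<in> carrier M" "Y \<in> carrier M" for a X Y
    using that E_smult E_add unfolding M(1) TR(2) by (auto simp: M(3,4) r_distr Ec Tc)
  show "(a \<otimes>\<^bsub>TR\<^esub> b) \<odot>\<^bsub>M\<^esub> X = a \<odot>\<^bsub>M\<^esub> (b \<odot>\<^bsub>M\<^esub> X)" if "a \<in> carrier TR" "b \<in> carrier TR" "X \<in> carrier M" for a b X
    using that E_smult Tmult unfolding M(1) TR(2,4) by (auto simp: M(4) m_assoc Ec Tc)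
  show "\<one>\<^bsub>TR\<^esub> \<odot>\<^bsub>M\<^esub> X = X" if "X \<in> carrier M" for X
    using that one unfolding M(1) TR(5) by (auto simp: M(4) Ec)
qed

section \<open>The Sally module and its filtration\<close>

text \<open>All that is retained of the canonical ideal is the last hypothesis, on the intersection of
  \<open>J\<^sup>2\<close> with the ideal generated by all parameters but the first.\<close>

locale sally_setting = noeth_local R \<mm> for R (structure) and \<mm> +
  fixes x :: 'a and xs :: "'a list" and J :: "'a set"
  assumes xxs_m: "set (x # xs) \<subseteq> \<mm>" and rs: "rseq (x # xs)" and J: "ideal J R" and QJ: "Idl (set (x # xs)) \<subseteq> J"
    and rad: "\<mm> \<subseteq> ring_radical R (Idl (set (x # xs)))"
    and tail: "Idl (set xs) \<inter> ideal_pow R J 2 \<subseteq> (Idl (set xs)) \<cdot> J"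

sublocale sally_setting < poly_cring R
  by unfold_locales

context sally_setting
begin

declare list.set(2) [simp del]

abbreviation (input) "Q \<equiv> Idl (set (x # xs))"
abbreviation (input) "T \<equiv> rees R Q"
abbreviation (input) "S \<equiv> sally_module R Q J"
abbreviation (input) "B \<equiv> rees_fibre R \<mm> Q"
abbreviation (input) "Jp \<equiv> ideal_pow R J"
abbreviation (input) "Qp \<equiv> ideal_pow R Q"
abbreviation (input) "mp \<equiv> ideal_pow R \<mm>"
abbreviation (input) "TT \<equiv> pol Qp"
abbreviation (input) "NS \<equiv> pol (\<lambda>i. J \<cdot> Qp i)"
abbreviation (input) "NB \<equiv> pol (\<lambda>i. \<mm> \<cdot> Qp i)"

text \<open>The coefficients in degree \<open>i\<close> of the polynomials representing elements of
  \<open>\<mm>^j S\<close>.\<close>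

definition W :: "nat => nat => 'a set" where "W j i = mp j \<cdot> Jp (Suc i) <+> J \<cdot> Qp i"

lemma xxs: "set (x # xs) \<subseteq> carrier R" using xxs_m idl_sub[OF mid] by blast
lemma Q: "ideal Q R" by (rule genideal_ideal[OF xxs])
lemmas Jpi = pow_ideal[OF J] and Qpi = pow_ideal[OF Q] and mpi = pow_ideal[OF mid]
lemmas JQi = prod_ideal[OF J Qpi] and mQi = prod_ideal[OF mid Qpi]

lemma Wi: "ideal (W j i) R" unfolding W_def by (rule add_ideals[OF prod_ideal[OF mpi Jpi] JQi])

lemma N_le_W: "J \<cdot> Qp i \<subseteq> W j i" unfolding W_def by (rule sum_ge2[OF prod_ideal[OF mpi Jpi] JQi])

lemma QpJp: "Qp i \<subseteq> Jp i" by (rule pow_mono[OF QJ])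

lemma Qp_W: "a \<in> Qp i ==> b \<in> W j k ==> a \<otimes> b \<in> W j (i + k)"
proof -
  assume a: "a \<in> Qp i" and "b \<in> W j k"
  then obtain u v where u: "u \<in> mp j \<cdot> Jp (Suc k)" and v: "v \<in> J \<cdot> Qp k" and b: "b = u \<oplus> v" unfolding W_def sum_mem by blast
  have c: "a \<in> carrier R" "u \<in> carrier R" "v \<in> carrier R"
    using idl_carr[OF Qpi a] idl_carr[OF prod_ideal[OF mpi Jpi] u] idl_carr[OF JQi v] by auto
  have "a \<otimes> u \<in> Jp i \<cdot> (mp j \<cdot> Jp (Suc k))" using a u QpJp by (intro prod_mem) auto
  also have "\<dots> = mp j \<cdot> Jp (i + Suc k)" unfolding prod_lcomm[OF Jpi mpi Jpi] pow_add[OF J] ..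
  finally have 1: "a \<otimes> u \<in> mp j \<cdot> Jp (Suc (i + k))" by simp
  have "a \<otimes> v \<in> Qp i \<cdot> (J \<cdot> Qp k)" using a v by (rule prod_mem)
  also have "\<dots> = J \<cdot> Qp (i + k)" unfolding prod_lcomm[OF Qpi J Qpi] pow_add[OF Q] ..
  finally have 2: "a \<otimes> v \<in> J \<cdot> Qp (i + k)" .
  have "a \<otimes> b = a \<otimes> u \<oplus> a \<otimes> v" unfolding b using c by (simp add: r_distr)
  then show ?thesis unfolding W_def sum_mem using 1 2 by blast
qed

lemma W_0: "W 0 i = Jp (Suc i)"
proof -
  have "J \<cdot> Qp i \<subseteq> Jp (Suc i)" unfolding ideal_pow.simps(2) by (rule prod_mono[OF subset_refl QpJp])
  then show ?thesis unfolding W_def using prod_one[OF Jpi, of "Suc i"] sum_le[OF Jpi, of "Jp (Suc i)" "Suc i" "J \<cdot> Qp i"]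
      sum_ge1[OF Jpi JQi, of "Suc i" i] by auto
qed

lemma W_le_0: "W j i \<subseteq> Jp (Suc i)"
  unfolding W_0[symmetric]
  unfolding W_def by (rule sum_mono[OF prod_mono]) (use mpi idl_sub in auto)

lemma Qp_JQ: "a \<in> Qp i ==> b \<in> J \<cdot> Qp k ==> a \<otimes> b \<in> J \<cdot> Qp (i + k)"
  using prod_mem[of a "Qp i" b "J \<cdot> Qp k"] prod_lcomm[OF Qpi J Qpi] pow_add[OF Q] by simp

lemma Qp_mQ: "a \<in> Qp i ==> b \<in> \<mm> \<cdot> Qp k ==> a \<otimes> b \<in> \<mm> \<cdot> Qp (i + k)"
  using prod_mem[of a "Qp i" b "\<mm> \<cdot> Qp k"] prod_lcomm[OF Qpi mid Qpi] pow_add[OF Q] by simp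

lemma T_carrier: "carrier T = TT" by (rule rees_carrier)
lemma T_cring: "cring T" by (rule rees_cring[OF Q])

lemma subq: "subquotient PP (pol (W j)) NS TT"
proof
  show "pol (W j) \<subseteq> carrier PP" "TT \<subseteq> carrier PP" using polD(1) by auto
  show "NS \<subseteq> pol (W j)" by (rule pol_mono[OF N_le_W])
  show "t \<otimes>\<^bsub>PP\<^esub> f \<in> NS" if "t \<in> TT" "f \<in> NS" for t f by (rule pol_mult[of "\<lambda>i. J \<cdot> Qp i" Qp "\<lambda>i. J \<cdot> Qp i"]) (use JQi Qp_JQ that in auto)
  show "t \<otimes>\<^bsub>PP\<^esub> f \<in> pol (W j)" if "t \<in> TT" "f \<in> pol (W j)" for t f by (rule pol_mult[of "W j" Qp "W j"]) (use Wi Qp_W that in auto)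
qed (use pol_zero[OF JQi] pol_diff[OF JQi] pol_diff[OF Wi] in auto)

lemma subqB: "subquotient PP TT NB TT"
proof
  have TTc: "TT \<subseteq> carrier PP" using polD(1) by auto
  then show "TT \<subseteq> carrier PP" .
  show "NB \<subseteq> TT" by (rule pol_mono[OF prod_le2[OF mid Qpi]])
  show "t \<otimes>\<^bsub>PP\<^esub> f \<in> NB" if "t \<in> TT" "f \<in> NB" for t f by (rule pol_mult[of "\<lambda>i. \<mm> \<cdot> Qp i" Qp "\<lambda>i. \<mm> \<cdot> Qp i"]) (use mQi Qp_mQ that in auto)
  show "t \<otimes>\<^bsub>PP\<^esub> f \<in> TT" if "t \<in> TT" "f \<in> TT" for t f by (rule pow_pol_mult[OF Q that])
qed (use pol_zero[OF mQi] pol_diff[OF mQi] pol_diff[OF Qpi] in auto)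

definition clsS :: "(nat => 'a) => (nat => 'a) set" where "clsS f = NS +>\<^bsub>PP\<^esub> f"
definition clsB :: "(nat => 'a) => (nat => 'a) set" where "clsB f = NB +>\<^bsub>PP\<^esub> f"

lemma clsS_eq: "subquotient.cls PP NS = clsS"
  using subquotient.cls_def[OF subq] by (auto simp: clsS_def)

lemma clsB_eq: "subquotient.cls PP NB = clsB"
  using subquotient.cls_def[OF subqB] by (auto simp: clsB_def)

lemmas clsS_iff = subquotient.cls_eq_iff[OF subq, unfolded clsS_eq]
lemmas clsB_iff = subquotient.cls_eq_iff[OF subqB, unfolded clsB_eq]
lemmas clsS_zero_iff = subquotient.cls_zero_iff[OF subq, unfolded clsS_eq]
lemmas clsB_zero_iff = subquotient.cls_zero_iff[OF subqB, unfolded clsB_eq]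

lemma ES: "rees_ext R J J = pol (W 0)"
  unfolding rees_ext_eq[OF J J] W_0 ideal_pow.simps(2) ..

lemma S_unfold: "S = poly_quot R (pol (W 0)) NS"
  unfolding sally_module_def ES rees_ext_eq[OF J Q] ..

lemma B_unfold: "B = poly_quot R TT NB"
  unfolding rees_fibre_def T_carrier rees_ext_eq[OF mid Q] ..

lemma poly_quot_ops: "carrier (poly_quot R E N) = carrier (quot_module (self_module PP E) N)"
  "\<zero>\<^bsub>poly_quot R E N\<^esub> = \<zero>\<^bsub>quot_module (self_module PP E) N\<^esub>"
  "X \<oplus>\<^bsub>poly_quot R E N\<^esub> Y = X \<oplus>\<^bsub>quot_module (self_module PP E) N\<^esub> Y"
  "t \<odot>\<^bsub>poly_quot R E N\<^esub> X = t \<odot>\<^bsub>quot_module (self_module PP E) N\<^esub> X"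
  "hpart (poly_quot R E N) i = (\<lambda>f. N +>\<^bsub>PP\<^esub> f) ` (E \<inter> poly_hpart R i)"
  by (simp_all add: poly_quot_def module.defs gmodule.defs)

lemma S_carrier: "carrier S = clsS ` pol (W 0)"
  unfolding S_unfold poly_quot_ops subquotient.qm_carrier[OF subq] clsS_eq ..
lemma S_zero: "\<zero>\<^bsub>S\<^esub> = clsS \<zero>\<^bsub>PP\<^esub>"
  unfolding S_unfold poly_quot_ops subquotient.qm_zero[OF subq] clsS_eq ..
lemma S_add: "f \<in> carrier PP ==> g \<in> carrier PP ==> clsS f \<oplus>\<^bsub>S\<^esub> clsS g = clsS (f \<oplus>\<^bsub>PP\<^esub> g)"
  unfolding S_unfold poly_quot_ops using subquotient.qm_add[OF subq] unfolding clsS_eq .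
lemma S_smult: "t \<in> TT ==> f \<in> pol (W 0) ==> t \<odot>\<^bsub>S\<^esub> clsS f = clsS (t \<otimes>\<^bsub>PP\<^esub> f)"
  unfolding S_unfold poly_quot_ops using subquotient.qm_smult[OF subq] unfolding clsS_eq .
lemma S_hpart: "hpart S i = clsS ` (pol (W 0) \<inter> poly_hpart R i)"
  unfolding S_unfold poly_quot_ops clsS_def ..

lemma B_carrier: "carrier B = clsB ` TT"
  unfolding B_unfold poly_quot_ops subquotient.qm_carrier[OF subqB] clsB_eq ..
lemma B_zero: "\<zero>\<^bsub>B\<^esub> = clsB \<zero>\<^bsub>PP\<^esub>"
  unfolding B_unfold poly_quot_ops subquotient.qm_zero[OF subqB] clsB_eq ..
lemma B_add: "f \<in> carrier PP ==> g \<in> carrier PP ==> clsB f \<oplus>\<^bsub>B\<^esub> clsB g = clsB (f \<oplus>\<^bsub>PP\<^esub> g)"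
  unfolding B_unfold poly_quot_ops using subquotient.qm_add[OF subqB] unfolding clsB_eq .
lemma B_smult: "t \<in> TT ==> f \<in> TT ==> t \<odot>\<^bsub>B\<^esub> clsB f = clsB (t \<otimes>\<^bsub>PP\<^esub> f)"
  unfolding B_unfold poly_quot_ops using subquotient.qm_smult[OF subqB] unfolding clsB_eq .
lemma B_hpart: "hpart B i = clsB ` (TT \<inter> poly_hpart R i)"
  unfolding B_unfold poly_quot_ops clsB_def ..

lemma pol_W_le: "pol (W j) \<subseteq> pol (W 0)"
  by (rule pol_mono) (use W_le_0 W_0 in auto)

lemma module_B: "module T B"
  by (rule subquotient.module_of_classes[OF subqB, unfolded clsB_eq])
    (simp_all add: T_cring T_carrier rees_simps B_carrier B_zero B_add B_smult polD(1))

lemma module_S: "module T S"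
  by (rule subquotient.module_of_classes[OF subq[of 0], unfolded clsS_eq])
    (simp_all add: T_cring T_carrier rees_simps S_carrier S_zero S_add S_smult polD(1)[of _ "W 0"])

lemma mon0_T: "a \<in> carrier R ==> mnm a 0 \<in> TT"
  by (rule mon_pol[OF Qpi]) simp

text \<open>Graded submodules of \<open>S\<close> are obtained from families of ideals that are compatible with
  multiplication by powers of \<open>Q\<close>; the filtration and the submodule generated in degree one are of
  this form.\<close>

lemma submodule_pol:
  assumes Ei: "\<And>i. ideal (E i) R" and QE: "\<And>i j a b. a \<in> Qp i ==> b \<in> E j ==> a \<otimes> b \<in> E (i + j)"
    and EJ: "\<And>i. E i \<subseteq> Jp (Suc i)"
  shows "submodule (clsS ` pol E) T S"
proof (rule module.submoduleI[OF module_S])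
  interpret M: module T S by (rule module_S)
  have pol_E_le: "pol E \<subseteq> pol (W 0)" by (rule pol_mono) (simp add: EJ W_0)
  show "clsS ` pol E \<subseteq> carrier S" unfolding S_carrier using pol_E_le by blast
  show "\<zero>\<^bsub>S\<^esub> \<in> clsS ` pol E" unfolding S_zero by (rule imageI) (rule pol_zero[OF Ei])
  show add: "X \<oplus>\<^bsub>S\<^esub> Y \<in> clsS ` pol E" if "X \<in> clsS ` pol E" "Y \<in> clsS ` pol E" for X Y
  proof -
    obtain f g where f: "f \<in> pol E" "X = clsS f" and g: "g \<in> pol E" "Y = clsS g"
      using \<open>X \<in> clsS ` pol E\<close> \<open>Y \<in> clsS ` pol E\<close> by blast
    have "X \<oplus>\<^bsub>S\<^esub> Y = clsS (f \<oplus>\<^bsub>PP\<^esub> g)" unfolding f(2) g(2) by (rule S_add) (use polD(1) f(1) g(1) in auto)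
    then show ?thesis using pol_add[OF Ei f(1) g(1)] by simp
  qed
  show sm: "a \<odot>\<^bsub>S\<^esub> X \<in> clsS ` pol E" if a: "a \<in> carrier T" and X: "X \<in> clsS ` pol E" for a X
  proof -
    obtain f where f: "f \<in> pol E" "X = clsS f" using X by blast
    have a': "a \<in> TT" using a T_carrier by simp
    have "a \<otimes>\<^bsub>PP\<^esub> f \<in> pol E" by (rule pol_mult[of E Qp E]) (use Ei QE a' f(1) in auto)
    then show ?thesis using f S_smult[OF a', of f] pol_E_le by blast
  qed
  show "\<ominus>\<^bsub>S\<^esub> X \<in> clsS ` pol E" if X: "X \<in> clsS ` pol E" for X
  proof -
    have Xc: "X \<in> carrier S" using X pol_E_le unfolding S_carrier by blast
    have "(\<ominus>\<^bsub>T\<^esub> \<one>\<^bsub>T\<^esub>) \<odot>\<^bsub>S\<^esub> X = \<ominus>\<^bsub>S\<^esub> X" using M.smult_l_minus[of "\<one>\<^bsub>T\<^esub>" X] Xc by simp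
    then show ?thesis using sm[OF _ X, of "\<ominus>\<^bsub>T\<^esub> \<one>\<^bsub>T\<^esub>"] by simp
  qed
qed

lemma submodule_W: "submodule (clsS ` pol (W j)) T S"
  by (rule submodule_pol) (simp_all add: Wi Qp_W W_le_0)

text \<open>A homogeneous element of \<open>\<mm>^j S\<close> of degree \<open>i\<close> is a sum of products of elements of
  \<open>\<mm>^j\<close> and \<open>J^(i+1)\<close>, up to \<open>J Q^i\<close>; an arbitrary one is the sum of
  its components.\<close>

lemma mS_span: "submod_span T S {mnm a 0 \<odot>\<^bsub>S\<^esub> X | a X. a \<in> mp j \<and> X \<in> carrier S} = clsS ` pol (W j)"
  (is "submod_span T S ?X = _")
proof
  have "?X \<subseteq> clsS ` pol (W j)"
  proof
    fix Y assume "Y \<in> ?X"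
    then obtain a f where a: "a \<in> mp j" and f: "f \<in> pol (W 0)" and Y: "Y = mnm a 0 \<odot>\<^bsub>S\<^esub> clsS f" unfolding S_carrier by blast
    have ac: "a \<in> carrier R" using idl_carr[OF mpi a] .
    have fc: "f \<in> carrier PP" using polD(1)[OF f] .
    have "mnm a 0 \<otimes>\<^bsub>PP\<^esub> f \<in> pol (W j)"
      unfolding pol_def
    proof (intro CollectI conjI allI)
      show "mnm a 0 \<otimes>\<^bsub>PP\<^esub> f \<in> carrier PP" using ac fc by simp
      fix i
      have "a \<otimes> cf f i \<in> mp j \<cdot> Jp (Suc i)" using a polD(2)[OF f, of i] unfolding W_0 by (rule prod_mem)
      then show "cf (mnm a 0 \<otimes>\<^bsub>PP\<^esub> f) i \<in> W j i"
        unfolding W_def UP.monom_mult_is_smult[OF ac fc] UP.coeff_smult[OF ac fc]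
        using sum_ge1[OF prod_ideal[OF mpi Jpi] JQi] by blast
    qed
    then show "Y \<in> clsS ` pol (W j)" unfolding Y S_smult[OF mon0_T[OF ac] f] by blast
  qed
  then show "submod_span T S ?X \<subseteq> clsS ` pol (W j)" unfolding submod_span_def using submodule_W by blast
  show "clsS ` pol (W j) \<subseteq> submod_span T S ?X"
    unfolding submod_span_def
  proof (intro Inter_greatest)
    fix N assume "N \<in> {N. submodule N T S \<and> ?X \<subseteq> N}"
    then have N: "submodule N T S" and XN: "?X \<subseteq> N" by auto
    interpret N: submodule N T S by (rule N)
    have Nadd: "X \<oplus>\<^bsub>S\<^esub> Y \<in> N" if "X \<in> N" "Y \<in> N" for X Y using N.m_closed that by simp
    have N0: "clsS \<zero>\<^bsub>PP\<^esub> \<in> N" using N.one_closed S_zero by simp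
    have prod: "c \<in> mp j \<cdot> Jp (Suc i) ==> clsS (mnm c i) \<in> N" for c i
    proof (induct rule: ideal_prod.induct)
      case (prod a e)
      have c: "a \<in> carrier R" "e \<in> carrier R" using idl_carr mpi Jpi prod by blast+
      have me: "mnm e i \<in> pol (W 0)" by (rule mon_pol[OF Wi]) (use prod W_0 in auto)
      then have "mnm a 0 \<odot>\<^bsub>S\<^esub> clsS (mnm e i) \<in> N" using XN prod(1) unfolding S_carrier by blast
      moreover have "mnm a 0 \<otimes>\<^bsub>PP\<^esub> mnm e i = mnm (a \<otimes> e) i" using UP.monom_mult[OF c, of 0 i] by simp
      ultimately show ?case using S_smult[OF mon0_T[OF c(1)] me] by simp
    next
      case (sum u v)
      have c: "u \<in> carrier R" "v \<in> carrier R" using idl_carr[OF prod_ideal[OF mpi Jpi]] sum by blast+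
      then show ?case using Nadd[OF sum(2,4)] S_add[of "mnm u i" "mnm v i"] by simp
    qed
    have comp: "clsS (mnm c i) \<in> N" if "c \<in> W j i" for c i
    proof -
      obtain u v where u: "u \<in> mp j \<cdot> Jp (Suc i)" and v: "v \<in> J \<cdot> Qp i" and c: "c = u \<oplus> v" using \<open>c \<in> W j i\<close> unfolding W_def sum_mem by blast
      have cc: "u \<in> carrier R" "v \<in> carrier R" using idl_carr[OF prod_ideal[OF mpi Jpi] u] idl_carr[OF JQi v] by auto
      have "mnm v i \<in> NS" by (rule mon_pol[of "\<lambda>i. J \<cdot> Qp i"]) (use JQi v in auto)
      then have "clsS (mnm v i) \<in> N" using clsS_zero_iff[of "mnm v i"] cc N0 by simp
      then show ?thesis using Nadd[OF prod[OF u], of "clsS (mnm v i)"] S_add[of "mnm u i" "mnm v i"] cc c by (simp add: UP.monom_add)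
    qed
    show "clsS ` pol (W j) \<subseteq> N"
    proof
      fix Y assume "Y \<in> clsS ` pol (W j)"
      then obtain f where f: "f \<in> pol (W j)" "Y = clsS f" by blast
      have "f \<in> {f \<in> carrier PP. clsS f \<in> N}"
        by (rule components_mem[OF polD(1)[OF f(1)]])
          (use N0 Nadd S_add comp polD[OF f(1)] in \<open>auto simp flip: S_add\<close>)
      then show "Y \<in> N" using f by simp
    qed
  qed
qed

definition mS :: "nat => (nat => 'a, (nat => 'a) set) gmodule" where
  "mS j = ideal_smult R Q (mp j) S"

lemma mS_ops: "carrier (mS j) = clsS ` pol (W j)" "\<zero>\<^bsub>mS j\<^esub> = clsS \<zero>\<^bsub>PP\<^esub>" "X \<oplus>\<^bsub>mS j\<^esub> Y = X \<oplus>\<^bsub>S\<^esub> Y"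
  "t \<odot>\<^bsub>mS j\<^esub> X = t \<odot>\<^bsub>S\<^esub> X" "hpart (mS j) i = clsS ` pol (W j) \<inter> hpart S i"
  unfolding mS_def ideal_smult_def mS_span by (simp_all add: gsub_def S_zero)

lemma module_mS: "module T (mS j)"
  by (rule subquotient.module_of_classes[OF subq[of j], unfolded clsS_eq])
    (simp_all add: T_cring T_carrier rees_simps mS_ops S_add S_smult polD(1)[of _ "W j"] subsetD[OF pol_W_le])

lemma mS_hpart: "hpart (mS j) i = clsS ` (pol (W j) \<inter> poly_hpart R i)"
proof
  show "clsS ` (pol (W j) \<inter> poly_hpart R i) \<subseteq> hpart (mS j) i"
    unfolding mS_ops S_hpart using pol_W_le by blast
  show "hpart (mS j) i \<subseteq> clsS ` (pol (W j) \<inter> poly_hpart R i)"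
  proof
    fix Y assume "Y \<in> hpart (mS j) i"
    then obtain f e where f: "f \<in> pol (W j)" "Y = clsS f" and e: "e \<in> pol (W 0)" "e \<in> poly_hpart R i" "Y = clsS e"
      unfolding mS_ops S_hpart by blast
    have c: "e \<in> carrier PP" "f \<in> carrier PP" using polD e f by blast+
    have "e \<ominus>\<^bsub>PP\<^esub> f \<in> NS" using clsS_iff[OF c] e f by simp
    then have "e \<ominus>\<^bsub>PP\<^esub> f \<in> pol (W j)" using pol_mono[of _ "W j", OF N_le_W] by blast
    then have "(e \<ominus>\<^bsub>PP\<^esub> f) \<oplus>\<^bsub>PP\<^esub> f \<in> pol (W j)" using pol_add[of "W j", OF Wi] f(1) by blast
    then have "e \<in> pol (W j)" using UP.P.diff_identities(1)[OF c] by simp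
    then show "Y \<in> clsS ` (pol (W j) \<inter> poly_hpart R i)" using e by blast
  qed
qed

definition Bsum :: "nat => (nat => 'a, nat => (nat => 'a) set) gmodule" where
  "Bsum s = gpower (gshift B (-1)) s"

lemma Bsum_ops: "carrier (Bsum s) = {..<s} \<rightarrow>\<^sub>E carrier B" "\<zero>\<^bsub>Bsum s\<^esub> = (\<lambda>i\<in>{..<s}. \<zero>\<^bsub>B\<^esub>)"
  "v \<oplus>\<^bsub>Bsum s\<^esub> w = (\<lambda>i\<in>{..<s}. v i \<oplus>\<^bsub>B\<^esub> w i)" "t \<odot>\<^bsub>Bsum s\<^esub> v = (\<lambda>i\<in>{..<s}. t \<odot>\<^bsub>B\<^esub> v i)"
  "hpart (Bsum s) i = {..<s} \<rightarrow>\<^sub>E hpart B (-1 + i)"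
  by (simp_all add: Bsum_def gpower_def gshift_def mod_power_def module.defs gmodule.defs)

lemma Bsum_mod_power: "mod_hom T M (Bsum s) = mod_hom T M (mod_power B s)" "carrier (Bsum s) = carrier (mod_power B s)"
  "\<zero>\<^bsub>Bsum s\<^esub> = \<zero>\<^bsub>mod_power B s\<^esub>"
  by (simp_all add: mod_hom_def Bsum_ops) (simp_all add: mod_power_def)

subsection \<open>The multiplicative set outside the extended maximal ideal\<close>

abbreviation (input) "U \<equiv> carrier T - rees_ext R \<mm> Q"

lemma U_eq: "U = TT - NB" unfolding T_carrier rees_ext_eq[OF mid Q] ..

text \<open>If neither factor lies in \<open>\<mm>\<T>\<close>, take the lowest coefficients that are nonzero in the fibre;
  the corresponding coefficient of the product is nonzero because the fibre is a domain.\<close>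

lemma fibre_prime:
  assumes F: "F \<in> TT" and G: "G \<in> TT" and FG: "F \<otimes>\<^bsub>PP\<^esub> G \<in> NB"
  shows "F \<in> NB \<or> G \<in> NB"
proof (rule ccontr)
  assume "\<not> ?thesis"
  then have nF: "\<exists>i. cf F i \<notin> \<mm> \<cdot> Qp i" and nG: "\<exists>i. cf G i \<notin> \<mm> \<cdot> Qp i" using polD(1)[OF F] polD(1)[OF G] unfolding pol_def by auto
  define i where "i = (LEAST i. cf F i \<notin> \<mm> \<cdot> Qp i)"
  define j where "j = (LEAST i. cf G i \<notin> \<mm> \<cdot> Qp i)"
  have i: "cf F i \<notin> \<mm> \<cdot> Qp i" "\<And>a. a < i ==> cf F a \<in> \<mm> \<cdot> Qp a"
    unfolding i_def using LeastI_ex[OF nF] not_less_Least by blast+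
  have j: "cf G j \<notin> \<mm> \<cdot> Qp j" "\<And>a. a < j ==> cf G a \<in> \<mm> \<cdot> Qp a"
    unfolding j_def using LeastI_ex[OF nG] not_less_Least by blast+
  note Fc = polD(1)[OF F] and Gc = polD(1)[OF G]
  let ?h = "\<lambda>a. cf F a \<otimes> cf G (i + j - a)"
  have hc: "?h \<in> {..i + j} \<rightarrow> carrier R" using Fc Gc by simp
  have others: "?h a \<in> \<mm> \<cdot> Qp (i + j)" if a: "a \<in> {..i + j} - {i}" for a
  proof (cases "a < i")
    case True
    have "cf G (i + j - a) \<otimes> cf F a \<in> \<mm> \<cdot> Qp ((i + j - a) + a)" by (rule Qp_mQ[OF polD(2)[OF G] i(2)[OF True]])
    then show ?thesis using a Fc Gc by (simp add: m_comm)
  next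
    case False
    then have "i + j - a < j" using a by auto
    then have "cf F a \<otimes> cf G (i + j - a) \<in> \<mm> \<cdot> Qp (a + (i + j - a))" by (intro Qp_mQ[OF polD(2)[OF F]] j(2))
    then show ?thesis using a by simp
  qed
  have "cf (F \<otimes>\<^bsub>PP\<^esub> G) (i + j) = finsum R ?h {..i + j}" using Fc Gc by simp
  also have "{..i + j} = insert i ({..i + j} - {i})" by auto
  also have "finsum R ?h (insert i ({..i + j} - {i})) = ?h i \<oplus> finsum R ?h ({..i + j} - {i})"
    using Fc Gc by (intro finsum_insert) auto
  finally have "?h i \<oplus> finsum R ?h ({..i + j} - {i}) \<in> \<mm> \<cdot> Qp (i + j)" using polD(2)[OF FG, of "i + j"] by simp
  moreover have "finsum R ?h ({..i + j} - {i}) \<in> \<mm> \<cdot> Qp (i + j)" by (rule idl_finsum[OF mQi others]) auto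
  moreover have "?h i \<in> carrier R" "finsum R ?h ({..i + j} - {i}) \<in> carrier R" using Fc Gc by auto
  ultimately have "?h i \<in> \<mm> \<cdot> Qp (i + j)" by (meson idl_addD[OF mQi])
  then have "cf F i \<otimes> cf G j \<in> Qp (i + j) \<cdot> \<mm>" using prod_comm[OF mid Qpi] by simp
  then have "cf F i \<in> Qp i \<cdot> \<mm> \<or> cf G j \<in> Qp j \<cdot> \<mm>"
    using fibre_domain[OF mprime xxs_m rs polD(2)[OF F] polD(2)[OF G]] by blast
  then show False using i(1) j(1) prod_comm[OF mid Qpi] by simp
qed

lemma one_U: "\<one>\<^bsub>PP\<^esub> \<in> U"
  unfolding U_eq using one_pol[OF Q] polD(2)[of "\<one>\<^bsub>PP\<^esub>" "\<lambda>i. \<mm> \<cdot> Qp i" 0] one_notin_m ideal_prod_one[OF mid] by auto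

lemma U_loc: "localization T S U"
proof (intro localization.intro localization_axioms.intro)
  show "module T S" by (rule module_S)
  show "U \<subseteq> carrier T" by blast
  show "\<one>\<^bsub>T\<^esub> \<in> U" using one_U by (simp add: rees_simps)
  show "u \<otimes>\<^bsub>T\<^esub> v \<in> U" if "u \<in> U" "v \<in> U" for u v
    using that fibre_prime[of u v] pow_pol_mult[OF Q, of u v] unfolding U_eq by (auto simp: rees_simps)
qed

lemma B_torsion_free: "u \<in> U ==> b \<in> carrier B ==> u \<odot>\<^bsub>B\<^esub> b = \<zero>\<^bsub>B\<^esub> ==> b = \<zero>\<^bsub>B\<^esub>"
proof -
  assume u: "u \<in> U" and "b \<in> carrier B" and ub: "u \<odot>\<^bsub>B\<^esub> b = \<zero>\<^bsub>B\<^esub>"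
  then obtain F where F: "F \<in> TT" "b = clsB F" unfolding B_carrier by blast
  have u': "u \<in> TT" "u \<notin> NB" using u unfolding U_eq by auto
  have c: "F \<in> carrier PP" "u \<in> carrier PP" using F u' polD by blast+
  have "clsB (u \<otimes>\<^bsub>PP\<^esub> F) = clsB \<zero>\<^bsub>PP\<^esub>" using ub B_smult[OF u'(1) F(1)] F B_zero by simp
  then have "u \<otimes>\<^bsub>PP\<^esub> F \<in> NB" using clsB_zero_iff[of "u \<otimes>\<^bsub>PP\<^esub> F"] c by simp
  then have "F \<in> NB" using fibre_prime[OF u'(1) F(1)] u' by blast
  then show ?thesis using clsB_zero_iff[OF c(1)] F B_zero by simp
qed

text \<open>Two elements \<open>F\<close> and \<open>G\<close> of the fibre satisfy the relation
  \<open>F G - G F = 0\<close>, in which one of them is regarded as a scalar.\<close>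

lemma B_rank_one:
  assumes "b \<in> carrier B" "b \<noteq> \<zero>\<^bsub>B\<^esub>" "y \<in> carrier B"
  shows "\<exists>u\<in>U. \<exists>t\<in>carrier T. u \<odot>\<^bsub>B\<^esub> y \<oplus>\<^bsub>B\<^esub> t \<odot>\<^bsub>B\<^esub> b = \<zero>\<^bsub>B\<^esub>"
proof -
  obtain F where F: "F \<in> TT" "b = clsB F" using assms(1) unfolding B_carrier by blast
  obtain G where G: "G \<in> TT" "y = clsB G" using assms(3) unfolding B_carrier by blast
  have c: "F \<in> carrier PP" "G \<in> carrier PP" using F G polD by blast+
  have FU: "F \<in> U" unfolding U_eq using F assms(2) clsB_zero_iff[OF c(1)] B_zero by auto
  have nG: "\<ominus>\<^bsub>PP\<^esub> G \<in> TT" by (rule pol_neg[OF Qpi G(1)])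
  have "F \<odot>\<^bsub>B\<^esub> y \<oplus>\<^bsub>B\<^esub> (\<ominus>\<^bsub>PP\<^esub> G) \<odot>\<^bsub>B\<^esub> b = clsB (F \<otimes>\<^bsub>PP\<^esub> G \<oplus>\<^bsub>PP\<^esub> (\<ominus>\<^bsub>PP\<^esub> G) \<otimes>\<^bsub>PP\<^esub> F)"
    using B_smult[OF F(1) G(1)] B_smult[OF nG F(1)] B_add[of "F \<otimes>\<^bsub>PP\<^esub> G" "(\<ominus>\<^bsub>PP\<^esub> G) \<otimes>\<^bsub>PP\<^esub> F"] F G c by simp
  also have "F \<otimes>\<^bsub>PP\<^esub> G \<oplus>\<^bsub>PP\<^esub> (\<ominus>\<^bsub>PP\<^esub> G) \<otimes>\<^bsub>PP\<^esub> F = \<zero>\<^bsub>PP\<^esub>"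
    using c UP.P.m_comm[of F G] by (simp add: UP.P.l_minus UP.P.r_neg)
  finally show ?thesis unfolding B_zero[symmetric] using FU nG T_carrier by blast
qed

lemma B_nonzero: "clsB \<one>\<^bsub>PP\<^esub> \<in> carrier B" "clsB \<one>\<^bsub>PP\<^esub> \<noteq> \<zero>\<^bsub>B\<^esub>"
  using one_U clsB_zero_iff[of "\<one>\<^bsub>PP\<^esub>"] unfolding U_eq B_carrier B_zero by auto

end

section \<open>The layers of the filtration\<close>

context sally_setting
begin

lemma Q_JSuc: "a \<in> Qp (Suc i) ==> b \<in> J ==> a \<otimes> b \<in> Qp i \<cdot> Jp 2"
proof -
  assume "a \<in> Qp (Suc i)" "b \<in> J"
  then have "a \<otimes> b \<in> (Qp i \<cdot> Qp (Suc 0)) \<cdot> J" using pow_add[OF Q, of i "Suc 0"] by (simp add: prod_mem)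
  also have "\<dots> = Qp i \<cdot> (Q \<cdot> J)" unfolding pow_one[OF Q] by (rule prod_assoc[OF Qpi Q J])
  also have "\<dots> \<subseteq> Qp i \<cdot> Jp 2"
    by (rule prod_mono[OF subset_refl]) (use prod_mono[OF QJ subset_refl, of J] pow_one[OF J] in \<open>simp add: numeral_2_eq_2 ideal_pow.simps(2)[of _ _ "Suc 0"]\<close>)
  finally show ?thesis .
qed

text \<open>The submodule generated by the classes of \<open>J\<^sup>2 t\<close> has degree two component
  \<open>Q J\<^sup>2\<close> modulo \<open>J Q\<^sup>2 \<subseteq> Q J\<^sup>2\<close>, while that of
  \<open>S\<close> is \<open>J\<^sup>3\<close>.\<close>

lemma cube_of_generation:
  assumes gen: "carrier S = submod_span T S (hpart S 1)"
  shows "Jp 3 = Q \<cdot> Jp 2"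
proof
  have eq3: "Jp 3 = J \<cdot> Jp 2" by (simp add: numeral_3_eq_3 numeral_2_eq_2 ideal_pow.simps(2)[of _ _ "Suc (Suc 0)"])
  show "Q \<cdot> Jp 2 \<subseteq> Jp 3" unfolding eq3 by (rule prod_mono[OF QJ subset_refl])
  define V where "V i = (case i of 0 => J | Suc k => Qp k \<cdot> Jp 2)" for i
  have V: "V 0 = J" "V (Suc k) = Qp k \<cdot> Jp 2" for k by (simp_all add: V_def)
  have Vi: "ideal (V i) R" for i using prod_ideal[OF Qpi Jpi] J by (cases i) (simp_all add: V)
  have QV: "a \<otimes> b \<in> V (i + j)" if a: "a \<in> Qp i" and b: "b \<in> V j" for i j a b
  proof (cases j)
    case 0
    then show ?thesis
      using a b Q_JSuc[of a "i - 1" b] idl_l[OF J, of b a] idl_carr[OF Qpi a] by (cases i) (simp_all add: V)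
  next
    case (Suc k)
    have "a \<otimes> b \<in> Qp i \<cdot> (Qp k \<cdot> Jp 2)" using a b Suc by (intro prod_mem) (simp_all add: V)
    then show ?thesis using Suc pow_add[OF Q, of i k] prod_assoc[OF Qpi Qpi Jpi, of i k 2] by (simp add: V)
  qed
  have VJ: "V i \<subseteq> Jp (Suc i)" for i
  proof (cases i)
    case (Suc k)
    have "Qp k \<cdot> Jp 2 \<subseteq> Jp k \<cdot> Jp 2" by (rule prod_mono[OF QpJp subset_refl])
    also have "\<dots> = Jp (k + 2)" by (rule pow_add[OF J, symmetric])
    finally show ?thesis using Suc by (simp add: V)
  qed (simp add: V pow_one[OF J])
  have NV: "J \<cdot> Qp i \<subseteq> V i" for i
  proof (rule prod_le[OF Vi])
    fix b a assume "b \<in> J" "a \<in> Qp i"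
    then show "b \<otimes> a \<in> V i" using QV[of a i b 0] idl_carr[OF J, of b] idl_carr[OF Qpi, of a i] by (simp add: V m_comm)
  qed
  have V1: "V (Suc 0) = Jp 2" using prod_one[OF Jpi] by (simp add: V)
  have "hpart S 1 \<subseteq> clsS ` pol V"
  proof
    fix X assume "X \<in> hpart S 1"
    then obtain a where a: "a \<in> carrier R" "mnm a (Suc 0) \<in> pol (W 0)" and X: "X = clsS (mnm a (Suc 0))"
      unfolding S_hpart poly_hpart_def by auto
    have "a \<in> V (Suc 0)" using mon_polD[OF a] unfolding W_0 V1 by (simp add: numeral_2_eq_2)
    then have "mnm a (Suc 0) \<in> pol V" by (rule mon_pol[of V, OF Vi])
    then show "X \<in> clsS ` pol V" using X by blast
  qed
  then have "carrier S \<subseteq> clsS ` pol V"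
    unfolding gen submod_span_def using submodule_pol[of V, OF Vi QV VJ] by blast
  then have le: "clsS ` pol (W 0) \<subseteq> clsS ` pol V" unfolding S_carrier .
  show "Jp 3 \<subseteq> Q \<cdot> Jp 2"
  proof
    fix a assume a: "a \<in> Jp 3"
    have ac: "a \<in> carrier R" using idl_carr[OF Jpi a] .
    have "mnm a 2 \<in> pol (W 0)" by (rule mon_pol[of "W 0", OF Wi]) (use a in \<open>simp add: W_0 numeral_3_eq_3 numeral_2_eq_2\<close>)
    then obtain v where v: "v \<in> pol V" "clsS (mnm a 2) = clsS v" using le by blast
    have vc: "v \<in> carrier PP" using polD(1)[OF v(1)] .
    have "mnm a 2 \<ominus>\<^bsub>PP\<^esub> v \<in> NS" using clsS_iff[of "mnm a 2" v] v(2) ac vc by simp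
    then have "mnm a 2 \<ominus>\<^bsub>PP\<^esub> v \<in> pol V" using pol_mono[of _ V, OF NV] by blast
    then have "(mnm a 2 \<ominus>\<^bsub>PP\<^esub> v) \<oplus>\<^bsub>PP\<^esub> v \<in> pol V" using pol_add[of V, OF Vi] v(1) by blast
    then have "mnm a 2 \<in> pol V" using UP.P.diff_identities(1)[of "mnm a 2" v] ac vc by simp
    then have "a \<in> V 2" using mon_polD[OF ac] by blast
    then show "a \<in> Q \<cdot> Jp 2" using pow_one[OF Q] by (simp add: numeral_2_eq_2 V)
  qed
qed

end

text \<open>If \<open>J\<^sup>3 = Q J\<^sup>2\<close>, the ideals \<open>W j i\<close> for \<open>i \<ge> 1\<close> are
  determined by those for \<open>i = 1\<close>, and in degree zero \<open>W j 0 = J\<close> contributes nothing to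
  \<open>S\<close>.\<close>

locale sally_cube = sally_setting +
  assumes J3: "ideal_pow R J 3 = (Idl (set (x # xs))) \<cdot> ideal_pow R J 2"
begin

lemma Jp_Suc_Suc: "Jp (Suc (Suc k)) = Qp k \<cdot> Jp 2"
proof (induct k)
  case 0 then show ?case using prod_one[OF Jpi] by (simp add: numeral_2_eq_2)
next
  case (Suc k)
  have "Jp (Suc (Suc (Suc k))) = J \<cdot> (Qp k \<cdot> Jp 2)" using Suc by (simp add: ideal_pow.simps(2)[of _ _ "Suc (Suc k)"])
  also have "\<dots> = Qp k \<cdot> (J \<cdot> Jp 2)" by (rule prod_lcomm[OF J Qpi Jpi])
  also have "J \<cdot> Jp 2 = Q \<cdot> Jp 2" using J3 by (simp add: numeral_3_eq_3 numeral_2_eq_2 ideal_pow.simps(2)[of _ _ "Suc (Suc 0)"])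
  also have "Qp k \<cdot> (Q \<cdot> Jp 2) = Qp (Suc k) \<cdot> Jp 2"
    unfolding ideal_pow.simps(2) using prod_lcomm[OF Qpi Q Jpi] prod_assoc[OF Q Qpi Jpi] by simp
  finally show ?case .
qed

lemma W_at_0: "W j 0 = J"
  unfolding W_def ideal_pow.simps(1) pow_one[OF J] ideal_prod_one[OF J]
  using prod_le2[OF mpi J] sum_le[OF J] sum_ge2[OF prod_ideal[OF mpi J] J] by (simp add: subset_antisym)

lemma W_Suc: "W j (Suc k) = Qp k \<cdot> W j (Suc 0)"
proof -
  have "Qp k \<cdot> W j (Suc 0) = Qp k \<cdot> (mp j \<cdot> Jp 2) <+> Qp k \<cdot> (J \<cdot> Q)"
    unfolding W_def pow_one[OF Q] by (subst ideal_prod_r_distr) (simp_all add: Qpi mpi Jpi J Q prod_ideal numeral_2_eq_2)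
  also have "Qp k \<cdot> (mp j \<cdot> Jp 2) = mp j \<cdot> Jp (Suc (Suc k))"
    unfolding Jp_Suc_Suc by (rule prod_lcomm[OF Qpi mpi Jpi])
  also have "Qp k \<cdot> (J \<cdot> Q) = J \<cdot> Qp (Suc k)"
    unfolding ideal_pow.simps(2) using prod_lcomm[OF Qpi J Q] prod_comm[OF Qpi Q] by simp
  finally show ?thesis unfolding W_def ..
qed

lemma W_decr: "W (Suc j) i \<subseteq> W j i"
  unfolding W_def by (rule sum_mono[OF prod_mono]) (use pow_Suc_le[OF mid] in auto)

lemma m_W: "\<mm> \<cdot> W j i \<subseteq> W (Suc j) i"
proof -
  have "\<mm> \<cdot> W j i = \<mm> \<cdot> (mp j \<cdot> Jp (Suc i)) <+> \<mm> \<cdot> (J \<cdot> Qp i)"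
    unfolding W_def by (rule ideal_prod_r_distr[OF mid prod_ideal[OF mpi Jpi] JQi])
  also have "\<dots> \<subseteq> mp (Suc j) \<cdot> Jp (Suc i) <+> J \<cdot> Qp i"
    by (rule sum_mono) (use prod_assoc[OF mid mpi Jpi, of j "Suc i"] prod_le2[OF mid JQi] in \<open>simp_all add: ideal_pow.simps(2)[of _ \<mm>]\<close>)
  finally show ?thesis unfolding W_def .
qed

end

text \<open>One layer \<open>\<mm>^j S / \<mm>^(j+1) S\<close> of the filtration, with minimal generators \<open>m\<close>
  of its part of degree one.\<close>

locale sally_layer = sally_cube +
  fixes j s :: nat and m :: "nat => 'a"
  assumes mZ: "\<And>r. r < s ==> m r \<in> W j (Suc 0)"
    and Zeq: "W j (Suc 0) = lin_set s m (carrier R) (W (Suc j) (Suc 0))"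
    and ind: "\<And>c r. (\<And>r. c r \<in> carrier R) ==> (\<Oplus>r\<in>{..<s}. c r \<otimes> m r) \<in> W (Suc j) (Suc 0) ==> r < s ==> c r \<in> \<mm>"
begin

abbreviation (input) "Z \<equiv> W j (Suc 0)"
abbreviation (input) "D \<equiv> W (Suc j) (Suc 0)"
abbreviation (input) "E' \<equiv> pol (W (Suc j))"

lemma mc: "r < s ==> m r \<in> carrier R" using mZ idl_carr[OF Wi] by blast

text \<open>The map from a free module over \<open>\<T>\<close> to \<open>\<mm>^j S\<close> given by the generators
  \<open>m r t\<close>, on the level of polynomials. The factor \<open>t\<close> accounts for the shift by
  \<open>-1\<close>.\<close>

definition mix :: "(nat => nat => 'a) => nat => 'a" where
  "mix \<Phi> = (\<Oplus>\<^bsub>PP\<^esub>r\<in>{..<s}. \<Phi> r \<otimes>\<^bsub>PP\<^esub> mnm (m r) (Suc 0))"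

lemma mix_carr: "(\<And>r. \<Phi> r \<in> carrier PP) ==> mix \<Phi> \<in> carrier PP"
  unfolding mix_def by (rule UP.P.finsum_closed) (auto simp: mc)

lemma mix_coeff:
  assumes \<Phi>: "\<And>r. \<Phi> r \<in> carrier PP"
  shows "cf (mix \<Phi>) (Suc k) = (\<Oplus>r\<in>{..<s}. cf (\<Phi> r) k \<otimes> m r)" "cf (mix \<Phi>) 0 = \<zero>"
proof -
  have e: "cf (mix \<Phi>) i = (\<Oplus>r\<in>{..<s}. cf (\<Phi> r \<otimes>\<^bsub>PP\<^esub> mnm (m r) (Suc 0)) i)" for i
    unfolding mix_def by (rule UP.coeff_finsum) (auto simp: \<Phi> mc)
  show "cf (mix \<Phi>) (Suc k) = (\<Oplus>r\<in>{..<s}. cf (\<Phi> r) k \<otimes> m r)"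
    unfolding e by (rule finsum_cong') (use \<Phi> mc coeff_mult_mon1(1)[unfolded One_nat_def] in auto)
  show "cf (mix \<Phi>) 0 = \<zero>"
    unfolding e by (rule add.finprod_one_eqI) (use \<Phi> mc coeff_mult_mon1(2)[unfolded One_nat_def] in auto)
qed

lemma mix_add: "(\<And>r. \<Phi> r \<in> carrier PP) ==> (\<And>r. \<Psi> r \<in> carrier PP) ==> mix (\<lambda>r. \<Phi> r \<oplus>\<^bsub>PP\<^esub> \<Psi> r) = mix \<Phi> \<oplus>\<^bsub>PP\<^esub> mix \<Psi>"
proof -
  assume c: "\<And>r. \<Phi> r \<in> carrier PP" "\<And>r. \<Psi> r \<in> carrier PP"
  let ?h = "\<lambda>\<Phi> r. \<Phi> r \<otimes>\<^bsub>PP\<^esub> mnm (m r) (Suc 0)"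
  have "mix (\<lambda>r. \<Phi> r \<oplus>\<^bsub>PP\<^esub> \<Psi> r) = (\<Oplus>\<^bsub>PP\<^esub>r\<in>{..<s}. ?h \<Phi> r \<oplus>\<^bsub>PP\<^esub> ?h \<Psi> r)"
    unfolding mix_def by (rule UP.P.finsum_cong') (auto simp: c mc UP.P.l_distr)
  also have "\<dots> = mix \<Phi> \<oplus>\<^bsub>PP\<^esub> mix \<Psi>"
    unfolding mix_def by (rule UP.P.finsum_addf) (auto simp: c mc)
  finally show ?thesis .
qed

lemma mix_mult: "t \<in> carrier PP ==> (\<And>r. \<Phi> r \<in> carrier PP) ==> mix (\<lambda>r. t \<otimes>\<^bsub>PP\<^esub> \<Phi> r) = t \<otimes>\<^bsub>PP\<^esub> mix \<Phi>"
  unfolding mix_def by (subst UP.P.finsum_rdistr) (auto simp: mc UP.P.m_assoc intro!: UP.P.finsum_cong')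

lemma TTc: "f \<in> TT ==> f \<in> carrier PP" by (rule polD(1))

lemma mix_W: assumes "\<And>r. \<Phi> r \<in> TT" shows "mix \<Phi> \<in> pol (W j)"
  unfolding pol_def
proof (intro CollectI conjI allI)
  show "mix \<Phi> \<in> carrier PP" by (rule mix_carr) (rule TTc[OF assms])
  fix i show "cf (mix \<Phi>) i \<in> W j i"
  proof (cases i)
    case 0 then show ?thesis using mix_coeff(2)[of \<Phi>] TTc[OF assms] idl_zero[OF Wi] by simp
  next
    case (Suc k)
    have "(\<Oplus>r\<in>{..<s}. cf (\<Phi> r) k \<otimes> m r) \<in> Qp k \<cdot> Z"
      by (rule idl_finsum[OF prod_ideal[OF Qpi Wi]]) (auto intro: prod_mem polD(2)[OF assms] mZ)
    then show ?thesis using mix_coeff(1)[of \<Phi> k] TTc[OF assms] Suc W_Suc[of j k] by simp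
  qed
qed

lemma mix_NB: assumes "\<And>r. \<Phi> r \<in> TT" "\<And>r. r < s ==> \<Phi> r \<in> NB" shows "mix \<Phi> \<in> E'"
  unfolding pol_def
proof (intro CollectI conjI allI)
  show "mix \<Phi> \<in> carrier PP" by (rule mix_carr) (rule TTc[OF assms(1)])
  fix i show "cf (mix \<Phi>) i \<in> W (Suc j) i"
  proof (cases i)
    case 0 then show ?thesis using mix_coeff(2)[of \<Phi>] TTc[OF assms(1)] idl_zero[OF Wi] by simp
  next
    case (Suc k)
    have le: "(\<mm> \<cdot> Qp k) \<cdot> Z \<subseteq> Qp k \<cdot> D"
    proof -
      have "(\<mm> \<cdot> Qp k) \<cdot> Z = Qp k \<cdot> (\<mm> \<cdot> Z)" using prod_assoc[OF mid Qpi Wi] prod_lcomm[OF mid Qpi Wi] by simp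
      also have "\<dots> \<subseteq> Qp k \<cdot> D" by (rule prod_mono[OF subset_refl m_W])
      finally show ?thesis .
    qed
    have "(\<Oplus>r\<in>{..<s}. cf (\<Phi> r) k \<otimes> m r) \<in> Qp k \<cdot> D"
    proof (rule idl_finsum[OF prod_ideal[OF Qpi Wi]])
      fix r assume "r \<in> {..<s}"
      then have "cf (\<Phi> r) k \<otimes> m r \<in> (\<mm> \<cdot> Qp k) \<cdot> Z" using polD(2)[OF assms(2)] mZ by (intro prod_mem) auto
      then show "cf (\<Phi> r) k \<otimes> m r \<in> Qp k \<cdot> D" using le by blast
    qed simp
    then show ?thesis using mix_coeff(1)[of \<Phi> k] TTc[OF assms(1)] Suc W_Suc[of "Suc j" k] by simp
  qed
qed

lemma layer_forms: "form_setting R x xs Z D J"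
proof (intro form_setting.intro form_setting_axioms.intro)
  show "cring R" by (rule is_cring)
  show "set (x # xs) \<subseteq> carrier R" by (rule xxs)
  then have xsc: "set xs \<subseteq> carrier R" by (auto simp: list.set(2))
  show "quasi_regular xs" using rs by (intro rseq_quasi_regular[OF xsc]) simp
  show "w \<in> Idl (set xs)" if "w \<in> carrier R" "x \<otimes> w \<in> Idl (set xs)" for w using rs that by simp
  show "ideal Z R" "ideal D R" "ideal J R" by (rule Wi Wi J)+
  show "D \<subseteq> Z" by (rule W_decr)
  have "Q \<cdot> J = J \<cdot> Qp (Suc 0)" unfolding pow_one[OF Q] by (rule prod_comm[OF Q J])
  then show "Q \<cdot> J \<subseteq> D" using N_le_W[of "Suc 0" "Suc j"] by simp
  show "Idl (set xs) \<inter> Z \<subseteq> (Idl (set xs)) \<cdot> J"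
    using tail W_le_0[of j "Suc 0"] by (auto simp: numeral_2_eq_2)
qed

text \<open>Together with \<open>mix_NB\<close> this says that the kernel of the induced map to the layer is exactly
  \<open>\<mm>\<T>\<close> in each coordinate. Compare coefficients in each degree; independence over the forms in
  the parameters is \<open>form_independence\<close>.\<close>

lemma mix_inj:
  assumes \<Phi>: "\<And>r. \<Phi> r \<in> TT" and mx: "mix \<Phi> \<in> E'" and r: "r < s"
  shows "\<Phi> r \<in> NB"
  unfolding pol_def
proof (intro CollectI conjI allI)
  show "\<Phi> r \<in> carrier PP" by (rule TTc[OF \<Phi>])
  fix k
  have "(\<Oplus>r\<in>{..<s}. cf (\<Phi> r) k \<otimes> m r) = cf (mix \<Phi>) (Suc k)" using mix_coeff(1)[of \<Phi> k] TTc[OF \<Phi>] by simp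
  also have "\<dots> \<in> Qp k \<cdot> D" using polD(2)[OF mx, of "Suc k"] W_Suc[of "Suc j" k] by simp
  finally have sum: "(\<Oplus>r\<in>{..<s}. cf (\<Phi> r) k \<otimes> m r) \<in> Qp k \<cdot> D" .
  have "cf (\<Phi> r) k \<in> Qp k \<cdot> \<mm>"
    by (rule form_setting.form_independence[OF layer_forms, of s m \<mm> "\<lambda>r. cf (\<Phi> r) k"])
      (use mZ mid ind polD(2)[OF \<Phi>] sum r in auto)
  then show "cf (\<Phi> r) k \<in> \<mm> \<cdot> Qp k" using prod_comm[OF mid Qpi] by simp
qed

text \<open>\<open>\<Phi>\<close> is a coordinate vector of \<open>f\<close> in the layer: \<open>f\<close> is the
  combination of the generators with coefficients \<open>\<Phi>\<close> modulo \<open>\<mm>^(j+1) S\<close>.\<close>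

definition expands :: "(nat => 'a) => (nat => nat => 'a) => bool" where
  "expands f \<Phi> \<longleftrightarrow> f \<in> carrier PP \<and> (\<forall>r. \<Phi> r \<in> TT) \<and> f \<ominus>\<^bsub>PP\<^esub> mix \<Phi> \<in> E'"

lemma expandsD: "expands f \<Phi> ==> f \<in> carrier PP" "expands f \<Phi> ==> \<Phi> r \<in> TT" "expands f \<Phi> ==> f \<ominus>\<^bsub>PP\<^esub> mix \<Phi> \<in> E'"
  "expands f \<Phi> ==> \<Phi> r \<in> carrier PP" "expands f \<Phi> ==> mix \<Phi> \<in> carrier PP"
  by (auto simp: expands_def TTc intro!: mix_carr)

lemma expands_add: assumes "expands f \<Phi>" "expands g \<Psi>" shows "expands (f \<oplus>\<^bsub>PP\<^esub> g) (\<lambda>r. \<Phi> r \<oplus>\<^bsub>PP\<^esub> \<Psi> r)"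
proof -
  note a = expandsD[OF assms(1)] and b = expandsD[OF assms(2)]
  have "(f \<oplus>\<^bsub>PP\<^esub> g) \<ominus>\<^bsub>PP\<^esub> mix (\<lambda>r. \<Phi> r \<oplus>\<^bsub>PP\<^esub> \<Psi> r) = (f \<ominus>\<^bsub>PP\<^esub> mix \<Phi>) \<oplus>\<^bsub>PP\<^esub> (g \<ominus>\<^bsub>PP\<^esub> mix \<Psi>)"
    unfolding mix_add[OF a(4) b(4)] using a(1,5) b(1,5) by (simp add: a_minus_def UP.P.minus_add UP.P.a_ac)
  then show ?thesis unfolding expands_def using a(1-3) b(1-3) pol_add[of "W (Suc j)", OF Wi] pol_add[of Qp, OF Qpi] by simp
qed

lemma expands_mult: assumes t: "t \<in> TT" and "expands f \<Phi>" shows "expands (t \<otimes>\<^bsub>PP\<^esub> f) (\<lambda>r. t \<otimes>\<^bsub>PP\<^esub> \<Phi> r)"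
proof -
  note a = expandsD[OF assms(2)]
  have tc: "t \<in> carrier PP" by (rule TTc[OF t])
  have e: "t \<otimes>\<^bsub>PP\<^esub> f \<ominus>\<^bsub>PP\<^esub> mix (\<lambda>r. t \<otimes>\<^bsub>PP\<^esub> \<Phi> r) = t \<otimes>\<^bsub>PP\<^esub> (f \<ominus>\<^bsub>PP\<^esub> mix \<Phi>)"
    unfolding mix_mult[OF tc a(4)] using a(1,5) tc by (simp add: a_minus_def UP.P.r_distr UP.P.r_minus)
  have "t \<otimes>\<^bsub>PP\<^esub> (f \<ominus>\<^bsub>PP\<^esub> mix \<Phi>) \<in> E'"
    by (rule pol_mult[of "W (Suc j)" Qp "W (Suc j)"]) (use Wi Qp_W t a(3) in auto)
  then show ?thesis unfolding expands_def e using a(1,2) tc t pow_pol_mult[OF Q t] by simp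
qed

lemma expands_neg: "expands f \<Phi> ==> expands (\<ominus>\<^bsub>PP\<^esub> f) (\<lambda>r. \<ominus>\<^bsub>PP\<^esub> \<Phi> r)"
proof -
  assume g: "expands f \<Phi>"
  have "\<ominus>\<^bsub>PP\<^esub> \<one>\<^bsub>PP\<^esub> \<in> TT" by (rule pol_neg[OF Qpi one_pol[OF Q]])
  then show ?thesis using expands_mult[of "\<ominus>\<^bsub>PP\<^esub> \<one>\<^bsub>PP\<^esub>" f \<Phi>] g expandsD(1,4)[OF g] by (simp add: UP.P.l_minus)
qed

lemma expands_E': assumes "expands f \<Phi>" "f \<in> E'" "r < s" shows "\<Phi> r \<in> NB"
proof (rule mix_inj[OF expandsD(2)[OF assms(1)] _ assms(3)])
  note a = expandsD[OF assms(1)]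
  have "f \<ominus>\<^bsub>PP\<^esub> (f \<ominus>\<^bsub>PP\<^esub> mix \<Phi>) \<in> E'" by (rule pol_diff[of "W (Suc j)", OF Wi assms(2) a(3)])
  moreover have "f \<ominus>\<^bsub>PP\<^esub> (f \<ominus>\<^bsub>PP\<^esub> mix \<Phi>) = mix \<Phi>"
    using UP.P.diff_identities(3)[OF a(1,5)] unfolding a_minus_def[of _ f "f \<ominus>\<^bsub>PP\<^esub> mix \<Phi>"] .
  ultimately show "mix \<Phi> \<in> E'" by simp
qed

lemma expands_unique:
  assumes "expands f \<Phi>" "expands g \<Psi>" "f \<ominus>\<^bsub>PP\<^esub> g \<in> E'" "r < s"
  shows "clsB (\<Phi> r) = clsB (\<Psi> r)"
proof -
  have "expands (f \<ominus>\<^bsub>PP\<^esub> g) (\<lambda>r. \<Phi> r \<ominus>\<^bsub>PP\<^esub> \<Psi> r)"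
    using expands_add[OF assms(1) expands_neg[OF assms(2)]] by (simp add: a_minus_def)
  then have "\<Phi> r \<ominus>\<^bsub>PP\<^esub> \<Psi> r \<in> NB" using expands_E' assms(3,4) by blast
  then show ?thesis using clsB_iff[of "\<Phi> r" "\<Psi> r"] expandsD(4)[OF assms(1)] expandsD(4)[OF assms(2)] by simp
qed

lemma mix_zero: "mix (\<lambda>_. \<zero>\<^bsub>PP\<^esub>) = \<zero>\<^bsub>PP\<^esub>"
  unfolding mix_def by (rule UP.P.add.finprod_one_eqI) (simp add: mc)

lemma expands_zero: "f \<in> E' ==> expands f (\<lambda>_. \<zero>\<^bsub>PP\<^esub>)"
  unfolding expands_def mix_zero using pol_zero[of Qp, OF Qpi] polD(1)[of f "W (Suc j)"] by (simp add: a_minus_def)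

text \<open>A homogeneous element has homogeneous coordinates: \<open>W j (k+1)\<close> is \<open>Q^k\<close> times
  \<open>W j 1\<close>, and the latter is spanned by the generators.\<close>

lemma expands_monom: assumes "a \<in> W j (Suc k)" shows "\<exists>c. (\<forall>r. c r \<in> Qp k) \<and> expands (mnm a (Suc k)) (\<lambda>r. mnm (c r) k)"
proof -
  have base: "ideal (lin_set s m (Qp k) (Qp k \<cdot> D)) R" by (rule lin_set_ideal[OF Qpi prod_ideal[OF Qpi Wi] mc])
  have "Qp k \<cdot> Z \<subseteq> lin_set s m (Qp k) (Qp k \<cdot> D)"
  proof (rule prod_le[OF base])
    fix q z assume q: "q \<in> Qp k" and "z \<in> Z"
    then obtain c b where c: "\<forall>r. c r \<in> carrier R" and b: "b \<in> D" and z: "z = (\<Oplus>r\<in>{..<s}. c r \<otimes> m r) \<oplus> b"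
      unfolding Zeq lin_set_def by blast
    have qc: "q \<in> carrier R" "b \<in> carrier R" using idl_carr[OF Qpi q] idl_carr[OF Wi b] by auto
    have sc: "(\<Oplus>r\<in>{..<s}. c r \<otimes> m r) \<in> carrier R" by (rule finsum_closed) (use c mc in auto)
    have "q \<otimes> z = (\<Oplus>r\<in>{..<s}. q \<otimes> (c r \<otimes> m r)) \<oplus> q \<otimes> b"
      unfolding z using qc sc by (subst finsum_rdistr[symmetric]) (auto simp: r_distr c mc)
    also have "(\<Oplus>r\<in>{..<s}. q \<otimes> (c r \<otimes> m r)) = (\<Oplus>r\<in>{..<s}. (q \<otimes> c r) \<otimes> m r)"
      by (rule finsum_cong') (use c mc qc in \<open>auto simp: m_assoc\<close>)
    finally show "q \<otimes> z \<in> lin_set s m (Qp k) (Qp k \<cdot> D)"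
      unfolding lin_set_def using prod_mem[OF q b] idl_r[OF Qpi q] c
      by (intro CollectI exI[of _ "\<lambda>r. q \<otimes> c r"] exI[of _ "q \<otimes> b"]) auto
  qed
  then obtain c b where c: "\<forall>r. c r \<in> Qp k" and b: "b \<in> Qp k \<cdot> D" and a: "a = (\<Oplus>r\<in>{..<s}. c r \<otimes> m r) \<oplus> b"
    using assms unfolding W_Suc[of j k] lin_set_def by blast
  have T: "mnm (c r) k \<in> TT" for r by (rule mon_pol[of Qp, OF Qpi]) (simp add: c)
  have cc: "c r \<in> carrier R" for r using c idl_carr[OF Qpi] by blast
  have bc: "b \<in> carrier R" using idl_carr[OF prod_ideal[OF Qpi Wi] b] .
  have sc: "(\<Oplus>r\<in>{..<s}. c r \<otimes> m r) \<in> carrier R" by (rule finsum_closed) (use cc mc in auto)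
  have ac: "a \<in> carrier R" unfolding a using sc bc by simp
  have mxc: "mix (\<lambda>r. mnm (c r) k) \<in> carrier PP" by (rule mix_carr) (simp add: cc)
  have eq: "mnm a (Suc k) \<ominus>\<^bsub>PP\<^esub> mix (\<lambda>r. mnm (c r) k) = mnm b (Suc k)"
  proof (rule UP.up_eqI)
    fix i show "cf (mnm a (Suc k) \<ominus>\<^bsub>PP\<^esub> mix (\<lambda>r. mnm (c r) k)) i = cf (mnm b (Suc k)) i"
    proof (cases i)
      case 0 then show ?thesis using mix_coeff(2)[of "\<lambda>r. mnm (c r) k"] cc ac bc mxc by (simp add: coeff_minus a_minus_def)
    next
      case (Suc l)
      have mx: "cf (mix (\<lambda>r. mnm (c r) k)) (Suc l) = (\<Oplus>r\<in>{..<s}. cf (mnm (c r) k) l \<otimes> m r)"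
        by (rule mix_coeff(1)) (simp add: cc)
      show ?thesis
      proof (cases "l = k")
        case True
        have "(\<Oplus>r\<in>{..<s}. cf (mnm (c r) k) l \<otimes> m r) = (\<Oplus>r\<in>{..<s}. c r \<otimes> m r)"
          by (rule finsum_cong') (use True cc mc in auto)
        then have "cf (mnm a (Suc k) \<ominus>\<^bsub>PP\<^esub> mix (\<lambda>r. mnm (c r) k)) i = ((\<Oplus>r\<in>{..<s}. c r \<otimes> m r) \<oplus> b) \<ominus> (\<Oplus>r\<in>{..<s}. c r \<otimes> m r)"
          using Suc True mx ac mxc by (simp add: coeff_minus a[symmetric])
        also have "\<dots> = b" by (rule diff_identities(4)[OF sc bc])
        finally show ?thesis using Suc True bc by simp
      next
        case False
        have "(\<Oplus>r\<in>{..<s}. cf (mnm (c r) k) l \<otimes> m r) = \<zero>"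
          by (rule add.finprod_one_eqI) (use False cc mc in auto)
        then show ?thesis using Suc False mx ac bc mxc by (simp add: coeff_minus a_minus_def)
      qed
    qed
  qed (use ac bc mxc in auto)
  have "mnm b (Suc k) \<in> E'" by (rule mon_pol[of "W (Suc j)", OF Wi]) (use b W_Suc[of "Suc j" k] in simp)
  then show ?thesis using T c ac unfolding expands_def by (intro exI[of _ c]) (simp add: eq)
qed

lemma expands_ex: assumes f: "f \<in> pol (W j)" shows "\<exists>\<Phi>. expands f \<Phi>"
proof -
  have "f \<in> {f \<in> carrier PP. \<exists>\<Phi>. expands f \<Phi>}"
  proof (rule components_mem[OF polD(1)[OF f]])
    show "\<zero>\<^bsub>PP\<^esub> \<in> {f \<in> carrier PP. \<exists>\<Phi>. expands f \<Phi>}" using expands_zero[OF pol_zero[of "W (Suc j)", OF Wi]] by auto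
    show "g \<oplus>\<^bsub>PP\<^esub> h \<in> {f \<in> carrier PP. \<exists>\<Phi>. expands f \<Phi>}"
      if "g \<in> {f \<in> carrier PP. \<exists>\<Phi>. expands f \<Phi>}" "h \<in> {f \<in> carrier PP. \<exists>\<Phi>. expands f \<Phi>}" for g h
      using that expands_add by fastforce
    fix i
    have ci: "cf f i \<in> W j i" by (rule polD(2)[OF f])
    have "\<exists>\<Phi>. expands (mnm (cf f i) i) \<Phi>"
    proof (cases i)
      case 0
      have "mnm (cf f i) i \<in> E'" by (rule mon_pol[of "W (Suc j)", OF Wi]) (use ci 0 in \<open>simp add: W_at_0\<close>)
      then show ?thesis using expands_zero by blast
    next
      case (Suc k) then show ?thesis using expands_monom[of "cf f i" k] ci by auto
    qed
    then show "mnm (cf f i) i \<in> {f \<in> carrier PP. \<exists>\<Phi>. expands f \<Phi>}" using polD(1)[OF f] by simp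
  qed auto
  then show ?thesis by simp
qed

text \<open>The coordinates of a class modulo \<open>\<mm>\<T>\<close>; they do not depend on the representative nor on the
  choice of \<open>\<Phi>\<close>, by \<open>expands_unique\<close>.\<close>

definition coords :: "(nat => 'a) set => nat => (nat => 'a) set" where
  "coords X = (\<lambda>r\<in>{..<s}. clsB ((SOME \<Phi>. \<exists>f. X = clsS f \<and> expands f \<Phi>) r))"

lemma coords_eq: assumes "expands f \<Phi>" shows "coords (clsS f) = (\<lambda>r\<in>{..<s}. clsB (\<Phi> r))"
proof -
  have "\<exists>\<Phi>. \<exists>g. clsS f = clsS g \<and> expands g \<Phi>" using assms by blast
  from someI_ex[OF this] obtain g where g: "clsS f = clsS g" "expands g (SOME \<Phi>. \<exists>g. clsS f = clsS g \<and> expands g \<Phi>)" by blast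
  have "f \<ominus>\<^bsub>PP\<^esub> g \<in> NS" using clsS_iff[OF expandsD(1)[OF assms] expandsD(1)[OF g(2)]] g(1) by simp
  then have "f \<ominus>\<^bsub>PP\<^esub> g \<in> E'" using pol_mono[of _ "W (Suc j)", OF N_le_W] by blast
  then show ?thesis unfolding coords_def using expands_unique[OF assms g(2)] by (auto intro!: restrict_ext)
qed

text \<open>Coordinates exist for every element and are unique modulo \<open>\<mm>\<T>\<close>, and the elements whose
  coordinates vanish modulo \<open>\<mm>\<T>\<close> are those of \<open>\<mm>^(j+1) S\<close>.\<close>

theorem layer_exact: "graded_short_exact T (mS (Suc j)) (mS j) (Bsum s) (\<lambda>X. X) coords"
  unfolding graded_short_exact_def
proof (intro conjI)
  have le: "E' \<subseteq> pol (W j)" by (rule pol_mono[OF W_decr])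
  show "(\<lambda>X. X) \<in> graded_hom T (mS (Suc j)) (mS j)"
    unfolding graded_hom_def mod_hom_def mS_hpart using le by (auto simp: mS_ops(1,3,4))
  show "inj_on (\<lambda>X. X) (carrier (mS (Suc j)))" by simp
  have vB: "(\<lambda>r\<in>{..<s}. clsB (\<Phi> r)) \<in> carrier (Bsum s)" if "expands f \<Phi>" for f \<Phi>
    unfolding Bsum_ops B_carrier using expandsD(2)[OF that] by auto
  have coords_closed: "coords X \<in> carrier (Bsum s)" if X: "X \<in> carrier (mS j)" for X
  proof -
    obtain f where f: "f \<in> pol (W j)" "X = clsS f" using X unfolding mS_ops by blast
    obtain \<Phi> where g: "expands f \<Phi>" using expands_ex[OF f(1)] by blast
    show ?thesis unfolding f(2) coords_eq[OF g] by (rule vB[OF g])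
  qed
  show "coords \<in> graded_hom T (mS j) (Bsum s)"
    unfolding graded_hom_def
  proof (intro CollectI conjI allI)
    show "coords \<in> mod_hom T (mS j) (Bsum s)"
      unfolding mod_hom_def
    proof (intro CollectI conjI ballI Pi_I)
      show "coords X \<in> carrier (Bsum s)" if "X \<in> carrier (mS j)" for X by (rule coords_closed[OF that])
      fix X assume "X \<in> carrier (mS j)"
      then obtain f where f: "f \<in> pol (W j)" "X = clsS f" unfolding mS_ops by blast
      obtain \<Phi> where g: "expands f \<Phi>" using expands_ex[OF f(1)] by blast
      fix Y assume "Y \<in> carrier (mS j)"
      then obtain f' where f': "f' \<in> pol (W j)" "Y = clsS f'" unfolding mS_ops by blast
      obtain \<Psi> where g': "expands f' \<Psi>" using expands_ex[OF f'(1)] by blast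
      have "X \<oplus>\<^bsub>mS j\<^esub> Y = clsS (f \<oplus>\<^bsub>PP\<^esub> f')" unfolding f f' mS_ops by (rule S_add[OF expandsD(1)[OF g] expandsD(1)[OF g']])
      then show "coords (X \<oplus>\<^bsub>mS j\<^esub> Y) = coords X \<oplus>\<^bsub>Bsum s\<^esub> coords Y"
        using coords_eq[OF expands_add[OF g g']] coords_eq[OF g] coords_eq[OF g'] f(2) f'(2) B_add expandsD(4)[OF g] expandsD(4)[OF g']
        by (auto simp: Bsum_ops intro!: restrict_ext)
    next
      fix t X assume "t \<in> carrier T"
      then have t: "t \<in> TT" unfolding T_carrier .
      assume "X \<in> carrier (mS j)"
      then obtain f where f: "f \<in> pol (W j)" "X = clsS f" unfolding mS_ops by blast
      obtain \<Phi> where g: "expands f \<Phi>" using expands_ex[OF f(1)] by blast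
      have "f \<in> pol (W 0)" using f(1) pol_W_le by blast
      then have "t \<odot>\<^bsub>mS j\<^esub> X = clsS (t \<otimes>\<^bsub>PP\<^esub> f)" unfolding f mS_ops by (rule S_smult[OF t])
      then show "coords (t \<odot>\<^bsub>mS j\<^esub> X) = t \<odot>\<^bsub>Bsum s\<^esub> coords X"
        using coords_eq[OF expands_mult[OF t g]] coords_eq[OF g] f(2) B_smult[OF t expandsD(2)[OF g]]
        by (auto simp: Bsum_ops intro!: restrict_ext)
    qed
    fix i show "coords ` hpart (mS j) i \<subseteq> hpart (Bsum s) i"
    proof
      fix v assume "v \<in> coords ` hpart (mS j) i"
      then obtain f where f: "f \<in> pol (W j)" "f \<in> poly_hpart R i" and v: "v = coords (clsS f)" unfolding mS_hpart by blast
      have "\<exists>\<Phi>. expands f \<Phi> \<and> (\<forall>r. \<Phi> r \<in> TT \<inter> poly_hpart R (-1 + i))"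
      proof (cases "i \<le> 0")
        case True
        have "f \<in> E'"
        proof (cases "i = 0")
          case True
          then obtain a where a: "a \<in> carrier R" "f = mnm a 0" using f(2) unfolding poly_hpart_def by auto
          then have "a \<in> W j 0" using mon_polD[OF a(1)] f(1) by simp
          then show ?thesis unfolding a(2) W_at_0 by (intro mon_pol[of "W (Suc j)", OF Wi]) (simp add: W_at_0)
        next
          case False then show ?thesis using True f(2) pol_zero[of "W (Suc j)", OF Wi] by (simp add: poly_hpart_def)
        qed
        then have "expands f (\<lambda>_. \<zero>\<^bsub>PP\<^esub>)" by (rule expands_zero)
        then show ?thesis using True pol_zero[of Qp, OF Qpi] by (intro exI[of _ "\<lambda>_. \<zero>\<^bsub>PP\<^esub>"]) (simp add: poly_hpart_def)
      next
        case False
        then obtain k where k: "i = int (Suc k)" by (metis not_le zero_less_imp_eq_int gr0_implies_Suc)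
        obtain a where a: "a \<in> carrier R" "f = mnm a (Suc k)" using f(2) k unfolding poly_hpart_def by (auto simp: nat_add_distrib)
        have "a \<in> W j (Suc k)" using mon_polD[OF a(1)] f(1) a(2) by simp
        then obtain c where c: "\<forall>r. c r \<in> Qp k" "expands (mnm a (Suc k)) (\<lambda>r. mnm (c r) k)" using expands_monom by blast
        have "mnm (c r) k \<in> TT \<inter> poly_hpart R (-1 + i)" for r
          using expandsD(2)[OF c(2)] idl_carr[OF Qpi c(1)[rule_format]] k by (auto simp: poly_hpart_def)
        then show ?thesis using c(2) a(2) by blast
      qed
      then obtain \<Phi> where \<Phi>: "expands f \<Phi>" "\<forall>r. \<Phi> r \<in> TT \<inter> poly_hpart R (-1 + i)" by blast
      show "v \<in> hpart (Bsum s) i" unfolding v coords_eq[OF \<Phi>(1)] Bsum_ops B_hpart using \<Phi>(2) by auto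
    qed
  qed
  show "(\<lambda>X. X) ` carrier (mS (Suc j)) = {X \<in> carrier (mS j). coords X = \<zero>\<^bsub>Bsum s\<^esub>}"
  proof (intro equalityI subsetI)
    fix X assume "X \<in> (\<lambda>X. X) ` carrier (mS (Suc j))"
    then obtain f where f: "f \<in> E'" "X = clsS f" unfolding mS_ops by auto
    show "X \<in> {X \<in> carrier (mS j). coords X = \<zero>\<^bsub>Bsum s\<^esub>}"
      using f le coords_eq[OF expands_zero[OF f(1)]] by (auto simp: mS_ops Bsum_ops B_zero)
  next
    fix X assume "X \<in> {X \<in> carrier (mS j). coords X = \<zero>\<^bsub>Bsum s\<^esub>}"
    then obtain f where f: "f \<in> pol (W j)" "X = clsS f" and z: "coords X = \<zero>\<^bsub>Bsum s\<^esub>" unfolding mS_ops by blast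
    obtain \<Phi> where g: "expands f \<Phi>" using expands_ex[OF f(1)] by blast
    have "\<Phi> r \<in> NB" if "r < s" for r
      using fun_cong[OF z, of r] that clsB_zero_iff[OF expandsD(4)[OF g]] unfolding f(2) coords_eq[OF g] Bsum_ops B_zero by simp
    then have "mix \<Phi> \<in> E'" by (rule mix_NB[OF expandsD(2)[OF g]])
    then have "(f \<ominus>\<^bsub>PP\<^esub> mix \<Phi>) \<oplus>\<^bsub>PP\<^esub> mix \<Phi> \<in> E'" by (rule pol_add[of "W (Suc j)", OF Wi expandsD(3)[OF g]])
    then have "f \<in> E'" using UP.P.diff_identities(1)[OF expandsD(1)[OF g] expandsD(5)[OF g]] by simp
    then show "X \<in> (\<lambda>X. X) ` carrier (mS (Suc j))" using f by (auto simp: mS_ops)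
  qed
  show "coords ` carrier (mS j) = carrier (Bsum s)"
  proof
    show "coords ` carrier (mS j) \<subseteq> carrier (Bsum s)" using coords_closed by blast
    show "carrier (Bsum s) \<subseteq> coords ` carrier (mS j)"
    proof
      fix v assume v: "v \<in> carrier (Bsum s)"
      then have "\<forall>r\<in>{..<s}. \<exists>F\<in>TT. v r = clsB F" unfolding Bsum_ops B_carrier by (auto simp: PiE_iff)
      then obtain F where F: "\<And>r. r < s ==> F r \<in> TT \<and> v r = clsB (F r)" by (metis lessThan_iff)
      define \<Phi> where "\<Phi> r = (if r < s then F r else \<zero>\<^bsub>PP\<^esub>)" for r
      have T: "\<Phi> r \<in> TT" for r unfolding \<Phi>_def using F pol_zero[of Qp, OF Qpi] by simp
      have mw: "mix \<Phi> \<in> pol (W j)" by (rule mix_W[OF T])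
      have "expands (mix \<Phi>) \<Phi>"
        unfolding expands_def using T polD(1)[OF mw] pol_zero[of "W (Suc j)", OF Wi] by (simp add: UP.P.r_neg a_minus_def)
      then have "coords (clsS (mix \<Phi>)) = v"
        using coords_eq v F unfolding Bsum_ops by (auto simp: \<Phi>_def PiE_iff extensional_def fun_eq_iff restrict_def)
      then show "v \<in> coords ` carrier (mS j)" using mw unfolding mS_ops by blast
    qed
  qed
qed

end

text \<open>The number of generators is positive unless the chain of ideals is stationary; this is what makes the ranks
  \<open>s i\<close> positive later on.\<close>

theorem (in sally_cube) layer_sequence:
  "\<exists>s g. graded_short_exact T (mS (Suc j)) (mS j) (Bsum s) (\<lambda>X. X) g \<and> (W (Suc j) (Suc 0) \<noteq> W j (Suc 0) --> s \<ge> 1)"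
proof -
  obtain s m where mZ: "\<forall>r<s. m r \<in> W j (Suc 0)"
    and Zeq: "W j (Suc 0) = lin_set s m (carrier R) (W (Suc j) (Suc 0))"
    and ind: "\<forall>c. (\<forall>r. c r \<in> carrier R) \<and> (\<Oplus>r\<in>{..<s}. c r \<otimes> m r) \<in> \<mm> \<cdot> W j (Suc 0) <+> W (Suc j) (Suc 0) --> (\<forall>r<s. c r \<in> \<mm>)"
    using minimal_generators[OF Wi[of j "Suc 0"] Wi[of "Suc j" "Suc 0"] W_decr] by (elim exE conjE)
  have "W (Suc j) (Suc 0) \<subseteq> \<mm> \<cdot> W j (Suc 0) <+> W (Suc j) (Suc 0)" by (rule sum_ge2[OF prod_ideal[OF mid Wi] Wi])
  then interpret L: sally_layer R \<mm> x xs J j s m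
    using mZ Zeq ind by unfold_locales blast+
  have "s \<ge> 1" if "W (Suc j) (Suc 0) \<noteq> W j (Suc 0)"
  proof (rule ccontr)
    assume "\<not> s \<ge> 1"
    then have "s = 0" by simp
    then have "W j (Suc 0) \<subseteq> W (Suc j) (Suc 0)"
      unfolding Zeq lin_set_def using idl_carr[OF Wi[of "Suc j" "Suc 0"]] by auto
    then show False using that W_decr by blast
  qed
  then show ?thesis using L.layer_exact by blast
qed

section \<open>Graded homomorphisms to the free modules over the fibre\<close>

lemma mod_homD:
  assumes "h \<in> mod_hom R M N"
  shows "x \<in> carrier M ==> h x \<in> carrier N" "x \<in> carrier M ==> y \<in> carrier M ==> h (x \<oplus>\<^bsub>M\<^esub> y) = h x \<oplus>\<^bsub>N\<^esub> h y"
    "r \<in> carrier R ==> x \<in> carrier M ==> h (r \<odot>\<^bsub>M\<^esub> x) = r \<odot>\<^bsub>N\<^esub> h x"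
  using assms unfolding mod_hom_def by auto

lemma mod_hom_inj:
  assumes "module R M" and h: "h \<in> mod_hom R M N" and ker: "{x \<in> carrier M. h x = \<zero>\<^bsub>N\<^esub>} = {\<zero>\<^bsub>M\<^esub>}"
  shows "inj_on h (carrier M)"
proof (rule inj_onI)
  interpret module R M by (rule assms(1))
  fix x y assume x: "x \<in> carrier M" and y: "y \<in> carrier M" and e: "h x = h y"
  let ?u = "\<ominus>\<^bsub>R\<^esub> \<one>\<^bsub>R\<^esub>"
  have neg: "?u \<odot>\<^bsub>M\<^esub> z = \<ominus>\<^bsub>M\<^esub> z" if "z \<in> carrier M" for z using that smult_l_minus[of "\<one>\<^bsub>R\<^esub>" z] by simp
  have hneg: "h (\<ominus>\<^bsub>M\<^esub> z) = ?u \<odot>\<^bsub>N\<^esub> h z" if "z \<in> carrier M" for z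
    using mod_homD(3)[OF h, of ?u z] neg[OF that] that by simp
  have "h (\<ominus>\<^bsub>M\<^esub> x) = h (\<ominus>\<^bsub>M\<^esub> y)" using hneg x y e by simp
  then have "h (y \<oplus>\<^bsub>M\<^esub> \<ominus>\<^bsub>M\<^esub> x) = h (y \<oplus>\<^bsub>M\<^esub> \<ominus>\<^bsub>M\<^esub> y)" using mod_homD(2)[OF h] x y by simp
  also have "\<dots> = h \<zero>\<^bsub>M\<^esub>" using y by (simp add: r_neg)
  also have "\<dots> = \<zero>\<^bsub>N\<^esub>" using ker by blast
  finally have "y \<oplus>\<^bsub>M\<^esub> \<ominus>\<^bsub>M\<^esub> x = \<zero>\<^bsub>M\<^esub>" using ker x y by blast
  then show "x = y" using x y by (metis add.inv_comm add.inv_inv add.m_comm local.minus_equality a_inv_closed minus_minus)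
qed

context sally_setting
begin

lemma Bsum_cases: "v \<in> carrier (Bsum s) ==> r < s ==> \<exists>F\<in>TT. v r = clsB F"
  by (auto simp: Bsum_ops B_carrier PiE_iff)

lemma Bsum_eqI: "v \<in> carrier (Bsum s) ==> w \<in> carrier (Bsum s) ==> (\<And>r. r < s ==> v r = w r) ==> v = w"
  unfolding Bsum_ops by (rule PiE_ext) auto

lemma B_hpart_le: "hpart B i \<subseteq> carrier B" unfolding B_hpart B_carrier by blast

lemma Bsum_hpart_le: "hpart (Bsum s) i \<subseteq> carrier (Bsum s)"
  using B_hpart_le by (fastforce simp: Bsum_ops PiE_iff)

lemma B_hpart_Suc: "X \<in> hpart B (int k) ==> \<exists>a. a \<in> Qp k \<and> X = clsB (mnm a k)"
  unfolding B_hpart poly_hpart_def using mon_polD[of _ k Qp] by auto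

lemma B_hpart_neg: "i < 0 ==> X \<in> hpart B i ==> X = clsB \<zero>\<^bsub>PP\<^esub>"
  unfolding B_hpart poly_hpart_def by auto

lemma mS_monom: "c \<in> W j i ==> clsS (mnm c i) \<in> hpart (mS j) (int i)"
  unfolding mS_hpart poly_hpart_def using mon_pol[of "W j" c i, OF Wi] idl_carr[OF Wi, of c j i] by auto

lemma mS_hpart_le: "hpart (mS j) i \<subseteq> carrier (mS j)"
  unfolding mS_hpart mS_ops(1) by blast

lemma mS_zero_hpart: "clsS \<zero>\<^bsub>PP\<^esub> \<in> hpart (mS j) i"
proof (cases "i < 0")
  case True
  then show ?thesis using pol_zero[of "W j", OF Wi] unfolding mS_hpart poly_hpart_def by auto
next
  case False
  then have "clsS (mnm \<zero> (nat i)) \<in> hpart (mS j) (int (nat i))" by (intro mS_monom idl_zero[OF Wi])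
  then show ?thesis using False by simp
qed

lemma graded_zero: assumes h: "h \<in> graded_hom T (mS j) (Bsum s)" shows "h (clsS \<zero>\<^bsub>PP\<^esub>) = \<zero>\<^bsub>Bsum s\<^esub>"
proof -
  have "h (clsS \<zero>\<^bsub>PP\<^esub>) \<in> hpart (Bsum s) (-1)" using h mS_zero_hpart[of j "-1"] unfolding graded_hom_def by blast
  then show ?thesis unfolding Bsum_ops B_zero using B_hpart_neg[of "-2"]
    by (auto simp: PiE_iff extensional_def fun_eq_iff restrict_def)
qed

text \<open>A class whose image is homogeneous of degree \<open>i\<close> may be replaced by its component of degree
  \<open>i\<close>: the images of the other components have no coordinate in degree \<open>i - 1\<close> of the
  fibre. This also shows that the inverse of a bijective graded homomorphism is graded.\<close>

lemma homogeneous_lift: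
  assumes h: "h \<in> graded_hom T (mS j) (Bsum s)" and X: "X \<in> carrier (mS j)" and hX: "h X \<in> hpart (Bsum s) i"
  shows "\<exists>Y\<in>hpart (mS j) i. h Y = h X"
proof (cases "i \<le> 0")
  case True
  have "h X = \<zero>\<^bsub>Bsum s\<^esub>" using hX True B_hpart_neg[of "-1 + i"] unfolding Bsum_ops B_zero
    by (auto simp: PiE_iff extensional_def fun_eq_iff restrict_def)
  then show ?thesis using graded_zero[OF h] mS_zero_hpart by metis
next
  case False
  then obtain k where k: "i = int (Suc k)" by (metis not_le zero_less_imp_eq_int gr0_implies_Suc)
  have hm: "h \<in> mod_hom T (mS j) (Bsum s)" and hg: "\<And>i. h ` hpart (mS j) i \<subseteq> hpart (Bsum s) i"
    using h unfolding graded_hom_def by auto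
  obtain f where f: "f \<in> pol (W j)" "X = clsS f" using X unfolding mS_ops by blast
  \<comment> \<open>The vectors without component in degree \<open>i\<close>, in terms of representatives; because of the shift this
    is degree \<open>k = i - 1\<close> of the fibre.\<close>
  define V where "V = {v \<in> carrier (Bsum s). \<forall>r<s. \<exists>F\<in>TT. v r = clsB F \<and> cf F k = \<zero>}"
  have z: "\<zero>\<^bsub>Bsum s\<^esub> \<in> V" unfolding V_def Bsum_ops B_carrier B_zero using pol_zero[of Qp, OF Qpi] by (auto intro!: bexI[of _ "\<zero>\<^bsub>PP\<^esub>"])
  have V_add: "v \<oplus>\<^bsub>Bsum s\<^esub> w \<in> V" if v: "v \<in> V" and w: "w \<in> V" for v w
  proof -
    have 1: "\<exists>H\<in>TT. (v \<oplus>\<^bsub>Bsum s\<^esub> w) r = clsB H \<and> cf H k = \<zero>" if r: "r < s" for r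
    proof -
      obtain F where F: "F \<in> TT" "v r = clsB F" "cf F k = \<zero>" using v r unfolding V_def by blast
      obtain G where G: "G \<in> TT" "w r = clsB G" "cf G k = \<zero>" using w r unfolding V_def by blast
      have c: "F \<in> carrier PP" "G \<in> carrier PP" using F G polD by blast+
      have "(v \<oplus>\<^bsub>Bsum s\<^esub> w) r = clsB (F \<oplus>\<^bsub>PP\<^esub> G)" using r F G B_add[OF c] by (simp add: Bsum_ops)
      then show ?thesis using pol_add[of Qp, OF Qpi F(1) G(1)] F G c by (intro bexI[of _ "F \<oplus>\<^bsub>PP\<^esub> G"]) auto
    qed
    moreover have "v \<oplus>\<^bsub>Bsum s\<^esub> w \<in> carrier (Bsum s)" using 1 unfolding Bsum_ops B_carrier by (fastforce simp: PiE_iff)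
    ultimately show ?thesis unfolding V_def by blast
  qed
  have other: "h (clsS (mnm c e)) \<in> V" if c: "c \<in> W j e" and e: "e \<noteq> Suc k" for c e
  proof (cases e)
    case 0
    have "h (clsS (mnm c e)) \<in> hpart (Bsum s) 0" using hg[of 0] mS_monom[OF c] 0 by auto
    then have "h (clsS (mnm c e)) = \<zero>\<^bsub>Bsum s\<^esub>" unfolding Bsum_ops B_zero using B_hpart_neg[of "-1"]
      by (auto simp: PiE_iff extensional_def fun_eq_iff restrict_def)
    then show ?thesis using z by simp
  next
    case (Suc q)
    have hp: "h (clsS (mnm c e)) \<in> hpart (Bsum s) (int (Suc q))" using hg[of "int (Suc q)"] mS_monom[OF c] Suc by auto
    have "\<exists>F\<in>TT. h (clsS (mnm c e)) r = clsB F \<and> cf F k = \<zero>" if "r < s" for r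
    proof -
      have "h (clsS (mnm c e)) r \<in> hpart B (int q)" using hp that by (auto simp: Bsum_ops PiE_iff)
      then obtain a where a: "a \<in> Qp q" "h (clsS (mnm c e)) r = clsB (mnm a q)" using B_hpart_Suc by blast
      then show ?thesis using mon_pol[of Qp a q, OF Qpi] idl_carr[OF Qpi a(1)] e Suc by (intro bexI[of _ "mnm a q"]) auto
    qed
    then show ?thesis using hp Bsum_hpart_le unfolding V_def by blast
  qed
  let ?b = "cf f (Suc k)"
  let ?f = "f \<ominus>\<^bsub>PP\<^esub> mnm ?b (Suc k)"
  have fc: "f \<in> carrier PP" by (rule polD(1)[OF f(1)])
  have bW: "?b \<in> W j (Suc k)" by (rule polD(2)[OF f(1)])
  have bc: "?b \<in> carrier R" using fc by simp
  have mb: "mnm ?b (Suc k) \<in> pol (W j)" by (rule mon_pol[of "W j", OF Wi bW])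
  have f': "?f \<in> pol (W j)" by (rule pol_diff[of "W j", OF Wi f(1) mb])
  have f'c: "?f \<in> carrier PP" by (rule polD(1)[OF f'])
  have "?f \<in> {g \<in> pol (W j). h (clsS g) \<in> V}"
  proof (rule components_mem[OF f'c])
    show "\<zero>\<^bsub>PP\<^esub> \<in> {g \<in> pol (W j). h (clsS g) \<in> V}" using z graded_zero[OF h] pol_zero[of "W j", OF Wi] by simp
    show "{g \<in> pol (W j). h (clsS g) \<in> V} \<subseteq> carrier PP" using polD(1)[of _ "W j"] by blast
    fix g g' assume "g \<in> {g \<in> pol (W j). h (clsS g) \<in> V}" "g' \<in> {g \<in> pol (W j). h (clsS g) \<in> V}"
    then have g: "g \<in> pol (W j)" "h (clsS g) \<in> V" and g': "g' \<in> pol (W j)" "h (clsS g') \<in> V" by auto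
    have "h (clsS (g \<oplus>\<^bsub>PP\<^esub> g')) = h (clsS g) \<oplus>\<^bsub>Bsum s\<^esub> h (clsS g')"
      using mod_homD(2)[OF hm, of "clsS g" "clsS g'"] g g' S_add[OF polD(1)[OF g(1)] polD(1)[OF g'(1)]] by (simp add: mS_ops)
    then show "g \<oplus>\<^bsub>PP\<^esub> g' \<in> {g \<in> pol (W j). h (clsS g) \<in> V}" using V_add g g' pol_add[of "W j", OF Wi] by simp
  next
    fix e show "mnm (cf ?f e) e \<in> {g \<in> pol (W j). h (clsS g) \<in> V}"
    proof (cases "e = Suc k")
      case True
      then have "cf ?f e = \<zero>" using fc bc by (simp add: coeff_minus a_minus_def r_neg)
      then show ?thesis using z graded_zero[OF h] pol_zero[of "W j", OF Wi] by simp
    next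
      case False
      have "cf ?f e \<in> W j e" by (rule polD(2)[OF f'])
      then show ?thesis using other[OF _ False] mon_pol[of "W j" "cf ?f e" e, OF Wi] by simp
    qed
  qed
  then have hf': "h (clsS ?f) \<in> V" by simp
  have "clsS ?f \<oplus>\<^bsub>S\<^esub> clsS (mnm ?b (Suc k)) = X"
    using S_add[of ?f "mnm ?b (Suc k)"] f'c bc fc UP.P.diff_identities(1)[of f "mnm ?b (Suc k)"] f(2) by simp
  then have sum: "h X = h (clsS ?f) \<oplus>\<^bsub>Bsum s\<^esub> h (clsS (mnm ?b (Suc k)))"
    using mod_homD(2)[OF hm, of "clsS ?f" "clsS (mnm ?b (Suc k))"] f' mb by (simp add: mS_ops)
  have hb: "h (clsS (mnm ?b (Suc k))) \<in> hpart (Bsum s) i" using hg[of i] mS_monom[OF bW] k by auto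
  have "h X = h (clsS (mnm ?b (Suc k)))"
  proof (rule Bsum_eqI)
    show "h X \<in> carrier (Bsum s)" "h (clsS (mnm ?b (Suc k))) \<in> carrier (Bsum s)" using hX hb Bsum_hpart_le by blast+
    fix r assume r: "r < s"
    have "h X r \<in> hpart B (int k)" "h (clsS (mnm ?b (Suc k))) r \<in> hpart B (int k)"
      using hX hb r k by (auto simp: Bsum_ops PiE_iff)
    then obtain a b where a: "a \<in> Qp k" "h X r = clsB (mnm a k)" and b: "b \<in> Qp k" "h (clsS (mnm ?b (Suc k))) r = clsB (mnm b k)"
      using B_hpart_Suc by meson
    obtain F where F: "F \<in> TT" "h (clsS ?f) r = clsB F" "cf F k = \<zero>" using hf' r unfolding V_def by blast
    have c: "a \<in> carrier R" "b \<in> carrier R" "F \<in> carrier PP" using idl_carr[OF Qpi] a b polD(1)[OF F(1)] by blast+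
    have "clsB (mnm a k) = clsB (F \<oplus>\<^bsub>PP\<^esub> mnm b k)"
      using fun_cong[OF sum, of r] a(2) b(2) F(2) r B_add[of F "mnm b k"] c by (simp add: Bsum_ops)
    then have "mnm a k \<ominus>\<^bsub>PP\<^esub> (F \<oplus>\<^bsub>PP\<^esub> mnm b k) \<in> NB" using clsB_iff[of "mnm a k" "F \<oplus>\<^bsub>PP\<^esub> mnm b k"] c by simp
    from polD(2)[OF this, of k] have "a \<ominus> b \<in> \<mm> \<cdot> Qp k" using c F(3) by (simp add: coeff_minus)
    then have "mnm (a \<ominus> b) k \<in> NB" by (intro mon_pol[of "\<lambda>i. \<mm> \<cdot> Qp i"] mQi)
    then have "mnm a k \<ominus>\<^bsub>PP\<^esub> mnm b k \<in> NB" using c by (simp add: a_minus_def)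
    then show "h X r = h (clsS (mnm ?b (Suc k))) r" using a(2) b(2) clsB_iff[of "mnm a k" "mnm b k"] c by simp
  qed
  then show ?thesis using mS_monom[OF bW] k by metis
qed

text \<open>Stated for subsets closed under addition and scalars instead of spans, so that it can be applied to preimages
  under homomorphisms.\<close>

definition generated_in_degree_one :: "nat => bool" where
  "generated_in_degree_one j \<longleftrightarrow> (\<forall>N. hpart (mS j) 1 \<subseteq> N \<and> N \<subseteq> carrier (mS j) \<and> (\<forall>X\<in>N. \<forall>Y\<in>N. X \<oplus>\<^bsub>mS j\<^esub> Y \<in> N) \<and>
     (\<forall>t\<in>carrier T. \<forall>X\<in>N. t \<odot>\<^bsub>mS j\<^esub> X \<in> N) --> carrier (mS j) \<subseteq> N)"

text \<open>The unit vectors of the free module have degree one and lift to elements \<open>Y\<close> of degree one.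
  Subtracting multiples of these lifts from a given element makes its coordinates vanish one after the other,
  until it falls into the kernel of \<open>h\<close>.\<close>

lemma generated_step:
  assumes h: "h \<in> graded_hom T (mS j) (Bsum s)" "h ` carrier (mS j) = carrier (Bsum s)"
    and ker: "\<And>N. hpart (mS j) 1 \<subseteq> N ==> N \<subseteq> carrier (mS j) ==> (\<And>X Y. X \<in> N ==> Y \<in> N ==> X \<oplus>\<^bsub>mS j\<^esub> Y \<in> N) ==>
     (\<And>t X. t \<in> carrier T ==> X \<in> N ==> t \<odot>\<^bsub>mS j\<^esub> X \<in> N) ==> {X \<in> carrier (mS j). h X = \<zero>\<^bsub>Bsum s\<^esub>} \<subseteq> N"
  shows "generated_in_degree_one j"
  unfolding generated_in_degree_one_def
proof (intro allI impI)
  interpret M: module T "mS j" by (rule module_mS)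
  fix N assume N: "hpart (mS j) 1 \<subseteq> N \<and> N \<subseteq> carrier (mS j) \<and> (\<forall>X\<in>N. \<forall>Y\<in>N. X \<oplus>\<^bsub>mS j\<^esub> Y \<in> N) \<and>
     (\<forall>t\<in>carrier T. \<forall>X\<in>N. t \<odot>\<^bsub>mS j\<^esub> X \<in> N)"
  have hm: "h \<in> mod_hom T (mS j) (Bsum s)" using h unfolding graded_hom_def by auto
  have kerN: "{X \<in> carrier (mS j). h X = \<zero>\<^bsub>Bsum s\<^esub>} \<subseteq> N" by (rule ker) (use N in blast)+
  have lift: "\<exists>Y\<in>N. h Y = (\<lambda>q\<in>{..<s}. if q = r then clsB \<one>\<^bsub>PP\<^esub> else clsB \<zero>\<^bsub>PP\<^esub>)" (is "\<exists>Y\<in>N. h Y = ?e r") for r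
  proof -
    have "\<one>\<^bsub>PP\<^esub> \<in> (\<lambda>a. mnm a 0) ` carrier R" "\<zero>\<^bsub>PP\<^esub> \<in> (\<lambda>a. mnm a 0) ` carrier R"
      using imageI[OF one_closed, of "\<lambda>a. mnm a 0"] imageI[OF zero_closed, of "\<lambda>a. mnm a 0"] by simp_all
    then have "clsB \<one>\<^bsub>PP\<^esub> \<in> clsB ` (TT \<inter> (\<lambda>a. mnm a 0) ` carrier R)" "clsB \<zero>\<^bsub>PP\<^esub> \<in> clsB ` (TT \<inter> (\<lambda>a. mnm a 0) ` carrier R)"
      using one_pol[OF Q] pol_zero[of Qp, OF Qpi] by blast+
    then have "clsB \<one>\<^bsub>PP\<^esub> \<in> hpart B (-1 + 1)" "clsB \<zero>\<^bsub>PP\<^esub> \<in> hpart B (-1 + 1)"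
      unfolding B_hpart poly_hpart_def by simp_all
    then have e: "?e r \<in> hpart (Bsum s) 1" unfolding Bsum_ops by auto
    then have "?e r \<in> h ` carrier (mS j)" using h(2) Bsum_hpart_le by blast
    then obtain X where X: "X \<in> carrier (mS j)" "h X = ?e r" by force
    have "h X \<in> hpart (Bsum s) 1" unfolding X(2) by (rule e)
    then obtain Y where "Y \<in> hpart (mS j) 1" "h Y = h X" using homogeneous_lift[OF h(1) X(1)] by blast
    then have "Y \<in> N" "h Y = ?e r" using N X(2) by (blast, simp)
    then show ?thesis by blast
  qed
  have claim: "X \<in> N" if "X \<in> carrier (mS j)" "\<And>r. r < s ==> t \<le> r ==> h X r = clsB \<zero>\<^bsub>PP\<^esub>" "t \<le> s" for t X
    using that
  proof (induct t arbitrary: X)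
    case 0
    have "h X = \<zero>\<^bsub>Bsum s\<^esub>"
      using mod_homD(1)[OF hm 0(1)] 0(2) unfolding Bsum_ops B_zero by (auto simp: PiE_iff extensional_def fun_eq_iff restrict_def)
    then show ?case using kerN 0(1) by blast
  next
    case (Suc t)
    obtain F where F: "F \<in> TT" "h X t = clsB F" using Bsum_cases[OF mod_homD(1)[OF hm Suc(2)], of t] Suc(4) by auto
    obtain Y where Y: "Y \<in> N" "h Y = (\<lambda>q\<in>{..<s}. if q = t then clsB \<one>\<^bsub>PP\<^esub> else clsB \<zero>\<^bsub>PP\<^esub>)" using lift by blast
    have Yc: "Y \<in> carrier (mS j)" using N Y by blast
    have Fc: "F \<in> carrier PP" by (rule polD(1)[OF F(1)])
    have nF: "\<ominus>\<^bsub>PP\<^esub> F \<in> TT" by (rule pol_neg[of Qp, OF Qpi F(1)])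
    have FT: "F \<in> carrier T" "\<ominus>\<^bsub>PP\<^esub> F \<in> carrier T" using F nF T_carrier by auto
    let ?X = "X \<oplus>\<^bsub>mS j\<^esub> (\<ominus>\<^bsub>PP\<^esub> F) \<odot>\<^bsub>mS j\<^esub> Y"
    have hX: "h ?X r = h X r \<oplus>\<^bsub>B\<^esub> (\<ominus>\<^bsub>PP\<^esub> F) \<odot>\<^bsub>B\<^esub> (if r = t then clsB \<one>\<^bsub>PP\<^esub> else clsB \<zero>\<^bsub>PP\<^esub>)" if "r < s" for r
      using mod_homD(2)[OF hm Suc(2), of "(\<ominus>\<^bsub>PP\<^esub> F) \<odot>\<^bsub>mS j\<^esub> Y"] mod_homD(3)[OF hm FT(2) Yc] FT Yc Y(2) that by (simp add: Bsum_ops)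
    have "?X \<in> N"
    proof (rule Suc(1))
      show "?X \<in> carrier (mS j)" using Suc(2) FT Yc by simp
      show "t \<le> s" using Suc(4) by simp
      fix r assume r: "r < s" "t \<le> r"
      show "h ?X r = clsB \<zero>\<^bsub>PP\<^esub>"
      proof (cases "r = t")
        case True
        then show ?thesis unfolding hX[OF r(1)] using F B_smult[OF nF one_pol[OF Q]] B_add[of F "\<ominus>\<^bsub>PP\<^esub> F"] Fc by (simp add: UP.P.r_neg)
      next
        case False
        then show ?thesis unfolding hX[OF r(1)] using Suc(3)[OF r(1)] r B_smult[OF nF pol_zero[of Qp, OF Qpi]] B_add[of "\<zero>\<^bsub>PP\<^esub>" "\<zero>\<^bsub>PP\<^esub>"] Fc by simp
      qed
    qed
    then have "?X \<oplus>\<^bsub>mS j\<^esub> F \<odot>\<^bsub>mS j\<^esub> Y \<in> N" using N Y FT by blast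
    moreover have "?X \<oplus>\<^bsub>mS j\<^esub> F \<odot>\<^bsub>mS j\<^esub> Y = X"
    proof -
      have "(\<ominus>\<^bsub>PP\<^esub> F) \<odot>\<^bsub>mS j\<^esub> Y \<oplus>\<^bsub>mS j\<^esub> F \<odot>\<^bsub>mS j\<^esub> Y = (\<ominus>\<^bsub>PP\<^esub> F \<oplus>\<^bsub>T\<^esub> F) \<odot>\<^bsub>mS j\<^esub> Y" using M.smult_l_distr FT Yc by simp
      also have "\<ominus>\<^bsub>PP\<^esub> F \<oplus>\<^bsub>T\<^esub> F = \<zero>\<^bsub>T\<^esub>" using Fc by (simp add: rees_simps UP.P.l_neg)
      finally show ?thesis using Suc(2) FT Yc by (simp add: M.a_assoc)
    qed
    ultimately show ?case by simp
  qed
  show "carrier (mS j) \<subseteq> N"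
  proof
    fix X assume "X \<in> carrier (mS j)"
    then show "X \<in> N" by (rule claim[of X s]) auto
  qed
qed

text \<open>The kernel of \<open>g\<close> is the image of a module generated in degree one; its part inside a closed set
  \<open>N\<close> is controlled by the preimage of \<open>N\<close> under \<open>f\<close>.\<close>

lemma generated_extension:
  assumes "graded_short_exact T (mS (Suc j)) (mS j) (Bsum s) f g" and gen: "generated_in_degree_one (Suc j)"
  shows "generated_in_degree_one j"
proof (rule generated_step[of g])
  have f: "f \<in> graded_hom T (mS (Suc j)) (mS j)" and im: "f ` carrier (mS (Suc j)) = {X \<in> carrier (mS j). g X = \<zero>\<^bsub>Bsum s\<^esub>}"
    and g: "g \<in> graded_hom T (mS j) (Bsum s)" and gs: "g ` carrier (mS j) = carrier (Bsum s)"
    using assms(1) unfolding graded_short_exact_def by auto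
  show "g \<in> graded_hom T (mS j) (Bsum s)" "g ` carrier (mS j) = carrier (Bsum s)" by (rule g gs)+
  interpret M: module T "mS (Suc j)" by (rule module_mS)
  have fm: "f \<in> mod_hom T (mS (Suc j)) (mS j)" and fg: "\<And>i. f ` hpart (mS (Suc j)) i \<subseteq> hpart (mS j) i"
    using f unfolding graded_hom_def by auto
  fix N assume N: "hpart (mS j) 1 \<subseteq> N" "N \<subseteq> carrier (mS j)" "\<And>X Y. X \<in> N ==> Y \<in> N ==> X \<oplus>\<^bsub>mS j\<^esub> Y \<in> N"
    "\<And>t X. t \<in> carrier T ==> X \<in> N ==> t \<odot>\<^bsub>mS j\<^esub> X \<in> N"
  let ?N = "{X \<in> carrier (mS (Suc j)). f X \<in> N}"
  have "carrier (mS (Suc j)) \<subseteq> ?N"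
    using gen[unfolded generated_in_degree_one_def, THEN spec[of _ ?N]]
  proof (rule mp, intro conjI ballI)
    show "hpart (mS (Suc j)) 1 \<subseteq> ?N" using fg N(1) mS_hpart_le by blast
  qed (use N mod_homD[OF fm] in auto)
  then show "{X \<in> carrier (mS j). g X = \<zero>\<^bsub>Bsum s\<^esub>} \<subseteq> N" unfolding im[symmetric] by blast
qed

lemma generated_iso:
  assumes "h \<in> graded_hom T (mS j) (Bsum s)" "bij_betw h (carrier (mS j)) (carrier (Bsum s))"
  shows "generated_in_degree_one j"
proof (rule generated_step[OF assms(1)])
  show "h ` carrier (mS j) = carrier (Bsum s)" using assms(2) unfolding bij_betw_def by simp
  have z: "clsS \<zero>\<^bsub>PP\<^esub> \<in> carrier (mS j)" using mS_zero_hpart mS_hpart_le by blast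
  have "X = clsS \<zero>\<^bsub>PP\<^esub>" if "X \<in> carrier (mS j)" "h X = \<zero>\<^bsub>Bsum s\<^esub>" for X
    using that assms(2) z graded_zero[OF assms(1)] unfolding bij_betw_def inj_on_def by metis
  then show "{X \<in> carrier (mS j). h X = \<zero>\<^bsub>Bsum s\<^esub>} \<subseteq> N" if "hpart (mS j) 1 \<subseteq> N" for N using mS_zero_hpart that by blast
qed

end

section \<open>The filtration determines the rank and the generation of the Sally module\<close>

context sally_setting
begin

lemma T_m1: "\<ominus>\<^bsub>T\<^esub> \<one>\<^bsub>T\<^esub> \<in> carrier T"
proof -
  interpret T: cring T by (rule T_cring)
  show ?thesis by simp
qed

lemma B_carrier_nontrivial: "carrier B \<noteq> {\<zero>\<^bsub>B\<^esub>}" using B_nonzero by auto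

lemma series_extension:
  assumes M': "module T M'" "loc_series T U M' r"
    and f: "f \<in> mod_hom T M' (mS j)" "inj_on f (carrier M')"
    and g: "g \<in> graded_hom T (mS j) (Bsum s)" "g ` carrier (mS j) = carrier (Bsum s)"
    and ex: "f ` carrier M' = {X \<in> carrier (mS j). g X = \<zero>\<^bsub>Bsum s\<^esub>}"
  shows "loc_series T U (mS j) (r + s)"
proof -
  have gm: "g \<in> mod_hom T (mS j) (mod_power B s)" using g(1) Bsum_mod_power(1)[of "mS j" s] unfolding graded_hom_def by simp
  show ?thesis
    by (rule loc_series_extension[OF module_mS module_B _ B_torsion_free B_rank_one B_carrier_nontrivial M' f gm])
      (use g(2) ex Bsum_mod_power(2,3)[of s] in auto)
qed

text \<open>Induction along the filtration, starting from the zero submodule of \<open>\<mm>^l S\<close>: each layer adds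
  the rank of a free module over the fibre.\<close>

lemma filtration_series:
  assumes iso: "graded_iso T (mS l) (Bsum (s 0))"
    and ex: "\<forall>i\<in>{1..l}. \<exists>f g. graded_short_exact T (mS (l - i + 1)) (mS (l - i)) (Bsum (s i)) f g"
  shows "i \<le> l ==> loc_series T U (mS (l - i)) (\<Sum>k\<le>i. s k)"
proof (induct i)
  case 0
  obtain h where h: "h \<in> graded_hom T (mS l) (Bsum (s 0))" "bij_betw h (carrier (mS l)) (carrier (Bsum (s 0)))"
    using iso unfolding graded_iso_def by blast
  interpret M: module T "mS l" by (rule module_mS)
  have z: "\<zero>\<^bsub>mS l\<^esub> = clsS \<zero>\<^bsub>PP\<^esub>" by (rule mS_ops(2))
  let ?M = "(mS l)\<lparr>carrier := {\<zero>\<^bsub>mS l\<^esub>}\<rparr>"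
  have sub: "submodule {\<zero>\<^bsub>mS l\<^esub>} T (mS l)" by (rule M.submoduleI) auto
  have M: "module T ?M" by (rule submodule.submodule_is_module[OF sub module_mS])
  have "loc_series T U (mS l) (0 + s 0)"
  proof (rule series_extension[OF M _ _ _ h(1)])
    show "loc_series T U ?M 0" by (rule loc_series_zero[OF M]) simp
    show "(\<lambda>X. X) \<in> mod_hom T ?M (mS l)" unfolding mod_hom_def by auto
    show "h ` carrier (mS l) = carrier (Bsum (s 0))" using h(2) unfolding bij_betw_def by simp
    show "(\<lambda>X. X) ` carrier ?M = {X \<in> carrier (mS l). h X = \<zero>\<^bsub>Bsum (s 0)\<^esub>}"
    proof -
      have "h \<zero>\<^bsub>mS l\<^esub> = \<zero>\<^bsub>Bsum (s 0)\<^esub>" using graded_zero[OF h(1)] z by simp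
      moreover have "X = \<zero>\<^bsub>mS l\<^esub>" if "X \<in> carrier (mS l)" "h X = h \<zero>\<^bsub>mS l\<^esub>" for X
        using inj_onD[OF bij_betw_imp_inj_on[OF h(2)] that(2,1) M.zero_closed] .
      ultimately show ?thesis using M.zero_closed by auto
    qed
  qed auto
  then show ?case by simp
next
  case (Suc i)
  obtain f g where fg: "graded_short_exact T (mS (l - Suc i + 1)) (mS (l - Suc i)) (Bsum (s (Suc i))) f g"
    using ex[THEN bspec, of "Suc i"] Suc(2) by (metis atLeastAtMost_iff le_add1 plus_1_eq_Suc)
  have e: "l - Suc i + 1 = l - i" using Suc(2) by simp
  have f: "f \<in> graded_hom T (mS (l - i)) (mS (l - Suc i))" "inj_on f (carrier (mS (l - i)))"
    and g: "g \<in> graded_hom T (mS (l - Suc i)) (Bsum (s (Suc i)))" "g ` carrier (mS (l - Suc i)) = carrier (Bsum (s (Suc i)))"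
    and k: "f ` carrier (mS (l - i)) = {X \<in> carrier (mS (l - Suc i)). g X = \<zero>\<^bsub>Bsum (s (Suc i))\<^esub>}"
    using fg unfolding e graded_short_exact_def by blast+
  have fm: "f \<in> mod_hom T (mS (l - i)) (mS (l - Suc i))" using f(1) unfolding graded_hom_def by simp
  have "loc_series T U (mS (l - i)) (\<Sum>k\<le>i. s k)" using Suc by simp
  then have "loc_series T U (mS (l - Suc i)) ((\<Sum>k\<le>i. s k) + s (Suc i))"
    by (rule series_extension[OF module_mS _ fm f(2) g k])
  then show ?case by simp
qed

lemma series_S: "loc_series T U (mS 0) n \<longleftrightarrow> loc_series T U S n"
  by (simp add: loc_series_def saturated_def rank_one_step_def mS_ops S_carrier S_zero)

lemma rank_of_series: "loc_series T U (mS 0) n ==> sally_rank R \<mm> Q J = enat n"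
  unfolding series_S sally_rank_def Let_def by (rule localization.loc_series_length[OF U_loc])

lemma filtration_rank:
  assumes "graded_iso T (mS l) (Bsum (s 0))"
    and "\<forall>i\<in>{1..l}. \<exists>f g. graded_short_exact T (mS (l - i + 1)) (mS (l - i)) (Bsum (s i)) f g"
  shows "sally_rank R \<mm> Q J = enat (\<Sum>i\<le>l. s i)"
  using filtration_series[OF assms, of l] rank_of_series by simp

lemma filtration_generated:
  assumes iso: "graded_iso T (mS l) (Bsum (s 0))"
    and ex: "\<forall>i\<in>{1..l}. \<exists>f g. graded_short_exact T (mS (l - i + 1)) (mS (l - i)) (Bsum (s i)) f g"
  shows "carrier S = submod_span T S (hpart S 1)"
proof
  have gen: "i \<le> l ==> generated_in_degree_one (l - i)" for i
  proof (induct i)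
    case 0
    then show ?case using iso generated_iso unfolding graded_iso_def by auto
  next
    case (Suc i)
    obtain f g where fg: "graded_short_exact T (mS (l - Suc i + 1)) (mS (l - Suc i)) (Bsum (s (Suc i))) f g"
      using ex[THEN bspec, of "Suc i"] Suc(2) by (metis atLeastAtMost_iff le_add1 plus_1_eq_Suc)
    have "Suc (l - Suc i) = l - i" using Suc(2) by simp
    then show ?case using generated_extension fg Suc by simp
  qed
  have g0: "generated_in_degree_one 0" using gen[of l] by simp
  have c0: "carrier (mS 0) = carrier S" unfolding mS_ops S_carrier ..
  have h0: "hpart (mS 0) 1 = hpart S 1" unfolding mS_hpart S_hpart ..
  show "carrier S \<subseteq> submod_span T S (hpart S 1)"
    unfolding submod_span_def
  proof (intro Inter_greatest)
    fix N assume "N \<in> {N. submodule N T S \<and> hpart S 1 \<subseteq> N}"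
    then interpret N: submodule N T S by simp
    have hN: "hpart S 1 \<subseteq> N" using \<open>N \<in> {N. submodule N T S \<and> hpart S 1 \<subseteq> N}\<close> by simp
    show "carrier S \<subseteq> N"
      using g0[unfolded generated_in_degree_one_def, THEN spec[of _ N]] hN N.subset N.m_closed N.smult_closed
      unfolding c0 h0 by (simp add: mS_ops)
  qed
  have "submodule (carrier S) T S" using submodule_W[of 0] unfolding S_carrier .
  moreover have "hpart S 1 \<subseteq> carrier S" using mS_hpart_le[of 0 1] unfolding c0 h0 .
  ultimately show "submod_span T S (hpart S 1) \<subseteq> carrier S" unfolding submod_span_def by blast
qed

lemma W_trivial_carrier: "(\<And>i. W j i \<subseteq> J \<cdot> Qp i) ==> carrier (mS j) = {\<zero>\<^bsub>mS j\<^esub>}"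
proof -
  assume le: "\<And>i. W j i \<subseteq> J \<cdot> Qp i"
  have "clsS f = clsS \<zero>\<^bsub>PP\<^esub>" if "f \<in> pol (W j)" for f
  proof -
    have "f \<in> NS" using that pol_mono[of "W j" "\<lambda>i. J \<cdot> Qp i", OF le] by blast
    then show ?thesis using clsS_zero_iff[OF polD(1)[OF that]] by blast
  qed
  then show ?thesis unfolding mS_ops using pol_zero[of "W j", OF Wi] by blast
qed

end

section \<open>Goto rings have the filtration\<close>

context sally_cube
begin

text \<open>A power of \<open>\<mm>\<close> lies in \<open>Q\<close>.\<close>

lemma W_eventually: "\<exists>k. W k (Suc 0) = J \<cdot> Qp (Suc 0)"
proof -
  obtain k where k: "mp k \<subseteq> Q" using radical_pow_le[OF Q rad] by blast
  have "mp k \<cdot> Jp (Suc (Suc 0)) \<subseteq> Q \<cdot> J"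
    by (rule prod_mono[OF k]) (use pow_Suc_le[OF J, of "Suc 0"] pow_one[OF J] in simp)
  also have "Q \<cdot> J = J \<cdot> Qp (Suc 0)" unfolding pow_one[OF Q] by (rule prod_comm[OF Q J])
  finally have "W k (Suc 0) \<subseteq> J \<cdot> Qp (Suc 0)" unfolding W_def by (intro sum_le[OF JQi]) auto
  then show ?thesis using N_le_W by blast
qed

text \<open>This is Nakayama's lemma: \<open>W (j+1) 1\<close> is \<open>\<mm> W j 1 + J Q\<close>.\<close>

lemma W_stationary: assumes "W (Suc j) (Suc 0) = W j (Suc 0)" shows "W j (Suc 0) = J \<cdot> Qp (Suc 0)"
proof (rule nakayama[OF Wi JQi N_le_W])
  have "mp (Suc j) \<cdot> Jp (Suc (Suc 0)) = \<mm> \<cdot> (mp j \<cdot> Jp (Suc (Suc 0)))"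
    unfolding ideal_pow.simps(2)[of _ \<mm>] by (rule prod_assoc[OF mid mpi Jpi])
  also have "\<dots> \<subseteq> \<mm> \<cdot> W j (Suc 0)"
    unfolding W_def by (rule prod_mono[OF subset_refl sum_ge1[OF prod_ideal[OF mpi Jpi] JQi]])
  finally have "W (Suc j) (Suc 0) \<subseteq> \<mm> \<cdot> W j (Suc 0) <+> J \<cdot> Qp (Suc 0)"
    unfolding W_def[of "Suc j"] by (rule sum_mono[OF _ subset_refl])
  then show "W j (Suc 0) \<subseteq> \<mm> \<cdot> W j (Suc 0) <+> J \<cdot> Qp (Suc 0)" using assms by simp
qed

lemma W_vanish: assumes "W j (Suc 0) = J \<cdot> Qp (Suc 0)" shows "carrier (mS j) = {\<zero>\<^bsub>mS j\<^esub>}"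
proof (rule W_trivial_carrier)
  fix i show "W j i \<subseteq> J \<cdot> Qp i"
  proof (cases i)
    case 0 then show ?thesis using W_at_0 ideal_prod_one[OF J] by simp
  next
    case (Suc k)
    have "W j i = J \<cdot> (Qp k \<cdot> Qp (Suc 0))" unfolding Suc W_Suc[of j k] assms by (rule prod_lcomm[OF Qpi J Qpi])
    then show ?thesis using pow_add[OF Q, of k "Suc 0"] Suc by simp
  qed
qed

text \<open>The chain \<open>W j 1\<close> reaches \<open>J Q\<close> after finitely many strict steps, at least one because
  the rank is positive. The last nonzero layer is all of \<open>\<mm>^l S\<close>. The numbering of the layers is
  reversed, since the filtration is read upwards from \<open>\<mm>^l S\<close>.\<close>

theorem filtration_exists:
  assumes rank: "sally_rank R \<mm> Q J = enat n" and n: "n \<ge> 1"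
  shows "\<exists>l s. l < n \<and> (\<forall>i\<le>l. s i \<ge> 1) \<and> n = (\<Sum>i\<le>l. s i) \<and> graded_iso T (mS l) (Bsum (s 0)) \<and>
    (\<forall>i\<in>{1..l}. \<exists>f g. graded_short_exact T (mS (l - i + 1)) (mS (l - i)) (Bsum (s i)) f g)"
proof -
  define P where "P j \<longleftrightarrow> W j (Suc 0) = J \<cdot> Qp (Suc 0)" for j
  define L where "L = (LEAST j. P j)"
  have PL: "P L" unfolding L_def by (rule LeastI_ex) (use W_eventually in \<open>simp add: P_def\<close>)
  have nP: "\<not> P j" if "j < L" for j using that not_less_Least unfolding L_def by blast
  have "L \<noteq> 0"
  proof
    assume "L = 0"
    then have "carrier (mS 0) = {\<zero>\<^bsub>mS 0\<^esub>}" using PL W_vanish unfolding P_def by blast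
    then have "sally_rank R \<mm> Q J = enat 0" by (intro rank_of_series loc_series_zero[OF module_mS])
    then show False using rank n by (simp add: zero_enat_def)
  qed
  then obtain l where l: "L = Suc l" using not0_implies_Suc by blast
  have "\<forall>j. \<exists>s g. graded_short_exact T (mS (Suc j)) (mS j) (Bsum s) (\<lambda>X. X) g \<and> (W (Suc j) (Suc 0) \<noteq> W j (Suc 0) --> s \<ge> 1)"
    using layer_sequence by blast
  then obtain t g where ex: "\<And>j. graded_short_exact T (mS (Suc j)) (mS j) (Bsum (t j)) (\<lambda>X. X) (g j)"
    and t: "\<And>j. W (Suc j) (Suc 0) \<noteq> W j (Suc 0) ==> t j \<ge> 1" by metis
  define s where "s i = t (l - i)" for i
  have s1: "s i \<ge> 1" for i
  proof -
    have "\<not> P (l - i)" using nP l by simp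
    then show ?thesis unfolding s_def using W_stationary t unfolding P_def by blast
  qed
  have gl: "g l \<in> graded_hom T (mS l) (Bsum (s 0))" "g l ` carrier (mS l) = carrier (Bsum (s 0))"
    and ker: "(\<lambda>X. X) ` carrier (mS (Suc l)) = {X \<in> carrier (mS l). g l X = \<zero>\<^bsub>Bsum (s 0)\<^esub>}"
    using ex[of l] unfolding graded_short_exact_def s_def by auto
  have "carrier (mS (Suc l)) = {\<zero>\<^bsub>mS (Suc l)\<^esub>}" using PL W_vanish unfolding P_def l by blast
  then have "{X \<in> carrier (mS l). g l X = \<zero>\<^bsub>Bsum (s 0)\<^esub>} = {\<zero>\<^bsub>mS l\<^esub>}" using ker by (simp add: mS_ops)
  then have "inj_on (g l) (carrier (mS l))" using gl(1) mod_hom_inj[OF module_mS] unfolding graded_hom_def by blast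
  then have iso: "graded_iso T (mS l) (Bsum (s 0))" unfolding graded_iso_def bij_betw_def using gl by blast
  have exs: "\<forall>i\<in>{1..l}. \<exists>f g. graded_short_exact T (mS (l - i + 1)) (mS (l - i)) (Bsum (s i)) f g"
    unfolding s_def using ex by auto
  have sum: "n = (\<Sum>i\<le>l. s i)" using filtration_rank[OF iso exs] rank by simp
  have "l < n"
  proof -
    have "(\<Sum>i\<le>l. 1) \<le> (\<Sum>i\<le>l. s i)" by (rule ordered_comm_monoid_add_class.sum_mono) (use s1 in simp)
    then show ?thesis using sum by simp
  qed
  then show ?thesis by (intro exI[of _ l] exI[of _ s] conjI allI impI s1 sum iso exs)
qed

end

section \<open>The top extension does not split\<close>

context sally_setting
begin

text \<open>Both sides are zero. In the form of an equality of scalar multiples the fact can be transported along any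
  homomorphism.\<close>

lemma m_kills_B: assumes a: "a \<in> \<mm>" and v: "v \<in> carrier (Bsum s)" shows "mnm a 0 \<odot>\<^bsub>Bsum s\<^esub> v = \<zero>\<^bsub>T\<^esub> \<odot>\<^bsub>Bsum s\<^esub> v"
proof -
  have ac: "a \<in> carrier R" using idl_carr[OF mid a] .
  have "mnm a 0 \<odot>\<^bsub>B\<^esub> v r = \<zero>\<^bsub>T\<^esub> \<odot>\<^bsub>B\<^esub> v r" if r: "r < s" for r
  proof -
    obtain F where F: "F \<in> TT" "v r = clsB F" using Bsum_cases[OF v r] by blast
    have "mnm a 0 \<in> pol (\<lambda>i. \<mm> \<cdot> Qp i)" by (rule mon_pol[of "\<lambda>i. \<mm> \<cdot> Qp i", OF mQi]) (use a ideal_prod_one[OF mid] in simp)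
    moreover have "u \<otimes> v \<in> \<mm> \<cdot> Qp (i + j)" if "u \<in> \<mm> \<cdot> Qp i" "v \<in> Qp j" for u v i j
      using Qp_mQ[OF that(2,1)] idl_carr[OF mQi that(1)] idl_carr[OF Qpi that(2)] by (simp add: m_comm add.commute)
    ultimately have "mnm a 0 \<otimes>\<^bsub>PP\<^esub> F \<in> NB"
      using F(1) by (intro pol_mult[of "\<lambda>i. \<mm> \<cdot> Qp i" "\<lambda>i. \<mm> \<cdot> Qp i" Qp]) (simp_all add: mQi)
    then have "clsB (mnm a 0 \<otimes>\<^bsub>PP\<^esub> F) = clsB \<zero>\<^bsub>PP\<^esub>" using clsB_zero_iff[of "mnm a 0 \<otimes>\<^bsub>PP\<^esub> F"] ac polD(1)[OF F(1)] by simp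
    then show ?thesis unfolding F(2) B_smult[OF mon0_T[OF ac] F(1)] using B_smult[OF pol_zero[of Qp, OF Qpi] F(1)] polD(1)[OF F(1)] by (simp add: rees_simps)
  qed
  then show ?thesis unfolding Bsum_ops by (auto intro!: restrict_ext)
qed

lemma Bsum_cancel: assumes v: "v \<in> carrier (Bsum s)" shows "v \<oplus>\<^bsub>Bsum s\<^esub> (\<ominus>\<^bsub>T\<^esub> \<one>\<^bsub>T\<^esub>) \<odot>\<^bsub>Bsum s\<^esub> v = \<zero>\<^bsub>Bsum s\<^esub>"
proof -
  interpret M: module T B by (rule module_B)
  have "v r \<oplus>\<^bsub>B\<^esub> (\<ominus>\<^bsub>T\<^esub> \<one>\<^bsub>T\<^esub>) \<odot>\<^bsub>B\<^esub> v r = \<zero>\<^bsub>B\<^esub>" if "r < s" for r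
  proof -
    have "v r \<in> carrier B" using v that by (auto simp: Bsum_ops PiE_iff)
    then show ?thesis using M.smult_l_minus[of "\<one>\<^bsub>T\<^esub>" "v r"] by (simp add: M.r_neg)
  qed
  then show ?thesis unfolding Bsum_ops by (auto intro!: restrict_ext)
qed

text \<open>A splitting would make \<open>\<mm>^l S\<close> a sum of images of free modules over the fibre, all annihilated
  by \<open>\<mm>\<close>. Then \<open>\<mm>^(l+1) S\<close> would be zero, although it is isomorphic to a nonzero
  free module over the fibre.\<close>

lemma nonsplit_extension:
  assumes iso: "graded_iso T (mS (Suc l)) (Bsum s)" and s: "s \<ge> 1"
    and ex: "graded_short_exact T (mS (Suc l)) (mS l) (Bsum s') f g"
  shows "\<exists>f. graded_short_exact T (Bsum s) (mS l) (Bsum s') f g \<and> \<not> split_epi T (mS l) (Bsum s') g"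
proof -
  obtain h where h: "h \<in> graded_hom T (mS (Suc l)) (Bsum s)" and bij: "bij_betw h (carrier (mS (Suc l))) (carrier (Bsum s))"
    using iso unfolding graded_iso_def by blast
  have hm: "h \<in> mod_hom T (mS (Suc l)) (Bsum s)" using h unfolding graded_hom_def by auto
  have hin: "X = Y" if "X \<in> carrier (mS (Suc l))" "Y \<in> carrier (mS (Suc l))" "h X = h Y" for X Y
    using bij that unfolding bij_betw_def inj_on_def by blast
  define k where "k = inv_into (carrier (mS (Suc l))) h"
  have k: "k v \<in> carrier (mS (Suc l))" "h (k v) = v" if "v \<in> carrier (Bsum s)" for v
    using bij that unfolding k_def bij_betw_def by (simp_all add: inv_into_into f_inv_into_f)
  have kh: "k (h X) = X" if "X \<in> carrier (mS (Suc l))" for X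
    using bij that unfolding k_def bij_betw_def by simp
  interpret M1: module T "mS (Suc l)" by (rule module_mS)
  interpret M0: module T "mS l" by (rule module_mS)
  have T0: "\<zero>\<^bsub>T\<^esub> \<in> carrier T" by (rule cring.cring_simprules(2)[OF T_cring])
  have kbij: "k ` carrier (Bsum s) = carrier (mS (Suc l))"
    using k(1) kh mod_homD(1)[OF hm] by force
  have kinj: "inj_on k (carrier (Bsum s))" by (rule inj_onI) (metis k(2))
  have km: "k \<in> mod_hom T (Bsum s) (mS (Suc l))"
    unfolding mod_hom_def
  proof (intro CollectI conjI ballI Pi_I)
    show "k v \<in> carrier (mS (Suc l))" if "v \<in> carrier (Bsum s)" for v by (rule k(1)[OF that])
    fix v assume v: "v \<in> carrier (Bsum s)"
    show "k (v \<oplus>\<^bsub>Bsum s\<^esub> w) = k v \<oplus>\<^bsub>mS (Suc l)\<^esub> k w" if w: "w \<in> carrier (Bsum s)" for w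
      using kh[of "k v \<oplus>\<^bsub>mS (Suc l)\<^esub> k w"] mod_homD(2)[OF hm k(1)[OF v] k(1)[OF w]] k(2)[OF v] k(2)[OF w] k(1)[OF v] k(1)[OF w] by simp
  next
    fix t v assume t: "t \<in> carrier T" and v: "v \<in> carrier (Bsum s)"
    show "k (t \<odot>\<^bsub>Bsum s\<^esub> v) = t \<odot>\<^bsub>mS (Suc l)\<^esub> k v"
      using kh[of "t \<odot>\<^bsub>mS (Suc l)\<^esub> k v"] mod_homD(3)[OF hm t k(1)[OF v]] k(2)[OF v] k(1)[OF v] t by simp
  qed
  have kg: "k v \<in> hpart (mS (Suc l)) i" if v: "v \<in> hpart (Bsum s) i" for v i
  proof -
    have vc: "v \<in> carrier (Bsum s)" using v Bsum_hpart_le by blast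
    then obtain Y where Y: "Y \<in> hpart (mS (Suc l)) i" "h Y = h (k v)"
      using homogeneous_lift[OF h k(1)[OF vc], of i] k(2)[OF vc] v by auto
    have "k v = Y" by (intro hin[OF k(1)[OF vc] subsetD[OF mS_hpart_le Y(1)] Y(2)[symmetric]])
    then show ?thesis using Y by simp
  qed
  have f: "f \<in> mod_hom T (mS (Suc l)) (mS l)" "\<And>i. f ` hpart (mS (Suc l)) i \<subseteq> hpart (mS l) i" "inj_on f (carrier (mS (Suc l)))"
    and g: "g \<in> graded_hom T (mS l) (Bsum s')" "g ` carrier (mS l) = carrier (Bsum s')"
    and ker: "f ` carrier (mS (Suc l)) = {X \<in> carrier (mS l). g X = \<zero>\<^bsub>Bsum s'\<^esub>}"
    using ex unfolding graded_short_exact_def graded_hom_def by auto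
  have gm: "g \<in> mod_hom T (mS l) (Bsum s')" using g unfolding graded_hom_def by auto
  have fkm: "f \<circ> k \<in> mod_hom T (Bsum s) (mS l)"
    unfolding mod_hom_def using mod_homD[OF km] mod_homD[OF f(1)] by (auto simp: Pi_iff)
  have fker: "(f \<circ> k) ` carrier (Bsum s) = {X \<in> carrier (mS l). g X = \<zero>\<^bsub>Bsum s'\<^esub>}"
    unfolding ker[symmetric] kbij[symmetric] by (simp add: image_comp)
  have exact: "graded_short_exact T (Bsum s) (mS l) (Bsum s') (f \<circ> k) g"
    unfolding graded_short_exact_def
  proof (intro conjI)
    show "f \<circ> k \<in> graded_hom T (Bsum s) (mS l)" unfolding graded_hom_def using fkm f(2) kg by fastforce
    show "inj_on (f \<circ> k) (carrier (Bsum s))" by (rule comp_inj_on[OF kinj]) (simp add: kbij f(3))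
  qed (use g fker in auto)
  have "\<not> split_epi T (mS l) (Bsum s') g"
  proof
    assume "split_epi T (mS l) (Bsum s') g"
    then obtain \<sigma> where \<sigma>: "\<sigma> \<in> mod_hom T (Bsum s') (mS l)" and g\<sigma>: "\<And>y. y \<in> carrier (Bsum s') ==> g (\<sigma> y) = y"
      unfolding split_epi_def by blast
    have kill: "mnm a 0 \<odot>\<^bsub>mS l\<^esub> q v = \<zero>\<^bsub>mS l\<^esub>" if q: "q \<in> mod_hom T (Bsum r) (mS l)" and a: "a \<in> \<mm>" and v: "v \<in> carrier (Bsum r)" for a q r v
    proof -
      have t: "mnm a 0 \<in> carrier T" using mon0_T idl_carr[OF mid a] T_carrier by simp
      have "mnm a 0 \<odot>\<^bsub>mS l\<^esub> q v = \<zero>\<^bsub>T\<^esub> \<odot>\<^bsub>mS l\<^esub> q v"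
        using mod_homD(3)[OF q t v] mod_homD(3)[OF q T0 v] m_kills_B[OF a v] by simp
      also have "\<dots> = \<zero>\<^bsub>mS l\<^esub>" by (rule M0.smult_l_null[OF mod_homD(1)[OF q v]])
      finally show ?thesis .
    qed
    have killall: "mnm a 0 \<odot>\<^bsub>mS l\<^esub> X = \<zero>\<^bsub>mS l\<^esub>" if a: "a \<in> \<mm>" and X: "X \<in> carrier (mS l)" for a X
    proof -
      have t: "mnm a 0 \<in> carrier T" using mon0_T idl_carr[OF mid a] T_carrier by simp
      have gX: "g X \<in> carrier (Bsum s')" by (rule mod_homD(1)[OF gm X])
      let ?Y = "\<sigma> (g X)" and ?u = "\<ominus>\<^bsub>T\<^esub> \<one>\<^bsub>T\<^esub>"
      have Y: "?Y \<in> carrier (mS l)" by (rule mod_homD(1)[OF \<sigma> gX])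
      let ?Z = "X \<oplus>\<^bsub>mS l\<^esub> ?u \<odot>\<^bsub>mS l\<^esub> ?Y"
      have uY: "?u \<odot>\<^bsub>mS l\<^esub> ?Y = \<ominus>\<^bsub>mS l\<^esub> ?Y" using M0.smult_l_minus[of "\<one>\<^bsub>T\<^esub>" ?Y] Y by simp
      have Zc: "?Z \<in> carrier (mS l)" using X Y by simp
      have "g ?Z = g X \<oplus>\<^bsub>Bsum s'\<^esub> ?u \<odot>\<^bsub>Bsum s'\<^esub> g X"
        using mod_homD(2)[OF gm X, of "?u \<odot>\<^bsub>mS l\<^esub> ?Y"] mod_homD(3)[OF gm T_m1 Y] g\<sigma>[OF gX] Y by simp
      then have "?Z \<in> (f \<circ> k) ` carrier (Bsum s)" unfolding fker using Zc Bsum_cancel[OF gX] by simp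
      then obtain v where v: "v \<in> carrier (Bsum s)" "?Z = (f \<circ> k) v" by blast
      have "X = ?Z \<oplus>\<^bsub>mS l\<^esub> ?Y" unfolding uY using X Y by (simp add: M0.a_assoc M0.l_neg)
      then have "mnm a 0 \<odot>\<^bsub>mS l\<^esub> X = mnm a 0 \<odot>\<^bsub>mS l\<^esub> ?Z \<oplus>\<^bsub>mS l\<^esub> mnm a 0 \<odot>\<^bsub>mS l\<^esub> ?Y"
        using M0.smult_r_distr[OF t Zc Y] by simp
      then show ?thesis using kill[OF fkm a v(1)] kill[OF \<sigma> a gX] v(2) by simp
    qed
    have "W (Suc l) i \<subseteq> J \<cdot> Qp i" for i
    proof -
      have "\<mm> \<cdot> (mp l \<cdot> Jp (Suc i)) \<subseteq> J \<cdot> Qp i"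
      proof (rule prod_le[OF JQi])
        fix a b assume a: "a \<in> \<mm>" and b: "b \<in> mp l \<cdot> Jp (Suc i)"
        have bW: "b \<in> W l i" using b sum_ge1[OF prod_ideal[OF mpi Jpi] JQi] unfolding W_def by blast
        have c: "a \<in> carrier R" "b \<in> carrier R" using idl_carr[OF mid a] idl_carr[OF Wi bW] by auto
        have mb: "mnm b i \<in> pol (W l)" by (rule mon_pol[of "W l", OF Wi bW])
        have "mnm a 0 \<otimes>\<^bsub>PP\<^esub> mnm b i = mnm (a \<otimes> b) i" using UP.monom_mult[OF c, of 0 i] by simp
        then have "clsS (mnm (a \<otimes> b) i) = clsS \<zero>\<^bsub>PP\<^esub>"
          using killall[OF a, of "clsS (mnm b i)"] mb S_smult[OF mon0_T[OF c(1)], of "mnm b i"] pol_W_le by (auto simp: mS_ops)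
        then have "mnm (a \<otimes> b) i \<in> NS" using clsS_zero_iff[of "mnm (a \<otimes> b) i"] c by simp
        then show "a \<otimes> b \<in> J \<cdot> Qp i" using mon_polD[of "a \<otimes> b" i "\<lambda>i. J \<cdot> Qp i"] c by simp
      qed
      then have "mp (Suc l) \<cdot> Jp (Suc i) \<subseteq> J \<cdot> Qp i"
        unfolding ideal_pow.simps(2)[of _ \<mm>] using prod_assoc[OF mid mpi Jpi] by simp
      then show ?thesis unfolding W_def by (intro sum_le[OF JQi]) auto
    qed
    then have "carrier (mS (Suc l)) = {\<zero>\<^bsub>mS (Suc l)\<^esub>}" by (rule W_trivial_carrier)
    then have one: "v = w" if "v \<in> carrier (Bsum s)" "w \<in> carrier (Bsum s)" for v w
      using k[OF that(1)] k[OF that(2)] by (metis singletonD)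
    have "(\<lambda>r\<in>{..<s}. clsB \<one>\<^bsub>PP\<^esub>) = (\<lambda>r\<in>{..<s}. \<zero>\<^bsub>B\<^esub>)"
      by (rule one) (use B_nonzero in \<open>auto simp: Bsum_ops B_carrier B_zero pol_zero[of Qp, OF Qpi]\<close>)
    from fun_cong[OF this, of 0] show False using s B_nonzero by simp
  qed
  then show ?thesis using exact by blast
qed

end

theorem theorem10p8:
  fixes A :: "('a, 'b) ring_scheme"
    and \<mm> I Q J :: "'a set"
    and n :: nat
    and T :: "('a, nat \<Rightarrow> 'a) up_ring"
    and S B :: "(nat \<Rightarrow> 'a, (nat \<Rightarrow> 'a) set) gmodule"
    and mS :: "nat \<Rightarrow> (nat \<Rightarrow> 'a, (nat \<Rightarrow> 'a) set) gmodule"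
    and Bsum :: "nat \<Rightarrow> (nat \<Rightarrow> 'a, nat \<Rightarrow> (nat \<Rightarrow> 'a) set) gmodule"
    and cond2 :: "nat \<Rightarrow> (nat \<Rightarrow> nat) \<Rightarrow> bool"
  assumes "CM_local_ring A \<mm>"
    and "krull_dim A > 0"
    and "canonical_ideal A \<mm> I"
    and "n \<ge> 1"
    and "sharp_param_ideal A \<mm> I Q"
    and "J = I <+>\<^bsub>A\<^esub> Q"
    and "T = rees A Q"
    and "S = sally_module A Q J"
    and "B = rees_fibre A \<mm> Q"
    and "\<And>j. mS j = ideal_smult A Q (ideal_pow A \<mm> j) S"
    and "\<And>r. Bsum r = gpower (gshift B (-1)) r"
    and "\<And>l s. cond2 l s \<longleftrightarrow>
           l < n \<and> (\<forall>i\<le>l. s i \<ge> 1) \<and> n = (\<Sum>i\<le>l. s i) \<and>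
           graded_iso T (mS l) (Bsum (s 0)) \<and>
           (\<forall>i\<in>{1..l}. \<exists>f g. graded_short_exact T (mS (l - i + 1)) (mS (l - i)) (Bsum (s i)) f g)"
  shows "(n_Goto_ring n A \<mm> I Q \<longleftrightarrow> (\<exists>l s. cond2 l s)) \<and>
         (\<forall>l s. cond2 l s \<and> l > 0 \<longrightarrow>
            (\<exists>f g. graded_short_exact T (Bsum (s 0)) (mS (l - 1)) (Bsum (s 1)) f g \<and>
                   \<not> split_epi T (mS (l - 1)) (Bsum (s 1)) g))"
proof -
  have nl: "noeth_local_ring A \<mm>" using assms(1) unfolding CM_local_ring_def by simp
  interpret L: noeth_local A \<mm>
    using nl unfolding noeth_local_def noeth_local_axioms_def noeth_local_ring_def by simp
  obtain as where sop: "system_of_params A \<mm> as" and Qas: "Q = Idl\<^bsub>A\<^esub> (set as)" and as0: "as ! 0 \<in> I"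
    using assms(5) unfolding sharp_param_ideal_def by blast
  have "as \<noteq> []" using sop assms(2) unfolding system_of_params_def by (auto simp: zero_enat_def)
  then obtain x xs where as: "as = x # xs" by (cases as) auto
  have xI: "x \<in> I" using as0 as by simp
  have sub: "set (x # xs) \<subseteq> \<mm>" and rad: "ring_radical A (Idl\<^bsub>A\<^esub> (set (x # xs))) = \<mm>"
    using sop unfolding system_of_params_def as by auto
  have I: "ideal I A" using assms(3) unfolding canonical_ideal_def by simp
  have xc: "set (x # xs) \<subseteq> carrier A" using sub L.idl_sub[OF L.mid] by blast
  have Q: "ideal (Idl\<^bsub>A\<^esub> (set (x # xs))) A" by (rule L.genideal_ideal[OF xc])
  have J: "J = I <+>\<^bsub>A\<^esub> Idl\<^bsub>A\<^esub> (set (x # xs))" unfolding assms(6) Qas as ..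
  interpret G: sally_setting A \<mm> x xs J
  proof (intro sally_setting.intro sally_setting_axioms.intro)
    show "noeth_local A \<mm>" by (rule L.noeth_local_axioms)
    show "set (x # xs) \<subseteq> \<mm>" by (rule sub)
    show "L.rseq (x # xs)" using L.system_of_params_rseq[OF assms(1) sop] as by simp
    show "ideal J A" unfolding J by (rule L.add_ideals[OF I Q])
    show "Idl\<^bsub>A\<^esub> (set (x # xs)) \<subseteq> J" unfolding J by (rule L.sum_ge2[OF I Q])
    show "\<mm> \<subseteq> ring_radical A (Idl\<^bsub>A\<^esub> (set (x # xs)))" unfolding rad ..
    show "Idl\<^bsub>A\<^esub> (set xs) \<inter> ideal_pow A J 2 \<subseteq> (Idl\<^bsub>A\<^esub> (set xs)) \<cdot>\<^bsub>A\<^esub> J"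
      by (rule L.square_tail[OF I xc xI _ J]) (rule L.canonical_ideal_tail[OF assms(3) sop[unfolded as] xI])
  qed
  have Qe: "Q = Idl\<^bsub>A\<^esub> (set (x # xs))" unfolding Qas as ..
  have mS: "mS = G.mS" by (rule ext) (simp add: assms(8,10) G.mS_def Qe)
  have Bsum: "Bsum = G.Bsum" by (rule ext) (simp add: assms(9,11) G.Bsum_def Qe)
  have Goto: "n_Goto_ring n A \<mm> I Q \<longleftrightarrow> carrier S = submod_span T S (hpart S 1) \<and> sally_rank A \<mm> Q J = enat n"
    unfolding n_Goto_ring_def Let_def assms(6-8) ..
  have "\<exists>l s. cond2 l s" if g: "n_Goto_ring n A \<mm> I Q"
  proof -
    have "ideal_pow A J 3 = (Idl\<^bsub>A\<^esub> (set (x # xs))) \<cdot>\<^bsub>A\<^esub> ideal_pow A J 2"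
      by (rule G.cube_of_generation) (use g Goto assms(7,8) Qe in simp)
    then interpret C: sally_cube A \<mm> x xs J by unfold_locales
    show ?thesis unfolding assms(12) mS Bsum assms(7) Qe
      by (rule C.filtration_exists[OF _ assms(4)]) (use g Goto Qe in simp)
  qed
  moreover have "n_Goto_ring n A \<mm> I Q" if c: "cond2 l s" for l s
    unfolding Goto using G.filtration_generated[of l s] G.filtration_rank[of l s] c
    unfolding assms(12) mS Bsum assms(7,8) Qe by metis
  moreover have "\<exists>f g. graded_short_exact T (Bsum (s 0)) (mS (l - 1)) (Bsum (s 1)) f g \<and> \<not> split_epi T (mS (l - 1)) (Bsum (s 1)) g"
    if c: "cond2 l s" and l: "l > 0" for l s
  proof -
    obtain k where k: "l = Suc k" using l gr0_implies_Suc by blast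
    have "\<exists>f g. graded_short_exact T (mS (Suc k)) (mS k) (Bsum (s 1)) f g"
    proof -
      have "\<forall>i\<in>{1..Suc k}. \<exists>f g. graded_short_exact T (mS (Suc k - i + 1)) (mS (Suc k - i)) (Bsum (s i)) f g"
        using c unfolding assms(12) k by (elim conjE)
      then have "\<exists>f g. graded_short_exact T (mS (Suc k - 1 + 1)) (mS (Suc k - 1)) (Bsum (s 1)) f g" by (rule bspec) simp
      then show ?thesis by simp
    qed
    then obtain f g where "graded_short_exact T (mS (Suc k)) (mS k) (Bsum (s 1)) f g" by blast
    moreover have "graded_iso T (mS (Suc k)) (Bsum (s 0))" "s 0 \<ge> 1" using c unfolding assms(12) k by auto
    ultimately show ?thesis using G.nonsplit_extension[of k "s 0" "s 1" f g]
      unfolding k mS Bsum assms(7) Qe by auto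
  qed
  ultimately show ?thesis by blast
qed

end
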